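(* Let $p\ge1$ and let $X,Y\in W^{1,p}(\mathbb{R}^2,\mathbb{R}^2)\cap L^\infty(\mathbb{R}^2,\mathbb{R}^2)$ be vector fields with bounded divergence and with $[X,Y]=0$. Let $\phi^X_t,\phi^Y_s$ be their Regular Lagrangian Flows. Then $$(X\cdot Y^\perp)\circ\phi^X_t=\det D\phi^X_t\;(X\cdot Y^\perp)\quad\text{a.e.},$$ and likewise $(X\cdot Y^\perp)\circ\phi^Y_s=\det D\phi^Y_s\,(X\cdot Y^\perp)$ a.e. In particular, for every $T>0$ there is a constant $C>0$ such that, for $t\in(-T,T)$, at a.e. point where $X\cdot Y^\perp>0$, $$\frac1C\,X\cdot Y^\perp\le (X\cdot Y^\perp)\circ\phi^X_t\le C\,X\cdot Y^\perp ,$$ and the same holds for $\phi^Y_s$, $s\in(-T,T)$.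
   Context: $Y^\perp=(-Y_2,Y_1)$. $(\cdot,\cdot)$ is the Euclidean scalar product, $\mathcal L^n$ is Lebesgue measure, and $(D\varphi\,Y)_i=\sum_j \partial_j\varphi_i\,Y_j$. Regular Lagrangian Flow (RLF): for an autonomous $X\in BV_{\rm loc}(\mathbb{R}^n,\mathbb{R}^n)\cap L^\infty$ with bounded divergence, a map $\phi^X:\mathbb{R}\times\mathbb{R}^n\to\mathbb{R}^n$, $(t,x)\mapsto\phi^X_t(x)$, is an RLF of $X$ if (1) $\partial_t\phi^X_t=X\circ\phi^X_t$, $\phi^X_0(x)=x$ in the sense of distributions, and (2) for every $T>0$ there is $C>0$ with $\mathcal L^n(\{x:\phi^X_t(x)\in A\})\le C\mathcal L^n(A)$ for all Borel sets $A$ and all $|t|\le T$. It is known that the RLF exists and is unique (up to null sets). Meaning of $\det D\phi^X_t$: it denotes the density $\xi=\xi(t,z)$, $\xi\in L^\infty([-T,T]\times\mathbb{R}^n)$ for every $T>0$, characterized by $$\int_{\mathbb{R}^{n+1}}\varphi(t,\phi^X_{-t}(z))\,dz\,dt=\int_{\mathbb{R}^{n+1}}\varphi(t,z)\,\xi(t,z)\,dz\,dt\quad\forall\varphi\in C_c(\mathbb{R}^{n+1}).$$ It coincides with the classical Jacobian determinant $\det D\phi^X_t$ in the smooth case. It is known that it satisfies $\partial_t\xi=(\operatorname{div}X\circ\phi^X_t)\,\xi$ distributionally with $\xi(0,\cdot)=1$, and that for every $T>0$ it is bounded above and below by positive constants on $(-T,T)\times\mathbb{R}^n$. Lie bracket: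 $[X,Y]$ is the distribution (for Sobolev fields it equals $DY\,X-DX\,Y$) defined by $$\int ([X,Y],\varphi)\,dz=\int\big((X,D\varphi\,Y)+\operatorname{div}Y\,(X,\varphi)-(Y,D\varphi\,X)-\operatorname{div}X\,(Y,\varphi)\big)\,dz,\quad \varphi\in C^1_c(\mathbb{R}^n,\mathbb{R}^n).$$ *)

theory Defs
  imports "HOL-Analysis.Analysis"
begin

primrec Ck :: "nat \<Rightarrow> ('a::euclidean_space \<Rightarrow> 'b::euclidean_space) \<Rightarrow> bool" where
  "Ck 0 f = continuous_on UNIV f"
| "Ck (Suc k) f = (f differentiable_on UNIV \<and>
     (\<forall>v. Ck k (\<lambda>x. frechet_derivative f (at x) v)))"

definition Cc :: "nat \<Rightarrow> ('a::euclidean_space \<Rightarrow> 'b::euclidean_space) set" where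
  "Cc k = {f. Ck k f \<and> compact (closure {x. f x \<noteq> 0})}"

definition Cc_inf :: "('a::euclidean_space \<Rightarrow> 'b::euclidean_space) set" where
  "Cc_inf = (\<Inter>k. Cc k)"

definition loc_integrable :: "('a::euclidean_space \<Rightarrow> 'b::euclidean_space) \<Rightarrow> bool" where
  "loc_integrable f \<longleftrightarrow> (\<forall>K. compact K \<longrightarrow> set_integrable lebesgue K f)"

definition Lp :: "real \<Rightarrow> ('a::euclidean_space \<Rightarrow> 'b::euclidean_space) set" where
  "Lp p = {f \<in> borel_measurable lebesgue. integrable lebesgue (\<lambda>x. norm (f x) powr p)}"

definition Linf :: "('a::euclidean_space \<Rightarrow> 'b::euclidean_space) set" where
  "Linf = {f \<in> borel_measurable lebesgue. \<exists>C. AE x in lebesgue. norm (f x) \<le> C}"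

definition has_weak_partial ::
    "('a::euclidean_space \<Rightarrow> 'b::euclidean_space) \<Rightarrow> 'a \<Rightarrow> ('a \<Rightarrow> 'b) \<Rightarrow> bool" where
  "has_weak_partial f b g \<longleftrightarrow> loc_integrable f \<and> loc_integrable g \<and>
     (\<forall>\<psi>\<in>Cc_inf. (LINT x|lebesgue. frechet_derivative \<psi> (at x) b *\<^sub>R f x)
                 = - (LINT x|lebesgue. \<psi> x *\<^sub>R g x))"

definition W1p :: "real \<Rightarrow> ('a::euclidean_space \<Rightarrow> 'b::euclidean_space) set" where
  "W1p p = {f \<in> Lp p. \<forall>b\<in>Basis. \<exists>g\<in>Lp p. has_weak_partial f b g}"

text \<open>In an integrand, \<open>frechet_derivative \<psi> (at x) (X x)\<close> is the scalar product of
  \<open>X x\<close> with the gradient of \<open>\<psi>\<close> at \<open>x\<close>.\<close>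

definition has_weak_divergence :: "('a::euclidean_space \<Rightarrow> 'a) \<Rightarrow> ('a \<Rightarrow> real) \<Rightarrow> bool" where
  "has_weak_divergence X d \<longleftrightarrow> loc_integrable X \<and> loc_integrable d \<and>
     (\<forall>\<psi>\<in>Cc_inf. (LINT x|lebesgue. frechet_derivative \<psi> (at x) (X x))
                 = - (LINT x|lebesgue. \<psi> x * d x))"

text \<open>Determined up to a null set whenever a weak divergence exists.\<close>

definition divergence :: "('a::euclidean_space \<Rightarrow> 'a) \<Rightarrow> 'a \<Rightarrow> real" where
  "divergence X = (SOME d. has_weak_divergence X d)"

definition bounded_divergence :: "('a::euclidean_space \<Rightarrow> 'a) \<Rightarrow> bool" where
  "bounded_divergence X \<longleftrightarrow> (\<exists>d\<in>Linf. has_weak_divergence X d)"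

text \<open>The bracket as a functional on vector-valued test functions of class \<open>C\<^sup>1\<close>;
  \<open>frechet_derivative \<phi> (at z) (Y z)\<close> is the vector \<open>D\<phi> Y\<close>.\<close>

definition lie_bracket ::
    "('a::euclidean_space \<Rightarrow> 'a) \<Rightarrow> ('a \<Rightarrow> 'a) \<Rightarrow> ('a \<Rightarrow> 'a) \<Rightarrow> real" where
  "lie_bracket X Y \<phi> = (LINT z|lebesgue.
       X z \<bullet> frechet_derivative \<phi> (at z) (Y z) + divergence Y z * (X z \<bullet> \<phi> z)
     - Y z \<bullet> frechet_derivative \<phi> (at z) (X z) - divergence X z * (Y z \<bullet> \<phi> z))"

text \<open>The Cauchy problem \<open>\<partial>\<^sub>t \<phi> = X \<circ> \<phi>\<close>, \<open>\<phi> 0 x = x\<close> in the sense of distributions: test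
  functions need not vanish at \<open>t = 0\<close>, and the initial datum appears as the boundary term of the
  integration by parts, once for positive and once for negative times.  The direction \<open>(1, 0)\<close> is
  the time direction.\<close>

definition distributional_flow ::
    "('a::euclidean_space \<Rightarrow> 'a) \<Rightarrow> (real \<Rightarrow> 'a \<Rightarrow> 'a) \<Rightarrow> bool" where
  "distributional_flow X \<phi> \<longleftrightarrow> (\<forall>\<psi>\<in>Cc_inf.
     (LINT q:{0<..} \<times> UNIV|lebesgue.
        frechet_derivative \<psi> (at q) (1, 0) *\<^sub>R \<phi> (fst q) (snd q)
          + \<psi> q *\<^sub>R X (\<phi> (fst q) (snd q)))
       = - (LINT x|lebesgue. \<psi> (0, x) *\<^sub>R x) \<and>
     (LINT q:{..<0} \<times> UNIV|lebesgue.
        frechet_derivative \<psi> (at q) (1, 0) *\<^sub>R \<phi> (fst q) (snd q)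
          + \<psi> q *\<^sub>R X (\<phi> (fst q) (snd q)))
       = (LINT x|lebesgue. \<psi> (0, x) *\<^sub>R x))"

text \<open>The first two conjuncts make the distributional equation and the compression bound
  meaningful (\<open>emeasure\<close> is \<open>0\<close> on non-measurable sets).\<close>

definition regular_lagrangian_flow ::
    "('a::euclidean_space \<Rightarrow> 'a) \<Rightarrow> (real \<Rightarrow> 'a \<Rightarrow> 'a) \<Rightarrow> bool" where
  "regular_lagrangian_flow X \<phi> \<longleftrightarrow>
     loc_integrable (\<lambda>(t, x). \<phi> t x) \<and>
     (\<forall>t. \<phi> t \<in> borel_measurable lebesgue) \<and>
     distributional_flow X \<phi> \<and>
     (\<forall>T>0. \<exists>C>0. \<forall>A\<in>sets borel. \<forall>t. \<bar>t\<bar> \<le> T \<longrightarrow>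
        emeasure lebesgue {x. \<phi> t x \<in> A} \<le> ennreal C * emeasure lebesgue A)"

text \<open>A flow is determined by the distributional equation only for almost every \<open>t\<close>. The
  representatives below are those determined, up to a null set of points, at every single \<open>t\<close>.\<close>

definition weakly_continuous_in_time :: "(real \<Rightarrow> 'a::euclidean_space \<Rightarrow> 'a) \<Rightarrow> bool" where
  "weakly_continuous_in_time \<phi> \<longleftrightarrow> (\<forall>t. loc_integrable (\<phi> t)) \<and>
     (\<forall>\<psi>\<in>Cc_inf. continuous_on UNIV (\<lambda>t. LINT x|lebesgue. \<psi> x *\<^sub>R \<phi> t x))"

definition is_jacobian_density ::
    "(real \<Rightarrow> 'a::euclidean_space \<Rightarrow> 'a) \<Rightarrow> (real \<times> 'a \<Rightarrow> real) \<Rightarrow> bool" where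
  "is_jacobian_density \<phi> \<xi> \<longleftrightarrow> \<xi> \<in> borel_measurable lebesgue \<and>
     (\<forall>T>0. \<exists>C. AE (t, z) in lebesgue. \<bar>t\<bar> \<le> T \<longrightarrow> \<bar>\<xi> (t, z)\<bar> \<le> C) \<and>
     (\<forall>\<psi>\<in>Cc 0. (LINT (t, z)|lebesgue. \<psi> (t, \<phi> (- t) z))
               = (LINT (t, z)|lebesgue. \<psi> (t, z) * \<xi> (t, z)))"

text \<open>\<open>det_flow \<phi> (t, z)\<close> is \<open>det D\<phi>\<^sub>t (z)\<close>, determined up to a null set of pairs \<open>(t, z)\<close>.\<close>

definition det_flow :: "(real \<Rightarrow> 'a::euclidean_space \<Rightarrow> 'a) \<Rightarrow> real \<times> 'a \<Rightarrow> real" where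
  "det_flow \<phi> = (SOME \<xi>. is_jacobian_density \<phi> \<xi>)"

definition perp :: "real ^ 2 \<Rightarrow> real ^ 2" where
  "perp v = vector [- v $ 2, v $ 1]"

end

theory Submission
  imports Defs
begin

text \<open>
  The vanishing bracket says that \<open>DX Y = DY X\<close> almost everywhere. In the plane this gives
  \<open>DJ X = div X J\<close> for \<open>J = X \<bullet> perp Y\<close>, by the trace identity for a determinant. The flow is
  represented by Lipschitz trajectories, and mollifying \<open>X\<close> and \<open>Y\<close> separately yields
  \<open>J (\<Phi>\<^sub>t z) = E\<^sub>t z J z\<close> with \<open>E\<^sub>t = exp (\<integral>\<^sub>0\<^sup>t div X \<circ> \<Phi>\<^sub>s ds)\<close>: the compression bound turns convergence
  in \<open>L\<^sup>1\<close> of the gradients into convergence along the trajectories.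

  It remains to see that \<open>E\<^sub>t\<close> is the density of the image of Lebesgue measure under \<open>\<Phi>\<^sub>-\<^sub>t\<close>. For a
  mollifier \<open>\<rho>\<close>, differentiate \<open>s \<mapsto> E\<^sub>s x \<integral> \<rho> (\<Phi>\<^sub>s x - \<Phi>\<^sub>s\<^sub>-\<^sub>t z) dz\<close>. At \<open>s = t\<close> this is \<open>E\<^sub>t x\<close>, at \<open>s = 0\<close> it
  is the mollified density at \<open>x\<close>, and the derivative is a DiPerna-Lions commutator, which vanishes
  in the limit. No uniqueness or group property of the flow is needed.
\<close>


subsection \<open>Smooth functions of compact support\<close>

text \<open>A Sobolev field has values only up to null sets, while a trajectory sees it on a single
  curve. What reconciles the two is the compression bound: preimages of null sets under each
  \<open>\<Phi>\<^sub>t\<close> are null, and composition with \<open>\<Phi>\<^sub>t\<close> costs a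
  constant factor in \<open>L\<^sup>1\<close>. Hence smooth approximations are differentiated along
  individual Lipschitz curves, where the chain rule is exact, and limits are taken only after
  integrating over the starting points.

  The curves \<open>\<Phi>\<^sub>s x\<close> and \<open>\<Phi>\<^sub>s\<^sub>-\<^sub>t z\<close> may
  be compared at the same s because X is autonomous: both move with velocity X. The derivative of a
  mollifier of width \<epsilon> contributes a factor 1/\<epsilon>, which is paired with a difference
  of values of X at points at distance at most \<epsilon>; this quotient is controlled in
  \<open>L\<^sup>1\<close> by the weak gradient. The factor \<open>E\<^sub>s\<close> contributes div
  X, the trace term that cancels the limit of the quotient.

  The bracket serves to trade \<open>DY X\<close> for \<open>DX Y\<close>; afterwards the derivative
  of J along X involves the gradient of X alone.\<close>

lemma Ck_SucI:
  assumes "\<And>x. (f has_derivative f' x) (at x)" "\<And>v. Ck k (\<lambda>x. f' x v)"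
  shows "Ck (Suc k) f"
proof -
  have "frechet_derivative f (at x) = f' x" for x
    using frechet_derivative_at[OF assms(1)] by metis
  then show ?thesis
    using assms by (auto simp: differentiable_on_def differentiable_def)
qed

lemma Ck_SucD:
  assumes "Ck (Suc k) f"
  shows "(f has_derivative frechet_derivative f (at x)) (at x)"
    and "Ck k (\<lambda>x. frechet_derivative f (at x) v)"
  using assms by (auto simp: differentiable_on_def frechet_derivative_works[symmetric])

lemma Ck_Suc_imp_Ck: "Ck (Suc k) f \<Longrightarrow> Ck k f"
proof (induction k arbitrary: f)
  case 0
  then show ?case by (auto intro: differentiable_imp_continuous_on)
next
  case (Suc k)
  have "Ck k (\<lambda>x. frechet_derivative f (at x) v)" for v
    using Ck_SucD(2)[OF Suc.prems, of v] by (rule Suc.IH)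
  then show ?case using Ck_SucD(1)[OF Suc.prems] by (intro Ck_SucI)
qed

lemma Ck_const: "Ck k (\<lambda>x. c)"
proof (induction k arbitrary: c)
  case (Suc k)
  show ?case by (rule Ck_SucI[where f'="\<lambda>_ _. 0"]) (auto intro: Suc)
qed simp

lemma Ck_add: "Ck k f \<Longrightarrow> Ck k g \<Longrightarrow> Ck k (\<lambda>x. f x + g x)"
proof (induction k arbitrary: f g)
  case (Suc k)
  show ?case
    by (rule Ck_SucI, rule has_derivative_add, (rule Ck_SucD Suc.prems)+,
        intro Suc.IH Ck_SucD(2) Suc.prems)
qed (auto intro: continuous_on_add)

lemma Ck_linear_comp:
  assumes "bounded_linear h"
  shows "Ck k f \<Longrightarrow> Ck k (\<lambda>x. h (f x))"
proof (induction k arbitrary: f)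
  case 0
  then show ?case using bounded_linear.continuous_on[OF assms] by auto
next
  case (Suc k)
  show ?case
    by (rule Ck_SucI, rule bounded_linear.has_derivative[OF assms], rule Ck_SucD, rule Suc.prems,
        rule Suc.IH, rule Ck_SucD, rule Suc.prems)
qed

lemma Ck_affine_comp:
  assumes L: "bounded_linear L"
  shows "Ck k f \<Longrightarrow> Ck k (\<lambda>x. f (c + L x))"
proof (induction k arbitrary: f)
  case 0
  have "continuous_on UNIV (\<lambda>x. c + L x)"
    by (intro continuous_intros bounded_linear.continuous_on[OF L])
  with 0 show ?case using continuous_on_compose2[of UNIV f UNIV "\<lambda>x. c + L x"] by auto
next
  case (Suc k)
  have aff: "((\<lambda>x. c + L x) has_derivative L) (at x)" for x
    by (auto intro!: derivative_eq_intros bounded_linear.has_derivative[OF L])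
  show ?case
  proof (rule Ck_SucI)
    fix x
    show "((\<lambda>x. f (c + L x)) has_derivative (\<lambda>v. frechet_derivative f (at (c + L x)) (L v))) (at x)"
      by (rule has_derivative_compose[OF aff]) (rule Ck_SucD(1)[OF Suc.prems])
  next
    fix v
    show "Ck k (\<lambda>x. frechet_derivative f (at (c + L x)) (L v))"
      using Suc.IH[OF Ck_SucD(2)[OF Suc.prems, of "L v"]] .
  qed
qed

lemma Ck_mult:
  fixes f g :: "'a::euclidean_space \<Rightarrow> real"
  shows "Ck k f \<Longrightarrow> Ck k g \<Longrightarrow> Ck k (\<lambda>x. f x * g x)"
proof (induction k arbitrary: f g)
  case (Suc k)
  show ?case
    by (rule Ck_SucI, rule has_derivative_mult, (rule Ck_SucD Suc.prems)+,
        intro Ck_add Suc.IH Ck_SucD(2) Suc.prems Ck_Suc_imp_Ck)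
qed (auto intro: continuous_on_mult)

lemma Ck_prod:
  fixes f :: "'i \<Rightarrow> 'a::euclidean_space \<Rightarrow> real"
  shows "(\<And>i. i \<in> I \<Longrightarrow> Ck k (f i)) \<Longrightarrow> Ck k (\<lambda>x. \<Prod>i\<in>I. f i x)"
  by (induction I rule: infinite_finite_induct) (auto intro: Ck_const Ck_mult)

lemma Cc_infI:
  assumes "\<And>k. Ck k f" "\<And>x. norm x > r \<Longrightarrow> f x = 0"
  shows "f \<in> Cc_inf"
proof -
  have "{x. f x \<noteq> 0} \<subseteq> cball 0 r" using assms(2) by (force simp: not_less[symmetric])
  then have "closure {x. f x \<noteq> 0} \<subseteq> cball 0 r" by (rule closure_minimal) auto
  then have "bounded (closure {x. f x \<noteq> 0})" using bounded_cball bounded_subset by blast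
  then show ?thesis using assms(1) by (simp add: Cc_inf_def Cc_def compact_eq_bounded_closed)
qed

lemma Cc_inf_D:
  assumes "f \<in> Cc_inf"
  shows "Ck k f" "\<exists>r. \<forall>x. norm x > r \<longrightarrow> f x = 0"
proof -
  show "Ck k f" using assms by (auto simp: Cc_inf_def Cc_def)
  have "bounded (closure {x. f x \<noteq> 0})"
    using assms by (auto simp: Cc_inf_def Cc_def compact_eq_bounded_closed)
  then obtain r where r: "\<forall>x\<in>closure {x. f x \<noteq> 0}. norm x \<le> r"
    by (auto simp: bounded_iff)
  then have "norm x > r \<longrightarrow> f x = 0" for x
    using r closure_subset[of "{x. f x \<noteq> 0}"] by force
  then show "\<exists>r. \<forall>x. norm x > r \<longrightarrow> f x = 0" by blast
qed

text \<open>The derivative of \<open>P (1/x) exp (-1/x)\<close> is of the same form, with \<open>P\<close> replaced by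
  \<open>y\<^sup>2 (P y - P' y)\<close>.\<close>

definition flat :: "real poly \<Rightarrow> real \<Rightarrow> real" where
  "flat P x = (if x > 0 then poly P (1 / x) * exp (- (1 / x)) else 0)"

lemma poly_times_exp_tendsto_0: "((\<lambda>y. poly P y * exp (- y)) \<longlongrightarrow> (0::real)) at_top"
proof -
  have "((\<lambda>y. \<Sum>i\<le>degree P. coeff P i * (y ^ i / exp y)) \<longlongrightarrow> (\<Sum>i\<le>degree P. coeff P i * 0)) at_top"
    by (intro tendsto_intros tendsto_power_div_exp_0)
  then show ?thesis
    by (simp add: poly_altdef sum_distrib_right exp_minus divide_inverse mult.assoc)
qed

lemma flat_tendsto_0: "(flat P \<longlongrightarrow> 0) (at 0)"
proof -
  have "((\<lambda>x. poly P (inverse x) * exp (- inverse x)) \<longlongrightarrow> 0) (at_right 0)"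
    using filterlim_compose[OF poly_times_exp_tendsto_0 filterlim_inverse_at_top_right] .
  then have "(flat P \<longlongrightarrow> 0) (at_right 0)"
    by (rule Lim_transform_eventually) (auto simp: flat_def eventually_at_right_field inverse_eq_divide intro!: exI[of _ 1])
  moreover have "(flat P \<longlongrightarrow> 0) (at_left 0)"
    by (rule tendsto_eventually) (auto simp: flat_def eventually_at_left_field intro!: exI[of _ "-1"])
  ultimately show ?thesis by (simp add: filterlim_split_at)
qed

lemma flat_has_derivative:
  "(flat P has_real_derivative flat ([:0, 0, 1:] * (P - pderiv P)) x) (at x)"
proof (cases "x = 0")
  case True
  \<comment> \<open>Dividing by h multiplies the polynomial in 1/h by one more 1/h, so the
    difference quotient at 0 is of the same form and tends to 0.\<close>
  have eq: "flat P h / h = flat ([:0, 1:] * P) h" for h by (simp add: flat_def)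
  have "((\<lambda>h. flat P h / h) \<longlongrightarrow> 0) (at 0)"
    unfolding eq by (rule flat_tendsto_0)
  then show ?thesis using True by (simp add: DERIV_def flat_def)
next
  case False
  show ?thesis
  proof (cases "x > 0")
    case True
    have "((\<lambda>x. poly P (1 / x) * exp (- (1 / x))) has_real_derivative
        flat ([:0, 0, 1:] * (P - pderiv P)) x) (at x)"
      using True
      by (auto intro!: derivative_eq_intros DERIV_chain2[OF poly_DERIV] simp: flat_def field_simps power2_eq_square)
    moreover have ev: "\<forall>\<^sub>F y in nhds x. flat P y = poly P (1 / y) * exp (- (1 / y))"
      using True by (auto simp: flat_def eventually_nhds intro!: exI[of _ "{0<..}"])
    ultimately show ?thesis using DERIV_cong_ev[OF refl ev refl] by blast
  next
    case neg: False
    have "\<forall>\<^sub>F y in nhds x. flat P y = 0"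
      using neg False by (auto simp: flat_def eventually_nhds intro!: exI[of _ "{..<0}"])
    then show ?thesis using neg by (simp add: flat_def cong: DERIV_cong_ev)
  qed
qed

lemma Ck_flat: "Ck k (flat P)"
proof (induction k arbitrary: P)
  case 0
  show ?case using flat_has_derivative by (auto intro: DERIV_continuous_on)
next
  case (Suc k)
  show ?case
  proof (rule Ck_SucI)
    show "(flat P has_derivative (\<lambda>v. flat ([:0, 0, 1:] * (P - pderiv P)) x * v)) (at x)" for x
      using flat_has_derivative[of P x] by (simp add: has_field_derivative_def)
    show "Ck k (\<lambda>x. flat ([:0, 0, 1:] * (P - pderiv P)) x * v)" for v
      by (intro Ck_mult Suc.IH Ck_const)
  qed
qed

text \<open>No sign is imposed, which is why later bounds carry the integral of
  \<open>\<bar>k\<bar>\<close> in place of 1.\<close>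

definition mollifier :: "('a::euclidean_space \<Rightarrow> real) \<Rightarrow> bool" where
  "mollifier \<rho> \<longleftrightarrow> \<rho> \<in> Cc_inf \<and> (\<forall>x. norm x > 1 \<longrightarrow> \<rho> x = 0) \<and> integral\<^sup>L lborel \<rho> = 1"

lemma Cc_inf_integrable:
  fixes f :: "'a::euclidean_space \<Rightarrow> real"
  assumes "f \<in> Cc_inf" shows "integrable lborel f"
proof -
  obtain r where r: "\<forall>x. norm x > r \<longrightarrow> f x = 0" using Cc_inf_D(2)[OF assms] by blast
  have "continuous_on UNIV f" using Cc_inf_D(1)[OF assms, of 0] by simp
  then have "set_integrable lborel (cball 0 r) f"
    using borel_integrable_compact[of "cball 0 r" f] continuous_on_subset
    unfolding set_integrable_def by fastforce
  moreover have "(\<lambda>x. indicator (cball 0 r) x *\<^sub>R f x) = f"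
    using r by (auto simp: fun_eq_iff indicator_def)
  ultimately show ?thesis by (simp add: set_integrable_def)
qed

text \<open>A product of one-dimensional bumps in the coordinates
  \<open>n * (x \<bullet> i)\<close>, with n the dimension, lives in a cube of half side 1/n. This
  cube lies in the unit ball because the norm is at most the sum of the moduli of the
  coordinates.\<close>

lemma mollifier_exists: "\<exists>\<rho> :: 'a::euclidean_space \<Rightarrow> real. mollifier \<rho>"
proof -
  \<comment> \<open>Positive exactly on (-1, 1): each factor vanishes beyond one end of the
    interval.\<close>
  define h where "h x = flat 1 (1 + x) * flat 1 (1 - x)" for x :: real
  define n where "n = real DIM('a)"
  have n: "n > 0" by (simp add: n_def)
  define b :: "'a \<Rightarrow> real" where "b x = (\<Prod>i\<in>Basis. h (n * (x \<bullet> i)))" for x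
  have h: "Ck k h" for k
    unfolding h_def
    using Ck_affine_comp[OF bounded_linear_ident Ck_flat, of k 1 1]
      Ck_affine_comp[OF bounded_linear_minus[OF bounded_linear_ident] Ck_flat, of k 1 1]
    by (intro Ck_mult) simp_all
  have bl: "bounded_linear (\<lambda>x::'a. n * (x \<bullet> i))" for i
    by (intro bounded_linear_intros)
  have Cb: "Ck k b" for k
    unfolding b_def using Ck_affine_comp[OF bl h, of k 0] by (intro Ck_prod) simp
  have h_nn: "h x \<ge> 0" for x by (simp add: h_def flat_def)
  have h_pos: "h x > 0" if "\<bar>x\<bar> < 1" for x using that by (auto simp: h_def flat_def)
  have b0: "b x = 0" if "norm x > 1" for x
  proof -
    have "\<exists>i\<in>Basis. \<bar>x \<bullet> i\<bar> \<ge> 1 / n"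
    proof (rule ccontr)
      assume "\<not> ?thesis"
      then have "(\<Sum>i\<in>Basis. \<bar>x \<bullet> i\<bar>) \<le> (\<Sum>i\<in>(Basis::'a set). 1 / n)"
        by (intro sum_mono) (force simp: not_le)
      also have "\<dots> = 1" by (simp add: n_def)
      finally show False using norm_le_l1[of x] that by linarith
    qed
    then obtain i where i: "i \<in> Basis" "\<bar>x \<bullet> i\<bar> \<ge> 1 / n" by blast
    then have "n * \<bar>x \<bullet> i\<bar> \<ge> 1" using n by (simp add: field_simps)
    then have "\<bar>n * (x \<bullet> i)\<bar> \<ge> 1" using n by (simp add: abs_mult)
    then have "h (n * (x \<bullet> i)) = 0" by (auto simp: h_def flat_def)
    then show ?thesis using i(1) by (auto simp: b_def)
  qed
  have b: "b \<in> Cc_inf" by (rule Cc_infI[where r=1]) (auto intro: Cb b0)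
  have int: "integrable lborel b" by (rule Cc_inf_integrable[OF b])
  \<comment> \<open>b is nonnegative, so a vanishing integral would make it 0 almost everywhere,
    although it is positive on a ball.\<close>
  have "integral\<^sup>L lborel b \<noteq> 0"
  proof
    assume "integral\<^sup>L lborel b = 0"
    then have "AE x in lborel. b x = 0"
      using integral_nonneg_eq_0_iff_AE[OF int] by (auto simp: b_def h_nn prod_nonneg)
    moreover have "b x \<noteq> 0" if "x \<in> ball 0 (1 / n)" for x
    proof -
      have "\<bar>n * (x \<bullet> i)\<bar> < 1" if "i \<in> Basis" for i
        using Basis_le_norm[OF that, of x] \<open>x \<in> ball 0 (1 / n)\<close> n by (auto simp: abs_mult field_simps)
           (smt (verit, best) mult.commute mult_le_cancel_left_pos)
      then have "b x > 0" unfolding b_def by (intro prod_pos) (auto intro: h_pos)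
      then show ?thesis by simp
    qed
    ultimately have "AE x in lborel. x \<notin> ball (0::'a) (1 / n)" by (auto elim: eventually_mono)
    then have "ball (0::'a) (1 / n) \<in> null_sets lborel"
      by (subst AE_iff_null_sets) auto
    then have "negligible (ball (0::'a) (1 / n))"
      by (simp add: negligible_iff_null_sets null_sets_completionI)
    then show False using n open_not_negligible[of "ball (0::'a) (1 / n)"] by auto
  qed
  moreover define c where "c = 1 / integral\<^sup>L lborel b"
  ultimately have "(\<integral>x. c * b x \<partial>lborel) = 1" by simp
  moreover have "(\<lambda>x. c * b x) \<in> Cc_inf"
    by (rule Cc_infI[where r=1]) (auto intro: Cb Ck_mult Ck_const b0)
  ultimately have "mollifier (\<lambda>x. c * b x)" by (auto simp: mollifier_def b0)
  then show ?thesis by blast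
qed


subsection \<open>Local \<open>L\<^sup>1\<close> norms\<close>

lemma ennreal_tendsto_0I:
  fixes f :: "'i \<Rightarrow> ennreal"
  assumes "\<And>e::real. e > 0 \<Longrightarrow> \<forall>\<^sub>F x in F. f x \<le> ennreal e"
  shows "(f \<longlongrightarrow> 0) F"
proof (rule order_tendstoI)
  fix a :: ennreal assume "0 < a"
  then obtain b where b: "0 < b" "b < a" using dense by blast
  then have "b \<noteq> top" by auto
  then obtain e where e: "b = ennreal e" "e \<ge> 0" by (cases b) auto
  with b have "e > 0" by (simp add: ennreal_less_zero_iff)
  from assms[OF this] show "\<forall>\<^sub>F x in F. f x < a"
    using b e by (auto elim!: eventually_mono)
qed simp

lemma ennreal_tendsto_0D:
  fixes f :: "'i \<Rightarrow> ennreal"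
  assumes "(f \<longlongrightarrow> 0) F" "e > 0"
  shows "\<forall>\<^sub>F x in F. f x \<le> ennreal e"
  using order_tendstoD(2)[OF assms(1), of "ennreal e"] assms(2)
  by (auto elim!: eventually_mono simp: less_imp_le)

lemma ennreal_tendsto_0_le:
  fixes f g :: "'i \<Rightarrow> ennreal"
  assumes "(g \<longlongrightarrow> 0) F" "\<And>x. f x \<le> g x"
  shows "(f \<longlongrightarrow> 0) F"
  by (rule tendsto_sandwich[OF _ _ tendsto_const assms(1)]) (auto simp: assms(2))

lemma ennreal_tendsto_0_cmult:
  fixes f :: "'i \<Rightarrow> ennreal"
  assumes "(f \<longlongrightarrow> 0) F" "c < top"
  shows "((\<lambda>x. c * f x) \<longlongrightarrow> 0) F"
  using ennreal_tendsto_cmult[OF assms(2,1)] by simp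

text \<open>The substitution \<open>w = y - e v\<close> freezes the kernel of a convolution at unit
  scale. With e = 1 it is the invariance of Lebesgue measure under reflections and translations, in
  which form it is also applied below.\<close>

lemma integral_affine_subst:
  fixes f :: "'a::euclidean_space \<Rightarrow> 'b::euclidean_space"
  assumes [measurable]: "f \<in> borel_measurable borel" and "e \<noteq> 0"
  shows "(\<integral>w. f w \<partial>lborel) = \<bar>e\<bar> ^ DIM('a) *\<^sub>R (\<integral>v. f (y - e *\<^sub>R v) \<partial>lborel)"
proof -
  have "(\<integral>w. f w \<partial>lborel) = (\<integral>w. f w \<partial>density (distr lborel borel (\<lambda>x. y + (- e) *\<^sub>R x)) (\<lambda>_. ennreal (\<bar>e\<bar>^DIM('a))))"
    using lborel_affine[of "- e" y] assms(2) by simp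
  also have "\<dots> = (\<integral>w. \<bar>e\<bar>^DIM('a) *\<^sub>R f w \<partial>distr lborel borel (\<lambda>x. y + (- e) *\<^sub>R x))"
    by (subst integral_density) auto
  also have "\<dots> = \<bar>e\<bar> ^ DIM('a) *\<^sub>R (\<integral>v. f (y - e *\<^sub>R v) \<partial>lborel)"
    by (subst integral_distr) (auto simp: integral_scaleR_right)
  finally show ?thesis .
qed

lemma lborel_distr_translation: "distr lborel borel (\<lambda>x. x + h) = (lborel :: 'a::euclidean_space measure)"
proof -
  have "(\<lambda>x. x + h) = (+) h" by (auto simp: add.commute)
  then show ?thesis using lborel_distr_plus[of h] by simp
qed

lemma nn_integral_translation:
  fixes f :: "'a::euclidean_space \<Rightarrow> ennreal"
  assumes [measurable]: "f \<in> borel_measurable borel"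
  shows "(\<integral>\<^sup>+x. f (x + h) \<partial>lborel) = (\<integral>\<^sup>+x. f x \<partial>lborel)"
  by (subst (2) lborel_distr_translation[of h, symmetric]) (simp add: nn_integral_distr)

lemma integral_translation:
  fixes f :: "'a::euclidean_space \<Rightarrow> 'b::euclidean_space"
  assumes [measurable]: "f \<in> borel_measurable borel"
  shows "(\<integral>x. f (x + h) \<partial>lborel) = (\<integral>x. f x \<partial>lborel)"
  by (subst (2) lborel_distr_translation[of h, symmetric]) (simp add: integral_distr)

text \<open>If f is not integrable, the Bochner integral is 0 by default and the bound still holds;
  this keeps integrability side conditions out of the estimates.\<close>

lemma norm_integral_le_nn_integral:
  fixes f :: "'a \<Rightarrow> 'b::{banach, second_countable_topology}"
  shows "ennreal (norm (integral\<^sup>L M f)) \<le> (\<integral>\<^sup>+x. ennreal (norm (f x)) \<partial>M)"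
  by (cases "integrable M f") (auto simp: integral_norm_bound_ennreal not_integrable_integral_eq)

lemma cball_measurable[measurable]: "cball (a::'a::euclidean_space) r \<in> sets borel"
  by auto

text \<open>An extended real, so that the triangle inequality and Minkowski's inequality hold without
  integrability assumptions.\<close>

definition nL :: "real \<Rightarrow> ('a::euclidean_space \<Rightarrow> 'b::euclidean_space) \<Rightarrow> ennreal" where
  "nL R f = (\<integral>\<^sup>+x. ennreal (norm (f x)) * indicator (cball 0 R) x \<partial>lborel)"

text \<open>Borel rather than Lebesgue measurability is built in because these functions are
  composed with flow maps, and a composition of Borel maps is measurable without any appeal to null
  sets.\<close>

definition loc1 :: "('a::euclidean_space \<Rightarrow> 'b::euclidean_space) \<Rightarrow> bool" where
  "loc1 f \<longleftrightarrow> f \<in> borel_measurable borel \<and> (\<forall>R. nL R f < top)"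

lemma loc1_measurable[measurable_dest]: "loc1 f \<Longrightarrow> f \<in> borel_measurable borel"
  by (simp add: loc1_def)

lemma loc1_finite: "loc1 f \<Longrightarrow> nL R f < top"
  by (simp add: loc1_def)

lemma nL_mono_AE:
  assumes "AE x in lborel. norm x \<le> R \<longrightarrow> norm (f x) \<le> norm (g x)"
  shows "nL R f \<le> nL R g"
  unfolding nL_def using assms
  by (intro nn_integral_mono_AE) (auto simp: indicator_def elim!: eventually_mono)

lemma nL_mono:
  assumes "\<And>x. norm x \<le> R \<Longrightarrow> norm (f x) \<le> norm (g x)"
  shows "nL R f \<le> nL R g"
  by (rule nL_mono_AE) (simp add: assms)

lemma nL_cong_AE:
  assumes "AE x in lborel. norm (f x) = norm (g x)"
  shows "nL R f = nL R g"
  unfolding nL_def using assms by (intro nn_integral_cong_AE) auto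

lemma nL_mono_radius: "R \<le> R' \<Longrightarrow> nL R f \<le> nL R' f"
  unfolding nL_def by (intro nn_integral_mono) (auto simp: indicator_def)

lemma nL_add_le:
  assumes [measurable]: "f \<in> borel_measurable borel" "g \<in> borel_measurable borel"
    and "\<And>x. norm x \<le> R \<Longrightarrow> norm (k x) \<le> norm (f x) + norm (g x)"
  shows "nL R k \<le> nL R f + nL R g"
proof -
  have "nL R k \<le> (\<integral>\<^sup>+x. ennreal (norm (f x)) * indicator (cball 0 R) x
      + ennreal (norm (g x)) * indicator (cball 0 R) x \<partial>lborel)"
    unfolding nL_def using assms(3)
    by (intro nn_integral_mono) (auto simp: indicator_def simp flip: ennreal_plus)
  also have "\<dots> = nL R f + nL R g"
    unfolding nL_def by (rule nn_integral_add) auto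
  finally show ?thesis .
qed

lemma nL_cmult_le:
  assumes [measurable]: "f \<in> borel_measurable borel" and "c \<ge> 0"
    and "\<And>x. norm x \<le> R \<Longrightarrow> norm (k x) \<le> c * norm (f x)"
  shows "nL R k \<le> ennreal c * nL R f"
proof -
  have "nL R k \<le> (\<integral>\<^sup>+x. ennreal c * (ennreal (norm (f x)) * indicator (cball 0 R) x) \<partial>lborel)"
    unfolding nL_def using assms(2,3)
    by (intro nn_integral_mono) (auto simp: indicator_def simp flip: ennreal_mult)
  also have "\<dots> = ennreal c * nL R f"
    unfolding nL_def by (rule nn_integral_cmult) auto
  finally show ?thesis .
qed

lemma nL_sum_le:
  assumes "finite I" "\<And>i. i \<in> I \<Longrightarrow> f i \<in> borel_measurable borel"
  shows "nL R (\<lambda>y. \<Sum>i\<in>I. f i y) \<le> (\<Sum>i\<in>I. nL R (f i))"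
  using assms
proof (induction I rule: finite_induct)
  case empty
  then show ?case by (simp add: nL_def)
next
  case (insert i I)
  have "nL R (\<lambda>y. \<Sum>i\<in>insert i I. f i y) \<le> nL R (f i) + nL R (\<lambda>y. \<Sum>i\<in>I. f i y)"
  proof (rule nL_add_le)
    show "f i \<in> borel_measurable borel" using insert.prems by simp
    show "(\<lambda>y. \<Sum>i\<in>I. f i y) \<in> borel_measurable borel"
      by (rule borel_measurable_sum) (use insert.prems in auto)
    show "norm (\<Sum>i\<in>insert i I. f i y) \<le> norm (f i y) + norm (\<Sum>i\<in>I. f i y)" for y
      unfolding sum.insert[OF insert.hyps] by (rule norm_triangle_ineq)
  qed
  also have "\<dots> \<le> nL R (f i) + (\<Sum>i\<in>I. nL R (f i))"
    using insert.IH insert.prems by (intro add_left_mono) auto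
  finally show ?case using insert.hyps by simp
qed

lemma nL_bounded:
  fixes f :: "'a::euclidean_space \<Rightarrow> 'b::euclidean_space"
  assumes "\<And>x. norm x \<le> R \<Longrightarrow> norm (f x) \<le> c"
  shows "nL R f \<le> ennreal c * emeasure lborel (cball (0::'a) R)"
proof -
  have "nL R f \<le> (\<integral>\<^sup>+x. ennreal c * indicator (cball (0::'a) R) x \<partial>lborel)"
    unfolding nL_def using assms
    by (intro nn_integral_mono) (auto simp: indicator_def intro: ennreal_leI)
  then show ?thesis by (simp add: nn_integral_cmult_indicator)
qed

lemma emeasure_cball_finite[simp]: "emeasure lborel (cball (x::'a::euclidean_space) R) < top"
  using emeasure_lborel_cball_finite[of x R] by (simp add: less_top)

lemma loc1_bounded:
  fixes f :: "'a::euclidean_space \<Rightarrow> 'b::euclidean_space"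
  assumes "f \<in> borel_measurable borel" "\<And>x. norm (f x) \<le> c"
  shows "loc1 f"
proof -
  have "nL R f < top" for R
  proof -
    have "nL R f \<le> ennreal c * emeasure lborel (cball (0::'a) R)"
      by (rule nL_bounded) (rule assms)
    also have "\<dots> < top" by (simp add: ennreal_mult_less_top)
    finally show ?thesis .
  qed
  then show ?thesis using assms by (auto simp: loc1_def)
qed

lemma loc1_le:
  assumes "loc1 g" "f \<in> borel_measurable borel" "\<And>x. norm (f x) \<le> c * norm (g x)"
  shows "loc1 f"
proof -
  have "nL R f < top" for R
  proof -
    have "nL R f \<le> ennreal (max c 0) * nL R g"
      using assms by (intro nL_cmult_le) (auto intro!: order_trans[OF assms(3)] mult_right_mono simp: loc1_def)
    also have "\<dots> < top" using loc1_finite[OF assms(1)] by (simp add: ennreal_mult_less_top)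
    finally show ?thesis .
  qed
  then show ?thesis using assms by (auto simp: loc1_def)
qed

lemma loc1_add:
  assumes "loc1 f" "loc1 g" shows "loc1 (\<lambda>x. f x + g x)"
proof -
  have [measurable]: "f \<in> borel_measurable borel" "g \<in> borel_measurable borel"
    using assms by auto
  have "nL R (\<lambda>x. f x + g x) < top" for R
  proof -
    have "nL R (\<lambda>x. f x + g x) \<le> nL R f + nL R g"
      by (intro nL_add_le) (auto intro: norm_triangle_ineq)
    also have "\<dots> < top" using loc1_finite[OF assms(1)] loc1_finite[OF assms(2)] by simp
    finally show ?thesis .
  qed
  then show ?thesis by (auto simp: loc1_def)
qed

lemma loc1_diff:
  assumes "loc1 f" "loc1 g" shows "loc1 (\<lambda>x. f x - g x)"
  using loc1_add[OF assms(1) loc1_le[OF assms(2), of "\<lambda>x. - g x" 1]] assms(2) by auto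

lemma loc1_sum:
  assumes "\<And>i. i \<in> I \<Longrightarrow> loc1 (f i)" shows "loc1 (\<lambda>x. \<Sum>i\<in>I. f i x)"
  using assms
  by (induction I rule: infinite_finite_induct) (auto intro: loc1_add loc1_bounded[where c=0])

lemma nL_shift:
  assumes [measurable]: "f \<in> borel_measurable borel"
  shows "nL R (\<lambda>x. f (x + h)) \<le> nL (R + norm h) f"
proof -
  have "nL R (\<lambda>x. f (x + h)) \<le> (\<integral>\<^sup>+x. ennreal (norm (f (x + h))) * indicator (cball 0 (R + norm h)) (x + h) \<partial>lborel)"
    unfolding nL_def
    by (intro nn_integral_mono) (auto simp: indicator_def intro: norm_triangle_mono)
  also have "\<dots> = nL (R + norm h) f"
    unfolding nL_def by (rule nn_integral_translation) auto
  finally show ?thesis .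
qed

text \<open>Minkowski's integral inequality, by Tonelli. Where \<open>F v x\<close> is not
  integrable in v the left integrand is 0, so the bound holds there as well.\<close>

lemma nL_integral_le:
  fixes F :: "'m \<Rightarrow> 'a::euclidean_space \<Rightarrow> 'b::euclidean_space"
  assumes "sigma_finite_measure M"
    and [measurable]: "(\<lambda>(v, x). F v x) \<in> borel_measurable (M \<Otimes>\<^sub>M lborel)"
  shows "nL R (\<lambda>x. \<integral>v. F v x \<partial>M) \<le> (\<integral>\<^sup>+v. nL R (F v) \<partial>M)"
proof -
  interpret M: sigma_finite_measure M by fact
  interpret pair_sigma_finite M "lborel :: 'a measure" ..
  have "nL R (\<lambda>x. \<integral>v. F v x \<partial>M) \<le> (\<integral>\<^sup>+x. (\<integral>\<^sup>+v. ennreal (norm (F v x)) \<partial>M) * indicator (cball 0 R) x \<partial>lborel)"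
    unfolding nL_def by (intro nn_integral_mono mult_right_mono norm_integral_le_nn_integral) auto
  also have "\<dots> = (\<integral>\<^sup>+x. (\<integral>\<^sup>+v. ennreal (norm (F v x)) * indicator (cball 0 R) x \<partial>M) \<partial>lborel)"
    by (intro nn_integral_cong nn_integral_multc[symmetric]) measurable
  also have "\<dots> = (\<integral>\<^sup>+v. (\<integral>\<^sup>+x. ennreal (norm (F v x)) * indicator (cball 0 R) x \<partial>lborel) \<partial>M)"
    by (rule Fubini') measurable
  finally show ?thesis unfolding nL_def .
qed

lemma nL_eq_0_imp_AE:
  assumes [measurable]: "f \<in> borel_measurable borel" and "\<And>R. nL R f = 0"
  shows "AE x in lborel. f x = 0"
proof -
  have "AE x in lborel. norm x \<le> real n \<longrightarrow> f x = 0" for n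
  proof -
    have "AE x in lborel. ennreal (norm (f x)) * indicator (cball 0 (real n)) x = 0"
      using assms(2)[of "real n"] unfolding nL_def by (subst (asm) nn_integral_0_iff_AE) auto
    then show ?thesis by (auto simp: indicator_def elim!: eventually_mono)
  qed
  then have "AE x in lborel. \<forall>n::nat. norm x \<le> real n \<longrightarrow> f x = 0"
    unfolding AE_all_countable by blast
  then show ?thesis by eventually_elim (meson real_arch_simple)
qed

text \<open>The compression bound compares the image of Lebesgue measure under g with C times
  Lebesgue measure. The displacement bound accounts for the larger radius on the right.\<close>

lemma nL_compose_le:
  fixes g :: "'a::euclidean_space \<Rightarrow> 'a" and f :: "'a \<Rightarrow> 'b::euclidean_space"
  assumes [measurable]: "f \<in> borel_measurable borel" "g \<in> borel_measurable borel"
    and r: "\<And>x. norm (g x - x) \<le> r"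
    and C: "\<And>A. A \<in> sets borel \<Longrightarrow> emeasure lborel (g -` A) \<le> C * emeasure lborel A"
  shows "nL R (\<lambda>x. f (g x)) \<le> C * nL (R + r) f"
proof -
  have "nL R (\<lambda>x. f (g x)) \<le> (\<integral>\<^sup>+x. ennreal (norm (f (g x))) * indicator (cball 0 (R + r)) (g x) \<partial>lborel)"
    unfolding nL_def
  proof (intro nn_integral_mono)
    fix x
    have "norm (g x) \<le> norm x + r" using r[of x] norm_triangle_sub[of "g x" x] by linarith
    then show "ennreal (norm (f (g x))) * indicator (cball 0 R) x \<le> ennreal (norm (f (g x))) * indicator (cball 0 (R + r)) (g x)"
      by (auto simp: indicator_def)
  qed
  also have "\<dots> = (\<integral>\<^sup>+y. ennreal (norm (f y)) * indicator (cball 0 (R + r)) y \<partial>distr lborel borel g)"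
    by (subst nn_integral_distr) auto
  also have "\<dots> \<le> (\<integral>\<^sup>+y. ennreal (norm (f y)) * indicator (cball 0 (R + r)) y \<partial>scale_measure C lborel)"
    by (rule nn_integral_mono_measure)
       (auto simp: le_measure emeasure_distr C)
  also have "\<dots> = C * nL (R + r) f"
    unfolding nL_def by (subst nn_integral_scale_measure) auto
  finally show ?thesis .
qed

text \<open>g is only locally integrable, so it is truncated at a height N. The part of g above N
  contributes at most M times its norm, small for large N by dominated convergence; the rest
  contributes at most N times the norm of \<open>h i\<close>.\<close>

lemma nL_mult_tendsto_0:
  fixes g :: "'a::euclidean_space \<Rightarrow> 'b::euclidean_space" and h :: "'i \<Rightarrow> 'a \<Rightarrow> 'c::euclidean_space"
  assumes g: "loc1 g" and h[measurable]: "\<And>i. h i \<in> borel_measurable borel"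
    and M: "\<And>i x. norm (h i x) \<le> M" and lim: "((\<lambda>i. nL R (h i)) \<longlongrightarrow> 0) F"
  shows "((\<lambda>i. nL R (\<lambda>x. norm (g x) * norm (h i x))) \<longlongrightarrow> 0) F"
proof (rule ennreal_tendsto_0I)
  fix e :: real assume e: "e > 0"
  note [measurable] = loc1_measurable[OF g]
  have M0: "M \<ge> 0" using M norm_ge_zero order_trans by blast
  define t where "t n x = (if norm (g x) > real n then g x else 0)" for n x
  have [measurable]: "t n \<in> borel_measurable borel" for n unfolding t_def by measurable
  have "(\<lambda>n. nL R (t n)) \<longlonglongrightarrow> (\<integral>\<^sup>+x. 0 \<partial>(lborel::'a measure))"
    unfolding nL_def
  proof (rule nn_integral_dominated_convergence[where w="\<lambda>x. ennreal (norm (g x)) * indicator (cball 0 R) x"])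
    show "AE x in lborel. (\<lambda>n. ennreal (norm (t n x)) * indicator (cball 0 R) x) \<longlonglongrightarrow> 0"
    proof (intro AE_I2 tendsto_eventually)
      fix x
      obtain N :: nat where "norm (g x) \<le> real N" using real_arch_simple by blast
      then show "\<forall>\<^sub>F n in sequentially. ennreal (norm (t n x)) * indicator (cball 0 R) x = 0"
        by (auto simp: t_def eventually_sequentially intro!: exI[of _ N])
    qed
  qed (use loc1_finite[OF g, of R] in \<open>auto simp: t_def nL_def indicator_def\<close>)
  then have "(\<lambda>n. ennreal M * nL R (t n)) \<longlonglongrightarrow> 0"
    by (intro ennreal_tendsto_0_cmult) auto
  from ennreal_tendsto_0D[OF this, of "e/2"] e
  obtain N where N: "ennreal M * nL R (t N) \<le> ennreal (e/2)"
    by (auto simp: eventually_sequentially)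
  have "((\<lambda>i. ennreal (real N) * nL R (h i)) \<longlongrightarrow> 0) F"
    by (intro ennreal_tendsto_0_cmult lim) auto
  from ennreal_tendsto_0D[OF this, of "e/2"] e
  have "\<forall>\<^sub>F i in F. ennreal (real N) * nL R (h i) \<le> ennreal (e/2)" by simp
  then show "\<forall>\<^sub>F i in F. nL R (\<lambda>x. norm (g x) * norm (h i x)) \<le> ennreal e"
  proof eventually_elim
    fix i assume i: "ennreal (real N) * nL R (h i) \<le> ennreal (e/2)"
    have "nL R (\<lambda>x. norm (g x) * norm (h i x)) \<le> nL R (\<lambda>x. real N *\<^sub>R h i x) + nL R (\<lambda>x. M *\<^sub>R t N x)"
    proof (rule nL_add_le)
      fix x
      show "norm (norm (g x) * norm (h i x)) \<le> norm (real N *\<^sub>R h i x) + norm (M *\<^sub>R t N x)"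
      proof (cases "norm (g x) > real N")
        case True
        then show ?thesis using M[of i x] M0 mult_left_mono[OF M[of i x], of "norm (g x)"]
          by (auto simp: t_def mult.commute intro!: add_increasing)
      next
        case False
        then show ?thesis by (auto simp: t_def intro!: mult_right_mono)
      qed
    qed auto
    also have "\<dots> \<le> ennreal (real N) * nL R (h i) + ennreal M * nL R (t N)"
      using M0 by (intro add_mono nL_cmult_le) auto
    also have "\<dots> \<le> ennreal (e/2) + ennreal (e/2)" by (intro add_mono i N)
    also have "\<dots> = ennreal e" using e by (simp flip: ennreal_plus)
    finally show "nL R (\<lambda>x. norm (g x) * norm (h i x)) \<le> ennreal e" .
  qed
qed


subsection \<open>Translation continuity and mollification\<close>

lemma ennreal_tendsto_0_eventually_le:
  fixes f g :: "'i \<Rightarrow> ennreal"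
  assumes "(g \<longlongrightarrow> 0) F" "\<forall>\<^sub>F x in F. f x \<le> g x"
  shows "(f \<longlongrightarrow> 0) F"
  using assms(2) by (intro tendsto_sandwich[OF _ _ tendsto_const assms(1)]) auto

definition L1_translation_continuous :: "('a::euclidean_space \<Rightarrow> 'b::euclidean_space) \<Rightarrow> bool" where
  "L1_translation_continuous f \<longleftrightarrow>
     ((\<lambda>h. \<integral>\<^sup>+x. ennreal (norm (f (x + h) - f x)) \<partial>lborel) \<longlongrightarrow> 0) (nhds 0)"

text \<open>The class is closed under \<open>L\<^sup>1\<close> limits: by translation invariance f -
  g and its translate are equally small, hence the three thirds.\<close>

lemma L1_translation_continuous_approx:
  fixes f :: "'a::euclidean_space \<Rightarrow> 'b::euclidean_space"
  assumes [measurable]: "f \<in> borel_measurable borel"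
    and ap: "\<And>e::real. e > 0 \<Longrightarrow> \<exists>g\<in>borel_measurable borel. L1_translation_continuous g \<and>
      (\<integral>\<^sup>+x. ennreal (norm (f x - g x)) \<partial>lborel) \<le> ennreal e"
  shows "L1_translation_continuous f"
  unfolding L1_translation_continuous_def
proof (rule ennreal_tendsto_0I)
  fix e :: real assume e: "e > 0"
  obtain g where [measurable]: "g \<in> borel_measurable borel" and tc: "L1_translation_continuous g"
    and le: "(\<integral>\<^sup>+x. ennreal (norm (f x - g x)) \<partial>lborel) \<le> ennreal (e/3)"
    using ap[of "e/3"] e by auto
  have "e/3 > 0" using e by simp
  from ennreal_tendsto_0D[OF tc[unfolded L1_translation_continuous_def] this]
  show "\<forall>\<^sub>F h in nhds 0. (\<integral>\<^sup>+x. ennreal (norm (f (x + h) - f x)) \<partial>lborel) \<le> ennreal e"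
  proof eventually_elim
    fix h assume h: "(\<integral>\<^sup>+x. ennreal (norm (g (x + h) - g x)) \<partial>lborel) \<le> ennreal (e/3)"
    have "(\<integral>\<^sup>+x. ennreal (norm (f (x + h) - f x)) \<partial>lborel)
       \<le> (\<integral>\<^sup>+x. ennreal (norm (f (x + h) - g (x + h))) + (ennreal (norm (g (x + h) - g x)) + ennreal (norm (f x - g x))) \<partial>lborel)"
    proof (intro nn_integral_mono)
      fix x
      have "norm (f (x + h) - f x) \<le> norm (f (x + h) - g (x + h)) + (norm (g (x + h) - g x) + norm (f x - g x))"
        using norm_triangle_ineq[of "f (x + h) - g (x + h)" "g (x + h) - f x"]
          norm_triangle_ineq[of "g (x + h) - g x" "g x - f x"] norm_minus_commute[of "f x" "g x"] by simp
      then show "ennreal (norm (f (x + h) - f x)) \<le> ennreal (norm (f (x + h) - g (x + h))) + (ennreal (norm (g (x + h) - g x)) + ennreal (norm (f x - g x)))"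
        by (simp flip: ennreal_plus)
    qed
    also have "\<dots> = (\<integral>\<^sup>+x. ennreal (norm (f (x + h) - g (x + h))) \<partial>lborel) + ((\<integral>\<^sup>+x. ennreal (norm (g (x + h) - g x)) \<partial>lborel) + (\<integral>\<^sup>+x. ennreal (norm (f x - g x)) \<partial>lborel))"
      by (simp add: nn_integral_add)
    also have "(\<integral>\<^sup>+x. ennreal (norm (f (x + h) - g (x + h))) \<partial>lborel) = (\<integral>\<^sup>+x. ennreal (norm (f x - g x)) \<partial>lborel)"
      by (rule nn_integral_translation) measurable
    also have "\<dots> + ((\<integral>\<^sup>+x. ennreal (norm (g (x + h) - g x)) \<partial>lborel) + (\<integral>\<^sup>+x. ennreal (norm (f x - g x)) \<partial>lborel))
      \<le> ennreal (e/3) + (ennreal (e/3) + ennreal (e/3))"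
      by (intro add_mono le h)
    also have "\<dots> = ennreal e" using e by (simp flip: ennreal_plus)
    finally show "(\<integral>\<^sup>+x. ennreal (norm (f (x + h) - f x)) \<partial>lborel) \<le> ennreal e" .
  qed
qed

text \<open>Each point of an open U stays in U under small translations, so the part of U that
  leaves U has vanishing measure by dominated convergence. The part that enters U under h is a
  translate of the part that leaves under -h, hence the sum \<open>D h + D (- h)\<close>.\<close>

lemma L1_translation_continuous_open:
  fixes U :: "'a::euclidean_space set" and c :: "'b::euclidean_space"
  assumes U: "open U" and fin: "emeasure lborel U < top"
  shows "L1_translation_continuous (\<lambda>x. indicat_real U x *\<^sub>R c)"
proof -
  have [measurable]: "U \<in> sets borel" using U by auto
  define D where "D h = (\<integral>\<^sup>+x. indicator {x\<in>U. x + h \<notin> U} x \<partial>(lborel::'a measure))" for h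
  have [measurable]: "{x \<in> U. x + h \<notin> U} \<in> sets borel" for h
  proof -
    have "{x \<in> U. x + h \<notin> U} = {x \<in> space borel. x \<in> U \<and> x + h \<notin> U}" by simp
    also have "\<dots> \<in> sets borel" by measurable
    finally show ?thesis .
  qed
  have D: "(D \<longlongrightarrow> 0) (nhds 0)"
  proof (subst tendsto_nhds_iff, intro conjI)
    show "D 0 = 0" by (simp add: D_def)
  next
    show "(D \<longlongrightarrow> 0) (at 0)"
    proof (rule iffD2[OF tendsto_at_iff_sequentially], intro allI impI)
      fix X :: "nat \<Rightarrow> 'a" assume X: "X \<longlonglongrightarrow> 0"
      have "(\<lambda>n. D (X n)) \<longlonglongrightarrow> (\<integral>\<^sup>+x. 0 \<partial>(lborel::'a measure))"
        unfolding D_def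
      proof (rule nn_integral_dominated_convergence[where w="indicator U"])
        show "AE x in lborel. (\<lambda>n. indicator {x \<in> U. x + X n \<notin> U} x :: ennreal) \<longlonglongrightarrow> 0"
        proof (intro AE_I2 tendsto_eventually)
          fix x
          have "(\<lambda>n. x + X n) \<longlonglongrightarrow> x" using tendsto_add[OF tendsto_const X, of x] by simp
          then show "\<forall>\<^sub>F n in sequentially. indicator {x \<in> U. x + X n \<notin> U} x = (0::ennreal)"
            using topological_tendstoD[OF _ U, of _ x sequentially]
            by (cases "x \<in> U") (auto elim!: eventually_mono simp: indicator_def)
        qed
        show "(\<integral>\<^sup>+x. indicator U x \<partial>(lborel::'a measure)) < \<infinity>" using fin by simp
      qed (auto simp: indicator_def)
      then show "(D \<circ> X) \<longlonglongrightarrow> 0" by (simp add: o_def)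
    qed
  qed
  have Dm: "((\<lambda>h. D (- h)) \<longlongrightarrow> 0) (nhds 0)"
    using filterlim_compose[OF D, of uminus "nhds 0"] tendsto_minus[of "\<lambda>x. x" "0::'a" "nhds 0"]
    by (auto simp: filterlim_ident)
  have "((\<lambda>h. ennreal (norm c) * (D h + D (- h))) \<longlongrightarrow> 0) (nhds 0)"
    using tendsto_add[OF D Dm] by (intro ennreal_tendsto_0_cmult) auto
  moreover have "(\<integral>\<^sup>+x. ennreal (norm (indicat_real U (x + h) *\<^sub>R c - indicat_real U x *\<^sub>R c)) \<partial>lborel)
      \<le> ennreal (norm c) * (D h + D (- h))" for h
  proof -
    have "(\<integral>\<^sup>+x. ennreal (norm (indicat_real U (x + h) *\<^sub>R c - indicat_real U x *\<^sub>R c)) \<partial>lborel)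
      \<le> (\<integral>\<^sup>+x. ennreal (norm c) * (indicator {x\<in>U. x + h \<notin> U} x + indicator {x\<in>U. x + (- h) \<notin> U} (x + h)) \<partial>lborel)"
      by (intro nn_integral_mono) (auto simp: indicator_def)
    also have "\<dots> = ennreal (norm c) * (D h + (\<integral>\<^sup>+x. indicator {x\<in>U. x + (- h) \<notin> U} (x + h) \<partial>lborel))"
      unfolding D_def by (subst nn_integral_cmult) (measurable, subst nn_integral_add, auto)
    also have "(\<integral>\<^sup>+x. indicator {x\<in>U. x + (- h) \<notin> U} (x + h) \<partial>lborel) = D (- h)"
      unfolding D_def by (rule nn_integral_translation) measurable
    finally show ?thesis .
  qed
  ultimately show ?thesis
    unfolding L1_translation_continuous_def by (rule ennreal_tendsto_0_le)
qed

text \<open>Induction over integrable functions. For indicators, outer regularity replaces the Borel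
  set by an open one, where pointwise convergence of the translates is available.\<close>

lemma integrable_imp_L1_translation_continuous:
  fixes f :: "'a::euclidean_space \<Rightarrow> 'b::euclidean_space"
  assumes "integrable lborel f"
  shows "L1_translation_continuous f"
  using assms
proof (induction rule: integrable_induct)
  case (base A c)
  have [measurable]: "A \<in> sets borel" using base by simp
  show ?case
  proof (rule L1_translation_continuous_approx)
    fix e :: real assume e: "e > 0"
    \<comment> \<open>The summand 1 covers the case c = 0.\<close>
    define e' where "e' = e / (norm c + 1)"
    have e': "e' > 0" using e by (simp add: e'_def add_nonneg_pos)
    obtain U where U: "open U" "A \<subseteq> U" "emeasure lborel (U - A) < e'"
      using outer_regular_lborel[OF _ e', of A] by auto
    have [measurable]: "U \<in> sets borel" using U by auto
    have "emeasure lborel U = emeasure lborel A + emeasure lborel (U - A)"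
      using U by (subst plus_emeasure) (auto simp: Un_absorb1)
    also have "\<dots> < top" using base U(3) by (auto simp: less_top[symmetric])
    finally have fin: "emeasure lborel U < top" .
    have "(\<integral>\<^sup>+x. ennreal (norm (indicat_real A x *\<^sub>R c - indicat_real U x *\<^sub>R c)) \<partial>lborel)
       = (\<integral>\<^sup>+x. ennreal (norm c) * indicator (U - A) x \<partial>lborel)"
      using U(2) by (intro nn_integral_cong) (auto simp: indicator_def)
    also have "\<dots> = ennreal (norm c) * emeasure lborel (U - A)"
      by (simp add: nn_integral_cmult_indicator)
    also have "\<dots> \<le> ennreal (norm c) * ennreal e'" using U(3) by (intro mult_left_mono) auto
    also have "\<dots> = ennreal (norm c * e')" using e' by (simp add: ennreal_mult)
    also have "ennreal (norm c * e') \<le> ennreal ((norm c + 1) * e')"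
      using e' by (intro ennreal_leI mult_right_mono) auto
    also have "(norm c + 1) * e' = e" by (simp add: e'_def add_nonneg_eq_0_iff)
    finally show "\<exists>g\<in>borel_measurable borel. L1_translation_continuous g \<and>
      (\<integral>\<^sup>+x. ennreal (norm (indicat_real A x *\<^sub>R c - g x)) \<partial>lborel) \<le> ennreal e"
      using L1_translation_continuous_open[OF U(1) fin, of c]
      by (intro bexI[of _ "\<lambda>x. indicat_real U x *\<^sub>R c"]) auto
  qed auto
next
  case (add f g)
  have [measurable]: "f \<in> borel_measurable borel" "g \<in> borel_measurable borel"
    using add(1,2) by auto
  let ?I = "\<lambda>f h. \<integral>\<^sup>+x. ennreal (norm (f (x + h) - f x)) \<partial>(lborel :: 'a measure)"
  have "((\<lambda>h. ?I f h + ?I g h) \<longlongrightarrow> 0) (nhds 0)"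
    using tendsto_add[OF add(3,4)[unfolded L1_translation_continuous_def]] by simp
  moreover have "?I (\<lambda>x. f x + g x) h \<le> ?I f h + ?I g h" for h
  proof -
    have "?I (\<lambda>x. f x + g x) h \<le> (\<integral>\<^sup>+x. ennreal (norm (f (x + h) - f x)) + ennreal (norm (g (x + h) - g x)) \<partial>lborel)"
      by (intro nn_integral_mono) (simp add: norm_diff_triangle_ineq flip: ennreal_plus)
    also have "\<dots> = ?I f h + ?I g h" by (rule nn_integral_add) auto
    finally show ?thesis .
  qed
  ultimately show ?case
    unfolding L1_translation_continuous_def by (rule ennreal_tendsto_0_le)
next
  case (lim f s)
  have [measurable]: "f \<in> borel_measurable borel" "\<And>i. s i \<in> borel_measurable borel"
    using lim(1,4) by auto
  show ?case
  proof (rule L1_translation_continuous_approx)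
    fix e :: real assume e: "e > 0"
    have "(\<lambda>i. \<integral>\<^sup>+x. ennreal (norm (f x - s i x)) \<partial>lborel) \<longlonglongrightarrow> 0"
      by (rule nn_integral_dominated_convergence_norm[where w="\<lambda>x. 2 * norm (f x)"])
         (use lim in \<open>auto simp: integrable_iff_bounded nn_integral_cmult ennreal_mult ennreal_mult_less_top\<close>)
    from ennreal_tendsto_0D[OF this e] obtain i where
      "(\<integral>\<^sup>+x. ennreal (norm (f x - s i x)) \<partial>lborel) \<le> ennreal e"
      by (auto simp: eventually_sequentially)
    then show "\<exists>g\<in>borel_measurable borel. L1_translation_continuous g \<and>
      (\<integral>\<^sup>+x. ennreal (norm (f x - g x)) \<partial>lborel) \<le> ennreal e"
      using lim(5) by (intro bexI[of _ "s i"]) auto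
  qed measurable
qed

lemma loc1_integrable:
  assumes "loc1 f" shows "integrable lborel (\<lambda>x. indicat_real (cball 0 R) x *\<^sub>R f x)"
proof -
  have [measurable]: "f \<in> borel_measurable borel" using assms by auto
  have "(\<integral>\<^sup>+x. ennreal (norm (indicat_real (cball 0 R) x *\<^sub>R f x)) \<partial>lborel) = nL R f"
    unfolding nL_def by (intro nn_integral_cong) (auto simp: indicator_def)
  then show ?thesis using loc1_finite[OF assms, of R] by (intro integrableI_bounded) auto
qed

lemma nL_translation_tendsto_0:
  assumes "loc1 f"
  shows "((\<lambda>h. nL R (\<lambda>x. f (x + h) - f x)) \<longlongrightarrow> 0) (nhds 0)"
proof -
  \<comment> \<open>Cutting off at radius R + 1 makes f integrable on the whole space; for h of norm
    at most 1 the cut is not felt on the ball of radius R.\<close>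
  define g where "g x = indicat_real (cball 0 (R + 1)) x *\<^sub>R f x" for x
  have [measurable]: "f \<in> borel_measurable borel" using assms by auto
  have [measurable]: "g \<in> borel_measurable borel" by (simp add: g_def[abs_def])
  have "((\<lambda>h. \<integral>\<^sup>+x. ennreal (norm (g (x + h) - g x)) \<partial>lborel) \<longlongrightarrow> 0) (nhds 0)"
    using integrable_imp_L1_translation_continuous[OF loc1_integrable[OF assms, of "R + 1"]]
    by (simp add: L1_translation_continuous_def g_def)
  moreover have "\<forall>\<^sub>F h in nhds (0::'a). norm h \<le> 1"
    by (auto simp: eventually_nhds_metric intro!: exI[of _ 1])
  then have "\<forall>\<^sub>F h in nhds 0. nL R (\<lambda>x. f (x + h) - f x) \<le> (\<integral>\<^sup>+x. ennreal (norm (g (x + h) - g x)) \<partial>lborel)"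
  proof eventually_elim
    fix h :: 'a assume h: "norm h \<le> 1"
    have le: "norm (x + h) \<le> R + 1" "norm x \<le> R + 1" if "norm x \<le> R" for x
      using norm_triangle_ineq[of x h] h that by auto
    show "nL R (\<lambda>x. f (x + h) - f x) \<le> (\<integral>\<^sup>+x. ennreal (norm (g (x + h) - g x)) \<partial>lborel)"
      unfolding nL_def by (intro nn_integral_mono) (auto simp: g_def indicator_def le)
  qed
  ultimately show ?thesis by (rule ennreal_tendsto_0_eventually_le)
qed
text \<open>Weaker than \<open>mollifier\<close>, because derivatives, absolute values and
  reflections of mollifiers have to qualify too.\<close>

definition bump :: "real \<Rightarrow> ('a::euclidean_space \<Rightarrow> real) \<Rightarrow> bool" where
  "bump r k \<longleftrightarrow> continuous_on UNIV k \<and> (\<forall>x. norm x > r \<longrightarrow> k x = 0)"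

lemma bump_measurable[measurable_dest]: "bump r k \<Longrightarrow> k \<in> borel_measurable borel"
  by (auto simp: bump_def intro: borel_measurable_continuous_onI)

lemma bump_bounded:
  assumes "bump r k" obtains B where "B \<ge> 0" "\<And>x. \<bar>k x\<bar> \<le> B"
proof -
  have "compact (k ` cball 0 r)"
    using assms by (intro compact_continuous_image) (auto simp: bump_def intro: continuous_on_subset)
  then obtain b where "\<forall>y\<in>k ` cball 0 r. norm y \<le> b"
    using compact_imp_bounded bounded_iff by metis
  then have b: "\<And>x. norm x \<le> r \<Longrightarrow> \<bar>k x\<bar> \<le> b" by auto
  have "\<bar>k x\<bar> \<le> max b 0" for x
    using b[of x] assms by (cases "norm x \<le> r") (auto simp: bump_def)
  then show thesis by (intro that[of "max b 0"]) auto
qed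

lemma bump_integrable:
  fixes f :: "'a::euclidean_space \<Rightarrow> 'b::euclidean_space"
  assumes "bump r k" "loc1 f"
  shows "integrable lborel (\<lambda>x. k x *\<^sub>R f x)"
proof -
  obtain B where B: "B \<ge> 0" "\<And>x. \<bar>k x\<bar> \<le> B" using bump_bounded[OF assms(1)] by blast
  have [measurable]: "k \<in> borel_measurable borel" "f \<in> borel_measurable borel"
    using assms by auto
  show ?thesis
  proof (rule Bochner_Integration.integrable_bound)
    show "integrable lborel (\<lambda>x. B *\<^sub>R (indicat_real (cball 0 r) x *\<^sub>R f x))"
      by (intro integrable_scaleR_right loc1_integrable assms)
    show "AE x in lborel. norm (k x *\<^sub>R f x) \<le> norm (B *\<^sub>R (indicat_real (cball 0 r) x *\<^sub>R f x))"
      using B assms(1) by (auto simp: indicator_def bump_def intro!: AE_I2 mult_right_mono)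
  qed auto
qed

lemma nn_integral_affine_subst:
  fixes f :: "'a::euclidean_space \<Rightarrow> ennreal"
  assumes [measurable]: "f \<in> borel_measurable borel" and "e \<noteq> 0"
  shows "(\<integral>\<^sup>+w. f w \<partial>lborel) = ennreal (\<bar>e\<bar> ^ DIM('a)) * (\<integral>\<^sup>+v. f (y - e *\<^sub>R v) \<partial>lborel)"
proof -
  have "(\<integral>\<^sup>+w. f w \<partial>lborel) = (\<integral>\<^sup>+w. f w \<partial>density (distr lborel borel (\<lambda>x. y + (- e) *\<^sub>R x)) (\<lambda>_. ennreal (\<bar>e\<bar>^DIM('a))))"
    using lborel_affine[of "- e" y] assms(2) by simp
  also have "\<dots> = ennreal (\<bar>e\<bar> ^ DIM('a)) * (\<integral>\<^sup>+v. f (y - e *\<^sub>R v) \<partial>lborel)"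
    by (subst nn_integral_density) (auto simp: nn_integral_cmult nn_integral_distr)
  finally show ?thesis .
qed

lemma loc1_affine:
  fixes f :: "'a::euclidean_space \<Rightarrow> 'b::euclidean_space"
  assumes "loc1 f" "e \<noteq> 0"
  shows "loc1 (\<lambda>v. f (y - e *\<^sub>R v))"
proof -
  have [measurable]: "f \<in> borel_measurable borel" using assms by auto
  have "nL R (\<lambda>v. f (y - e *\<^sub>R v)) < top" for R
  proof -
    let ?R = "norm y + \<bar>e\<bar> * R"
    have le: "norm (y - e *\<^sub>R v) \<le> ?R" if "norm v \<le> R" for v
    proof -
      have "norm (y - e *\<^sub>R v) \<le> norm y + \<bar>e\<bar> * norm v"
        using norm_triangle_ineq4[of y "e *\<^sub>R v"] by simp
      then show ?thesis using mult_left_mono[OF that, of "\<bar>e\<bar>"] by simp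
    qed
    have "nL R (\<lambda>v. f (y - e *\<^sub>R v)) \<le> (\<integral>\<^sup>+v. ennreal (norm (f (y - e *\<^sub>R v))) * indicator (cball 0 ?R) (y - e *\<^sub>R v) \<partial>lborel)"
      unfolding nL_def by (intro nn_integral_mono) (auto simp: indicator_def le)
    moreover have "nL ?R f = ennreal (\<bar>e\<bar> ^ DIM('a)) * (\<integral>\<^sup>+v. ennreal (norm (f (y - e *\<^sub>R v))) * indicator (cball 0 ?R) (y - e *\<^sub>R v) \<partial>lborel)"
      unfolding nL_def by (rule nn_integral_affine_subst) (use assms in auto)
    moreover have "nL ?R f < top" by (rule loc1_finite[OF assms(1)])
    moreover have "\<not> \<bar>e\<bar> ^ DIM('a) \<le> 0" using assms(2) by (simp add: not_le)
    ultimately show ?thesis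
      by (auto simp: ennreal_mult_less_top ennreal_eq_0_iff intro: le_less_trans)
  qed
  then show ?thesis by (auto simp: loc1_def)
qed

text \<open>The convolution with the rescaled kernel after the substitution
  \<open>w = y - e v\<close>: the kernel stays fixed, and e enters only through translations of f.
  This is the form to which translation continuity applies.\<close>

definition moll :: "('a::euclidean_space \<Rightarrow> real) \<Rightarrow> real \<Rightarrow> ('a \<Rightarrow> 'b::euclidean_space) \<Rightarrow> 'a \<Rightarrow> 'b" where
  "moll k e f y = (\<integral>v. k v *\<^sub>R f (y - e *\<^sub>R v) \<partial>lborel)"

lemma moll_eq:
  fixes f :: "'a::euclidean_space \<Rightarrow> 'b::euclidean_space"
  assumes [measurable]: "k \<in> borel_measurable borel" "f \<in> borel_measurable borel" and "e > 0"
  shows "(\<integral>w. k ((y - w) /\<^sub>R e) *\<^sub>R f w \<partial>lborel) = e ^ DIM('a) *\<^sub>R moll k e f y"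
  using integral_affine_subst[of "\<lambda>w. k ((y - w) /\<^sub>R e) *\<^sub>R f w" e y] assms(3)
  by (simp add: moll_def)

text \<open>As k has integral 1, \<open>f y\<close> can be taken under the integral; Minkowski's
  inequality then leaves an average over v of the translation moduli of f.\<close>

lemma nL_moll_diff_le:
  fixes f :: "'a::euclidean_space \<Rightarrow> 'b::euclidean_space"
  assumes k: "bump r k" "integral\<^sup>L lborel k = 1" and f: "loc1 f" and e: "e > 0"
    and d: "\<And>v. norm v \<le> r \<Longrightarrow> nL R (\<lambda>y. f (y - e *\<^sub>R v) - f y) \<le> d"
  shows "nL R (\<lambda>y. moll k e f y - f y) \<le> d * (\<integral>\<^sup>+v. ennreal \<bar>k v\<bar> \<partial>lborel)"
proof -
  have [measurable]: "k \<in> borel_measurable borel" "f \<in> borel_measurable borel"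
    using k f by auto
  have eq: "moll k e f y - f y = (\<integral>v. k v *\<^sub>R (f (y - e *\<^sub>R v) - f y) \<partial>lborel)" for y
  proof -
    have "integrable lborel (\<lambda>v. k v *\<^sub>R f (y - e *\<^sub>R v))"
      using bump_integrable[OF k(1) loc1_affine[OF f]] e by simp
    moreover have "integrable lborel (\<lambda>v. k v *\<^sub>R f y)"
      by (rule bump_integrable[OF k(1) loc1_bounded[where c="norm (f y)"]]) auto
    moreover have "integrable lborel k" using k(2) not_integrable_integral_eq by fastforce
    then have "(\<integral>v. k v *\<^sub>R f y \<partial>lborel) = f y" using k(2) by simp
    ultimately show ?thesis by (simp add: moll_def scaleR_diff_right)
  qed
  have "nL R (\<lambda>y. moll k e f y - f y) \<le> (\<integral>\<^sup>+v. nL R (\<lambda>y. k v *\<^sub>R (f (y - e *\<^sub>R v) - f y)) \<partial>lborel)"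
    unfolding eq by (rule nL_integral_le) (auto intro: lborel.sigma_finite_measure_axioms)
  also have "\<dots> \<le> (\<integral>\<^sup>+v. d * ennreal \<bar>k v\<bar> \<partial>lborel)"
  proof (intro nn_integral_mono)
    fix v
    have "nL R (\<lambda>y. k v *\<^sub>R (f (y - e *\<^sub>R v) - f y)) \<le> ennreal \<bar>k v\<bar> * nL R (\<lambda>y. f (y - e *\<^sub>R v) - f y)"
      by (rule nL_cmult_le) auto
    also have "\<dots> \<le> d * ennreal \<bar>k v\<bar>"
    proof (cases "norm v \<le> r")
      case True
      then show ?thesis by (subst mult.commute) (intro mult_right_mono d, auto)
    next
      case False
      then show ?thesis using k by (auto simp: bump_def)
    qed
    finally show "nL R (\<lambda>y. k v *\<^sub>R (f (y - e *\<^sub>R v) - f y)) \<le> d * ennreal \<bar>k v\<bar>" .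
  qed
  also have "\<dots> = d * (\<integral>\<^sup>+v. ennreal \<bar>k v\<bar> \<partial>lborel)" by (rule nn_integral_cmult) auto
  finally show ?thesis .
qed

lemma bump_nn_integral_finite:
  assumes "bump r k" shows "(\<integral>\<^sup>+v. ennreal \<bar>k v\<bar> \<partial>lborel) < top"
proof -
  have "integrable lborel (\<lambda>x. k x *\<^sub>R (1::real))"
    by (rule bump_integrable[OF assms loc1_bounded[where c=1]]) auto
  then show ?thesis by (simp add: integrable_iff_bounded)
qed

lemma moll_tendsto:
  fixes f :: "'a::euclidean_space \<Rightarrow> 'b::euclidean_space"
  assumes k: "bump r k" "integral\<^sup>L lborel k = 1" and f: "loc1 f"
  shows "((\<lambda>e. nL R (\<lambda>y. moll k e f y - f y)) \<longlongrightarrow> 0) (at_right 0)"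
proof -
  define K where "K = enn2real (\<integral>\<^sup>+v. ennreal \<bar>k v\<bar> \<partial>lborel)"
  have K: "(\<integral>\<^sup>+v. ennreal \<bar>k v\<bar> \<partial>lborel) = ennreal K" "K \<ge> 0"
    using bump_nn_integral_finite[OF k(1)] by (auto simp: K_def)
  show ?thesis
  proof (rule ennreal_tendsto_0I)
    fix \<eta> :: real assume \<eta>: "\<eta> > 0"
    define \<eta>' where "\<eta>' = \<eta> / (K + 1)"
    have \<eta>': "\<eta>' > 0" using \<eta> K by (simp add: \<eta>'_def)
    from ennreal_tendsto_0D[OF nL_translation_tendsto_0[OF f] this, of R] obtain \<delta>
      where \<delta>: "\<delta> > 0" "\<And>h. norm h < \<delta> \<Longrightarrow> nL R (\<lambda>x. f (x + h) - f x) \<le> ennreal \<eta>'"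
      by (auto simp: eventually_nhds_metric)
    \<comment> \<open>For e below this value a translation by \<open>e *\<^sub>R v\<close> with v in
      the support of k is shorter than \<delta>. The summand 1 keeps the denominator
      positive.\<close>
    define \<epsilon> where "\<epsilon> = \<delta> / (\<bar>r\<bar> + 1)"
    have \<epsilon>: "\<epsilon> > 0" using \<delta> by (simp add: \<epsilon>_def)
    have "nL R (\<lambda>y. moll k e f y - f y) \<le> ennreal \<eta>" if e: "0 < e" "e < \<epsilon>" for e
    proof -
      have "nL R (\<lambda>y. moll k e f y - f y) \<le> ennreal \<eta>' * (\<integral>\<^sup>+v. ennreal \<bar>k v\<bar> \<partial>lborel)"
      proof (rule nL_moll_diff_le[OF k f e(1)])
        fix v :: 'a assume "norm v \<le> r"
        then have "norm (- (e *\<^sub>R v)) \<le> e * (\<bar>r\<bar> + 1)" using e(1) by simp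
        also have "\<dots> < \<delta>" using e(2) by (simp add: \<epsilon>_def pos_less_divide_eq add_nonneg_pos)
        finally show "nL R (\<lambda>y. f (y - e *\<^sub>R v) - f y) \<le> ennreal \<eta>'"
          using \<delta>(2)[of "- (e *\<^sub>R v)"] by simp
      qed
      also have "\<dots> = ennreal (\<eta>' * K)" using \<eta>' K by (simp add: ennreal_mult)
      also have "\<dots> \<le> ennreal (\<eta>' * (K + 1))" using \<eta>' by (intro ennreal_leI mult_left_mono) auto
      also have "\<eta>' * (K + 1) = \<eta>" using K by (simp add: \<eta>'_def)
      finally show ?thesis .
    qed
    then show "\<forall>\<^sub>F e in at_right 0. nL R (\<lambda>y. moll k e f y - f y) \<le> ennreal \<eta>"
      using \<epsilon> by (auto simp: eventually_at_right_field)
  qed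
qed

lemma moll_measurable[measurable]:
  assumes [measurable]: "k \<in> borel_measurable borel" "f \<in> borel_measurable borel"
  shows "moll k e f \<in> borel_measurable borel"
proof -
  have "moll k e f = (\<lambda>y. \<integral>v. k v *\<^sub>R f (y - e *\<^sub>R v) \<partial>lborel)" by (simp add: moll_def fun_eq_iff)
  also have "\<dots> \<in> borel_measurable borel" by measurable
  finally show ?thesis .
qed

text \<open>The fundamental lemma of the calculus of variations with few test functions: the
  rescaled translates of one kernel suffice. With a product kernel, only products of functions of t
  and of x have to be tested; \<open>half_flow_eq\<close> relies on this.\<close>

lemma AE_zero_by_convolution:
  fixes f :: "'a::euclidean_space \<Rightarrow> 'b::euclidean_space"
  assumes k: "bump r k" "integral\<^sup>L lborel k = 1" and f: "loc1 f"
    and 0: "\<And>e y. e > 0 \<Longrightarrow> (\<integral>w. k ((y - w) /\<^sub>R e) *\<^sub>R f w \<partial>lborel) = 0"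
  shows "AE x in lborel. f x = 0"
proof (rule nL_eq_0_imp_AE)
  show [measurable]: "f \<in> borel_measurable borel" using f by auto
  have [measurable]: "k \<in> borel_measurable borel" using k by auto
  fix R
  have "moll k e f y = 0" if "e > 0" for e y
    using 0[OF that, of y] moll_eq[of k f e y] that by auto
  \<comment> \<open>All mollifications vanish, so their convergence to f is convergence of a
    constant to 0.\<close>
  then have "\<forall>\<^sub>F e in at_right 0. nL R (\<lambda>y. moll k e f y - f y) = nL R f"
    unfolding nL_def by (auto simp: eventually_at_right_field intro!: exI[of _ 1])
  with moll_tendsto[OF k f, of R] have "((\<lambda>e::real. nL R f) \<longlongrightarrow> 0) (at_right 0)"
    by (rule Lim_transform_eventually)
  then show "nL R f = 0" using tendsto_unique[OF _ tendsto_const] by force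
qed

section \<open>Borel representatives of Lebesgue measurable functions\<close>

lemma AE_lebesgue_iff: "(AE x in lebesgue. P x) \<longleftrightarrow> (AE x in lborel. P x)"
  by (rule AE_completion_iff)

lemma borel_version:
  fixes f :: "'a::euclidean_space \<Rightarrow> 'b::euclidean_space"
  assumes "f \<in> borel_measurable lebesgue"
  obtains g where "g \<in> borel_measurable borel" "AE x in lborel. f x = g x"
proof -
  have "\<forall>i\<in>Basis. \<exists>g\<in>borel_measurable lborel. AE x in lborel. f x \<bullet> i = g x"
  proof
    fix i :: 'b
    have "(\<lambda>x. f x \<bullet> i) \<in> borel_measurable lebesgue" using assms by measurable
    then show "\<exists>g\<in>borel_measurable lborel. AE x in lborel. f x \<bullet> i = g x"
      by (rule completion_ex_borel_measurable_real)
  qed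
  then obtain g where g: "\<And>i. i \<in> Basis \<Longrightarrow> g i \<in> borel_measurable lborel"
    "\<And>i. i \<in> Basis \<Longrightarrow> AE x in lborel. f x \<bullet> i = g i x"
    by metis
  show thesis
  proof
    show "(\<lambda>x. \<Sum>i\<in>Basis. g i x *\<^sub>R i) \<in> borel_measurable borel"
      using g(1) by (intro borel_measurable_sum borel_measurable_scaleR) auto
    have "AE x in lborel. \<forall>i\<in>Basis. f x \<bullet> i = g i x"
      using g(2) by (simp add: AE_finite_all)
    then show "AE x in lborel. f x = (\<Sum>i\<in>Basis. g i x *\<^sub>R i)"
      by eventually_elim (metis (no_types, lifting) euclidean_representation sum.cong)
  qed
qed

text \<open>The bridge between the definitions, which integrate over \<open>lebesgue\<close>, and
  the proof, which integrates Borel functions over \<open>lborel\<close>.\<close>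

lemma lebesgue_integral_cong_lborel:
  fixes F G :: "'a::euclidean_space \<Rightarrow> 'b::euclidean_space"
  assumes AE: "AE x in lborel. F x = G x" and [measurable]: "G \<in> borel_measurable borel"
  shows "F \<in> borel_measurable lebesgue" "integral\<^sup>L lebesgue F = integral\<^sup>L lborel G"
    "integrable lebesgue F \<longleftrightarrow> integrable lborel G"
proof -
  have G: "G \<in> borel_measurable lborel" by simp
  have GL: "G \<in> borel_measurable lebesgue" by (rule measurable_completion[OF G])
  have ae: "AE x in lebesgue. F x = G x" using AE by (simp add: AE_lebesgue_iff)
  then have "AE x in lebesgue. G x = F x" by (auto elim: eventually_mono)
  then show F: "F \<in> borel_measurable lebesgue" by (rule borel_measurable_AE[OF GL])
  show "integral\<^sup>L lebesgue F = integral\<^sup>L lborel G"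
    using integral_cong_AE[OF F GL ae] integral_completion[OF G] by simp
  show "integrable lebesgue F \<longleftrightarrow> integrable lborel G"
    using integrable_cong_AE[OF F GL ae] integrable_completion[OF G] by simp
qed

lemma loc_integrable_measurable:
  fixes f :: "'a::euclidean_space \<Rightarrow> 'b::euclidean_space"
  assumes "loc_integrable f" shows "f \<in> borel_measurable lebesgue"
proof (rule borel_measurable_LIMSEQ_metric)
  show "(\<lambda>x. indicat_real (cball 0 (real n)) x *\<^sub>R f x) \<in> borel_measurable lebesgue" for n
    using assms unfolding loc_integrable_def set_integrable_def
    by (intro borel_measurable_integrable) auto
  show "(\<lambda>n. indicat_real (cball 0 (real n)) x *\<^sub>R f x) \<longlonglongrightarrow> f x" for x
  proof (rule tendsto_eventually)
    obtain N :: nat where "norm x \<le> real N" using real_arch_simple by blast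
    then show "\<forall>\<^sub>F n in sequentially. indicat_real (cball 0 (real n)) x *\<^sub>R f x = f x"
      by (auto simp: eventually_sequentially indicator_def intro!: exI[of _ N])
  qed
qed

lemma loc_integrable_imp_loc1:
  fixes f g :: "'a::euclidean_space \<Rightarrow> 'b::euclidean_space"
  assumes "loc_integrable f" and [measurable]: "g \<in> borel_measurable borel"
    and "AE x in lborel. f x = g x"
  shows "loc1 g"
proof -
  have "nL R g < top" for R
  proof -
    have "integrable lebesgue (\<lambda>x. indicat_real (cball 0 R) x *\<^sub>R f x)"
      using assms(1) by (auto simp: loc_integrable_def set_integrable_def)
    moreover have "AE x in lborel. indicat_real (cball 0 R) x *\<^sub>R f x = indicat_real (cball 0 R) x *\<^sub>R g x"
      using assms(3) by eventually_elim simp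
    ultimately have "integrable lborel (\<lambda>x. indicat_real (cball 0 R) x *\<^sub>R g x)"
      by (subst (asm) lebesgue_integral_cong_lborel(3)) auto
    moreover have "(\<integral>\<^sup>+x. ennreal (norm (indicat_real (cball 0 R) x *\<^sub>R g x)) \<partial>lborel) = nL R g"
      unfolding nL_def by (intro nn_integral_cong) (auto simp: indicator_def)
    ultimately show ?thesis by (simp add: integrable_iff_bounded)
  qed
  then show ?thesis by (simp add: loc1_def)
qed

lemma loc_integrable_borel_version:
  fixes f :: "'a::euclidean_space \<Rightarrow> 'b::euclidean_space"
  assumes "loc_integrable f"
  obtains g where "loc1 g" "AE x in lborel. f x = g x"
  using borel_version[OF loc_integrable_measurable[OF assms]] loc_integrable_imp_loc1[OF assms] by metis

lemma Cc_inf_bump: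
  assumes "k \<in> Cc_inf" obtains r where "bump r k"
  using Cc_inf_D(1)[OF assms, of 0] Cc_inf_D(2)[OF assms] by (auto simp: bump_def)

lemma mollifier_bump: "mollifier k \<Longrightarrow> bump 1 k"
  using Cc_inf_D(1)[of k 0] by (auto simp: mollifier_def bump_def)

lemma Cc_inf_rescale:
  fixes k :: "'a::euclidean_space \<Rightarrow> real"
  assumes "k \<in> Cc_inf" "e > 0"
  shows "(\<lambda>w. k ((y - w) /\<^sub>R e)) \<in> Cc_inf"
proof -
  obtain r where r: "\<forall>x. norm x > r \<longrightarrow> k x = 0" using Cc_inf_D(2)[OF assms(1)] by blast
  have bl: "bounded_linear (\<lambda>w::'a. - (w /\<^sub>R e))"
    by (intro bounded_linear_minus bounded_linear_scaleR_right)
  have "Ck n (\<lambda>w. k (y /\<^sub>R e + - (w /\<^sub>R e)))" for n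
    by (rule Ck_affine_comp[OF bl Cc_inf_D(1)[OF assms(1)]])
  moreover have "(\<lambda>w. k (y /\<^sub>R e + - (w /\<^sub>R e))) = (\<lambda>w. k ((y - w) /\<^sub>R e))"
    by (simp add: algebra_simps)
  ultimately have *: "Ck n (\<lambda>w. k ((y - w) /\<^sub>R e))" for n by metis
  show ?thesis
  proof (rule Cc_infI[OF *])
    fix w :: 'a assume w: "norm y + e * \<bar>r\<bar> < norm w"
    have "norm w - norm y \<le> norm (y - w)"
      by (metis norm_minus_commute norm_triangle_ineq2)
    with w have "e * \<bar>r\<bar> < norm (y - w)" by linarith
    then have "\<bar>r\<bar> < inverse e * norm (y - w)" using assms(2) by (simp add: field_simps)
    also have "\<dots> = norm ((y - w) /\<^sub>R e)" using assms(2) by (simp only: norm_scaleR) simp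
    finally have "\<bar>r\<bar> < norm ((y - w) /\<^sub>R e)" .
    then show "k ((y - w) /\<^sub>R e) = 0" using r by auto
  qed
qed

lemma AE_zero_by_Cc_inf:
  fixes f :: "'a::euclidean_space \<Rightarrow> 'b::euclidean_space"
  assumes f: "loc1 f" and 0: "\<And>\<psi>. \<psi> \<in> Cc_inf \<Longrightarrow> (\<integral>w. \<psi> w *\<^sub>R f w \<partial>lborel) = 0"
  shows "AE x in lborel. f x = 0"
proof -
  obtain k :: "'a \<Rightarrow> real" where k: "mollifier k" using mollifier_exists by blast
  have "k \<in> Cc_inf" "integral\<^sup>L lborel k = 1" using k by (auto simp: mollifier_def)
  then show ?thesis
    using mollifier_bump[OF k] f by (intro AE_zero_by_convolution[of 1 k] 0 Cc_inf_rescale) auto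
qed


subsection \<open>Lipschitz curves and the chain rule\<close>

text \<open>\<open>prim u t\<close> is the integral of \<open>u\<close> from \<open>0\<close> to \<open>t\<close>, for either sign of \<open>t\<close>; writing it with
  a kernel makes it an ordinary integral over the line, to which Fubini applies directly.\<close>

definition kern :: "real \<Rightarrow> real \<Rightarrow> real" where
  "kern t s = (if 0 < s \<and> s < t then 1 else if t < s \<and> s < 0 then -1 else 0)"

definition prim :: "(real \<Rightarrow> 'a::euclidean_space) \<Rightarrow> real \<Rightarrow> 'a" where
  "prim u t = (\<integral>s. kern t s *\<^sub>R u s \<partial>lborel)"

lemma kern_measurable[measurable]:
  assumes [measurable]: "f \<in> borel_measurable M" "g \<in> borel_measurable M"
  shows "(\<lambda>x. kern (f x) (g x)) \<in> borel_measurable M"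
  unfolding kern_def by measurable

lemma abs_kern_le: "\<bar>kern t s\<bar> \<le> indicator {-\<bar>t\<bar>..\<bar>t\<bar>} s"
  by (auto simp: kern_def indicator_def)

lemma kern_eq_0: "\<bar>t\<bar> < \<bar>s\<bar> \<Longrightarrow> kern t s = 0"
  by (auto simp: kern_def)

lemma kern_diff_le: "\<bar>kern t r - kern s r\<bar> \<le> indicator {min s t..max s t} r"
  by (auto simp: kern_def indicator_def)

definition locally_bounded_fun :: "(real \<Rightarrow> 'a::euclidean_space) \<Rightarrow> bool" where
  "locally_bounded_fun u \<longleftrightarrow> u \<in> borel_measurable borel \<and> (\<forall>T. \<exists>M. \<forall>s. \<bar>s\<bar> \<le> T \<longrightarrow> norm (u s) \<le> M)"

lemma locally_bounded_fun_measurable[measurable_dest]: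
  "locally_bounded_fun u \<Longrightarrow> u \<in> borel_measurable borel"
  by (simp add: locally_bounded_fun_def)

lemma locally_bounded_funI:
  "u \<in> borel_measurable borel \<Longrightarrow> (\<And>s. norm (u s) \<le> M) \<Longrightarrow> locally_bounded_fun u"
  by (auto simp: locally_bounded_fun_def)

lemma integrable_between:
  fixes u :: "real \<Rightarrow> 'a::euclidean_space" and k :: "real \<Rightarrow> real"
  assumes [measurable]: "u \<in> borel_measurable borel" "k \<in> borel_measurable borel"
    and "\<And>r. \<bar>k r\<bar> \<le> indicator {a..b} r" "\<And>r. a \<le> r \<Longrightarrow> r \<le> b \<Longrightarrow> norm (u r) \<le> M" and ab: "a \<le> b"
  shows "integrable lborel (\<lambda>r. k r *\<^sub>R u r)" "norm (\<integral>r. k r *\<^sub>R u r \<partial>lborel) \<le> M * (b - a)"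
proof -
  have M: "M \<ge> 0" using assms(4)[of a] ab norm_ge_zero order_trans by blast
  have int: "integrable lborel (\<lambda>r. M * indicat_real {a..b} r)"
    by (intro integrable_mult_right integrable_real_indicator) (auto simp: emeasure_lborel_Icc_eq)
  have le: "norm (k r *\<^sub>R u r) \<le> M * indicat_real {a..b} r" for r
    using assms(3)[of r] assms(4)[of r] M
    by (cases "r \<in> {a..b}") (auto simp: mult_le_one intro: order_trans[OF mult_mono[of _ 1 _ M]])
  show i: "integrable lborel (\<lambda>r. k r *\<^sub>R u r)"
    by (rule Bochner_Integration.integrable_bound[OF int]) (use le M in \<open>auto intro!: AE_I2\<close>)
  have "norm (\<integral>r. k r *\<^sub>R u r \<partial>lborel) \<le> (\<integral>r. norm (k r *\<^sub>R u r) \<partial>lborel)"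
    by (rule integral_norm_bound)
  also have "\<dots> \<le> (\<integral>r. M * indicat_real {a..b} r \<partial>lborel)"
    by (intro integral_mono integrable_norm i int le)
  also have "\<dots> = M * (b - a)" using ab by simp
  finally show "norm (\<integral>r. k r *\<^sub>R u r \<partial>lborel) \<le> M * (b - a)" .
qed

lemma prim_integrable:
  assumes "locally_bounded_fun u" shows "integrable lborel (\<lambda>s. kern t s *\<^sub>R u s)"
proof -
  obtain M where M: "\<forall>s. \<bar>s\<bar> \<le> \<bar>t\<bar> \<longrightarrow> norm (u s) \<le> M"
    using assms by (auto simp: locally_bounded_fun_def)
  show ?thesis
    by (rule integrable_between(1)[OF _ _ abs_kern_le, where M=M]) (use assms M in auto)
qed

lemma prim_diff_eq:
  assumes "locally_bounded_fun u"
  shows "prim u t - prim u s = (\<integral>r. (kern t r - kern s r) *\<^sub>R u r \<partial>lborel)"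
  using prim_integrable[OF assms] by (simp add: prim_def scaleR_diff_left)

lemma norm_prim_diff_le:
  assumes "locally_bounded_fun u" "\<And>r. min s t \<le> r \<Longrightarrow> r \<le> max s t \<Longrightarrow> norm (u r) \<le> M"
  shows "norm (prim u t - prim u s) \<le> M * \<bar>t - s\<bar>"
proof -
  have [measurable]: "u \<in> borel_measurable borel" using assms by auto
  have "norm (prim u t - prim u s) \<le> M * (max s t - min s t)"
    unfolding prim_diff_eq[OF assms(1)]
    by (rule integrable_between(2)[OF _ _ kern_diff_le]) (use assms in auto)
  then show ?thesis by (simp add: max_def min_def split: if_splits)
qed

lemma prim_0[simp]: "prim u 0 = 0"
proof -
  have "kern 0 s = 0" for s by (simp add: kern_def)
  then show ?thesis by (simp add: prim_def)
qed

lemma norm_prim_le: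
  assumes "u \<in> borel_measurable borel" "\<And>s. norm (u s) \<le> M"
  shows "norm (prim u t) \<le> M * \<bar>t\<bar>"
  using norm_prim_diff_le[OF locally_bounded_funI[OF assms], of 0 t M] assms by simp

lemma prim_measurable[measurable]:
  assumes [measurable]: "(\<lambda>(x, s). u x s) \<in> borel_measurable (M \<Otimes>\<^sub>M borel)" "g \<in> borel_measurable M"
  shows "(\<lambda>x. prim (u x) (g x)) \<in> borel_measurable M"
  unfolding prim_def by measurable

lemma continuous_prim:
  assumes "locally_bounded_fun u" shows "continuous_on UNIV (prim u)"
proof (rule continuous_at_imp_continuous_on, rule ballI)
  fix s
  obtain M where M: "\<forall>r. \<bar>r\<bar> \<le> \<bar>s\<bar> + 1 \<longrightarrow> norm (u r) \<le> M"
    using assms by (auto simp: locally_bounded_fun_def)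
  have "(prim u \<longlongrightarrow> prim u s) (at s)"
  proof (rule LIM_zero_cancel, rule Lim_null_comparison)
    show "\<forall>\<^sub>F t in at s. norm (prim u t - prim u s) \<le> M * \<bar>t - s\<bar>"
      unfolding eventually_at
      by (intro exI[of _ 1]) (auto simp: dist_real_def intro!: norm_prim_diff_le[OF assms] M[rule_format])
    show "((\<lambda>t. M * \<bar>t - s\<bar>) \<longlongrightarrow> 0) (at s)"
      by (auto intro!: tendsto_eq_intros)
  qed
  then show "isCont (prim u) s" by (simp add: isCont_def)
qed

text \<open>The sum over the basis stands in for the operator norm: it is continuous in the base
  point as soon as \<open>F' x v\<close> is for each fixed v, the form in which continuity of
  derivatives is stated throughout.\<close>

lemma derivative_norm_le:
  fixes F' :: "'a::euclidean_space \<Rightarrow> 'b::real_normed_vector"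
  assumes "linear F'" shows "norm (F' v) \<le> (\<Sum>b\<in>Basis. norm (F' b)) * norm v"
proof -
  have "F' v = F' (\<Sum>b\<in>Basis. (v \<bullet> b) *\<^sub>R b)" by (simp add: euclidean_representation)
  also have "\<dots> = (\<Sum>b\<in>Basis. (v \<bullet> b) *\<^sub>R F' b)"
    using assms by (simp add: linear_sum linear_scale)
  also have "norm \<dots> \<le> (\<Sum>b\<in>Basis. norm v * norm (F' b))"
    by (intro sum_norm_le) (auto intro!: mult_right_mono Basis_le_norm)
  finally show ?thesis by (subst mult.commute) (simp only: sum_distrib_left)
qed

text \<open>Expanding \<open>u x\<close> in the basis reduces the joint dependence on point and
  direction to finitely many fixed directions.\<close>

lemma derivative_measurable:
  fixes F' :: "'a::euclidean_space \<Rightarrow> 'c::euclidean_space \<Rightarrow> 'b::euclidean_space"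
  assumes "\<And>x. linear (F' x)" "\<And>v. continuous_on UNIV (\<lambda>x. F' x v)"
    and [measurable]: "g \<in> borel_measurable M" "u \<in> borel_measurable M"
  shows "(\<lambda>x. F' (g x) (u x)) \<in> borel_measurable M"
proof -
  have [measurable]: "(\<lambda>x. F' x v) \<in> borel_measurable borel" for v
    by (rule borel_measurable_continuous_onI) (rule assms)
  have "F' (g x) (u x) = (\<Sum>b\<in>Basis. (u x \<bullet> b) *\<^sub>R F' (g x) b)" for x
  proof -
    have "F' (g x) (u x) = F' (g x) (\<Sum>b\<in>Basis. (u x \<bullet> b) *\<^sub>R b)"
      by (simp add: euclidean_representation)
    then show ?thesis using assms(1) by (simp add: linear_sum linear_scale)
  qed
  then show ?thesis by simp
qed

text \<open>Both \<open>F \<circ> \<gamma>\<close> and the primitive of \<open>F' (\<gamma> s) (u s)\<close> change by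
  \<open>F' (\<gamma> s) (\<gamma> t - \<gamma> s) + o(t - s)\<close>, so that their difference has derivative zero everywhere.\<close>

lemma chain_rule_prim:
  fixes F :: "'a::euclidean_space \<Rightarrow> 'b::euclidean_space"
  assumes dF: "\<And>x. (F has_derivative F' x) (at x)"
    and cF: "\<And>v. continuous_on UNIV (\<lambda>x. F' x v)"
    and u: "locally_bounded_fun u"
  shows "F (a + prim u t) = F a + prim (\<lambda>s. F' (a + prim u s) (u s)) t"
    and "locally_bounded_fun (\<lambda>s. F' (a + prim u s) (u s))"
proof -
  define \<gamma> where "\<gamma> t = a + prim u t" for t
  define w where "w s = F' (\<gamma> s) (u s)" for s
  have [measurable]: "u \<in> borel_measurable borel" using u by auto
  have lin: "linear (F' x)" for x using dF[of x] by (rule has_derivative_linear)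
  have bl: "bounded_linear (F' x)" for x using dF[of x] by (rule has_derivative_bounded_linear)
  have c\<gamma>: "continuous_on S \<gamma>" for S
    unfolding \<gamma>_def
    by (intro continuous_on_add continuous_on_const continuous_on_subset[OF continuous_prim[OF u]]) auto
  have [measurable]: "\<gamma> \<in> borel_measurable borel"
    by (rule borel_measurable_continuous_onI) (rule c\<gamma>)
  have [measurable]: "w \<in> borel_measurable borel"
    unfolding w_def by (rule derivative_measurable[OF lin cF]) measurable
  define N where "N x = (\<Sum>b\<in>Basis. norm (F' x b))" for x
  have cN: "continuous_on UNIV N" unfolding N_def by (intro continuous_intros cF)
  show lw: "locally_bounded_fun (\<lambda>s. F' (a + prim u s) (u s))"
    unfolding locally_bounded_fun_def \<gamma>_def[symmetric] w_def[symmetric]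
  proof safe
    fix T :: real
    obtain M where M: "\<forall>s. \<bar>s\<bar> \<le> T \<longrightarrow> norm (u s) \<le> M" using u by (auto simp: locally_bounded_fun_def)
    have "compact ((\<lambda>s. N (\<gamma> s)) ` {-T..T})"
      by (intro compact_continuous_image continuous_on_compose2[OF cN c\<gamma>]) auto
    then obtain B where "\<forall>x\<in>(\<lambda>s. N (\<gamma> s)) ` {-T..T}. norm x \<le> B"
      using compact_imp_bounded bounded_iff by metis
    then have B: "N (\<gamma> s) \<le> B" if "\<bar>s\<bar> \<le> T" for s using that by (fastforce simp: abs_le_iff)
    have "norm (w s) \<le> B * M" if s: "\<bar>s\<bar> \<le> T" for s
    proof -
      have "norm (w s) \<le> N (\<gamma> s) * norm (u s)" unfolding w_def N_def by (rule derivative_norm_le[OF lin])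
      also have "\<dots> \<le> B * M" using B[OF s] M s
        by (intro mult_mono) (auto simp: N_def sum_nonneg intro: order_trans[OF _ B[OF s]])
      finally show ?thesis .
    qed
    then show "\<exists>M. \<forall>s. \<bar>s\<bar> \<le> T \<longrightarrow> norm (w s) \<le> M" by blast
  qed measurable
  moreover have w_eq: "w = (\<lambda>s. F' (a + prim u s) (u s))" by (simp add: fun_eq_iff w_def \<gamma>_def)
  ultimately have lw: "locally_bounded_fun w" by simp
  \<comment> \<open>u is only measurable, so neither summand need be differentiable at a given s; in
    the difference the leading terms cancel.\<close>
  define G where "G t = F (\<gamma> t) - prim w t" for t
  have "(G has_derivative (\<lambda>h. 0)) (at s)" for s
    unfolding has_derivative_at_alt
  proof (intro conjI allI impI)
    fix e :: real assume e: "e > 0"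
    obtain M0 where M0: "\<forall>r. \<bar>r\<bar> \<le> \<bar>s\<bar> + 1 \<longrightarrow> norm (u r) \<le> M0" using u by (auto simp: locally_bounded_fun_def)
    define M where "M = max M0 1"
    have M: "norm (u r) \<le> M" if "\<bar>r\<bar> \<le> \<bar>s\<bar> + 1" for r using M0 that by (auto simp: M_def le_max_iff_disj)
    have M1: "M > 0" by (simp add: M_def)
    \<comment> \<open>Two errors of size \<open>e' * M * \<bar>t - s\<bar>\<close> will be added:
      the Taylor remainder of F at \<open>\<gamma> s\<close>, and the oscillation of
      \<open>F'\<close> along the curve.\<close>
    define e' where "e' = e / (2 * M)"
    have e': "e' > 0" using e M1 by (simp add: e'_def)
    obtain d1 where d1: "d1 > 0" "\<And>y. norm (y - \<gamma> s) < d1 \<Longrightarrow> norm (F y - F (\<gamma> s) - F' (\<gamma> s) (y - \<gamma> s)) \<le> e' * norm (y - \<gamma> s)"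
      using dF[of "\<gamma> s", unfolded has_derivative_at_alt] e' by metis
    have "((\<lambda>r. \<Sum>b\<in>Basis. norm (F' (\<gamma> r) b - F' (\<gamma> s) b)) \<longlongrightarrow> (\<Sum>b\<in>Basis. norm (F' (\<gamma> s) b - F' (\<gamma> s) b))) (at s)"
    proof (intro tendsto_intros)
      fix b
      have "continuous_on UNIV (\<lambda>r. F' (\<gamma> r) b)" by (rule continuous_on_compose2[OF cF c\<gamma>]) auto
      then show "((\<lambda>r. F' (\<gamma> r) b) \<longlongrightarrow> F' (\<gamma> s) b) (at s)" by (simp add: continuous_on_def)
    qed
    then have "\<forall>\<^sub>F r in at s. (\<Sum>b\<in>Basis. norm (F' (\<gamma> r) b - F' (\<gamma> s) b)) < e'"
      using e' by (intro order_tendstoD(2)[of _ "\<Sum>b\<in>Basis. norm (F' (\<gamma> s) b - F' (\<gamma> s) b)"]) auto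
    then obtain d2 where d2: "d2 > 0" "\<And>r. r \<noteq> s \<Longrightarrow> \<bar>r - s\<bar> < d2 \<Longrightarrow> (\<Sum>b\<in>Basis. norm (F' (\<gamma> r) b - F' (\<gamma> s) b)) < e'"
      by (auto simp: eventually_at dist_real_def)
    have d2': "(\<Sum>b\<in>Basis. norm (F' (\<gamma> r) b - F' (\<gamma> s) b)) \<le> e'" if "\<bar>r - s\<bar> < d2" for r
      using d2(2)[of r] that e' by (cases "r = s") auto
    \<comment> \<open>The bound 1 keeps r in the range where M bounds u, \<open>d1 / M\<close> keeps
      \<open>\<gamma> t\<close> within d1 of \<open>\<gamma> s\<close>, and d2 controls the
      oscillation of \<open>F'\<close>.\<close>
    define d where "d = min 1 (min (d1 / M) d2)"
    have "d > 0" using d1 d2 M1 by (simp add: d_def)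
    moreover have "norm (G t - G s - 0) \<le> e * norm (t - s)" if t: "norm (t - s) < d" for t
    proof -
      have near: "\<bar>r - s\<bar> < d" "\<bar>r\<bar> \<le> \<bar>s\<bar> + 1" if "min s t \<le> r" "r \<le> max s t" for r
      proof -
        show *: "\<bar>r - s\<bar> < d" using that t by (auto simp: min_def max_def abs_if split: if_splits)
        then show "\<bar>r\<bar> \<le> \<bar>s\<bar> + 1" by (auto simp: d_def)
      qed
      have \<gamma>le: "norm (\<gamma> t - \<gamma> s) \<le> M * \<bar>t - s\<bar>"
        using norm_prim_diff_le[OF u, of s t M] M near by (simp add: \<gamma>_def)
      have "M * \<bar>t - s\<bar> < d1" using t M1 by (simp add: d_def pos_less_divide_eq mult.commute)
      then have "norm (F (\<gamma> t) - F (\<gamma> s) - F' (\<gamma> s) (\<gamma> t - \<gamma> s)) \<le> e' * norm (\<gamma> t - \<gamma> s)"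
        using \<gamma>le by (intro d1(2)) linarith
      also have "\<dots> \<le> e' * (M * \<bar>t - s\<bar>)" using e' \<gamma>le by (intro mult_left_mono) auto
      finally have 1: "norm (F (\<gamma> t) - F (\<gamma> s) - F' (\<gamma> s) (\<gamma> t - \<gamma> s)) \<le> e' * (M * \<bar>t - s\<bar>)" .
      have int: "integrable lborel (\<lambda>r. (kern t r - kern s r) *\<^sub>R u r)"
        using prim_integrable[OF u] by (simp add: scaleR_diff_left)
      have intw: "integrable lborel (\<lambda>r. (kern t r - kern s r) *\<^sub>R w r)"
        using prim_integrable[OF lw] by (simp add: scaleR_diff_left)
      have "F' (\<gamma> s) (\<gamma> t - \<gamma> s) = F' (\<gamma> s) (\<integral>r. (kern t r - kern s r) *\<^sub>R u r \<partial>lborel)"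
        using prim_diff_eq[OF u] by (simp add: \<gamma>_def)
      also have "\<dots> = (\<integral>r. F' (\<gamma> s) ((kern t r - kern s r) *\<^sub>R u r) \<partial>lborel)"
        by (rule integral_bounded_linear[OF bl int, symmetric])
      also have "\<dots> = (\<integral>r. (kern t r - kern s r) *\<^sub>R F' (\<gamma> s) (u r) \<partial>lborel)"
        by (simp add: linear_scale[OF lin])
      finally have F'eq: "F' (\<gamma> s) (\<gamma> t - \<gamma> s) = (\<integral>r. (kern t r - kern s r) *\<^sub>R F' (\<gamma> s) (u r) \<partial>lborel)" .
      have intF: "integrable lborel (\<lambda>r. (kern t r - kern s r) *\<^sub>R F' (\<gamma> s) (u r))"
        using integrable_bounded_linear[OF bl int] by (simp add: linear_scale[OF lin])
      have [measurable]: "(\<lambda>r. F' (\<gamma> s) (u r)) \<in> borel_measurable borel"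
        by (rule derivative_measurable[OF lin cF]) measurable
      have "prim w t - prim w s - F' (\<gamma> s) (\<gamma> t - \<gamma> s) = (\<integral>r. (kern t r - kern s r) *\<^sub>R (w r - F' (\<gamma> s) (u r)) \<partial>lborel)"
        unfolding F'eq prim_diff_eq[OF lw]
        using Bochner_Integration.integral_diff[OF intw intF] by (simp add: scaleR_diff_right)
      also have "norm \<dots> \<le> e' * M * (max s t - min s t)"
      proof (rule integrable_between(2)[OF _ _ kern_diff_le])
        fix r assume r: "min s t \<le> r" "r \<le> max s t"
        have "norm (w r - F' (\<gamma> s) (u r)) \<le> (\<Sum>b\<in>Basis. norm (F' (\<gamma> r) b - F' (\<gamma> s) b)) * norm (u r)"
          unfolding w_def
          using derivative_norm_le[of "\<lambda>v. F' (\<gamma> r) v - F' (\<gamma> s) v" "u r"] lin by (simp add: linear_compose_sub)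
        also have "\<dots> \<le> e' * M"
          using near[OF r] M e' by (intro mult_mono d2') (auto simp: d_def)
        finally show "norm (w r - F' (\<gamma> s) (u r)) \<le> e' * M" .
      qed auto
      also have "max s t - min s t = \<bar>t - s\<bar>" by (simp add: max_def min_def)
      finally have 2: "norm (prim w t - prim w s - F' (\<gamma> s) (\<gamma> t - \<gamma> s)) \<le> e' * M * \<bar>t - s\<bar>" .
      have "G t - G s = (F (\<gamma> t) - F (\<gamma> s) - F' (\<gamma> s) (\<gamma> t - \<gamma> s)) - (prim w t - prim w s - F' (\<gamma> s) (\<gamma> t - \<gamma> s))"
        by (simp add: G_def)
      then have "norm (G t - G s) \<le> e' * (M * \<bar>t - s\<bar>) + e' * M * \<bar>t - s\<bar>"
        using order_trans[OF norm_triangle_ineq4 add_mono[OF 1 2]] by simp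
      also have "\<dots> = e * \<bar>t - s\<bar>" using M1 by (simp add: e'_def)
      finally show ?thesis by simp
    qed
    ultimately show "\<exists>d>0. \<forall>y. norm (y - s) < d \<longrightarrow> norm (G y - G s - 0) \<le> e * norm (y - s)" by blast
  qed auto
  then have "G t = G 0"
    by (intro has_derivative_zero_unique[of UNIV G]) auto
  then show "F (a + prim u t) = F a + prim (\<lambda>s. F' (a + prim u s) (u s)) t"
    by (simp add: G_def \<gamma>_def w_eq algebra_simps)
qed

section \<open>Primitives of continuous functions and test functions in time\<close>

lemma loc1_locally_bounded:
  assumes "f \<in> borel_measurable borel" "\<And>R. \<exists>c. \<forall>x. norm x \<le> R \<longrightarrow> norm (f x) \<le> c"
  shows "loc1 f"
proof -
  have "nL R f < top" for R
  proof -
    obtain c where "\<forall>x. norm x \<le> R \<longrightarrow> norm (f x) \<le> c" using assms(2) by blast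
    then have "nL R f \<le> ennreal c * emeasure lborel (cball (0::'a) R)"
      by (intro nL_bounded) auto
    also have "\<dots> < top" by (simp add: ennreal_mult_less_top)
    finally show ?thesis .
  qed
  then show ?thesis using assms by (auto simp: loc1_def)
qed

lemma prim_const: "prim (\<lambda>_. c) t = t *\<^sub>R c"
proof -
  have "(\<lambda>s. kern t s *\<^sub>R c) = (\<lambda>s. (indicat_real {0<..<t} s - indicat_real {t<..<0} s) *\<^sub>R c)"
    by (auto simp: fun_eq_iff kern_def indicator_def)
  moreover have "integrable lborel (indicat_real {0<..<t})" "integrable lborel (indicat_real {t<..<0})"
    by (auto intro!: integrable_real_indicator emeasure_bounded_finite[simplified])
  ultimately show ?thesis
    by (cases "t \<ge> 0") (auto simp: prim_def)
qed

lemma prim_diff: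
  assumes "locally_bounded_fun u" "locally_bounded_fun v"
  shows "prim (\<lambda>s. u s - v s) t = prim u t - prim v t"
  using prim_integrable[OF assms(1)] prim_integrable[OF assms(2)]
  by (simp add: prim_def scaleR_diff_right)

lemma continuous_locally_bounded_fun:
  assumes "continuous_on UNIV u" shows "locally_bounded_fun u"
  unfolding locally_bounded_fun_def
proof safe
  show "u \<in> borel_measurable borel" by (rule borel_measurable_continuous_onI[OF assms])
  fix T :: real
  have "compact (u ` {-T..T})"
    by (intro compact_continuous_image continuous_on_subset[OF assms]) auto
  then obtain B where "\<forall>x\<in>u ` {-T..T}. norm x \<le> B"
    using compact_imp_bounded bounded_iff by metis
  then show "\<exists>M. \<forall>s. \<bar>s\<bar> \<le> T \<longrightarrow> norm (u s) \<le> M" by (intro exI[of _ B]) (auto simp: abs_le_iff)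
qed

lemma prim_has_derivative:
  fixes g :: "real \<Rightarrow> 'a::euclidean_space"
  assumes "continuous_on UNIV g"
  shows "(prim g has_derivative (\<lambda>h. h *\<^sub>R g s)) (at s)"
  unfolding has_derivative_at_alt
proof (intro conjI allI impI)
  show "bounded_linear (\<lambda>h. h *\<^sub>R g s)" by (rule bounded_linear_scaleR_left)
  fix e :: real assume e: "e > 0"
  obtain d where d: "d > 0" "\<And>r. \<bar>r - s\<bar> < d \<Longrightarrow> norm (g r - g s) < e"
    using assms e unfolding continuous_on_iff by (metis UNIV_I dist_norm dist_real_def)
  have lb: "locally_bounded_fun g" "locally_bounded_fun (\<lambda>_. g s)" "locally_bounded_fun (\<lambda>r. g r - g s)"
    by (auto intro!: continuous_locally_bounded_fun continuous_intros assms)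
  have "norm (prim g t - prim g s - (t - s) *\<^sub>R g s) \<le> e * norm (t - s)" if "norm (t - s) < d" for t
  proof -
    have "prim g t - prim g s - (t - s) *\<^sub>R g s = prim (\<lambda>r. g r - g s) t - prim (\<lambda>r. g r - g s) s"
      by (simp add: prim_diff[OF lb(1,2)] prim_const scaleR_diff_left)
    also have "norm \<dots> \<le> e * \<bar>t - s\<bar>"
    proof (rule norm_prim_diff_le[OF lb(3)])
      fix r assume "min s t \<le> r" "r \<le> max s t"
      then have "\<bar>r - s\<bar> < d" using that by (auto simp: min_def max_def abs_if split: if_splits)
      then show "norm (g r - g s) \<le> e" using d(2) less_imp_le by blast
    qed
    finally show ?thesis by simp
  qed
  then show "\<exists>d>0. \<forall>y. norm (y - s) < d \<longrightarrow> norm (prim g y - prim g s - (y - s) *\<^sub>R g s) \<le> e * norm (y - s)"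
    using d(1) by blast
qed

text \<open>A test function has a compactly supported primitive once its integral is cancelled by a
  mollifier placed at time \<open>2 \<sigma>\<close>, on the side of the origin that is not seen.\<close>

lemma test_primitive:
  fixes a :: "real \<Rightarrow> real"
  assumes a: "a \<in> Cc_inf" and \<sigma>: "\<sigma> = 1 \<or> \<sigma> = -1"
  obtains \<theta> \<theta>' where "\<theta> \<in> Cc_inf" "\<And>t. (\<theta> has_derivative (\<lambda>h. h * \<theta>' t)) (at t)" "\<theta>' \<in> Cc_inf"
    "\<And>t. \<sigma> * t < 0 \<Longrightarrow> \<theta>' t = a t"
proof -
  obtain k :: "real \<Rightarrow> real" where k: "mollifier k" using mollifier_exists by blast
  define \<beta> where "\<beta> t = k (t - 2 * \<sigma>)" for t
  have k': "k \<in> Cc_inf" "integral\<^sup>L lborel k = 1" "\<And>x. \<bar>x\<bar> > 1 \<Longrightarrow> k x = 0" using k by (auto simp: mollifier_def)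
  obtain r where r: "\<forall>x. norm x > r \<longrightarrow> a x = 0" using Cc_inf_D(2)[OF a] by blast
  define c where "c = integral\<^sup>L lborel a"
  define g where "g t = a t + (- c) * \<beta> t" for t
  \<comment> \<open>The shifted mollifier vanishes for \<open>\<bar>t\<bar> > 3\<close> and a
    vanishes for \<open>\<bar>t\<bar> > r\<close>, so g vanishes from L on.\<close>
  define L where "L = max (\<bar>r\<bar> + 1) 4"
  have \<beta>0: "\<beta> t = 0" if "\<bar>t\<bar> > 3" for t
    unfolding \<beta>_def by (rule k'(3)) (use \<sigma> that in \<open>auto simp: abs_if split: if_splits\<close>)
  have g0: "g t = 0" if "\<bar>t\<bar> \<ge> L" for t
    using that r \<beta>0[of t] by (auto simp: g_def L_def)
  have \<beta>C: "Ck n \<beta>" for n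
    using Ck_affine_comp[OF bounded_linear_ident Cc_inf_D(1)[OF k'(1)], of n "- 2 * \<sigma>"]
    by (simp add: \<beta>_def[abs_def] add.commute)
  have \<beta>I: "\<beta> \<in> Cc_inf" by (rule Cc_infI[OF \<beta>C, of 3]) (auto intro: \<beta>0)
  have gC: "Ck n g" for n
    unfolding g_def by (intro Ck_add Ck_mult Ck_const \<beta>C Cc_inf_D(1)[OF a])
  have gI: "g \<in> Cc_inf" by (rule Cc_infI[OF gC, of L]) (auto intro: g0)
  have [measurable]: "k \<in> borel_measurable borel" "g \<in> borel_measurable borel"
    using Cc_inf_integrable[OF k'(1)] Cc_inf_integrable[OF gI] by auto
  have "(\<integral>t. \<beta> t \<partial>lborel) = 1"
    using integral_translation[of k "- 2 * \<sigma>"] k'(2) by (simp add: \<beta>_def)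
  then have int0: "integral\<^sup>L lborel g = 0"
    using Cc_inf_integrable[OF a] Cc_inf_integrable[OF \<beta>I] by (simp add: g_def[abs_def] c_def)
  have cg: "continuous_on UNIV g" using gC[of 0] by simp
  note lb = continuous_locally_bounded_fun[OF cg]
  define \<theta> where "\<theta> t = prim g t - prim g (- L)" for t
  have d\<theta>: "(\<theta> has_derivative (\<lambda>h. h * g t)) (at t)" for t
    using has_derivative_diff[OF prim_has_derivative[OF cg, of t] has_derivative_const[of "prim g (- L)"]]
    by (simp add: \<theta>_def[abs_def])
  have \<theta>0: "\<theta> t = 0" if t: "\<bar>t\<bar> > L" for t
  proof (cases "t < 0")
    case True
    have "norm (prim g t - prim g (- L)) \<le> 0 * \<bar>t - (- L)\<bar>"
      by (rule norm_prim_diff_le[OF lb]) (use True t in \<open>auto simp: g0\<close>)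
    then show ?thesis by (simp add: \<theta>_def)
  next
    case False
    \<comment> \<open>To the right of L the two kernels differ by 1 on the whole support of g,
      except at 0, so the primitive equals the total integral of g, which was arranged to be
      0.\<close>
    have "\<theta> t = (\<integral>r. (kern t r - kern (- L) r) *\<^sub>R g r \<partial>lborel)"
      by (simp add: \<theta>_def prim_diff_eq[OF lb])
    also have "\<dots> = (\<integral>r. g r \<partial>lborel)"
    proof (rule integral_cong_AE)
      show "AE r in lborel. (kern t r - kern (- L) r) *\<^sub>R g r = g r"
        using AE_lborel_singleton[of 0]
      proof eventually_elim
        fix r :: real assume "r \<noteq> 0"
        then show "(kern t r - kern (- L) r) *\<^sub>R g r = g r"
          using g0[of r] False t by (cases "\<bar>r\<bar> \<ge> L") (auto simp: kern_def)
      qed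
    qed auto
    finally show ?thesis using int0 by simp
  qed
  have \<theta>C: "Ck (Suc n) \<theta>" for n
    by (rule Ck_SucI[OF d\<theta>]) (intro Ck_mult Ck_const gC)
  have "\<theta> \<in> Cc_inf"
    by (rule Cc_infI[OF Ck_Suc_imp_Ck[OF \<theta>C], of L]) (auto intro: \<theta>0)
  moreover have "g t = a t" if "\<sigma> * t < 0" for t
  proof -
    have "k (t - 2 * \<sigma>) = 0" by (rule k'(3)) (use \<sigma> that in auto)
    then show ?thesis by (simp add: g_def \<beta>_def)
  qed
  ultimately show thesis using d\<theta> gI that by blast
qed

lemma product_test:
  fixes \<theta> :: "real \<Rightarrow> real" and b :: "'a::euclidean_space \<Rightarrow> real"
  assumes \<theta>: "\<theta> \<in> Cc_inf" and d: "\<And>t. (\<theta> has_derivative (\<lambda>h. h * \<theta>' t)) (at t)" and b: "b \<in> Cc_inf"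
  shows "(\<lambda>q. \<theta> (fst q) * b (snd q)) \<in> Cc_inf"
    "frechet_derivative (\<lambda>q. \<theta> (fst q) * b (snd q)) (at q) (1, 0) = \<theta>' (fst q) * b (snd q)"
proof -
  obtain r where r: "\<forall>x. norm x > r \<longrightarrow> \<theta> x = 0" using Cc_inf_D(2)[OF \<theta>] by blast
  obtain r' where r': "\<forall>x. norm x > r' \<longrightarrow> b x = 0" using Cc_inf_D(2)[OF b] by blast
  show "(\<lambda>q. \<theta> (fst q) * b (snd q)) \<in> Cc_inf"
  proof (rule Cc_infI[where r="r + r'"])
    show "Ck n (\<lambda>q. \<theta> (fst q) * b (snd q))" for n
      using Ck_affine_comp[OF bounded_linear_fst Cc_inf_D(1)[OF \<theta>, of n], of 0]
        Ck_affine_comp[OF bounded_linear_snd Cc_inf_D(1)[OF b, of n], of 0]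
      by (intro Ck_mult) simp_all
    fix q :: "real \<times> 'a" assume "r + r' < norm q"
    then have "norm (fst q) > r \<or> norm (snd q) > r'"
      using norm_Pair_le[of "fst q" "snd q"] by (simp add: not_le[symmetric])
    then show "\<theta> (fst q) * b (snd q) = 0" using r r' by auto
  qed
  have db: "(b has_derivative frechet_derivative b (at x)) (at x)" for x
    using Ck_SucD(1)[OF Cc_inf_D(1)[OF b]] .
  have "((\<lambda>q. \<theta> (fst q) * b (snd q)) has_derivative
      (\<lambda>v. \<theta> (fst q) * frechet_derivative b (at (snd q)) (snd v) + fst v * \<theta>' (fst q) * b (snd q))) (at q)"
    by (rule has_derivative_mult[OF has_derivative_compose[OF has_derivative_fst[OF has_derivative_ident] d]
        has_derivative_compose[OF has_derivative_snd[OF has_derivative_ident] db]])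
  from frechet_derivative_at[OF this, symmetric]
  show "frechet_derivative (\<lambda>q. \<theta> (fst q) * b (snd q)) (at q) (1, 0) = \<theta>' (fst q) * b (snd q)"
    using linear_0[OF has_derivative_linear[OF db]] by simp
qed


subsection \<open>Identification of the flow\<close>

text \<open>Attaches a second coordinate to a curve, so that \<open>chain_rule_prim\<close> also
  covers functions of time (second velocity 1) and integrating factors (second velocity
  \<open>d\<close>).\<close>

lemma prim_Pair:
  assumes "locally_bounded_fun u" "locally_bounded_fun v"
  shows "prim (\<lambda>s. (u s, v s)) t = (prim u t, prim v t)"
    and "locally_bounded_fun (\<lambda>s. (u s, v s))"
proof -
  have [measurable]: "u \<in> borel_measurable borel" "v \<in> borel_measurable borel" using assms by auto
  show l: "locally_bounded_fun (\<lambda>s. (u s, v s))"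
    unfolding locally_bounded_fun_def
  proof safe
    fix T
    obtain M where M: "\<forall>s. \<bar>s\<bar> \<le> T \<longrightarrow> norm (u s) \<le> M" using assms(1) unfolding locally_bounded_fun_def by blast
    obtain N where N: "\<forall>s. \<bar>s\<bar> \<le> T \<longrightarrow> norm (v s) \<le> N" using assms(2) unfolding locally_bounded_fun_def by blast
    have "norm (u s, v s) \<le> M + N" if "\<bar>s\<bar> \<le> T" for s
      using norm_Pair_le[of "u s" "v s"] M N that by fastforce
    then show "\<exists>M. \<forall>s. \<bar>s\<bar> \<le> T \<longrightarrow> norm (u s, v s) \<le> M" by blast
  qed measurable
  have "fst (prim (\<lambda>s. (u s, v s)) t) = prim u t" "snd (prim (\<lambda>s. (u s, v s)) t) = prim v t"
    unfolding prim_def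
    using integral_bounded_linear[OF bounded_linear_fst prim_integrable[OF l, of t]]
      integral_bounded_linear[OF bounded_linear_snd prim_integrable[OF l, of t]] by simp_all
  then show "prim (\<lambda>s. (u s, v s)) t = (prim u t, prim v t)" by (metis prod.collapse)
qed

lemma locally_bounded_fun_const: "locally_bounded_fun (\<lambda>_. c)"
  by (rule locally_bounded_funI[where M="norm c"]) auto

lemma lborel_Fubini:
  fixes f :: "'a::euclidean_space \<times> 'b::euclidean_space \<Rightarrow> 'c::euclidean_space"
  assumes "integrable lborel f"
  shows "(\<integral>q. f q \<partial>lborel) = (\<integral>y. \<integral>x. f (x, y) \<partial>lborel \<partial>lborel)"
    "(\<integral>q. f q \<partial>lborel) = (\<integral>x. \<integral>y. f (x, y) \<partial>lborel \<partial>lborel)"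
  using lborel_pair.integral_snd[of "\<lambda>x y. f (x, y)"] lborel_pair.integral_fst[of "\<lambda>x y. f (x, y)"] assms
  by (simp_all add: lborel_prod case_prod_unfold)

text \<open>\<open>\<sigma> = -1\<close> stands for positive and \<open>\<sigma> = 1\<close> for negative times.\<close>

lemma half_flow_eq:
  fixes \<phi> U :: "real \<times> 'a::euclidean_space \<Rightarrow> 'a"
  assumes \<sigma>: "\<sigma> = 1 \<or> \<sigma> = -1" and \<phi>: "loc1 \<phi>"
    and U[measurable]: "U \<in> borel_measurable (borel \<Otimes>\<^sub>M borel)" and UM: "\<And>q. norm (U q) \<le> M"
    and eq: "\<And>\<psi>. \<psi> \<in> Cc_inf \<Longrightarrow> (\<integral>q. indicator {t. \<sigma> * t < 0} (fst q) *\<^sub>R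
        (frechet_derivative \<psi> (at q) (1, 0) *\<^sub>R \<phi> q + \<psi> q *\<^sub>R U q) \<partial>lborel)
      = \<sigma> *\<^sub>R (\<integral>x. \<psi> (0, x) *\<^sub>R x \<partial>lborel)"
  shows "AE q in lborel. \<sigma> * fst q < 0 \<longrightarrow> \<phi> q = snd q + prim (\<lambda>s. U (s, snd q)) (fst q)"
proof -
  define \<Phi> where "\<Phi> q = snd q + prim (\<lambda>s. U (s, snd q)) (fst q)" for q
  define H where "H = {t. \<sigma> * t < 0}"
  have [measurable]: "H \<in> sets borel" by (simp add: H_def)
  have U': "U \<in> borel_measurable borel" using U by (simp add: borel_prod)
  have \<phi>': "\<phi> \<in> borel_measurable borel" using \<phi> by auto
  then have [measurable]: "\<phi> \<in> borel_measurable (borel \<Otimes>\<^sub>M borel)" by (simp add: borel_prod)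
  have \<Phi>m[measurable]: "\<Phi> \<in> borel_measurable (borel \<Otimes>\<^sub>M borel)"
    unfolding \<Phi>_def by measurable
  then have \<Phi>m': "\<Phi> \<in> borel_measurable borel" by (simp add: borel_prod)
  have fstm: "(\<lambda>q. indicat_real H (fst q)) \<in> borel_measurable (borel \<Otimes>\<^sub>M (borel::'a measure))" by measurable
  then have Hm: "(\<lambda>q::real\<times>'a. indicat_real H (fst q)) \<in> borel_measurable borel" by (simp add: borel_prod)
  have lbU: "locally_bounded_fun (\<lambda>s. U (s, x))" for x
    by (rule locally_bounded_funI[where M=M]) (auto simp: UM)
  have M0: "M \<ge> 0" using UM norm_ge_zero order_trans by blast
  have \<Phi>le: "norm (\<Phi> q) \<le> norm (snd q) + M * \<bar>fst q\<bar>" for q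
  proof -
    have "norm (prim (\<lambda>s. U (s, snd q)) (fst q)) \<le> M * \<bar>fst q\<bar>"
      by (rule norm_prim_le) (use UM in auto)
    then show ?thesis using norm_triangle_ineq[of "snd q" "prim (\<lambda>s. U (s, snd q)) (fst q)"] by (simp add: \<Phi>_def)
  qed
  have \<Phi>1: "loc1 \<Phi>"
  proof (rule loc1_locally_bounded[OF \<Phi>m'])
    fix R
    have "norm (\<Phi> q) \<le> R + M * R" if "norm q \<le> R" for q
      using \<Phi>le[of q] norm_fst_le[of "fst q" "snd q"] norm_snd_le[of "snd q" "fst q"] that
        mult_left_mono[OF _ M0, of "\<bar>fst q\<bar>" R] by simp
    then show "\<exists>c. \<forall>q. norm q \<le> R \<longrightarrow> norm (\<Phi> q) \<le> c" by blast
  qed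
  have H1: "loc1 (\<lambda>q. indicat_real H (fst q) *\<^sub>R f q)" if "loc1 f" for f :: "real \<times> 'a \<Rightarrow> 'a"
    by (rule loc1_le[OF that, where c=1]) (use Hm that in \<open>auto simp: indicator_def\<close>)
  have U1: "loc1 U" by (rule loc1_bounded[OF U' UM])
  define D where "D q = indicat_real H (fst q) *\<^sub>R (\<phi> q - \<Phi> q)" for q
  have D1: "loc1 D" unfolding D_def by (intro H1 loc1_diff \<phi> \<Phi>1)
  \<comment> \<open>The equation is tested with \<theta>(t) b(x), where the derivative of \<theta>
    is a on the half line in question. The explicit curve \<open>\<Phi>\<close> satisfies the same
    tested equation as \<open>\<phi>\<close> with the same U, so only their difference against a b
    survives.\<close>
  have key: "(\<integral>q. (a (fst q) * b (snd q)) *\<^sub>R D q \<partial>lborel) = 0"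
    if a: "a \<in> Cc_inf" and b: "b \<in> Cc_inf" for a :: "real \<Rightarrow> real" and b :: "'a \<Rightarrow> real"
  proof -
    obtain \<theta> \<theta>' where \<theta>: "\<theta> \<in> Cc_inf" and d: "\<And>t. (\<theta> has_derivative (\<lambda>h. h * \<theta>' t)) (at t)"
      and \<theta>': "\<theta>' \<in> Cc_inf" and \<theta>a: "\<And>t. \<sigma> * t < 0 \<Longrightarrow> \<theta>' t = a t"
      using test_primitive[OF a \<sigma>] by metis
    note pt = product_test[OF \<theta> d b]
    have pt': "(\<lambda>q. \<theta>' (fst q) * b (snd q)) \<in> Cc_inf"
    proof -
      have "(\<theta>' has_derivative (\<lambda>h. h * frechet_derivative \<theta>' (at t) 1)) (at t)" for t
      proof -
        have 1: "(\<theta>' has_derivative frechet_derivative \<theta>' (at t)) (at t)"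
          by (rule Ck_SucD(1)[OF Cc_inf_D(1)[OF \<theta>']])
        have "frechet_derivative \<theta>' (at t) h = h * frechet_derivative \<theta>' (at t) 1" for h
          using linear_scale[OF has_derivative_linear[OF 1], of h 1] by simp
        then have "frechet_derivative \<theta>' (at t) = (\<lambda>h. h * frechet_derivative \<theta>' (at t) 1)" by blast
        with 1 show ?thesis by simp
      qed
      then show ?thesis by (rule product_test(1)[OF \<theta>' _ b])
    qed
    obtain r1 where r1: "bump r1 (\<lambda>q. \<theta> (fst q) * b (snd q))" using Cc_inf_bump[OF pt(1)] by blast
    obtain r2 where r2: "bump r2 (\<lambda>q. \<theta>' (fst q) * b (snd q))" using Cc_inf_bump[OF pt'] by blast
    obtain r3 where r3: "bump r3 b" using Cc_inf_bump[OF b] by blast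
    obtain r where r: "\<forall>x. norm x > r \<longrightarrow> \<theta> x = 0" using Cc_inf_D(2)[OF \<theta>] by blast
    obtain r' where r': "\<forall>x. norm x > r' \<longrightarrow> \<theta>' x = 0" using Cc_inf_D(2)[OF \<theta>'] by blast
    define L where "L = max 1 (max r r') + 1"
    have L: "L > 0" "\<And>t. \<bar>t\<bar> \<ge> L \<Longrightarrow> \<theta> t = 0" "\<And>t. \<bar>t\<bar> \<ge> L \<Longrightarrow> \<theta>' t = 0"
      using r r' by (auto simp: L_def)
    have c\<theta>: "continuous_on UNIV \<theta>" "continuous_on UNIV \<theta>'"
      using Cc_inf_D(1)[OF \<theta>, of 0] Cc_inf_D(1)[OF \<theta>', of 0] by simp_all
    have [measurable]: "\<theta> \<in> borel_measurable borel" "\<theta>' \<in> borel_measurable borel" "b \<in> borel_measurable borel"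
      using Cc_inf_integrable[OF \<theta>] Cc_inf_integrable[OF \<theta>'] Cc_inf_integrable[OF b] by auto
    \<comment> \<open>For fixed x this is the product rule for
      \<open>\<theta> t *\<^sub>R \<Phi> (t, x)\<close>, integrated from 0 to the end of the half
      line, where \<theta> vanishes; the boundary term at 0 is the initial datum.\<close>
    have slice: "(\<integral>t. indicat_real H t *\<^sub>R (\<theta>' t *\<^sub>R \<Phi> (t, x) + \<theta> t *\<^sub>R U (t, x)) \<partial>lborel) = \<sigma> *\<^sub>R (\<theta> 0 *\<^sub>R x)" for x
    proof -
      define w where "w t = \<theta>' t *\<^sub>R \<Phi> (t, x) + \<theta> t *\<^sub>R U (t, x)" for t
      have [measurable]: "w \<in> borel_measurable borel" unfolding w_def by measurable
      have dF: "((\<lambda>p. \<theta> (fst p) *\<^sub>R snd p) has_derivative (\<lambda>v. \<theta> (fst p) *\<^sub>R snd v + (fst v * \<theta>' (fst p)) *\<^sub>R snd p)) (at p)" for p :: "real \<times> 'a"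
        by (rule has_derivative_scaleR[OF has_derivative_compose[OF has_derivative_fst[OF has_derivative_ident] d]
              has_derivative_snd[OF has_derivative_ident]])
      have cF: "continuous_on UNIV (\<lambda>p. \<theta> (fst p) *\<^sub>R snd v + (fst v * \<theta>' (fst p)) *\<^sub>R snd p)" for v :: "real \<times> 'a"
        by (intro continuous_intros continuous_on_compose2[OF c\<theta>(1)] continuous_on_compose2[OF c\<theta>(2)]) auto
      note pp = prim_Pair[OF locally_bounded_fun_const[of "1::real"] lbU[of x]]
      have "\<theta> t *\<^sub>R \<Phi> (t, x) = \<theta> 0 *\<^sub>R x + prim w t" for t
        using chain_rule_prim(1)[OF dF cF pp(2), of "(0, x)" t]
        by (simp add: pp(1) prim_const \<Phi>_def w_def[abs_def] add.commute)
      \<comment> \<open>\<open>- \<sigma> * L\<close> lies in the half line under consideration, at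
        the edge of the region where \<theta> may be nonzero.\<close>
      from this[of "- \<sigma> * L"] have z: "\<theta> 0 *\<^sub>R x + prim w (- \<sigma> * L) = 0"
        using L(2)[of "- \<sigma> * L"] L(1) \<sigma> by auto
      have "prim w (- \<sigma> * L) = (\<integral>t. (- \<sigma>) *\<^sub>R (indicat_real H t *\<^sub>R w t) \<partial>lborel)"
        unfolding prim_def
      proof (rule Bochner_Integration.integral_cong[OF refl])
        fix t
        show "kern (- \<sigma> * L) t *\<^sub>R w t = (- \<sigma>) *\<^sub>R (indicat_real H t *\<^sub>R w t)"
        proof (cases "\<bar>t\<bar> \<ge> L")
          case True
          then show ?thesis by (simp add: w_def L)
        next
          case False
          then show ?thesis using \<sigma> by (auto simp: kern_def H_def indicator_def)
        qed
      qed
      also have "\<dots> = (- \<sigma>) *\<^sub>R (\<integral>t. indicat_real H t *\<^sub>R w t \<partial>lborel)"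
        by (rule integral_scaleR_right)
      finally have "(- \<sigma>) *\<^sub>R (\<integral>t. indicat_real H t *\<^sub>R w t \<partial>lborel) = - (\<theta> 0 *\<^sub>R x)"
        using z by (simp only: add_eq_0_iff)
      then show ?thesis using \<sigma> by (auto simp: w_def) (metis add.inverse_inverse)
    qed
    define W where "W q = (\<theta>' (fst q) * b (snd q)) *\<^sub>R (indicat_real H (fst q) *\<^sub>R \<Phi> q)
      + (\<theta> (fst q) * b (snd q)) *\<^sub>R (indicat_real H (fst q) *\<^sub>R U q)" for q
    have intW: "integrable lborel W"
      unfolding W_def
      by (intro Bochner_Integration.integrable_add bump_integrable[OF r2 H1[OF \<Phi>1]] bump_integrable[OF r1 H1[OF U1]])
    have "(\<integral>q. W q \<partial>lborel) = (\<integral>x. \<integral>t. W (t, x) \<partial>lborel \<partial>lborel)" by (rule lborel_Fubini(1)[OF intW])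
    also have "\<dots> = (\<integral>x. b x *\<^sub>R (\<integral>t. indicat_real H t *\<^sub>R (\<theta>' t *\<^sub>R \<Phi> (t, x) + \<theta> t *\<^sub>R U (t, x)) \<partial>lborel) \<partial>lborel)"
      unfolding W_def by (simp flip: integral_scaleR_right add: algebra_simps)
    also have "\<dots> = \<sigma> *\<^sub>R (\<integral>x. (\<theta> 0 * b x) *\<^sub>R x \<partial>lborel)"
      unfolding slice by (simp flip: integral_scaleR_right add: algebra_simps)
    finally have W: "(\<integral>q. W q \<partial>lborel) = \<sigma> *\<^sub>R (\<integral>x. (\<theta> 0 * b x) *\<^sub>R x \<partial>lborel)" .
    define V where "V q = (\<theta>' (fst q) * b (snd q)) *\<^sub>R (indicat_real H (fst q) *\<^sub>R \<phi> q)
      + (\<theta> (fst q) * b (snd q)) *\<^sub>R (indicat_real H (fst q) *\<^sub>R U q)" for q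
    have intV: "integrable lborel V"
      unfolding V_def
      by (intro Bochner_Integration.integrable_add bump_integrable[OF r2 H1[OF \<phi>]] bump_integrable[OF r1 H1[OF U1]])
    have "(\<integral>q. V q \<partial>lborel) = \<sigma> *\<^sub>R (\<integral>x. (\<theta> 0 * b x) *\<^sub>R x \<partial>lborel)"
      using eq[OF pt(1)] unfolding pt(2) V_def H_def by (simp add: algebra_simps)
    with W have "(\<integral>q. V q - W q \<partial>lborel) = 0" using intV intW by simp
    moreover have "V q - W q = (a (fst q) * b (snd q)) *\<^sub>R D q" for q
      using \<theta>a[of "fst q"] by (auto simp: V_def W_def D_def H_def indicator_def algebra_simps)
    ultimately show ?thesis by simp
  qed
  obtain k1 :: "real \<Rightarrow> real" where k1: "mollifier k1" using mollifier_exists by blast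
  obtain k2 :: "'a \<Rightarrow> real" where k2: "mollifier k2" using mollifier_exists by blast
  have k1': "k1 \<in> Cc_inf" "integral\<^sup>L lborel k1 = 1" and k2': "k2 \<in> Cc_inf" "integral\<^sup>L lborel k2 = 1"
    using k1 k2 by (auto simp: mollifier_def)
  \<comment> \<open>Rescaled translates of a product kernel are products of rescaled translates, so
    \<open>key\<close> covers every test that \<open>AE_zero_by_convolution\<close> asks
    for.\<close>
  define k where "k q = k1 (fst q) * k2 (snd q)" for q
  have "k \<in> Cc_inf"
  proof -
    have "(k1 has_derivative (\<lambda>h. h * frechet_derivative k1 (at t) 1)) (at t)" for t
    proof -
      have 1: "(k1 has_derivative frechet_derivative k1 (at t)) (at t)"
        by (rule Ck_SucD(1)[OF Cc_inf_D(1)[OF k1'(1)]])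
      have "frechet_derivative k1 (at t) h = h * frechet_derivative k1 (at t) 1" for h
        using linear_scale[OF has_derivative_linear[OF 1], of h 1] by simp
      then have "frechet_derivative k1 (at t) = (\<lambda>h. h * frechet_derivative k1 (at t) 1)" by blast
      with 1 show ?thesis by simp
    qed
    then show ?thesis unfolding k_def by (rule product_test(1)[OF k1'(1) _ k2'(1)])
  qed
  then obtain r where r: "bump r k" using Cc_inf_bump by blast
  have "(\<integral>q. k q \<partial>lborel) = (\<integral>x. \<integral>t. k (t, x) \<partial>lborel \<partial>lborel)"
    by (rule lborel_Fubini(1)[OF Cc_inf_integrable[OF \<open>k \<in> Cc_inf\<close>]])
  also have "\<dots> = 1" by (simp add: k_def k1' k2')
  finally have k_int: "integral\<^sup>L lborel k = 1" .
  have "AE q in lborel. D q = 0"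
  proof (rule AE_zero_by_convolution[OF r k_int D1])
    fix e :: real and y :: "real \<times> 'a" assume e: "e > 0"
    show "(\<integral>w. k ((y - w) /\<^sub>R e) *\<^sub>R D w \<partial>lborel) = 0"
      using key[OF Cc_inf_rescale[OF k1'(1) e, of "fst y"] Cc_inf_rescale[OF k2'(1) e, of "snd y"]]
      by (simp add: k_def)
  qed
  then show ?thesis
    by eventually_elim (auto simp: D_def H_def \<Phi>_def indicator_def)
qed

text \<open>The exceptional set of the integral equation is independent of t, so entire trajectories
  are available. The displacement bound holds at every point, which lets radii of balls be tracked
  without exceptional sets, and compression holds at every single time.\<close>

definition good_flow :: "('a::euclidean_space \<Rightarrow> 'a) \<Rightarrow> real \<Rightarrow> (real \<Rightarrow> 'a \<Rightarrow> 'a) \<Rightarrow> bool" where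
  "good_flow X M \<Phi> \<longleftrightarrow> (\<lambda>(t, z). \<Phi> t z) \<in> borel_measurable (borel \<Otimes>\<^sub>M borel) \<and>
     (\<forall>t z. norm (\<Phi> t z - z) \<le> M * \<bar>t\<bar>) \<and>
     (AE z in lborel. \<forall>t. \<Phi> t z = z + prim (\<lambda>s. X (\<Phi> s z)) t) \<and>
     (\<forall>T>0. \<exists>C>0. \<forall>t. \<bar>t\<bar> \<le> T \<longrightarrow> (\<forall>A\<in>sets borel.
        emeasure lborel (\<Phi> t -` A) \<le> ennreal C * emeasure lborel A))"

section \<open>Almost everywhere statements on products\<close>

lemma AE_lborel_prodD:
  fixes P :: "'a::euclidean_space \<times> 'b::euclidean_space \<Rightarrow> bool"
  assumes "AE q in lborel. P q" shows "AE x in lborel. AE y in lborel. P (x, y)"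
  using lborel_pair.AE_pair[of P, unfolded lborel_prod, OF assms] .

lemma AE_lborel_prodI:
  fixes P :: "'a::euclidean_space \<times> 'b::euclidean_space \<Rightarrow> bool"
  assumes "Measurable.pred (borel \<Otimes>\<^sub>M borel) P" "AE x in lborel. AE y in lborel. P (x, y)"
  shows "AE q in lborel. P q"
proof -
  have "{q \<in> space (lborel \<Otimes>\<^sub>M lborel). P q} \<in> sets ((lborel::'a measure) \<Otimes>\<^sub>M (lborel::'b measure))"
    using assms(1) unfolding lborel_prod borel_prod pred_def by simp
  from lborel_pair.AE_pair_measure[OF this assms(2)] show ?thesis unfolding lborel_prod .
qed

text \<open>Exchanging the order of the slices needs a measurable set, hence the passage to a Borel
  null superset N.\<close>

lemma AE_lborel_prod_swap:
  fixes P :: "'a::euclidean_space \<times> 'b::euclidean_space \<Rightarrow> bool"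
  assumes P: "AE q in lborel. P q" shows "AE y in lborel. AE x in lborel. P (x, y)"
proof -
  obtain N where N: "{q \<in> space lborel. \<not> P q} \<subseteq> N" "emeasure lborel N = 0" "N \<in> sets lborel"
    by (rule AE_E[OF P])
  have [measurable]: "N \<in> sets (borel \<Otimes>\<^sub>M borel)" using N(3) unfolding borel_prod by simp
  have m: "Measurable.pred (borel \<Otimes>\<^sub>M borel) (\<lambda>q. q \<notin> N)" by measurable
  have "AE q in lborel. q \<notin> N" using N by (intro AE_not_in) auto
  then have 1: "AE x in lborel. AE y in lborel. (x, y) \<notin> N" by (rule AE_lborel_prodD)
  have m2: "{q \<in> space (lborel \<Otimes>\<^sub>M lborel). (fst q, snd q) \<notin> N} \<in> sets ((lborel::'a measure) \<Otimes>\<^sub>M (lborel::'b measure))"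
    using m unfolding pred_def lborel_prod borel_prod by simp
  have "AE y in lborel. AE x in lborel. (x, y) \<notin> N"
    using lborel_pair.AE_commute[OF m2] 1 by simp
  then show ?thesis
    using N(1) by (auto elim!: eventually_mono)
qed

lemma AE_lborel_dense:
  fixes t :: real
  assumes "AE s in lborel. P s" "e > 0" obtains s where "\<bar>s - t\<bar> < e" "P s"
proof -
  have "\<exists>s. \<bar>s - t\<bar> < e \<and> P s"
  proof (rule ccontr)
    assume "\<not> ?thesis"
    then have "AE s in lborel. s \<notin> ball t e"
      using assms(1) by (auto elim!: eventually_mono simp: dist_real_def abs_minus_commute)
    then have "ball t e \<in> null_sets lborel" by (subst AE_iff_null_sets) auto
    then have "negligible (ball t e)" by (simp add: negligible_iff_null_sets null_sets_completionI)
    then show False using assms(2) open_not_negligible[of "ball t e"] by auto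
  qed
  then show thesis using that by blast
qed

text \<open>By Fatou's lemma for open sets, then by outer regularity.\<close>

lemma compression_all_times:
  fixes \<Phi> :: "real \<Rightarrow> 'a::euclidean_space \<Rightarrow> 'a"
  assumes m[measurable]: "\<And>t. \<Phi> t \<in> borel_measurable borel" and cont: "\<And>z. continuous_on UNIV (\<lambda>t. \<Phi> t z)"
    and ae: "AE t in lborel. \<bar>t\<bar> \<le> T + 1 \<longrightarrow> (\<forall>A\<in>sets borel. emeasure lborel (\<Phi> t -` A) \<le> ennreal C * emeasure lborel A)"
    and t: "\<bar>t\<bar> \<le> T" and A: "A \<in> sets borel"
  shows "emeasure lborel (\<Phi> t -` A) \<le> ennreal C * emeasure lborel A"
proof -
  have sets_vim: "\<Phi> t -` B \<in> sets borel" if "B \<in> sets borel" for t B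
    using measurable_sets[OF m that, of t] by simp
  have "\<forall>n. \<exists>s. \<bar>s - t\<bar> < 1 / Suc n \<and> (\<forall>A\<in>sets borel. emeasure lborel (\<Phi> s -` A) \<le> ennreal C * emeasure lborel A)"
  proof
    fix n
    obtain s where s: "\<bar>s - t\<bar> < 1 / Suc n" "\<bar>s\<bar> \<le> T + 1 \<longrightarrow> (\<forall>A\<in>sets borel. emeasure lborel (\<Phi> s -` A) \<le> ennreal C * emeasure lborel A)"
      by (rule AE_lborel_dense[OF ae, of "1 / Suc n" t]) auto
    moreover have "1 / real (Suc n) \<le> 1" by simp
    \<comment> \<open>The approximating times may leave [-T, T]; this is the reason for the margin 1
      in the hypothesis.\<close>
    with s(1) t have "\<bar>s\<bar> \<le> T + 1" by linarith
    ultimately show "\<exists>s. \<bar>s - t\<bar> < 1 / Suc n \<and> (\<forall>A\<in>sets borel. emeasure lborel (\<Phi> s -` A) \<le> ennreal C * emeasure lborel A)"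
      by blast
  qed
  then obtain s where s: "\<And>n. \<bar>s n - t\<bar> < 1 / Suc n"
    "\<And>n A. A \<in> sets borel \<Longrightarrow> emeasure lborel (\<Phi> (s n) -` A) \<le> ennreal C * emeasure lborel A"
    by metis
  have "(\<lambda>n. s n - t) \<longlonglongrightarrow> 0"
    by (rule Lim_null_comparison[OF _ LIMSEQ_inverse_real_of_nat])
       (use s(1) in \<open>auto simp: less_imp_le inverse_eq_divide\<close>)
  then have st: "s \<longlonglongrightarrow> t" by (rule LIM_zero_cancel)
  have \<Phi>s: "(\<lambda>n. \<Phi> (s n) z) \<longlonglongrightarrow> \<Phi> t z" for z
    using continuous_on_tendsto_compose[OF cont st] by simp
  have open_le: "emeasure lborel (\<Phi> t -` U) \<le> ennreal C * emeasure lborel U" if U: "open U" for U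
  proof -
    have [measurable]: "U \<in> sets borel" using U by auto
    have "emeasure lborel (\<Phi> t -` U) = (\<integral>\<^sup>+z. indicator U (\<Phi> t z) \<partial>lborel)"
      using sets_vim[of U t] by (simp flip: nn_integral_indicator add: indicator_vimage)
    also have "\<dots> \<le> (\<integral>\<^sup>+z. liminf (\<lambda>n. indicator U (\<Phi> (s n) z)) \<partial>lborel)"
    proof (intro nn_integral_mono)
      fix z
      show "indicator U (\<Phi> t z) \<le> liminf (\<lambda>n. indicator U (\<Phi> (s n) z) :: ennreal)"
      proof (cases "\<Phi> t z \<in> U")
        case True
        then have "\<forall>\<^sub>F n in sequentially. \<Phi> (s n) z \<in> U"
          using topological_tendstoD[OF \<Phi>s U] by blast
        then have "\<forall>\<^sub>F n in sequentially. (1::ennreal) \<le> indicator U (\<Phi> (s n) z)"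
          by eventually_elim auto
        then have "1 \<le> liminf (\<lambda>n. indicator U (\<Phi> (s n) z) :: ennreal)"
          by (rule Liminf_bounded)
        then show ?thesis using True by simp
      qed auto
    qed
    also have "\<dots> \<le> liminf (\<lambda>n. \<integral>\<^sup>+z. indicator U (\<Phi> (s n) z) \<partial>lborel)"
      by (rule nn_integral_liminf) measurable
    also have "\<dots> = liminf (\<lambda>n. emeasure lborel (\<Phi> (s n) -` U))"
      using sets_vim[of U] by (simp flip: nn_integral_indicator add: indicator_vimage)
    also have "\<dots> \<le> liminf (\<lambda>n. ennreal C * emeasure lborel U)"
      by (intro Liminf_mono always_eventually allI s(2)) auto
    also have "\<dots> = ennreal C * emeasure lborel U" by (simp add: Liminf_const)
    finally show ?thesis .
  qed
  show ?thesis
  proof (rule ennreal_le_epsilon)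
    fix e :: real assume e: "e > 0"
    define d where "d = e / (\<bar>C\<bar> + 1)"
    have d: "d > 0" using e by (simp add: d_def add_nonneg_pos)
    obtain U where U: "open U" "A \<subseteq> U" "emeasure lborel (U - A) < d"
      using outer_regular_lborel[OF A d] by blast
    have "emeasure lborel (\<Phi> t -` A) \<le> emeasure lborel (\<Phi> t -` U)"
      using U sets_vim[of U t] by (intro emeasure_mono) auto
    also have "\<dots> \<le> ennreal C * emeasure lborel U" by (rule open_le[OF U(1)])
    also have "emeasure lborel U = emeasure lborel A + emeasure lborel (U - A)"
      using U A by (subst plus_emeasure) (auto simp: Un_absorb1)
    also have "ennreal C * \<dots> \<le> ennreal C * (emeasure lborel A + ennreal d)"
      using U(3) by (intro mult_left_mono add_left_mono) auto
    also have "\<dots> = ennreal C * emeasure lborel A + ennreal C * ennreal d" by (simp add: distrib_left)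
    also have "ennreal C * ennreal d \<le> ennreal e"
    proof -
      have "ennreal C * ennreal d \<le> ennreal (\<bar>C\<bar> + 1) * ennreal d"
        by (intro mult_right_mono ennreal_leI) auto
      also have "\<dots> = ennreal ((\<bar>C\<bar> + 1) * d)" using d by (intro ennreal_mult[symmetric]) auto
      also have "(\<bar>C\<bar> + 1) * d = e" by (simp add: d_def add_nonneg_eq_0_iff)
      finally show ?thesis .
    qed
    finally show "emeasure lborel (\<Phi> t -` A) \<le> ennreal C * emeasure lborel A + ennreal e"
      by (simp add: add_left_mono)
  qed
qed

text \<open>Compression lets \<open>\<phi>\<close> avoid, at each time and for almost every starting
  point, the null set where X0 differs from X. The distributional equation thus has the known
  right-hand side X(f), with f a Borel version of \<open>\<phi>\<close>, and its solution must be
  the primitive in time of that right-hand side.\<close>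

lemma regular_lagrangian_flow_good:
  fixes X0 X :: "'a::euclidean_space \<Rightarrow> 'a"
  assumes rlf: "regular_lagrangian_flow X0 \<phi>" and X[measurable]: "X \<in> borel_measurable borel"
    and XM: "\<And>x. norm (X x) \<le> M" and X0: "AE x in lborel. X0 x = X x"
  obtains \<Phi> where "good_flow X M \<Phi>" "AE q in lborel. \<phi> (fst q) (snd q) = \<Phi> (fst q) (snd q)"
proof -
  note rlf' = rlf[unfolded regular_lagrangian_flow_def]
  have li: "loc_integrable (\<lambda>(t, x). \<phi> t x)" using rlf' by (rule conjunct1)
  obtain f where f: "loc1 f" and f\<phi>: "AE q in lborel. (\<lambda>(t, x). \<phi> t x) q = f q"
    by (rule loc_integrable_borel_version[OF li])
  have f\<phi>': "AE q in lborel. \<phi> (fst q) (snd q) = f q" using f\<phi> by (simp add: case_prod_unfold)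
  have fm': "f \<in> borel_measurable borel" using f by auto
  then have fm[measurable]: "f \<in> borel_measurable (borel \<Otimes>\<^sub>M borel)" by (simp add: borel_prod)
  have f\<phi>t: "AE t in lborel. AE z in lborel. \<phi> t z = f (t, z)"
    using AE_lborel_prodD[OF f\<phi>'] by simp
  have comp: "\<exists>C>0. \<forall>A\<in>sets borel. \<forall>t. \<bar>t\<bar> \<le> T \<longrightarrow>
        emeasure lebesgue {x. \<phi> t x \<in> A} \<le> ennreal C * emeasure lborel A" if "T > 0" for T
  proof -
    have "\<forall>T>0. \<exists>C>0. \<forall>A\<in>sets borel. \<forall>t. \<bar>t\<bar> \<le> T \<longrightarrow>
        emeasure lebesgue {x. \<phi> t x \<in> A} \<le> ennreal C * emeasure lebesgue A"
      using rlf'[THEN conjunct2, THEN conjunct2, THEN conjunct2] .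
    from this[rule_format, OF that] obtain C where C: "C > 0" "\<forall>A\<in>sets borel. \<forall>t. \<bar>t\<bar> \<le> T \<longrightarrow>
        emeasure lebesgue {x. \<phi> t x \<in> A} \<le> ennreal C * emeasure lebesgue A" by (elim exE conjE)
    show ?thesis
    proof (intro exI[of _ C] conjI ballI allI impI C(1))
      fix A :: "'a set" and t :: real assume A: "A \<in> sets borel" "\<bar>t\<bar> \<le> T"
      have "emeasure lebesgue A = emeasure lborel A" using A(1) by simp
      with C(2)[rule_format, OF A]
      show "emeasure lebesgue {x. \<phi> t x \<in> A} \<le> ennreal C * emeasure lborel A" by (simp only:)
    qed
  qed
  have \<phi>leb: "\<phi> t \<in> borel_measurable lebesgue" for t
    using rlf'[THEN conjunct2, THEN conjunct1] by (rule spec)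
  have \<phi>set: "{x. \<phi> t x \<in> A} \<in> sets lebesgue" if "A \<in> sets borel" for t A
    using measurable_sets[OF \<phi>leb that, of t] by (simp add: vimage_def)
  obtain N where N: "{x \<in> space lborel. \<not> X0 x = X x} \<subseteq> N" "emeasure lborel N = 0" "N \<in> sets lborel"
    by (rule AE_E[OF X0])
  have N': "N \<in> sets borel" using N(3) by simp
  \<comment> \<open>The preimage of N is Lebesgue measurable and has measure at most C times
    0.\<close>
  have \<phi>N: "AE z in lborel. \<phi> t z \<notin> N" for t
  proof -
    have "\<bar>t\<bar> + 1 > 0" by simp
    from comp[OF this] obtain C where C: "\<forall>A\<in>sets borel. \<forall>s. \<bar>s\<bar> \<le> \<bar>t\<bar> + 1 \<longrightarrow>
        emeasure lebesgue {x. \<phi> s x \<in> A} \<le> ennreal C * emeasure lborel A"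
      by (elim exE conjE)
    have "emeasure lebesgue {x. \<phi> t x \<in> N} \<le> ennreal C * emeasure lborel N"
      by (rule C[rule_format, OF N']) simp
    then have "emeasure lebesgue {x. \<phi> t x \<in> N} = 0" using N(2) by simp
    then have "{x. \<phi> t x \<in> N} \<in> null_sets lebesgue" using \<phi>set[OF N'] by (simp add: null_sets_def)
    then have "AE z in lebesgue. z \<notin> {x. \<phi> t x \<in> N}" by (rule AE_not_in)
    then show ?thesis by (simp add: AE_lebesgue_iff)
  qed
  have "AE q in lborel. f q \<notin> N"
  proof (rule AE_lborel_prodI)
    have [measurable]: "N \<in> sets borel" by (rule N')
    show "Measurable.pred (borel \<Otimes>\<^sub>M borel) (\<lambda>q. f q \<notin> N)" by measurable
    show "AE t in lborel. AE z in lborel. f (t, z) \<notin> N"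
      using f\<phi>t
    proof eventually_elim
      fix t assume "AE z in lborel. \<phi> t z = f (t, z)"
      with \<phi>N[of t] show "AE z in lborel. f (t, z) \<notin> N" by eventually_elim simp
    qed
  qed
  with f\<phi>' have X\<phi>: "AE q in lborel. \<phi> (fst q) (snd q) = f q \<and> X0 (\<phi> (fst q) (snd q)) = X (f q)"
    by eventually_elim (use N(1) in auto)
  define U where "U q = X (f q)" for q
  have U[measurable]: "U \<in> borel_measurable (borel \<Otimes>\<^sub>M borel)" unfolding U_def by measurable
  have U': "U \<in> borel_measurable borel" using U by (simp add: borel_prod)
  have half: "AE q in lborel. \<sigma> * fst q < 0 \<longrightarrow> f q = snd q + prim (\<lambda>s. U (s, snd q)) (fst q)"
    if \<sigma>: "\<sigma> = 1 \<or> \<sigma> = -1"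
      and eq: "\<And>\<psi>. \<psi> \<in> Cc_inf \<Longrightarrow> (LINT q:{t. \<sigma> * t < 0} \<times> UNIV|lebesgue.
        frechet_derivative \<psi> (at q) (1, 0) *\<^sub>R \<phi> (fst q) (snd q)
          + \<psi> q *\<^sub>R X0 (\<phi> (fst q) (snd q))) = \<sigma> *\<^sub>R (LINT x|lebesgue. \<psi> (0, x) *\<^sub>R x)" for \<sigma>
  proof (rule half_flow_eq[OF \<sigma> f U, of M])
    show "norm (U q) \<le> M" for q by (simp add: U_def XM)
    fix \<psi> :: "real \<times> 'a \<Rightarrow> real" assume \<psi>: "\<psi> \<in> Cc_inf"
    have cd: "continuous_on UNIV (\<lambda>q. frechet_derivative \<psi> (at q) (1, 0))"
      using Ck_SucD(2)[OF Cc_inf_D(1)[OF \<psi>], of 0] by simp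
    have cpsi: "continuous_on UNIV \<psi>" using Cc_inf_D(1)[OF \<psi>, of 0] by simp
    have [measurable]: "(\<lambda>q. frechet_derivative \<psi> (at q) (1, 0)) \<in> borel_measurable borel" "\<psi> \<in> borel_measurable borel"
      using cd cpsi by (auto intro: borel_measurable_continuous_onI)
    have [measurable]: "(\<lambda>q::real \<times> 'a. indicat_real {t. \<sigma> * t < 0} (fst q)) \<in> borel_measurable borel"
    proof -
      have "(\<lambda>q::real \<times> 'a. indicat_real {t. \<sigma> * t < 0} (fst q)) \<in> borel_measurable (borel \<Otimes>\<^sub>M borel)"
        by measurable
      then show ?thesis by (simp add: borel_prod)
    qed
    note [measurable] = U' fm'
    have "(\<integral>q. indicator {t. \<sigma> * t < 0} (fst q) *\<^sub>R
        (frechet_derivative \<psi> (at q) (1, 0) *\<^sub>R f q + \<psi> q *\<^sub>R U q) \<partial>lborel)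
       = (LINT q:{t. \<sigma> * t < 0} \<times> UNIV|lebesgue.
        frechet_derivative \<psi> (at q) (1, 0) *\<^sub>R \<phi> (fst q) (snd q)
          + \<psi> q *\<^sub>R X0 (\<phi> (fst q) (snd q)))"
      unfolding set_lebesgue_integral_def
    proof (rule lebesgue_integral_cong_lborel(2)[symmetric])
      show "AE q in lborel. indicat_real ({t. \<sigma> * t < 0} \<times> UNIV) q *\<^sub>R (frechet_derivative \<psi> (at q) (1, 0) *\<^sub>R \<phi> (fst q) (snd q)
          + \<psi> q *\<^sub>R X0 (\<phi> (fst q) (snd q))) = indicator {t. \<sigma> * t < 0} (fst q) *\<^sub>R
        (frechet_derivative \<psi> (at q) (1, 0) *\<^sub>R f q + \<psi> q *\<^sub>R U q)"
        using X\<phi> by eventually_elim (auto simp: U_def indicator_def)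
    qed measurable
    also have "\<dots> = \<sigma> *\<^sub>R (LINT x|lebesgue. \<psi> (0, x) *\<^sub>R x)" by (rule eq[OF \<psi>])
    also have "(LINT x|lebesgue. \<psi> (0, x) *\<^sub>R x) = (\<integral>x. \<psi> (0, x) *\<^sub>R x \<partial>lborel)"
    proof (rule integral_completion)
      have "continuous_on UNIV (\<lambda>x. \<psi> (0, x) *\<^sub>R x)"
        by (intro continuous_intros continuous_on_compose2[OF cpsi]) auto
      then show "(\<lambda>x. \<psi> (0, x) *\<^sub>R x) \<in> borel_measurable lborel"
        by (simp add: borel_measurable_continuous_onI)
    qed
    finally show "(\<integral>q. indicator {t. \<sigma> * t < 0} (fst q) *\<^sub>R
        (frechet_derivative \<psi> (at q) (1, 0) *\<^sub>R f q + \<psi> q *\<^sub>R U q) \<partial>lborel) = \<sigma> *\<^sub>R (\<integral>x. \<psi> (0, x) *\<^sub>R x \<partial>lborel)" .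
  qed
  \<comment> \<open>A formula at every t and z, whereas f and \<open>\<phi>\<close> are compared
    only almost everywhere. Being a primitive of a function bounded by M, it is Lipschitz in time at
    every z.\<close>
  define \<Phi> where "\<Phi> t z = z + prim (\<lambda>s. U (s, z)) t" for t z
  have sets_eq: "{t. (- 1) * t < 0} = {0::real<..}" "{t. 1 * t < 0} = {..<0::real}" by auto
  have dist: "distributional_flow X0 \<phi>" using rlf'[THEN conjunct2, THEN conjunct2, THEN conjunct1] .
  have neg: "AE q in lborel. 1 * fst q < 0 \<longrightarrow> f q = snd q + prim (\<lambda>s. U (s, snd q)) (fst q)"
  proof (rule half)
    fix \<psi> :: "real \<times> 'a \<Rightarrow> real" assume "\<psi> \<in> Cc_inf"
    then show "(LINT q:{t. 1 * t < 0} \<times> UNIV|lebesgue. frechet_derivative \<psi> (at q) (1, 0) *\<^sub>R \<phi> (fst q) (snd q)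
          + \<psi> q *\<^sub>R X0 (\<phi> (fst q) (snd q))) = 1 *\<^sub>R (LINT x|lebesgue. \<psi> (0, x) *\<^sub>R x)"
      unfolding sets_eq using dist by (simp add: distributional_flow_def)
  qed simp
  have pos: "AE q in lborel. (- 1) * fst q < 0 \<longrightarrow> f q = snd q + prim (\<lambda>s. U (s, snd q)) (fst q)"
  proof (rule half)
    fix \<psi> :: "real \<times> 'a \<Rightarrow> real" assume "\<psi> \<in> Cc_inf"
    then show "(LINT q:{t. (- 1) * t < 0} \<times> UNIV|lebesgue. frechet_derivative \<psi> (at q) (1, 0) *\<^sub>R \<phi> (fst q) (snd q)
          + \<psi> q *\<^sub>R X0 (\<phi> (fst q) (snd q))) = (- 1) *\<^sub>R (LINT x|lebesgue. \<psi> (0, x) *\<^sub>R x)"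
      unfolding sets_eq using dist by (simp add: distributional_flow_def)
  qed simp
  have nz: "AE q in (lborel :: (real \<times> 'a) measure). fst q \<noteq> 0"
  proof (rule AE_lborel_prodI)
    show "AE x in lborel. AE y in (lborel :: 'a measure). fst (x, y) \<noteq> (0::real)"
      using AE_lborel_singleton[of "0::real"] by eventually_elim simp
  qed measurable
  have f\<Phi>: "AE q in lborel. f q = \<Phi> (fst q) (snd q)"
    using neg pos nz
  proof eventually_elim
    fix q :: "real \<times> 'a"
    assume "1 * fst q < 0 \<longrightarrow> f q = snd q + prim (\<lambda>s. U (s, snd q)) (fst q)"
      "(- 1) * fst q < 0 \<longrightarrow> f q = snd q + prim (\<lambda>s. U (s, snd q)) (fst q)" "fst q \<noteq> 0"
    then have "f q = snd q + prim (\<lambda>s. U (s, snd q)) (fst q)" by linarith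
    then show "f q = \<Phi> (fst q) (snd q)" unfolding \<Phi>_def .
  qed
  have lbU: "locally_bounded_fun (\<lambda>s. U (s, z))" for z
    by (rule locally_bounded_funI[where M=M]) (auto simp: U_def XM)
  have \<Phi>m: "(\<lambda>(t, z). \<Phi> t z) \<in> borel_measurable (borel \<Otimes>\<^sub>M borel)"
    unfolding \<Phi>_def by measurable
  have \<Phi>tm: "\<Phi> t \<in> borel_measurable borel" for t
  proof -
    have "(\<lambda>z. (t, z)) \<in> borel \<rightarrow>\<^sub>M borel \<Otimes>\<^sub>M borel" by measurable
    from measurable_compose[OF this \<Phi>m] show ?thesis by simp
  qed
  have "good_flow X M \<Phi>"
    unfolding good_flow_def
  proof (intro conjI allI impI)
    show "norm (\<Phi> t z - z) \<le> M * \<bar>t\<bar>" for t z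
    proof -
      have "norm (prim (\<lambda>s. U (s, z)) t) \<le> M * \<bar>t\<bar>"
      proof (rule norm_prim_le)
        show "norm (U (s, z)) \<le> M" for s unfolding U_def by (rule XM)
      qed measurable
      then show ?thesis by (simp add: \<Phi>_def)
    qed
    have "AE z in lborel. AE s in lborel. f (s, z) = \<Phi> s z"
      using AE_lborel_prod_swap[OF f\<Phi>] by simp
    then show "AE z in lborel. \<forall>t. \<Phi> t z = z + prim (\<lambda>s. X (\<Phi> s z)) t"
    proof eventually_elim
      fix z assume ae: "AE s in lborel. f (s, z) = \<Phi> s z"
      have "(\<lambda>s. (s, z)) \<in> borel \<rightarrow>\<^sub>M borel \<Otimes>\<^sub>M borel" by measurable
      from measurable_compose[OF this \<Phi>m] have [measurable]: "(\<lambda>s. \<Phi> s z) \<in> borel_measurable borel"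
        by simp
      \<comment> \<open>f and \<open>\<Phi>\<close> agree at z for almost every s, which is enough
        under the integral. The set of admissible z does not involve t.\<close>
      have prim_eq: "prim (\<lambda>s. U (s, z)) t = prim (\<lambda>s. X (\<Phi> s z)) t" for t
        unfolding prim_def
      proof (rule integral_cong_AE)
        show "AE s in lborel. kern t s *\<^sub>R U (s, z) = kern t s *\<^sub>R X (\<Phi> s z)"
          using ae by eventually_elim (simp add: U_def)
      qed measurable
      show "\<forall>t. \<Phi> t z = z + prim (\<lambda>s. X (\<Phi> s z)) t"
        by (rule allI, rule trans[OF \<Phi>_def arg_cong[where f="\<lambda>p. z + p", OF prim_eq]])
    qed
  next
    fix T :: real assume T: "T > 0"
    have "T + 1 > 0" using T by simp
    from comp[OF this] obtain C where C: "C > 0" "\<forall>A\<in>sets borel. \<forall>t. \<bar>t\<bar> \<le> T + 1 \<longrightarrow>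
        emeasure lebesgue {x. \<phi> t x \<in> A} \<le> ennreal C * emeasure lborel A"
      by (elim exE conjE)
    have ae: "AE t in lborel. \<bar>t\<bar> \<le> T + 1 \<longrightarrow> (\<forall>A\<in>sets borel. emeasure lborel (\<Phi> t -` A) \<le> ennreal C * emeasure lborel A)"
      using f\<phi>t AE_lborel_prodD[OF f\<Phi>]
    proof eventually_elim
      fix t assume "AE z in lborel. \<phi> t z = f (t, z)" "AE z in lborel. f (t, z) = \<Phi> (fst (t, z)) (snd (t, z))"
      then have aet: "AE z in lborel. \<phi> t z = \<Phi> t z" by eventually_elim simp
      show "\<bar>t\<bar> \<le> T + 1 \<longrightarrow> (\<forall>A\<in>sets borel. emeasure lborel (\<Phi> t -` A) \<le> ennreal C * emeasure lborel A)"
      proof (intro impI ballI)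
        fix A :: "'a set" assume t: "\<bar>t\<bar> \<le> T + 1" and A: "A \<in> sets borel"
        have s: "\<Phi> t -` A \<in> sets borel" using measurable_sets[OF \<Phi>tm A, of t] by simp
        have "emeasure lborel (\<Phi> t -` A) = emeasure lebesgue (\<Phi> t -` A)" using s by simp
        also have "\<dots> = emeasure lebesgue {x. \<phi> t x \<in> A}"
        proof (rule emeasure_eq_AE)
          show "AE x in lebesgue. (x \<in> \<Phi> t -` A) = (x \<in> {x. \<phi> t x \<in> A})"
            unfolding AE_lebesgue_iff using aet by eventually_elim simp
          show "\<Phi> t -` A \<in> sets lebesgue" using s by simp
          show "{x. \<phi> t x \<in> A} \<in> sets lebesgue" by (rule \<phi>set[OF A])
        qed
        also have "\<dots> \<le> ennreal C * emeasure lborel A" by (rule C(2)[rule_format, OF A t])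
        finally show "emeasure lborel (\<Phi> t -` A) \<le> ennreal C * emeasure lborel A" .
      qed
    qed
    show "\<exists>C>0. \<forall>t. \<bar>t\<bar> \<le> T \<longrightarrow> (\<forall>A\<in>sets borel. emeasure lborel (\<Phi> t -` A) \<le> ennreal C * emeasure lborel A)"
    proof (intro exI[of _ C] conjI allI impI ballI C(1))
      fix t A assume tA: "\<bar>t\<bar> \<le> T" "A \<in> sets (borel :: 'a measure)"
      show "emeasure lborel (\<Phi> t -` A) \<le> ennreal C * emeasure lborel A"
      proof (rule compression_all_times[OF \<Phi>tm _ ae tA])
        show "continuous_on UNIV (\<lambda>t. \<Phi> t z)" for z
          unfolding \<Phi>_def by (rule continuous_on_add[OF continuous_on_const continuous_prim[OF lbU]])
      qed
    qed
  qed (rule \<Phi>m)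
  moreover have "AE q in lborel. \<phi> (fst q) (snd q) = \<Phi> (fst q) (snd q)"
    using f\<phi>' f\<Phi> by eventually_elim simp
  ultimately show thesis using that by blast
qed


subsection \<open>Convolution and Sobolev approximation\<close>

definition conv :: "('a::euclidean_space \<Rightarrow> real) \<Rightarrow> ('a \<Rightarrow> 'b::euclidean_space) \<Rightarrow> 'a \<Rightarrow> 'b" where
  "conv k f z = (\<integral>w. k (z - w) *\<^sub>R f w \<partial>lborel)"

lemma bump_reflect:
  assumes "bump r k" shows "bump (r + norm z) (\<lambda>w. k (z - w))"
  unfolding bump_def
proof (intro conjI allI impI)
  show "continuous_on UNIV (\<lambda>w. k (z - w))"
    by (rule continuous_on_compose2[of UNIV k]) (use assms in \<open>auto simp: bump_def intro!: continuous_intros\<close>)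
  fix x :: 'a assume "r + norm z < norm x"
  moreover have "norm x - norm z \<le> norm (z - x)" by (metis norm_minus_commute norm_triangle_ineq2)
  ultimately have "norm (z - x) > r" by linarith
  then show "k (z - x) = 0" using assms by (auto simp: bump_def)
qed

lemma conv_integrable:
  assumes "bump r k" "loc1 f" shows "integrable lborel (\<lambda>w. k (z - w) *\<^sub>R f w)"
  by (rule bump_integrable[OF bump_reflect[OF assms(1)] assms(2)])

text \<open>Used with \<open>s n\<close> an increment of a kernel, for continuity of a convolution,
  and with \<open>s n\<close> the remainder of a difference quotient, for its differentiability. The
  common bound and support give the dominating function.\<close>

lemma kernel_integral_tendsto_0:
  fixes s :: "nat \<Rightarrow> 'a::euclidean_space \<Rightarrow> real" and f :: "'a \<Rightarrow> 'b::euclidean_space"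
  assumes f: "loc1 f" and [measurable]: "\<And>n. s n \<in> borel_measurable borel"
    and B: "\<And>n w. \<bar>s n w\<bar> \<le> B" and R: "\<And>n w. norm w > R \<Longrightarrow> s n w = 0"
    and lim: "\<And>w. (\<lambda>n. s n w) \<longlonglongrightarrow> 0"
  shows "(\<lambda>n. \<integral>w. s n w *\<^sub>R f w \<partial>lborel) \<longlonglongrightarrow> 0"
proof -
  have [measurable]: "f \<in> borel_measurable borel" using f by auto
  have "(\<lambda>n. \<integral>w. s n w *\<^sub>R f w \<partial>lborel) \<longlonglongrightarrow> (\<integral>w. (0::'b) \<partial>(lborel::'a measure))"
  proof (rule integral_dominated_convergence[where w="\<lambda>w. B * norm (indicat_real (cball 0 R) w *\<^sub>R f w)"])
    show "integrable lborel (\<lambda>w. B * norm (indicat_real (cball 0 R) w *\<^sub>R f w))"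
      by (intro integrable_mult_right integrable_norm loc1_integrable f)
    show "AE w in lborel. (\<lambda>n. s n w *\<^sub>R f w) \<longlonglongrightarrow> 0"
      using tendsto_scaleR[OF lim tendsto_const] by (intro AE_I2) force
    show "AE w in lborel. norm (s n w *\<^sub>R f w) \<le> B * norm (indicat_real (cball 0 R) w *\<^sub>R f w)" for n
    proof (intro AE_I2)
      fix w
      show "norm (s n w *\<^sub>R f w) \<le> B * norm (indicat_real (cball 0 R) w *\<^sub>R f w)"
        using R[of w n] B[of n w] by (cases "norm w > R") (auto intro!: mult_right_mono)
    qed
  qed auto
  then show ?thesis by simp
qed

lemma conv_continuous:
  assumes k: "bump r k" and f: "loc1 f" shows "continuous_on UNIV (conv k f)"
proof (rule continuous_at_imp_continuous_on, rule ballI)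
  fix z
  obtain B where B: "B \<ge> 0" "\<And>x. \<bar>k x\<bar> \<le> B" using bump_bounded[OF k] by blast
  have [measurable]: "k \<in> borel_measurable borel" using k by auto
  have "(conv k f \<circ> y) \<longlonglongrightarrow> conv k f z" if y: "y \<longlonglongrightarrow> z" for y
  proof -
    obtain K where K: "\<And>n. norm (y n) \<le> K" using convergent_imp_Bseq[of y] y by (auto simp: convergent_def Bseq_def)
    have "(\<lambda>n. \<integral>w. (k (y n - w) - k (z - w)) *\<^sub>R f w \<partial>lborel) \<longlonglongrightarrow> 0"
    proof (rule kernel_integral_tendsto_0[OF f, where B="2*B" and R="\<bar>r\<bar> + \<bar>K\<bar> + norm z"])
      show "\<bar>k (y n - w) - k (z - w)\<bar> \<le> 2 * B" for n w
        using B(2)[of "y n - w"] B(2)[of "z - w"] by linarith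
      show "k (y n - w) - k (z - w) = 0" if "\<bar>r\<bar> + \<bar>K\<bar> + norm z < norm w" for n w
      proof -
        have "norm w - norm (y n) \<le> norm (y n - w)" "norm w - norm z \<le> norm (z - w)"
          by (metis norm_minus_commute norm_triangle_ineq2)+
        then have "norm (y n - w) > r" "norm (z - w) > r" using that K[of n] norm_ge_zero[of z] by linarith+
        then show ?thesis using k by (auto simp: bump_def)
      qed
      have "isCont k (z - w)" for w using k by (auto simp: bump_def continuous_on_eq_continuous_at)
      then have "(\<lambda>n. k (y n - w)) \<longlonglongrightarrow> k (z - w)" for w
        by (rule isCont_tendsto_compose) (intro tendsto_intros y)
      then show "(\<lambda>n. k (y n - w) - k (z - w)) \<longlonglongrightarrow> 0" for w by (simp add: LIM_zero)
    qed measurable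
    moreover have "(\<integral>w. (k (y n - w) - k (z - w)) *\<^sub>R f w \<partial>lborel) = conv k f (y n) - conv k f z" for n
      unfolding conv_def scaleR_diff_left
      by (rule Bochner_Integration.integral_diff; rule conv_integrable[OF k f])
    ultimately show ?thesis by (simp add: LIM_zero_iff o_def)
  qed
  then show "isCont (conv k f) z" by (simp add: continuous_at_sequentially)
qed

lemma bump_derivative:
  assumes d: "\<And>x. (k has_derivative k' x) (at x)" and c: "\<And>v. continuous_on UNIV (\<lambda>x. k' x v)"
    and k: "bump r k"
  shows "bump r (\<lambda>x. k' x v)"
  unfolding bump_def
proof (intro conjI allI impI c)
  fix x :: 'a assume x: "r < norm x"
  have "open (- cball (0::'a) r)" by auto
  moreover have "x \<in> - cball 0 r" using x by auto
  moreover have "k y = 0" if "y \<in> - cball 0 r" for y using that k by (auto simp: bump_def)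
  ultimately have "((\<lambda>_. 0) has_derivative k' x) (at x)"
    using has_derivative_transform_within_open[OF d[of x], of "- cball 0 r" "\<lambda>_. 0"] by blast
  then have "k' x = (\<lambda>_. 0)" using has_derivative_unique[OF _ has_derivative_const] by blast
  then show "k' x v = 0" by simp
qed

text \<open>Differentiation under the integral. The kernel is Lipschitz with constant B, so the
  remainder divided by \<open>norm (h n)\<close> is bounded by 2 B, and it tends to 0
  pointwise.\<close>

lemma conv_has_derivative:
  fixes f :: "'a::euclidean_space \<Rightarrow> 'b::euclidean_space"
  assumes d: "\<And>x. (k has_derivative k' x) (at x)" and c: "\<And>v. continuous_on UNIV (\<lambda>x. k' x v)"
    and k: "bump r k" and f: "loc1 f"
  shows "(conv k f has_derivative (\<lambda>v. conv (\<lambda>x. k' x v) f z)) (at z)"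
proof -
  have lin: "linear (k' x)" for x by (rule has_derivative_linear[OF d])
  have kb: "bump r (\<lambda>x. k' x v)" for v by (rule bump_derivative[OF d c k])
  have [measurable]: "k \<in> borel_measurable borel" "\<And>v. (\<lambda>x. k' x v) \<in> borel_measurable borel"
    using k kb by auto
  have "bump r (\<lambda>x. \<Sum>b\<in>Basis. norm (k' x b))"
    using kb by (auto simp: bump_def intro!: continuous_intros)
  then obtain B where B: "B \<ge> 0" "\<And>x. \<bar>\<Sum>b\<in>Basis. norm (k' x b)\<bar> \<le> B"
    using bump_bounded by blast
  have kle: "\<bar>k' x v\<bar> \<le> B * norm v" for x v
    using derivative_norm_le[OF lin, of x v] mult_right_mono[OF B(2)[of x], of "norm v"]
    by (simp add: sum_nonneg)
  have Lip: "\<bar>k x - k y\<bar> \<le> B * norm (x - y)" for x y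
  proof -
    have "norm (k x - k y) \<le> B * norm (x - y)"
    proof (rule differentiable_bound[of UNIV k k'])
      show "onorm (k' x) \<le> B" for x
        using kle by (intro onorm_bound B(1)) (simp add: mult.commute)
    qed (auto intro: d)
    then show ?thesis by simp
  qed
  have linL: "linear (\<lambda>v. conv (\<lambda>x. k' x v) f z)"
  proof (rule linearI)
    fix u v
    show "conv (\<lambda>x. k' x (u + v)) f z = conv (\<lambda>x. k' x u) f z + conv (\<lambda>x. k' x v) f z"
      unfolding conv_def
      using Bochner_Integration.integral_add[OF conv_integrable[OF kb[of u] f, of z] conv_integrable[OF kb[of v] f, of z]]
      by (simp add: linear_add[OF lin] scaleR_add_left)
  next
    fix a v
    show "conv (\<lambda>x. k' x (a *\<^sub>R v)) f z = a *\<^sub>R conv (\<lambda>x. k' x v) f z"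
      unfolding conv_def by (simp add: linear_scale[OF lin] flip: scaleR_scaleR)
  qed
  show ?thesis
    unfolding has_derivative_at
  proof (intro conjI)
    show "bounded_linear (\<lambda>v. conv (\<lambda>x. k' x v) f z)"
      using linL by (simp add: linear_conv_bounded_linear)
    show "(\<lambda>h. norm (conv k f (z + h) - conv k f z - conv (\<lambda>x. k' x h) f z) / norm h) \<midarrow>0\<rightarrow> 0"
    proof (rule iffD2[OF tendsto_at_iff_sequentially], intro allI impI)
      fix h :: "nat \<Rightarrow> 'a" assume h0: "\<forall>i. h i \<in> UNIV - {0}" and h: "h \<longlonglongrightarrow> 0"
      have hn: "norm (h n) > 0" for n using h0 by auto
      obtain K where K: "\<And>n. norm (h n) \<le> K" using convergent_imp_Bseq[of h] h by (auto simp: convergent_def Bseq_def)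
      define s where "s n w = (k (z + h n - w) - k (z - w) - k' (z - w) (h n)) / norm (h n)" for n w
      have "(\<lambda>n. \<integral>w. s n w *\<^sub>R f w \<partial>lborel) \<longlonglongrightarrow> 0"
      proof (rule kernel_integral_tendsto_0[OF f, where B="2*B" and R="\<bar>r\<bar> + \<bar>K\<bar> + norm z"])
        show "s n \<in> borel_measurable borel" for n unfolding s_def[abs_def] by measurable
        show "\<bar>s n w\<bar> \<le> 2 * B" for n w
        proof -
          have "\<bar>k (z + h n - w) - k (z - w) - k' (z - w) (h n)\<bar> \<le> 2 * B * norm (h n)"
            using Lip[of "z + h n - w" "z - w"] kle[of "z - w" "h n"] by (simp add: algebra_simps)
          then show ?thesis using hn[of n] by (simp add: s_def pos_divide_le_eq)
        qed
        show "s n w = 0" if "\<bar>r\<bar> + \<bar>K\<bar> + norm z < norm w" for n w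
        proof -
          have "norm w - norm (z + h n) \<le> norm (z + h n - w)" "norm w - norm z \<le> norm (z - w)"
            by (metis norm_minus_commute norm_triangle_ineq2)+
          moreover have "norm (z + h n) \<le> norm z + K" using norm_triangle_ineq[of z "h n"] K[of n] by linarith
          ultimately have "norm (z + h n - w) > r" "norm (z - w) > r" using that by linarith+
          then show ?thesis using k kb[of "h n"] by (auto simp: bump_def s_def)
        qed
        show "(\<lambda>n. s n w) \<longlonglongrightarrow> 0" for w
        proof -
          have "(\<lambda>h. norm (k (z - w + h) - k (z - w) - k' (z - w) h) / norm h) \<midarrow>0\<rightarrow> 0"
            using d[of "z - w"] by (simp add: has_derivative_at)
          then have "((\<lambda>h. norm (k (z - w + h) - k (z - w) - k' (z - w) h) / norm h) \<circ> h) \<longlonglongrightarrow> 0"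
            using h h0 by (simp add: tendsto_at_iff_sequentially)
          then have "(\<lambda>n. \<bar>s n w\<bar>) \<longlonglongrightarrow> 0" by (simp add: o_def s_def algebra_simps abs_mult)
          then show ?thesis by (rule tendsto_rabs_zero_cancel)
        qed
      qed
      moreover have "norm (\<integral>w. s n w *\<^sub>R f w \<partial>lborel)
        = norm (conv k f (z + h n) - conv k f z - conv (\<lambda>x. k' x (h n)) f z) / norm (h n)" for n
      proof -
        have "(\<integral>w. s n w *\<^sub>R f w \<partial>lborel)
          = (1 / norm (h n)) *\<^sub>R (\<integral>w. k (z + h n - w) *\<^sub>R f w - k (z - w) *\<^sub>R f w - k' (z - w) (h n) *\<^sub>R f w \<partial>lborel)"
          by (simp flip: integral_scaleR_right add: s_def scaleR_diff_left scaleR_diff_right diff_divide_distrib)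
        also have "\<dots> = (1 / norm (h n)) *\<^sub>R (conv k f (z + h n) - conv k f z - conv (\<lambda>x. k' x (h n)) f z)"
          unfolding conv_def
          by (subst Bochner_Integration.integral_diff | rule refl Bochner_Integration.integrable_diff conv_integrable[OF k f]
              conv_integrable[OF kb f])+
        finally show ?thesis by simp
      qed
      ultimately show "((\<lambda>h. norm (conv k f (z + h) - conv k f z - conv (\<lambda>x. k' x h) f z) / norm h) \<circ> h) \<longlonglongrightarrow> 0"
        using tendsto_norm_zero by (fastforce simp: o_def)
    qed
  qed
qed

section \<open>Weak derivatives and their mollification\<close>

definition weak_partials :: "('a::euclidean_space \<Rightarrow> 'b::euclidean_space) \<Rightarrow> ('a \<Rightarrow> 'a \<Rightarrow> 'b) \<Rightarrow> bool" where
  "weak_partials X G \<longleftrightarrow> loc1 X \<and> (\<forall>b\<in>Basis. loc1 (G b)) \<and> (\<forall>\<psi>\<in>Cc_inf. \<forall>b\<in>Basis.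
     (\<integral>x. frechet_derivative \<psi> (at x) b *\<^sub>R X x \<partial>lborel) = - (\<integral>x. \<psi> x *\<^sub>R G b x \<partial>lborel))"

definition weak_D :: "('a::euclidean_space \<Rightarrow> 'a \<Rightarrow> 'b::euclidean_space) \<Rightarrow> 'a \<Rightarrow> 'a \<Rightarrow> 'b" where
  "weak_D G z v = (\<Sum>b\<in>Basis. (v \<bullet> b) *\<^sub>R G b z)"

lemma weak_partials_loc1:
  assumes "weak_partials X G" shows "loc1 X" "b \<in> Basis \<Longrightarrow> loc1 (G b)"
  using assms by (auto simp: weak_partials_def)

lemma weak_D_loc1:
  assumes "weak_partials X G" shows "loc1 (\<lambda>z. weak_D G z v)"
  unfolding weak_D_def
proof (rule loc1_sum)
  fix b :: 'a assume b: "b \<in> Basis"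
  show "loc1 (\<lambda>x. (v \<bullet> b) *\<^sub>R G b x)"
    by (rule loc1_le[OF weak_partials_loc1(2)[OF assms b], where c="\<bar>v \<bullet> b\<bar>"])
       (use loc1_measurable[OF weak_partials_loc1(2)[OF assms b]] in auto)
qed

lemma linear_weak_D: "linear (weak_D G z)"
  by (rule linearI)
     (auto simp: weak_D_def inner_add_left scaleR_add_left sum.distrib scaleR_sum_right)

text \<open>In w the test function \<open>k (z - w)\<close> has derivative with a minus sign, which
  cancels the one in the definition of the weak derivative.\<close>

lemma conv_weak_partial:
  assumes X: "weak_partials X G" and k: "k \<in> Cc_inf" and b: "b \<in> Basis"
  shows "conv (\<lambda>x. frechet_derivative k (at x) b) X z = conv k (G b) z"
proof -
  have d: "(k has_derivative frechet_derivative k (at x)) (at x)" for x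
    by (rule Ck_SucD(1)[OF Cc_inf_D(1)[OF k]])
  have \<psi>: "(\<lambda>w. k (z - w)) \<in> Cc_inf" using Cc_inf_rescale[OF k, of 1 z] by simp
  have "((\<lambda>w. k (z - w)) has_derivative (\<lambda>v. frechet_derivative k (at (z - w)) (- v))) (at w)" for w
    by (rule has_derivative_compose[OF _ d]) (auto intro!: derivative_eq_intros)
  from frechet_derivative_at[OF this, symmetric]
  have "frechet_derivative (\<lambda>w. k (z - w)) (at w) b = - frechet_derivative k (at (z - w)) b" for w
    using linear_neg[OF has_derivative_linear[OF d]] by simp
  then show ?thesis
    using X \<psi> b unfolding weak_partials_def conv_def by fastforce
qed

lemma conv_weak_D:
  assumes X: "weak_partials X G" and k: "k \<in> Cc_inf"
  shows "conv (\<lambda>x. frechet_derivative k (at x) v) X z = (\<Sum>b\<in>Basis. (v \<bullet> b) *\<^sub>R conv k (G b) z)"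
proof -
  have d: "(k has_derivative frechet_derivative k (at x)) (at x)" for x
    by (rule Ck_SucD(1)[OF Cc_inf_D(1)[OF k]])
  have c: "continuous_on UNIV (\<lambda>x. frechet_derivative k (at x) v)" for v
    using Ck_SucD(2)[OF Cc_inf_D(1)[OF k], of 0] by simp
  obtain r where r: "bump r k" using Cc_inf_bump[OF k] by blast
  define L where "L v = conv (\<lambda>x. frechet_derivative k (at x) v) X z" for v
  have "linear L"
    using has_derivative_linear[OF conv_has_derivative[OF d c r weak_partials_loc1(1)[OF X]]]
    unfolding L_def .
  then have "L (\<Sum>b\<in>Basis. (v \<bullet> b) *\<^sub>R b) = (\<Sum>b\<in>Basis. (v \<bullet> b) *\<^sub>R L b)"
    by (simp add: linear_sum linear_scale)
  moreover have "L b = conv k (G b) z" if "b \<in> Basis" for b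
    unfolding L_def by (rule conv_weak_partial[OF X k that])
  ultimately show ?thesis by (simp add: euclidean_representation flip: L_def)
qed

lemma norm_conv_le:
  assumes k: "bump r k" and M: "\<And>x. norm (f x) \<le> M"
  shows "norm (conv k f z) \<le> M * (\<integral>w. \<bar>k w\<bar> \<partial>lborel)"
proof -
  have M0: "M \<ge> 0" using M norm_ge_zero order_trans by blast
  have [measurable]: "k \<in> borel_measurable borel" using k by auto
  have ab: "bump r (\<lambda>w. \<bar>k w\<bar>)" using k by (auto simp: bump_def intro!: continuous_intros)
  have int: "integrable lborel (\<lambda>w. M * \<bar>k (z - w)\<bar>)"
    using conv_integrable[OF ab loc1_bounded[where c=1], of "\<lambda>_. 1::real" z] by simp
  have "norm (conv k f z) \<le> (\<integral>w. norm (k (z - w) *\<^sub>R f w) \<partial>lborel)"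
    unfolding conv_def by (rule integral_norm_bound)
  also have "\<dots> \<le> (\<integral>w. M * \<bar>k (z - w)\<bar> \<partial>lborel)"
    using M M0 by (intro integral_mono_AE' int) (auto simp: mult.commute[of M] intro!: mult_left_mono AE_I2)
  also have "\<dots> = M * (\<integral>w. \<bar>k w\<bar> \<partial>lborel)"
    using integral_affine_subst[of "\<lambda>w. \<bar>k w\<bar>" 1 z] by simp
  finally show ?thesis .
qed

definition scaled :: "('a::euclidean_space \<Rightarrow> real) \<Rightarrow> real \<Rightarrow> 'a \<Rightarrow> real" where
  "scaled k e x = k (x /\<^sub>R e) / e ^ DIM('a)"

lemma scaled_Cc_inf:
  assumes "k \<in> Cc_inf" "e > 0" shows "scaled k e \<in> Cc_inf"
proof -
  have "(\<lambda>w. k ((0 - w) /\<^sub>R e)) \<in> Cc_inf" by (rule Cc_inf_rescale[OF assms])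
  obtain r where r: "\<forall>x. norm x > r \<longrightarrow> k x = 0" using Cc_inf_D(2)[OF assms(1)] by blast
  have "Ck n (\<lambda>w. inverse (e ^ DIM('a)) * k (0 + w /\<^sub>R e))" for n
    by (intro Ck_mult Ck_const Ck_affine_comp[OF bounded_linear_scaleR_right Cc_inf_D(1)[OF assms(1)]])
  then have "Ck n (scaled k e)" for n
    by (simp add: scaled_def[abs_def] divide_inverse mult.commute)
  moreover have "scaled k e x = 0" if "e * \<bar>r\<bar> < norm x" for x
  proof -
    have "\<bar>r\<bar> < inverse e * norm x" using that assms(2) by (simp add: field_simps)
    also have "\<dots> = norm (x /\<^sub>R e)" using assms(2) by (simp only: norm_scaleR) simp
    finally show ?thesis using r by (simp add: scaled_def)
  qed
  ultimately show ?thesis by (rule Cc_infI)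
qed

lemma conv_scaled_eq_moll:
  fixes f :: "'a::euclidean_space \<Rightarrow> 'b::euclidean_space"
  assumes [measurable]: "k \<in> borel_measurable borel" "f \<in> borel_measurable borel" and e: "e > 0"
  shows "conv (scaled k e) f = moll k e f"
proof
  fix z
  have "conv (scaled k e) f z = (\<integral>w. inverse (e ^ DIM('a)) *\<^sub>R (k ((z - w) /\<^sub>R e) *\<^sub>R f w) \<partial>lborel)"
    by (simp add: conv_def scaled_def divide_inverse mult.commute)
  also have "\<dots> = inverse (e ^ DIM('a)) *\<^sub>R (\<integral>w. k ((z - w) /\<^sub>R e) *\<^sub>R f w \<partial>lborel)"
    by (rule integral_scaleR_right)
  also have "\<dots> = moll k e f z" using e by (subst moll_eq) auto
  finally show "conv (scaled k e) f z = moll k e f z" .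
qed

lemma integral_abs_scaled:
  assumes [measurable]: "k \<in> borel_measurable borel" and e: "e > 0"
  shows "(\<integral>w. \<bar>scaled k e w\<bar> \<partial>lborel) = (\<integral>w. \<bar>k w\<bar> \<partial>lborel)"
proof -
  have [measurable]: "scaled k e \<in> borel_measurable borel" unfolding scaled_def[abs_def] by measurable
  have "(\<integral>w. \<bar>scaled k e w\<bar> \<partial>lborel) = (\<integral>w. \<bar>k (- w)\<bar> \<partial>lborel)"
    using integral_affine_subst[of "\<lambda>w. \<bar>scaled k e w\<bar>" e 0] e by (simp add: scaled_def)
  also have "\<dots> = (\<integral>w. \<bar>k w\<bar> \<partial>lborel)"
    using integral_affine_subst[of "\<lambda>w. \<bar>k w\<bar>" 1 0] by simp
  finally show ?thesis .
qed

lemma sequence_at_right_0: "filterlim (\<lambda>n. inverse (real (Suc n))) (at_right 0) sequentially"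
  by (rule tendsto_imp_filterlim_at_right[OF LIMSEQ_inverse_real_of_nat]) auto

text \<open>The gradient of the mollified field is the mollified weak gradient, so both limits are
  instances of \<open>moll_tendsto\<close>. The uniform bound is M times the integral of
  \<open>\<bar>k\<bar>\<close>.\<close>

lemma weak_partials_approx:
  fixes X :: "'a::euclidean_space \<Rightarrow> 'b::euclidean_space"
  assumes X: "weak_partials X G" and M: "\<And>x. norm (X x) \<le> M"
  obtains Xn DXn M' where
    "\<And>n z. (Xn n has_derivative DXn n z) (at z)" "\<And>n v. continuous_on UNIV (\<lambda>z. DXn n z v)"
    "\<And>n z. norm (Xn n z) \<le> M'"
    "\<And>R. (\<lambda>n. nL R (\<lambda>z. Xn n z - X z)) \<longlonglongrightarrow> 0"
    "\<And>R v. (\<lambda>n. nL R (\<lambda>z. DXn n z v - weak_D G z v)) \<longlonglongrightarrow> 0"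
proof -
  obtain k :: "'a \<Rightarrow> real" where "mollifier k" using mollifier_exists by blast
  then have k: "k \<in> Cc_inf" "integral\<^sup>L lborel k = 1" and kb: "bump 1 k"
    using mollifier_bump by (auto simp: mollifier_def)
  have [measurable]: "k \<in> borel_measurable borel" using kb by auto
  define e where "e n = inverse (real (Suc n))" for n
  have e: "e n > 0" for n by (simp add: e_def)
  define kn where "kn n = scaled k (e n)" for n
  have kn: "kn n \<in> Cc_inf" for n unfolding kn_def by (rule scaled_Cc_inf[OF k(1) e])
  have d: "(kn n has_derivative frechet_derivative (kn n) (at x)) (at x)" for n x
    by (rule Ck_SucD(1)[OF Cc_inf_D(1)[OF kn]])
  have c: "continuous_on UNIV (\<lambda>x. frechet_derivative (kn n) (at x) v)" for n v
    using Ck_SucD(2)[OF Cc_inf_D(1)[OF kn], of 0] by simp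
  have lim: "(\<lambda>n. nL R (\<lambda>z. conv (kn n) f z - f z)) \<longlonglongrightarrow> 0" if f: "loc1 f" for R and f :: "'a \<Rightarrow> 'b"
  proof -
    have "conv (kn n) f = moll k (e n) f" for n
      unfolding kn_def by (rule conv_scaled_eq_moll) (use f e in auto)
    then show ?thesis
      using filterlim_compose[OF moll_tendsto[OF kb k(2) f, of R] sequence_at_right_0] by (simp add: e_def)
  qed
  show thesis
  proof
    fix n z
    obtain r where r: "bump r (kn n)" using Cc_inf_bump[OF kn] by blast
    show "(conv (kn n) X has_derivative (\<lambda>v. conv (\<lambda>x. frechet_derivative (kn n) (at x) v) X z)) (at z)"
      by (rule conv_has_derivative[OF d c r weak_partials_loc1(1)[OF X]])
    show "continuous_on UNIV (\<lambda>z. conv (\<lambda>x. frechet_derivative (kn n) (at x) v) X z)" for v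
      using conv_continuous[OF bump_derivative[OF d c r] weak_partials_loc1(1)[OF X]] .
    show "norm (conv (kn n) X z) \<le> M * (\<integral>w. \<bar>k w\<bar> \<partial>lborel)"
      using norm_conv_le[OF r M] integral_abs_scaled[of k "e n"] e by (simp add: kn_def)
  next
    fix R
    show "(\<lambda>n. nL R (\<lambda>z. conv (kn n) X z - X z)) \<longlonglongrightarrow> 0" by (rule lim[OF weak_partials_loc1(1)[OF X]])
    fix v
    have "(\<lambda>n. \<Sum>b\<in>Basis. ennreal \<bar>v \<bullet> b\<bar> * nL R (\<lambda>z. conv (kn n) (G b) z - G b z)) \<longlonglongrightarrow> (\<Sum>b\<in>(Basis::'a set). 0)"
      by (intro tendsto_sum ennreal_tendsto_0_cmult lim weak_partials_loc1(2)[OF X]) auto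
    then have "(\<lambda>n. \<Sum>b\<in>Basis. ennreal \<bar>v \<bullet> b\<bar> * nL R (\<lambda>z. conv (kn n) (G b) z - G b z)) \<longlonglongrightarrow> 0"
      by simp
    moreover have "nL R (\<lambda>z. conv (\<lambda>x. frechet_derivative (kn n) (at x) v) X z - weak_D G z v)
      \<le> (\<Sum>b\<in>Basis. ennreal \<bar>v \<bullet> b\<bar> * nL R (\<lambda>z. conv (kn n) (G b) z - G b z))" for n
    proof -
      have m: "(\<lambda>z. conv (kn n) (G b) z - G b z) \<in> borel_measurable borel" if "b \<in> Basis" for b
      proof -
        obtain r where r: "bump r (kn n)" using Cc_inf_bump[OF kn] by blast
        have "conv (kn n) (G b) \<in> borel_measurable borel"
          by (rule borel_measurable_continuous_onI[OF conv_continuous[OF r weak_partials_loc1(2)[OF X that]]])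
        then show ?thesis using loc1_measurable[OF weak_partials_loc1(2)[OF X that]] by measurable
      qed
      have eq: "conv (\<lambda>x. frechet_derivative (kn n) (at x) v) X z - weak_D G z v
        = (\<Sum>b\<in>Basis. (v \<bullet> b) *\<^sub>R (conv (kn n) (G b) z - G b z))" for z
        by (simp add: conv_weak_D[OF X kn] weak_D_def sum_subtractf scaleR_diff_right)
      have "nL R (\<lambda>z. \<Sum>b\<in>Basis. (v \<bullet> b) *\<^sub>R (conv (kn n) (G b) z - G b z))
        \<le> (\<Sum>b\<in>Basis. nL R (\<lambda>z. (v \<bullet> b) *\<^sub>R (conv (kn n) (G b) z - G b z)))"
        by (intro nL_sum_le finite_Basis borel_measurable_scaleR borel_measurable_const m)
      also have "\<dots> \<le> (\<Sum>b\<in>Basis. ennreal \<bar>v \<bullet> b\<bar> * nL R (\<lambda>z. conv (kn n) (G b) z - G b z))"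
        by (intro sum_mono nL_cmult_le m) auto
      finally show ?thesis unfolding eq .
    qed
    ultimately show "(\<lambda>n. nL R (\<lambda>z. conv (\<lambda>x. frechet_derivative (kn n) (at x) v) X z - weak_D G z v)) \<longlonglongrightarrow> 0"
      by (rule ennreal_tendsto_0_le)
  qed
qed


subsection \<open>Vanishing bracket\<close>

lemma has_derivative_continuous_on_UNIV:
  assumes "\<And>x. (f has_derivative f' x) (at x)" shows "continuous_on UNIV f"
  using assms by (intro continuous_at_imp_continuous_on ballI) (rule has_derivative_continuous)

text \<open>The convolution of F with the constant 1 is a constant function; its derivative,
  computed under the integral, is the integral of the derivative of F.\<close>

lemma integral_derivative_eq_0:
  fixes F :: "'a::euclidean_space \<Rightarrow> real"
  assumes d: "\<And>x. (F has_derivative F' x) (at x)" and c: "\<And>v. continuous_on UNIV (\<lambda>x. F' x v)"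
    and F: "bump r F"
  shows "(\<integral>x. F' x v \<partial>lborel) = 0" "integrable lborel (\<lambda>x. F' x v)"
proof -
  have one: "loc1 (\<lambda>_::'a. 1::real)" by (rule loc1_bounded[where c=1]) auto
  have [measurable]: "F \<in> borel_measurable borel" "(\<lambda>x. F' x v) \<in> borel_measurable borel"
    using F bump_derivative[OF d c F, of v] by auto
  have "conv F (\<lambda>_. 1::real) = (\<lambda>z. integral\<^sup>L lborel F)"
    using integral_affine_subst[of F 1] by (simp add: conv_def fun_eq_iff)
  then have "((\<lambda>z. integral\<^sup>L lborel F) has_derivative (\<lambda>v. conv (\<lambda>x. F' x v) (\<lambda>_. 1::real) 0)) (at 0)"
    using conv_has_derivative[OF d c F one, of 0] by simp
  then have "(\<lambda>v. conv (\<lambda>x. F' x v) (\<lambda>_. 1::real) 0) = (\<lambda>_. 0)"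
    using has_derivative_unique[OF _ has_derivative_const] by blast
  then have "conv (\<lambda>x. F' x v) (\<lambda>_. 1::real) 0 = 0" by metis
  then show "(\<integral>x. F' x v \<partial>lborel) = 0"
    using integral_affine_subst[of "\<lambda>x. F' x v" 1 0] by (simp add: conv_def)
  show "integrable lborel (\<lambda>x. F' x v)"
    using bump_integrable[OF bump_derivative[OF d c F, of v] one] by simp
qed

text \<open>Measurability and local integrability are bundled with convergence so that limits of
  sums and products can be assembled term by term.\<close>

definition L1cvg :: "(nat \<Rightarrow> 'a::euclidean_space \<Rightarrow> 'b::euclidean_space) \<Rightarrow> ('a \<Rightarrow> 'b) \<Rightarrow> bool" where
  "L1cvg fn f \<longleftrightarrow> (\<forall>n. fn n \<in> borel_measurable borel) \<and> loc1 f \<and>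
     (\<forall>R. (\<lambda>n. nL R (\<lambda>z. fn n z - f z)) \<longlonglongrightarrow> 0)"

lemma L1cvgD:
  assumes "L1cvg fn f"
  shows "fn n \<in> borel_measurable borel" "loc1 f" "f \<in> borel_measurable borel"
    "(\<lambda>n. nL R (\<lambda>z. fn n z - f z)) \<longlonglongrightarrow> 0"
  using assms by (auto simp: L1cvg_def)

lemma L1cvg_const: "loc1 f \<Longrightarrow> L1cvg (\<lambda>_. f) f"
  by (auto simp: L1cvg_def nL_def)

lemma L1cvg_add:
  assumes f: "L1cvg fn f" and g: "L1cvg gn g"
  shows "L1cvg (\<lambda>n z. fn n z + gn n z) (\<lambda>z. f z + g z)"
  unfolding L1cvg_def
proof (intro conjI allI)
  note [measurable] = L1cvgD(1,3)[OF f] L1cvgD(1,3)[OF g]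
  show "(\<lambda>z. fn n z + gn n z) \<in> borel_measurable borel" for n by measurable
  show "loc1 (\<lambda>z. f z + g z)" by (rule loc1_add[OF L1cvgD(2)[OF f] L1cvgD(2)[OF g]])
  fix R
  have "(\<lambda>n. nL R (\<lambda>z. fn n z - f z) + nL R (\<lambda>z. gn n z - g z)) \<longlonglongrightarrow> 0"
    using tendsto_add[OF L1cvgD(4)[OF f, of R] L1cvgD(4)[OF g, of R]] by simp
  moreover have "nL R (\<lambda>z. fn n z + gn n z - (f z + g z)) \<le> nL R (\<lambda>z. fn n z - f z) + nL R (\<lambda>z. gn n z - g z)" for n
    by (rule nL_add_le) (auto intro: norm_diff_triangle_ineq)
  ultimately show "(\<lambda>n. nL R (\<lambda>z. fn n z + gn n z - (f z + g z))) \<longlonglongrightarrow> 0"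
    by (rule ennreal_tendsto_0_le)
qed

lemma L1cvg_sum:
  assumes "finite I" "\<And>i. i \<in> I \<Longrightarrow> L1cvg (fn i) (f i)"
  shows "L1cvg (\<lambda>n z. \<Sum>i\<in>I. fn i n z) (\<lambda>z. \<Sum>i\<in>I. f i z)"
  using assms
proof (induction I rule: finite_induct)
  case empty
  show ?case using L1cvg_const[OF loc1_bounded[where f="\<lambda>_. 0" and c=0]] by simp
next
  case (insert i I)
  show ?case unfolding sum.insert[OF insert.hyps] by (rule L1cvg_add) (use insert in auto)
qed

text \<open>The factors play different roles: the first is uniformly bounded, the second may be a
  gradient that converges only in \<open>L\<^sup>1\<close>. In the splitting P(fn, gn - g) + P(fn -
  f, g) the second term pairs a vanishing bounded factor with an unbounded g, which is where
  \<open>nL_mult_tendsto_0\<close> comes in.\<close>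

lemma L1cvg_bilinear:
  fixes fn :: "nat \<Rightarrow> 'a::euclidean_space \<Rightarrow> 'b::euclidean_space" and gn :: "nat \<Rightarrow> 'a \<Rightarrow> 'c::euclidean_space"
    and P :: "'b \<Rightarrow> 'c \<Rightarrow> 'd::euclidean_space"
  assumes P: "bounded_bilinear P" and f: "L1cvg fn f" and g: "L1cvg gn g"
    and M: "\<And>n z. norm (fn n z) \<le> M" "\<And>z. norm (f z) \<le> M"
  shows "L1cvg (\<lambda>n z. P (fn n z) (gn n z)) (\<lambda>z. P (f z) (g z))"
  unfolding L1cvg_def
proof (intro conjI allI)
  interpret P: bounded_bilinear P by fact
  note [measurable] = L1cvgD(1,3)[OF f] L1cvgD(1,3)[OF g]
  obtain K where K: "K > 0" "\<And>a b. norm (P a b) \<le> norm a * norm b * K" using P.pos_bounded by blast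
  have M0: "M \<ge> 0" using M(2) norm_ge_zero order_trans by blast
  have "continuous_on UNIV (\<lambda>x. P (fst x) (snd x))"
    by (intro P.continuous_on continuous_intros)
  then have Pm: "(\<lambda>x. P (fst x) (snd x)) \<in> borel_measurable borel" by (rule borel_measurable_continuous_onI)
  have PM: "(\<lambda>z. P (u z) (v z)) \<in> borel_measurable borel"
    if [measurable]: "u \<in> borel_measurable borel" "v \<in> borel_measurable borel" for u :: "'a \<Rightarrow> 'b" and v
  proof -
    have "(\<lambda>z. (u z, v z)) \<in> borel_measurable borel" by measurable
    from measurable_compose[OF this Pm] show ?thesis by simp
  qed
  show "(\<lambda>z. P (fn n z) (gn n z)) \<in> borel_measurable borel" for n by (rule PM) measurable
  show "loc1 (\<lambda>z. P (f z) (g z))"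
  proof (rule loc1_le[OF L1cvgD(2)[OF g], where c="M * K"])
    show "(\<lambda>z. P (f z) (g z)) \<in> borel_measurable borel" by (rule PM) measurable
    fix z
    have "norm (P (f z) (g z)) \<le> norm (f z) * (norm (g z) * K)" using K(2) by (simp add: mult.assoc)
    also have "\<dots> \<le> M * (norm (g z) * K)" using K(1) by (intro mult_right_mono M) auto
    finally show "norm (P (f z) (g z)) \<le> M * K * norm (g z)" by (simp add: mult_ac)
  qed
  fix R
  have 1: "(\<lambda>n. ennreal (M * K) * nL R (\<lambda>z. gn n z - g z)) \<longlonglongrightarrow> 0"
    by (intro ennreal_tendsto_0_cmult L1cvgD(4)[OF g]) auto
  have "(\<lambda>n. nL R (\<lambda>z. norm (g z) * norm (fn n z - f z))) \<longlonglongrightarrow> 0"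
  proof (rule nL_mult_tendsto_0[OF L1cvgD(2)[OF g], where M="2*M"])
    show "norm (fn n z - f z) \<le> 2 * M" for n z
      using norm_triangle_ineq4[of "fn n z" "f z"] M(1)[of n z] M(2)[of z] by linarith
    show "(\<lambda>n. nL R (\<lambda>z. fn n z - f z)) \<longlonglongrightarrow> 0" by (rule L1cvgD(4)[OF f])
  qed measurable
  then have 2: "(\<lambda>n. ennreal K * nL R (\<lambda>z. norm (g z) * norm (fn n z - f z))) \<longlonglongrightarrow> 0"
    by (intro ennreal_tendsto_0_cmult) auto
  have "nL R (\<lambda>z. P (fn n z) (gn n z) - P (f z) (g z))
    \<le> ennreal (M * K) * nL R (\<lambda>z. gn n z - g z) + ennreal K * nL R (\<lambda>z. norm (g z) * norm (fn n z - f z))" for n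
  proof -
    have "nL R (\<lambda>z. P (fn n z) (gn n z) - P (f z) (g z))
      \<le> nL R (\<lambda>z. P (fn n z) (gn n z - g z)) + nL R (\<lambda>z. P (fn n z - f z) (g z))"
    proof (rule nL_add_le)
      show "norm (P (fn n z) (gn n z) - P (f z) (g z)) \<le> norm (P (fn n z) (gn n z - g z)) + norm (P (fn n z - f z) (g z))" for z
        using norm_triangle_ineq[of "P (fn n z) (gn n z - g z)" "P (fn n z - f z) (g z)"]
        by (simp add: P.diff_left P.diff_right)
    qed (rule PM; measurable)+
    also have "nL R (\<lambda>z. P (fn n z) (gn n z - g z)) \<le> ennreal (M * K) * nL R (\<lambda>z. gn n z - g z)"
    proof (rule nL_cmult_le)
      fix z
      have "norm (P (fn n z) (gn n z - g z)) \<le> norm (fn n z) * (norm (gn n z - g z) * K)" using K(2) by (simp add: mult.assoc)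
      also have "\<dots> \<le> M * (norm (gn n z - g z) * K)" using K(1) by (intro mult_right_mono M) auto
      finally show "norm (P (fn n z) (gn n z - g z)) \<le> M * K * norm (gn n z - g z)" by (simp add: mult_ac)
    qed (use M0 K in auto)
    also have "nL R (\<lambda>z. P (fn n z - f z) (g z)) \<le> ennreal K * nL R (\<lambda>z. norm (g z) * norm (fn n z - f z))"
    proof (rule nL_cmult_le)
      show "norm (P (fn n z - f z) (g z)) \<le> K * norm (norm (g z) * norm (fn n z - f z))" for z
        using K(2)[of "fn n z - f z" "g z"] by (simp add: mult_ac)
    qed (use K in auto)
    finally show ?thesis by (simp add: add_mono)
  qed
  moreover have "(\<lambda>n. ennreal (M * K) * nL R (\<lambda>z. gn n z - g z) + ennreal K * nL R (\<lambda>z. norm (g z) * norm (fn n z - f z))) \<longlonglongrightarrow> 0"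
    using tendsto_add[OF 1 2] by simp
  ultimately show "(\<lambda>n. nL R (\<lambda>z. P (fn n z) (gn n z) - P (f z) (g z))) \<longlonglongrightarrow> 0"
    by (rule ennreal_tendsto_0_le[rotated])
qed

lemma L1cvg_linear:
  assumes h: "bounded_linear h" and f: "L1cvg fn f"
  shows "L1cvg (\<lambda>n z. h (fn n z)) (\<lambda>z. h (f z))"
proof -
  have "bounded_bilinear (\<lambda>(a::real) x. a *\<^sub>R h x)"
    by (rule bounded_bilinear.comp[OF bounded_bilinear_scaleR bounded_linear_ident h])
  from L1cvg_bilinear[OF this L1cvg_const[OF loc1_bounded[where c=1]] f, of "\<lambda>_. 1" 1]
  show ?thesis by simp
qed

lemma L1cvg_integral_0:
  assumes f: "L1cvg fn f" and 0: "\<And>n. integral\<^sup>L lborel (fn n) = 0" "\<And>n. integrable lborel (fn n)"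
    and R: "\<And>n z. norm z > R \<Longrightarrow> fn n z = 0" "\<And>z. norm z > R \<Longrightarrow> f z = 0"
  shows "integral\<^sup>L lborel f = 0" "integrable lborel f"
proof -
  have "f = (\<lambda>x. indicat_real (cball 0 R) x *\<^sub>R f x)" using R(2) by (force simp: indicator_def fun_eq_iff)
  then show int: "integrable lborel f" using loc1_integrable[OF L1cvgD(2)[OF f], of R] by metis
  have "ennreal (norm (integral\<^sup>L lborel f)) \<le> nL R (\<lambda>z. fn n z - f z)" for n
  proof -
    have "integral\<^sup>L lborel f = - (\<integral>z. fn n z - f z \<partial>lborel)" using 0 int by simp
    then have "ennreal (norm (integral\<^sup>L lborel f)) \<le> (\<integral>\<^sup>+z. ennreal (norm (fn n z - f z)) \<partial>lborel)"
      using norm_integral_le_nn_integral[of lborel "\<lambda>z. fn n z - f z"] by simp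
    also have "\<dots> = nL R (\<lambda>z. fn n z - f z)"
      unfolding nL_def using R by (intro nn_integral_cong) (force simp: indicator_def)
    finally show ?thesis .
  qed
  then have "ennreal (norm (integral\<^sup>L lborel f)) \<le> 0"
    using LIMSEQ_le_const[OF L1cvgD(4)[OF f, of R]] by blast
  then show "integral\<^sup>L lborel f = 0" by (simp add: ennreal_eq_0_iff)
qed

lemma weak_partials_L1cvg:
  fixes X :: "'a::euclidean_space \<Rightarrow> 'b::euclidean_space"
  assumes X: "weak_partials X G" and M: "\<And>x. norm (X x) \<le> M"
  obtains Xn DXn M' where
    "\<And>n z. (Xn n has_derivative DXn n z) (at z)" "\<And>n v. continuous_on UNIV (\<lambda>z. DXn n z v)"
    "\<And>n z. norm (Xn n z) \<le> M'" "\<And>x. norm (X x) \<le> M'"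
    "L1cvg Xn X" "\<And>v. L1cvg (\<lambda>n z. DXn n z v) (\<lambda>z. weak_D G z v)"
proof -
  obtain Xn DXn M' where *:
    "\<And>n z. (Xn n has_derivative DXn n z) (at z)" "\<And>n v. continuous_on UNIV (\<lambda>z. DXn n z v)"
    "\<And>n z. norm (Xn n z) \<le> M'"
    "\<And>R. (\<lambda>n. nL R (\<lambda>z. Xn n z - X z)) \<longlonglongrightarrow> 0"
    "\<And>R v. (\<lambda>n. nL R (\<lambda>z. DXn n z v - weak_D G z v)) \<longlonglongrightarrow> 0"
    by (rule weak_partials_approx[OF X M], rule that) assumption+
  show thesis
  proof (rule that[of Xn DXn "max M M'"])
    show "norm (Xn n z) \<le> max M M'" for n z using *(3)[of n z] by simp
    show "norm (X z) \<le> max M M'" for z using M[of z] by simp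
    have "continuous_on UNIV (Xn n)" for n
      by (rule has_derivative_continuous_on_UNIV[OF *(1)])
    then show "L1cvg Xn X"
      using *(4) weak_partials_loc1(1)[OF X] by (auto simp: L1cvg_def intro: borel_measurable_continuous_onI)
    show "L1cvg (\<lambda>n z. DXn n z v) (\<lambda>z. weak_D G z v)" for v
      using *(2,5) weak_D_loc1[OF X] by (auto simp: L1cvg_def intro: borel_measurable_continuous_onI)
  qed (rule *)+
qed

definition tr :: "('a::euclidean_space \<Rightarrow> 'a) \<Rightarrow> real" where
  "tr A = (\<Sum>b\<in>Basis. A b \<bullet> b)"

lemma bounded_linear_inner_const: "bounded_linear (\<lambda>x. x \<bullet> c)"
  by (rule bounded_linear_inner_left)

text \<open>The divergence theorem for the vector field \<open>\<psi> (X \<bullet> c) Y\<close>.\<close>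

lemma weak_product_rule:
  fixes X Y :: "'a::euclidean_space \<Rightarrow> 'a" and c :: 'a
  assumes X: "weak_partials X GX" and XM: "\<And>x. norm (X x) \<le> M"
    and Y: "weak_partials Y GY" and YM: "\<And>x. norm (Y x) \<le> N" and \<psi>: "\<psi> \<in> Cc_inf"
  defines "h \<equiv> (\<lambda>z. \<psi> z * (weak_D GX z (Y z) \<bullet> c) + (X z \<bullet> c) * frechet_derivative \<psi> (at z) (Y z)
      + \<psi> z * ((X z \<bullet> c) * tr (weak_D GY z)))"
  shows "integrable lborel h" "integral\<^sup>L lborel h = 0"
proof -
  obtain Xn DXn M' where xn:
    "\<And>n z. (Xn n has_derivative DXn n z) (at z)" "\<And>n v. continuous_on UNIV (\<lambda>z. DXn n z v)"
    "\<And>n z. norm (Xn n z) \<le> M'" "\<And>x. norm (X x) \<le> M'"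
    "L1cvg Xn X" "\<And>v. L1cvg (\<lambda>n z. DXn n z v) (\<lambda>z. weak_D GX z v)"
    by (rule weak_partials_L1cvg[OF X XM], rule that) assumption+
  obtain Yn DYn N' where yn:
    "\<And>n z. (Yn n has_derivative DYn n z) (at z)" "\<And>n v. continuous_on UNIV (\<lambda>z. DYn n z v)"
    "\<And>n z. norm (Yn n z) \<le> N'" "\<And>x. norm (Y x) \<le> N'"
    "L1cvg Yn Y" "\<And>v. L1cvg (\<lambda>n z. DYn n z v) (\<lambda>z. weak_D GY z v)"
    by (rule weak_partials_L1cvg[OF Y YM], rule that) assumption+
  define D\<psi> where "D\<psi> z = frechet_derivative \<psi> (at z)" for z
  have d\<psi>: "(\<psi> has_derivative D\<psi> z) (at z)" for z
    unfolding D\<psi>_def by (rule Ck_SucD(1)[OF Cc_inf_D(1)[OF \<psi>]])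
  have c\<psi>: "continuous_on UNIV (\<lambda>z. D\<psi> z v)" for v
    unfolding D\<psi>_def using Ck_SucD(2)[OF Cc_inf_D(1)[OF \<psi>], of 0] by simp
  obtain r where r: "bump r \<psi>" using Cc_inf_bump[OF \<psi>] by blast
  have rD: "bump r (\<lambda>z. D\<psi> z v)" for v by (rule bump_derivative[OF d\<psi> c\<psi> r])
  have cc: "continuous_on UNIV \<psi>" "\<And>n. continuous_on UNIV (Xn n)" "\<And>n. continuous_on UNIV (Yn n)"
    by (rule has_derivative_continuous_on_UNIV[OF d\<psi>] has_derivative_continuous_on_UNIV[OF xn(1)]
        has_derivative_continuous_on_UNIV[OF yn(1)])+
  \<comment> \<open>The derivative of one component of the compactly supported field
    \<open>\<psi> (Xn \<bullet> c) Yn\<close>; summing the direction b over the basis gives its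
    divergence.\<close>
  define Fd where "Fd n b z v = (Xn n z \<bullet> c) * (\<psi> z * (DYn n z v \<bullet> b) + D\<psi> z v * (Yn n z \<bullet> b))
      + (DXn n z v \<bullet> c) * (\<psi> z * (Yn n z \<bullet> b))" for n b z v
  have dF: "((\<lambda>z. (Xn n z \<bullet> c) * (\<psi> z * (Yn n z \<bullet> b))) has_derivative Fd n b z) (at z)" for n b z
    unfolding Fd_def
    by (intro has_derivative_mult d\<psi> bounded_linear.has_derivative[OF bounded_linear_inner_const] xn(1) yn(1))
  have cF: "continuous_on UNIV (\<lambda>z. Fd n b z v)" for n b v
    unfolding Fd_def by (intro continuous_intros cc xn(2) yn(2) c\<psi>)
  have bF: "bump r (\<lambda>z. (Xn n z \<bullet> c) * (\<psi> z * (Yn n z \<bullet> b)))" for n b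
    using r by (auto simp: bump_def intro!: continuous_intros cc)
  define hn where "hn n z = (\<Sum>b\<in>Basis. Fd n b z b)" for n z
  have hn0: "integral\<^sup>L lborel (hn n) = 0" "integrable lborel (hn n)" for n
    using integral_derivative_eq_0[OF dF cF bF] by (simp_all add: hn_def[abs_def])
  define hh where "hh z = (\<Sum>b\<in>Basis. (X z \<bullet> c) * (\<psi> z * (weak_D GY z b \<bullet> b) + D\<psi> z b * (Y z \<bullet> b))
      + (\<psi> z * (Y z \<bullet> b)) * (weak_D GX z b \<bullet> c))" for z
  have hh: "hh = h"
  proof
    fix z
    have "weak_D GX z (Y z) = (\<Sum>b\<in>Basis. (Y z \<bullet> b) *\<^sub>R weak_D GX z b)"
    proof -
      have "weak_D GX z (Y z) = weak_D GX z (\<Sum>b\<in>Basis. (Y z \<bullet> b) *\<^sub>R b)" by (simp add: euclidean_representation)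
      then show ?thesis by (simp add: linear_sum[OF linear_weak_D] linear_scale[OF linear_weak_D])
    qed
    moreover have "D\<psi> z (Y z) = (\<Sum>b\<in>Basis. (Y z \<bullet> b) * D\<psi> z b)"
    proof -
      have l: "linear (D\<psi> z)" by (rule has_derivative_linear[OF d\<psi>])
      have "D\<psi> z (Y z) = D\<psi> z (\<Sum>b\<in>Basis. (Y z \<bullet> b) *\<^sub>R b)" by (simp add: euclidean_representation)
      then show ?thesis by (simp add: linear_sum[OF l] linear_scale[OF l])
    qed
    ultimately show "hh z = h z"
      by (simp add: hh_def h_def tr_def inner_sum_left sum.distrib sum_distrib_left algebra_simps flip: D\<psi>_def)
  qed
  have "bounded_bilinear ((*) :: real \<Rightarrow> real \<Rightarrow> real)" by (rule bounded_bilinear_mult)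
  note bil = L1cvg_bilinear[OF this]
  obtain B where B: "\<And>z. \<bar>\<psi> z\<bar> \<le> B" using bump_bounded[OF r] by blast
  have \<psi>1: "loc1 \<psi>" by (rule loc1_bounded[where c=B]) (use r B in auto)
  have D\<psi>1: "L1cvg (\<lambda>_ z. D\<psi> z b) (\<lambda>z. D\<psi> z b)" for b
  proof -
    obtain B where "\<And>z. \<bar>D\<psi> z b\<bar> \<le> B" using bump_bounded[OF rD] by blast
    then show ?thesis by (intro L1cvg_const loc1_bounded[where c=B]) (use rD in auto)
  qed
  have ib: "\<bar>x \<bullet> y\<bar> \<le> K * norm y" if "norm x \<le> K" for x y :: 'a and K
    using Cauchy_Schwarz_ineq2[of x y] mult_right_mono[OF that, of "norm y"] by simp
  have "L1cvg hn hh"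
    unfolding hn_def hh_def Fd_def
  \<comment> \<open>Products are commuted where necessary so that the bounded factor comes first and
    the gradient second, as \<open>L1cvg_bilinear\<close> requires.\<close>
  proof (intro L1cvg_sum finite_Basis L1cvg_add)
    fix b :: 'a assume b: "b \<in> Basis"
    have Xc: "L1cvg (\<lambda>n z. Xn n z \<bullet> c) (\<lambda>z. X z \<bullet> c)"
      by (rule L1cvg_linear[OF bounded_linear_inner_const xn(5)])
    have Yb: "L1cvg (\<lambda>n z. Yn n z \<bullet> b) (\<lambda>z. Y z \<bullet> b)"
      by (rule L1cvg_linear[OF bounded_linear_inner_const yn(5)])
    have "L1cvg (\<lambda>n z. \<psi> z * (DYn n z b \<bullet> b)) (\<lambda>z. \<psi> z * (weak_D GY z b \<bullet> b))"
      by (rule bil[OF L1cvg_const[OF \<psi>1] L1cvg_linear[OF bounded_linear_inner_const yn(6)], where M=B])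
         (use B in auto)
    moreover have "L1cvg (\<lambda>n z. (Yn n z \<bullet> b) * D\<psi> z b) (\<lambda>z. (Y z \<bullet> b) * D\<psi> z b)"
      by (rule bil[OF Yb D\<psi>1, where M="N' * norm b"]) (use ib yn(3,4) in auto)
    then have "L1cvg (\<lambda>n z. D\<psi> z b * (Yn n z \<bullet> b)) (\<lambda>z. D\<psi> z b * (Y z \<bullet> b))" by (simp add: mult.commute)
    ultimately have *: "L1cvg (\<lambda>n z. \<psi> z * (DYn n z b \<bullet> b) + D\<psi> z b * (Yn n z \<bullet> b))
        (\<lambda>z. \<psi> z * (weak_D GY z b \<bullet> b) + D\<psi> z b * (Y z \<bullet> b))"
      by (rule L1cvg_add)
    show "L1cvg (\<lambda>n z. (Xn n z \<bullet> c) * (\<psi> z * (DYn n z b \<bullet> b) + D\<psi> z b * (Yn n z \<bullet> b)))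
        (\<lambda>z. (X z \<bullet> c) * (\<psi> z * (weak_D GY z b \<bullet> b) + D\<psi> z b * (Y z \<bullet> b)))"
      by (rule bil[OF Xc *, where M="M' * norm c"]) (use ib xn(3,4) in auto)
    have \<psi>Y: "L1cvg (\<lambda>n z. \<psi> z * (Yn n z \<bullet> b)) (\<lambda>z. \<psi> z * (Y z \<bullet> b))"
      by (rule bil[OF L1cvg_const[OF \<psi>1] Yb, where M=B]) (use B in auto)
    have bd: "\<bar>\<psi> z * (y \<bullet> b)\<bar> \<le> B * (N' * norm b)" if "norm y \<le> N'" for z and y :: 'a
      unfolding abs_mult using B[of z] ib[OF that, of b] by (intro mult_mono) (auto intro: order_trans[OF abs_ge_zero])
    have "L1cvg (\<lambda>n z. (\<psi> z * (Yn n z \<bullet> b)) * (DXn n z b \<bullet> c)) (\<lambda>z. (\<psi> z * (Y z \<bullet> b)) * (weak_D GX z b \<bullet> c))"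
      by (rule bil[OF \<psi>Y L1cvg_linear[OF bounded_linear_inner_const xn(6)], where M="B * (N' * norm b)"])
         (use bd yn(3,4) in auto)
    then show "L1cvg (\<lambda>n z. (DXn n z b \<bullet> c) * (\<psi> z * (Yn n z \<bullet> b))) (\<lambda>z. (\<psi> z * (Y z \<bullet> b)) * (weak_D GX z b \<bullet> c))"
      by (simp add: mult_ac)
  qed
  then have cv: "L1cvg hn h" by (simp add: hh)
  have "hn n z = 0" "h z = 0" if "norm z > r" for n z
  proof -
    have 0: "\<psi> z = 0" "\<And>v. D\<psi> z v = 0" using that r rD by (auto simp: bump_def)
    show "hn n z = 0" by (simp add: hn_def Fd_def 0)
    show "h z = 0" by (simp add: h_def 0 flip: D\<psi>_def)
  qed
  from L1cvg_integral_0[OF cv hn0 this] show "integrable lborel h" "integral\<^sup>L lborel h = 0" by blast+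
qed
lemma weak_D_apply_loc1:
  assumes X: "weak_partials X G" and [measurable]: "Y \<in> borel_measurable borel" and Y: "\<And>x. norm (Y x) \<le> N"
  shows "loc1 (\<lambda>z. weak_D G z (Y z))"
  unfolding weak_D_def
proof (rule loc1_sum)
  fix b :: 'a assume b: "b \<in> Basis"
  have [measurable]: "G b \<in> borel_measurable borel" using weak_partials_loc1(2)[OF X b] by auto
  show "loc1 (\<lambda>x. (Y x \<bullet> b) *\<^sub>R G b x)"
  proof (rule loc1_le[OF weak_partials_loc1(2)[OF X b], where c=N])
    show "norm ((Y x \<bullet> b) *\<^sub>R G b x) \<le> N * norm (G b x)" for x
      using order_trans[OF Basis_le_norm[OF b, of "Y x"] Y[of x]] by (auto intro: mult_right_mono)
  qed measurable
qed

text \<open>With test fields of the form \<psi> c, the product rule for (X, Y) minus that for (Y, X)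
  produces exactly the bracket integrand plus the test of \<open>DX Y - DY X\<close>. A vanishing
  bracket therefore leaves that test equal to 0 for every \<psi> and c.\<close>

lemma vanishing_bracket_imp_commuting:
  fixes X Y :: "'a::euclidean_space \<Rightarrow> 'a"
  assumes X: "weak_partials X GX" and XM: "\<And>x. norm (X x) \<le> M"
    and Y: "weak_partials Y GY" and YM: "\<And>x. norm (Y x) \<le> N"
    and dX: "AE z in lborel. dX z = tr (weak_D GX z)" and dY: "AE z in lborel. dY z = tr (weak_D GY z)"
    and [measurable]: "dX \<in> borel_measurable borel" "dY \<in> borel_measurable borel"
    and br: "\<And>\<psi> c. \<psi> \<in> Cc_inf \<Longrightarrow> (\<integral>z. (X z \<bullet> c) * frechet_derivative \<psi> (at z) (Y z) + dY z * (X z \<bullet> c * \<psi> z)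
      - (Y z \<bullet> c) * frechet_derivative \<psi> (at z) (X z) - dX z * (Y z \<bullet> c * \<psi> z) \<partial>lborel) = 0"
  shows "AE z in lborel. weak_D GX z (Y z) = weak_D GY z (X z)"
proof -
  have Xm[measurable]: "X \<in> borel_measurable borel" and Ym[measurable]: "Y \<in> borel_measurable borel"
    using weak_partials_loc1(1)[OF X] weak_partials_loc1(1)[OF Y] by auto
  define W where "W z = weak_D GX z (Y z) - weak_D GY z (X z)" for z
  have W1: "loc1 W"
    unfolding W_def
    by (intro loc1_diff weak_D_apply_loc1[OF X Ym YM] weak_D_apply_loc1[OF Y Xm XM])
  have "AE z in lborel. W z = 0"
  proof (rule AE_zero_by_Cc_inf[OF W1])
    fix \<psi> :: "'a \<Rightarrow> real" assume \<psi>: "\<psi> \<in> Cc_inf"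
    obtain r where r: "bump r \<psi>" using Cc_inf_bump[OF \<psi>] by blast
    have intW: "integrable lborel (\<lambda>z. \<psi> z *\<^sub>R W z)" by (rule bump_integrable[OF r W1])
    have "(\<integral>z. \<psi> z *\<^sub>R W z \<partial>lborel) \<bullet> c = 0" for c
    proof -
      define h1 where "h1 z = \<psi> z * (weak_D GX z (Y z) \<bullet> c) + (X z \<bullet> c) * frechet_derivative \<psi> (at z) (Y z)
        + \<psi> z * ((X z \<bullet> c) * tr (weak_D GY z))" for z
      define h2 where "h2 z = \<psi> z * (weak_D GY z (X z) \<bullet> c) + (Y z \<bullet> c) * frechet_derivative \<psi> (at z) (X z)
        + \<psi> z * ((Y z \<bullet> c) * tr (weak_D GX z))" for z
      note h1 = weak_product_rule[OF X XM Y YM \<psi>, of c, folded h1_def]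
      note h2 = weak_product_rule[OF Y YM X XM \<psi>, of c, folded h2_def]
      define B where "B z = (X z \<bullet> c) * frechet_derivative \<psi> (at z) (Y z) + dY z * (X z \<bullet> c * \<psi> z)
        - (Y z \<bullet> c) * frechet_derivative \<psi> (at z) (X z) - dX z * (Y z \<bullet> c * \<psi> z)" for z
      have d\<psi>: "(\<psi> has_derivative frechet_derivative \<psi> (at z)) (at z)" for z
        by (rule Ck_SucD(1)[OF Cc_inf_D(1)[OF \<psi>]])
      have c\<psi>: "continuous_on UNIV (\<lambda>z. frechet_derivative \<psi> (at z) v)" for v
        using Ck_SucD(2)[OF Cc_inf_D(1)[OF \<psi>], of 0] by simp
      note dm = derivative_measurable[OF has_derivative_linear[OF d\<psi>] c\<psi>]
      have [measurable]: "(\<lambda>z. frechet_derivative \<psi> (at z) (Y z)) \<in> borel_measurable borel"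
        "(\<lambda>z. frechet_derivative \<psi> (at z) (X z)) \<in> borel_measurable borel" "\<psi> \<in> borel_measurable borel"
        using dm[of "\<lambda>z. z" borel Y] dm[of "\<lambda>z. z" borel X] r by auto
      have Bm: "B \<in> borel_measurable borel" unfolding B_def by measurable
      have intWc: "integrable lborel (\<lambda>z. \<psi> z *\<^sub>R W z \<bullet> c)" using intW by (rule integrable_inner_left)
      \<comment> \<open>h1 and h2 have integral 0, so the bracket integrand B and the test of W have
        opposite integrals.\<close>
      have "AE z in lborel. B z = (h1 z - h2 z) - \<psi> z *\<^sub>R W z \<bullet> c"
        using dX dY
        by eventually_elim (simp add: B_def h1_def h2_def W_def inner_diff_left algebra_simps)
      then have "(\<integral>z. B z \<partial>lborel) = (\<integral>z. (h1 z - h2 z) - \<psi> z *\<^sub>R W z \<bullet> c \<partial>lborel)"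
        using h1(1) h2(1) intWc Bm by (intro integral_cong_AE) auto
      also have "\<dots> = - (\<integral>z. \<psi> z *\<^sub>R W z \<bullet> c \<partial>lborel)"
        using h1 h2 intWc by simp
      also have "(\<integral>z. \<psi> z *\<^sub>R W z \<bullet> c \<partial>lborel) = (\<integral>z. \<psi> z *\<^sub>R W z \<partial>lborel) \<bullet> c"
        using intW by (rule integral_inner_left)
      finally show ?thesis using br[OF \<psi>, of c] by (simp add: B_def)
    qed
    then show "(\<integral>z. \<psi> z *\<^sub>R W z \<partial>lborel) = 0" using inner_eq_zero_iff by blast
  qed
  then show ?thesis by eventually_elim (simp add: W_def)
qed


subsection \<open>Transport along the flow\<close>

lemma good_flow_measurable:
  assumes "good_flow X M \<Phi>"
  shows "(\<lambda>(t, z). \<Phi> t z) \<in> borel_measurable (borel \<Otimes>\<^sub>M borel)" "\<Phi> t \<in> borel_measurable borel"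
    "(\<lambda>s. \<Phi> s z) \<in> borel_measurable borel"
proof -
  show m: "(\<lambda>(t, z). \<Phi> t z) \<in> borel_measurable (borel \<Otimes>\<^sub>M borel)"
    using assms unfolding good_flow_def by (rule conjunct1)
  have "(\<lambda>z. (t, z)) \<in> borel \<rightarrow>\<^sub>M borel \<Otimes>\<^sub>M borel" by measurable
  from measurable_compose[OF this m] show "\<Phi> t \<in> borel_measurable borel" by simp
  have "(\<lambda>s. (s, z)) \<in> borel \<rightarrow>\<^sub>M borel \<Otimes>\<^sub>M borel" by measurable
  from measurable_compose[OF this m] show "(\<lambda>s. \<Phi> s z) \<in> borel_measurable borel" by simp
qed

lemma good_flowD:
  assumes "good_flow X M \<Phi>"
  shows "norm (\<Phi> t z - z) \<le> M * \<bar>t\<bar>"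
    "AE z in lborel. \<forall>t. \<Phi> t z = z + prim (\<lambda>s. X (\<Phi> s z)) t"
    "T > 0 \<Longrightarrow> \<exists>C>0. \<forall>t. \<bar>t\<bar> \<le> T \<longrightarrow> (\<forall>A\<in>sets borel. emeasure lborel (\<Phi> t -` A) \<le> ennreal C * emeasure lborel A)"
  using assms unfolding good_flow_def by blast+

text \<open>Minkowski's inequality in time, then compression at each time s. The weight is an
  integrating factor; q may depend on s because the commutator does.\<close>

lemma nL_prim_flow_le:
  fixes q w :: "real \<Rightarrow> 'a::euclidean_space \<Rightarrow> real"
  assumes \<Phi>: "good_flow X M \<Phi>" and M: "M \<ge> 0"
    and q[measurable]: "(\<lambda>(s, x). q s x) \<in> borel_measurable (borel \<Otimes>\<^sub>M borel)"
    and w[measurable]: "(\<lambda>(s, x). w s x) \<in> borel_measurable (borel \<Otimes>\<^sub>M borel)"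
    and W: "\<And>s x. \<bar>s\<bar> \<le> T \<Longrightarrow> \<bar>w s x\<bar> \<le> W" and C: "\<And>s A. \<bar>s\<bar> \<le> T \<Longrightarrow> A \<in> sets borel \<Longrightarrow>
      emeasure lborel (\<Phi> s -` A) \<le> ennreal C * emeasure lborel A" and t: "\<bar>t\<bar> \<le> T"
  shows "nL R (\<lambda>x. prim (\<lambda>s. w s x * q s (\<Phi> s x)) t)
    \<le> (\<integral>\<^sup>+s. indicator {-T..T} s * (ennreal W * (ennreal C * nL (R + M * T) (q s))) \<partial>lborel)"
proof -
  note [measurable] = good_flow_measurable(1)[OF \<Phi>]
  have W0: "W \<ge> 0" using W[of t] t abs_ge_zero order_trans by blast
  have qs: "q s \<in> borel_measurable borel" for s
  proof -
    have "(\<lambda>z. (s, z)) \<in> borel \<rightarrow>\<^sub>M borel \<Otimes>\<^sub>M borel" by measurable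
    from measurable_compose[OF this q] show ?thesis by simp
  qed
  have "nL R (\<lambda>x. prim (\<lambda>s. w s x * q s (\<Phi> s x)) t)
    \<le> (\<integral>\<^sup>+s. nL R (\<lambda>x. kern t s *\<^sub>R (w s x * q s (\<Phi> s x))) \<partial>lborel)"
    unfolding prim_def by (rule nL_integral_le) (auto intro: lborel.sigma_finite_measure_axioms)
  also have "\<dots> \<le> (\<integral>\<^sup>+s. indicator {-T..T} s * (ennreal W * (ennreal C * nL (R + M * T) (q s))) \<partial>lborel)"
  proof (intro nn_integral_mono)
    fix s
    show "nL R (\<lambda>x. kern t s *\<^sub>R (w s x * q s (\<Phi> s x)))
      \<le> indicator {-T..T} s * (ennreal W * (ennreal C * nL (R + M * T) (q s)))"
    proof (cases "\<bar>s\<bar> \<le> T")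
      case False
      then have "kern t s = 0" using t by (intro kern_eq_0) linarith
      then show ?thesis by (simp add: nL_def)
    next
      case True
      note [measurable] = qs good_flow_measurable(2)[OF \<Phi>]
      have "nL R (\<lambda>x. kern t s *\<^sub>R (w s x * q s (\<Phi> s x))) \<le> ennreal W * nL R (\<lambda>x. q s (\<Phi> s x))"
      proof (rule nL_cmult_le)
        fix x
        have k: "\<bar>kern t s\<bar> \<le> 1" by (simp add: kern_def)
        have "\<bar>kern t s\<bar> * (\<bar>w s x\<bar> * \<bar>q s (\<Phi> s x)\<bar>) \<le> 1 * (W * \<bar>q s (\<Phi> s x)\<bar>)"
          using W[OF True, of x] k W0 by (intro mult_mono mult_right_mono) auto
        then show "norm (kern t s *\<^sub>R (w s x * q s (\<Phi> s x))) \<le> W * norm (q s (\<Phi> s x))"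
          by (simp add: abs_mult)
      qed (use W0 in measurable)
      also have "nL R (\<lambda>x. q s (\<Phi> s x)) \<le> ennreal C * nL (R + M * T) (q s)"
      proof (rule nL_compose_le)
        show "norm (\<Phi> s x - x) \<le> M * T" for x
          using good_flowD(1)[OF \<Phi>, of s x] mult_left_mono[OF True M] by linarith
        show "emeasure lborel (\<Phi> s -` A) \<le> ennreal C * emeasure lborel A" if "A \<in> sets borel" for A
          by (rule C[OF True that])
      qed measurable
      finally show ?thesis using True by (simp add: indicator_def abs_le_iff mult_left_mono)
    qed
  qed
  finally show ?thesis .
qed

text \<open>Liouville's formula, taken as the candidate for the Jacobian determinant; that it is the
  density of an image measure is the content of \<open>jac_is_density\<close>.\<close>

definition jac :: "('a::euclidean_space \<Rightarrow> real) \<Rightarrow> (real \<Rightarrow> 'a \<Rightarrow> 'a) \<Rightarrow> real \<Rightarrow> 'a \<Rightarrow> real" where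
  "jac d \<Phi> t z = exp (prim (\<lambda>s. d (\<Phi> s z)) t)"

lemma jac_bounds:
  assumes [measurable]: "d \<in> borel_measurable borel" and D: "\<And>z. \<bar>d z\<bar> \<le> D"
    and \<Phi>: "good_flow X M \<Phi>" and t: "\<bar>t\<bar> \<le> T"
  shows "jac d \<Phi> t z \<le> exp (D * T)" "exp (- (D * T)) \<le> jac d \<Phi> t z" "jac d \<Phi> t z > 0"
proof -
  note [measurable] = good_flow_measurable(3)[OF \<Phi>]
  have D0: "D \<ge> 0" using D abs_ge_zero order_trans by blast
  have "norm (prim (\<lambda>s. d (\<Phi> s z)) t) \<le> D * \<bar>t\<bar>" by (rule norm_prim_le) (use D in auto)
  also have "\<dots> \<le> D * T" using D0 t by (rule mult_left_mono[rotated])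
  finally show "jac d \<Phi> t z \<le> exp (D * T)" "exp (- (D * T)) \<le> jac d \<Phi> t z" by (auto simp: jac_def)
qed (simp add: jac_def)

lemma jac_measurable:
  assumes [measurable]: "d \<in> borel_measurable borel" and \<Phi>: "good_flow X M \<Phi>"
  shows "(\<lambda>(t, z). jac d \<Phi> t z) \<in> borel_measurable (borel \<Otimes>\<^sub>M borel)" "jac d \<Phi> t \<in> borel_measurable borel"
proof -
  note [measurable] = good_flow_measurable(1)[OF \<Phi>]
  have "(\<lambda>q. exp (prim (\<lambda>s. d (\<Phi> s (snd q))) (fst q))) \<in> borel_measurable (borel \<Otimes>\<^sub>M borel)"
    by measurable
  then show m: "(\<lambda>(t, z). jac d \<Phi> t z) \<in> borel_measurable (borel \<Otimes>\<^sub>M borel)"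
    by (simp add: jac_def case_prod_unfold)
  have "(\<lambda>z. (t, z)) \<in> borel \<rightarrow>\<^sub>M borel \<Otimes>\<^sub>M borel" by measurable
  from measurable_compose[OF this m] show "jac d \<Phi> t \<in> borel_measurable borel" by simp
qed

lemma nL_const_time_integral:
  "(\<integral>\<^sup>+s. indicator {-T..T} s * c \<partial>lborel) = ennreal (2 * \<bar>T\<bar>) * c" if "T \<ge> 0" for T :: real
  using that by (simp add: nn_integral_multc)

text \<open>Along a trajectory, \<open>Jn / jac d \<Phi>\<close> has derivative \<open>(DJn X - d Jn) / jac d \<Phi>\<close>, which
  tends to \<open>0\<close> in \<open>L\<^sup>1\<close> of space and time by the compression bound.\<close>

lemma transport_along_flow:
  fixes X :: "'a::euclidean_space \<Rightarrow> 'a" and J :: "'a \<Rightarrow> real"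
  assumes \<Phi>: "good_flow X M \<Phi>" and X[measurable]: "X \<in> borel_measurable borel" and XM: "\<And>x. norm (X x) \<le> M"
    and d[measurable]: "d \<in> borel_measurable borel" and D: "\<And>z. \<bar>d z\<bar> \<le> D"
    and dJ: "\<And>n z. (Jn n has_derivative DJn n z) (at z)" and cJ: "\<And>n v. continuous_on UNIV (\<lambda>z. DJn n z v)"
    and J: "L1cvg Jn J" and Q: "\<And>R. (\<lambda>n. nL R (\<lambda>z. DJn n z (X z) - d z * Jn n z)) \<longlonglongrightarrow> 0"
  shows "AE z in lborel. J (\<Phi> t z) = jac d \<Phi> t z * J z"
proof -
  have M0: "M \<ge> 0" using XM norm_ge_zero order_trans by blast
  note [measurable] = L1cvgD(1,3)[OF J] good_flow_measurable[OF \<Phi>]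
  have Qm[measurable]: "(\<lambda>z. DJn n z (X z)) \<in> borel_measurable borel" for n
    using derivative_measurable[OF has_derivative_linear[OF dJ] cJ, of "\<lambda>z. z" borel X] X by simp
  define T where "T = \<bar>t\<bar> + 1"
  have T: "T > 0" "\<bar>t\<bar> \<le> T" by (auto simp: T_def)
  obtain C where C: "C > 0" "\<And>s A. \<bar>s\<bar> \<le> T \<Longrightarrow> A \<in> sets borel \<Longrightarrow> emeasure lborel (\<Phi> s -` A) \<le> ennreal C * emeasure lborel A"
    using good_flowD(3)[OF \<Phi> T(1)] by blast
  define Ei where "Ei s z = exp (- prim (\<lambda>r. d (\<Phi> r z)) s)" for s z
  have Ei_jac: "Ei s z = 1 / jac d \<Phi> s z" for s z by (simp add: Ei_def jac_def exp_minus divide_inverse)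
  note [measurable] = jac_measurable[OF d \<Phi>]
  have Ei_m[measurable]: "(\<lambda>(s, z). Ei s z) \<in> borel_measurable (borel \<Otimes>\<^sub>M borel)" unfolding Ei_jac by measurable
  have [measurable]: "Ei s \<in> borel_measurable borel" for s unfolding Ei_jac by measurable
  define W where "W = exp (D * T)"
  have W: "\<bar>Ei s z\<bar> \<le> W" if "\<bar>s\<bar> \<le> T" for s z
  proof -
    have "Ei s z \<le> 1 / exp (- (D * T))"
      unfolding Ei_jac using jac_bounds[OF d D \<Phi> that, of z] by (intro divide_left_mono) auto
    then show ?thesis by (simp add: W_def Ei_def exp_minus divide_inverse)
  qed
  have W0: "W \<ge> 0" by (simp add: W_def)
  define q where "q n z = DJn n z (X z) - d z * Jn n z" for n z
  have qm[measurable]: "q n \<in> borel_measurable borel" for n unfolding q_def by measurable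
  \<comment> \<open>Integrating factor: the chain rule is applied to Jn(y) exp(-r) along the curve
    whose second coordinate is the primitive of d along the trajectory, which leaves only the defect
    q.\<close>
  have id: "AE z in lborel. Jn n (\<Phi> t z) * Ei t z - Jn n z = prim (\<lambda>s. Ei s z * q n (\<Phi> s z)) t" for n
    using good_flowD(2)[OF \<Phi>]
  proof eventually_elim
    fix z assume flow: "\<forall>t. \<Phi> t z = z + prim (\<lambda>s. X (\<Phi> s z)) t"
    have lbX: "locally_bounded_fun (\<lambda>s. X (\<Phi> s z))" by (rule locally_bounded_funI[where M=M]) (use XM in auto)
    have lbd: "locally_bounded_fun (\<lambda>s. d (\<Phi> s z))" by (rule locally_bounded_funI[where M=D]) (use D in auto)
    note pp = prim_Pair[OF lbX lbd]
    define F' where "F' p v = Jn n (fst p) * (- snd v * exp (- snd p)) + DJn n (fst p) (fst v) * exp (- snd p)" for p v :: "'a \<times> real"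
    have dF: "((\<lambda>p. Jn n (fst p) * exp (- snd p)) has_derivative F' p) (at p)" for p
      unfolding F'_def
      by (intro has_derivative_mult has_derivative_compose[OF has_derivative_fst[OF has_derivative_ident] dJ])
         (auto intro!: derivative_eq_intros simp: mult.commute)
    have cJ0: "continuous_on UNIV (Jn n)" by (rule has_derivative_continuous_on_UNIV[OF dJ])
    have cF: "continuous_on UNIV (\<lambda>p. F' p v)" for v
      unfolding F'_def
      by (intro continuous_intros continuous_on_compose2[OF cJ0] continuous_on_compose2[OF cJ]) auto
    have curve: "(z, 0) + prim (\<lambda>s. (X (\<Phi> s z), d (\<Phi> s z))) s = (\<Phi> s z, prim (\<lambda>s. d (\<Phi> s z)) s)" for s
      unfolding pp(1) add_Pair add_0 flow[rule_format, symmetric] ..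
    have "Jn n (\<Phi> t z) * Ei t z = Jn n z + prim (\<lambda>s. F' (\<Phi> s z, prim (\<lambda>s. d (\<Phi> s z)) s) (X (\<Phi> s z), d (\<Phi> s z))) t"
      using chain_rule_prim(1)[OF dF cF pp(2), of "(z, 0)" t] unfolding curve by (simp add: Ei_def)
    also have "(\<lambda>s. F' (\<Phi> s z, prim (\<lambda>s. d (\<Phi> s z)) s) (X (\<Phi> s z), d (\<Phi> s z))) = (\<lambda>s. Ei s z * q n (\<Phi> s z))"
      by (simp add: F'_def q_def Ei_def fun_eq_iff algebra_simps)
    finally show "Jn n (\<Phi> t z) * Ei t z - Jn n z = prim (\<lambda>s. Ei s z * q n (\<Phi> s z)) t" by simp
  qed
  \<comment> \<open>Three errors: J against Jn at the end point, controlled by compression; the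
    defect q accumulated along the trajectory; and Jn against J at the starting point.\<close>
  have "nL R (\<lambda>z. J (\<Phi> t z) * Ei t z - J z) \<le> 0" for R
  proof (rule LIMSEQ_le_const)
    define R' where "R' = R + M * T"
    have q0: "(\<lambda>n. ennreal (2 * \<bar>T\<bar>) * (ennreal W * (ennreal C * nL R' (q n)))) \<longlonglongrightarrow> 0"
      unfolding q_def by (intro ennreal_tendsto_0_cmult Q) auto
    have J0: "(\<lambda>n. ennreal W * (ennreal C * nL R' (\<lambda>z. Jn n z - J z))) \<longlonglongrightarrow> 0"
      by (intro ennreal_tendsto_0_cmult L1cvgD(4)[OF J]) auto
    show "(\<lambda>n. ennreal W * (ennreal C * nL R' (\<lambda>z. Jn n z - J z)) + (ennreal (2 * \<bar>T\<bar>) * (ennreal W * (ennreal C * nL R' (q n))) + nL R (\<lambda>z. Jn n z - J z))) \<longlonglongrightarrow> 0"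
      using tendsto_add[OF J0 tendsto_add[OF q0 L1cvgD(4)[OF J, of R]]] by simp
    have "nL R (\<lambda>z. J (\<Phi> t z) * Ei t z - J z)
      \<le> ennreal W * (ennreal C * nL R' (\<lambda>z. Jn n z - J z)) + (ennreal (2 * \<bar>T\<bar>) * (ennreal W * (ennreal C * nL R' (q n))) + nL R (\<lambda>z. Jn n z - J z))" for n
    proof -
      have "nL R (\<lambda>z. J (\<Phi> t z) * Ei t z - J z)
        \<le> nL R (\<lambda>z. Ei t z * (Jn n (\<Phi> t z) - J (\<Phi> t z))) + nL R (\<lambda>z. Jn n (\<Phi> t z) * Ei t z - J z)"
      proof (rule nL_add_le)
        show "norm (J (\<Phi> t x) * Ei t x - J x) \<le> norm (Ei t x * (Jn n (\<Phi> t x) - J (\<Phi> t x))) + norm (Jn n (\<Phi> t x) * Ei t x - J x)" for x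
          using norm_triangle_ineq4[of "Jn n (\<Phi> t x) * Ei t x - J x" "Ei t x * (Jn n (\<Phi> t x) - J (\<Phi> t x))"]
          by (simp add: algebra_simps)
      qed measurable
      also have "nL R (\<lambda>z. Jn n (\<Phi> t z) * Ei t z - J z) \<le> nL R (\<lambda>z. Jn n (\<Phi> t z) * Ei t z - Jn n z) + nL R (\<lambda>z. Jn n z - J z)"
      proof (rule nL_add_le)
        show "norm (Jn n (\<Phi> t x) * Ei t x - J x) \<le> norm (Jn n (\<Phi> t x) * Ei t x - Jn n x) + norm (Jn n x - J x)" for x
          using norm_triangle_ineq[of "Jn n (\<Phi> t x) * Ei t x - Jn n x" "Jn n x - J x"] by simp
      qed measurable
      also have "nL R (\<lambda>z. Ei t z * (Jn n (\<Phi> t z) - J (\<Phi> t z))) \<le> ennreal W * nL R (\<lambda>z. Jn n (\<Phi> t z) - J (\<Phi> t z))"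
        by (rule nL_cmult_le) (use W0 W[OF T(2)] in \<open>auto simp: abs_mult intro: mult_right_mono\<close>)
      also have "nL R (\<lambda>z. Jn n (\<Phi> t z) - J (\<Phi> t z)) \<le> ennreal C * nL R' (\<lambda>z. Jn n z - J z)"
        unfolding R'_def
      proof (rule nL_compose_le[where f="\<lambda>z. Jn n z - J z"])
        show "norm (\<Phi> t x - x) \<le> M * T" for x
          using good_flowD(1)[OF \<Phi>, of t x] mult_left_mono[OF T(2) M0] by linarith
        show "emeasure lborel (\<Phi> t -` A) \<le> ennreal C * emeasure lborel A" if "A \<in> sets borel" for A
          by (rule C(2)[OF T(2) that])
      qed measurable
      also have "nL R (\<lambda>z. Jn n (\<Phi> t z) * Ei t z - Jn n z) = nL R (\<lambda>z. prim (\<lambda>s. Ei s z * q n (\<Phi> s z)) t)"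
        by (rule nL_cong_AE) (use id[of n] in \<open>eventually_elim, simp\<close>)
      also have "\<dots> \<le> (\<integral>\<^sup>+s. indicator {-T..T} s * (ennreal W * (ennreal C * nL R' (q n))) \<partial>lborel)"
        unfolding R'_def
      proof (rule nL_prim_flow_le[OF \<Phi> M0 _ Ei_m _ _ T(2)])
        show "emeasure lborel (\<Phi> s -` A) \<le> ennreal C * emeasure lborel A"
          if "\<bar>s\<bar> \<le> T" "A \<in> sets borel" for s A by (rule C(2)[OF that])
      qed (measurable, rule W)
      also have "\<dots> = ennreal (2 * \<bar>T\<bar>) * (ennreal W * (ennreal C * nL R' (q n)))"
        by (rule nL_const_time_integral) (use T in auto)
      finally show ?thesis by (simp add: add_mono mult_left_mono)
    qed
    then show "\<exists>N. \<forall>n\<ge>N. nL R (\<lambda>z. J (\<Phi> t z) * Ei t z - J z)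
      \<le> ennreal W * (ennreal C * nL R' (\<lambda>z. Jn n z - J z)) + (ennreal (2 * \<bar>T\<bar>) * (ennreal W * (ennreal C * nL R' (q n))) + nL R (\<lambda>z. Jn n z - J z))"
      by blast
  qed
  then have "AE z in lborel. J (\<Phi> t z) * Ei t z - J z = 0"
    by (intro nL_eq_0_imp_AE) auto
  then show ?thesis
  proof eventually_elim
    fix z assume "J (\<Phi> t z) * Ei t z - J z = 0"
    moreover have "jac d \<Phi> t z \<noteq> 0" by (simp add: jac_def)
    ultimately show "J (\<Phi> t z) = jac d \<Phi> t z * J z" by (simp add: Ei_jac field_simps)
  qed
qed


subsection \<open>The commutator estimate\<close>

text \<open>For a smooth field the quotient is the average, over the segment from
  \<open>y - e *\<^sub>R v\<close> to y, of the derivative in direction v. Comparing this average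
  with its value at y costs only the translation modulus \<eta>. The Sobolev case follows by
  mollification with e held fixed.\<close>

lemma difference_quotient_bound:
  fixes X :: "'a::euclidean_space \<Rightarrow> 'b::euclidean_space"
  assumes X: "weak_partials X G" and M: "\<And>x. norm (X x) \<le> M" and e: "e > 0"
    and \<eta>: "\<And>h. norm h \<le> e * norm v \<Longrightarrow> nL R (\<lambda>y. weak_D G (y + h) v - weak_D G y v) \<le> \<eta>"
  shows "nL R (\<lambda>y. (X y - X (y - e *\<^sub>R v)) /\<^sub>R e - weak_D G y v) \<le> \<eta>"
proof -
  obtain Xn DXn M' where xn:
    "\<And>n z. (Xn n has_derivative DXn n z) (at z)" "\<And>n v. continuous_on UNIV (\<lambda>z. DXn n z v)"
    "\<And>n z. norm (Xn n z) \<le> M'" "\<And>x. norm (X x) \<le> M'"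
    "L1cvg Xn X" "\<And>v. L1cvg (\<lambda>n z. DXn n z v) (\<lambda>z. weak_D G z v)"
    by (rule weak_partials_L1cvg[OF X M], rule that) assumption+
  define g where "g y = weak_D G y v" for y
  define Dn where "Dn n y = DXn n y v" for n y
  note [measurable] = L1cvgD(1,3)[OF xn(5)]
  have [measurable]: "g \<in> borel_measurable borel" "Dn n \<in> borel_measurable borel" for n
    using L1cvgD(1,3)[OF xn(6)[of v]] by (simp_all add: g_def[abs_def] Dn_def[abs_def])
  define R' where "R' = R + e * norm v"
  define \<delta> where "\<delta> n = nL R' (\<lambda>y. Dn n y - g y)" for n
  \<comment> \<open>The factor 1/e is harmless: e is fixed while n tends to infinity.\<close>
  define \<theta> where "\<theta> n = ennreal (inverse e) * (nL R' (\<lambda>y. Xn n y - X y) + nL R' (\<lambda>y. Xn n y - X y))" for n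
  have lim: "(\<lambda>n. \<theta> n + (\<delta> n + \<eta>)) \<longlonglongrightarrow> 0 + (0 + \<eta>)"
    unfolding \<delta>_def \<theta>_def g_def Dn_def
    by (intro tendsto_add tendsto_const L1cvgD(4)[OF xn(6)] ennreal_tendsto_0_cmult)
       (use tendsto_add[OF L1cvgD(4)[OF xn(5), of R'] L1cvgD(4)[OF xn(5), of R']] in auto)
  have "nL R (\<lambda>y. (X y - X (y - e *\<^sub>R v)) /\<^sub>R e - g y) \<le> \<theta> n + (\<delta> n + \<eta>)" for n
  proof -
    \<comment> \<open>The fundamental theorem along the curve with constant velocity v started at
      \<open>y - e *\<^sub>R v\<close>; \<open>kern e s / e\<close> is an averaging weight of total
      mass 1, so \<open>g y\<close> can be subtracted inside.\<close>
    have chain: "(Xn n y - Xn n (y - e *\<^sub>R v)) /\<^sub>R e - g y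
      = (\<integral>s. (kern e s / e) *\<^sub>R (Dn n (y + (s - e) *\<^sub>R v) - g y) \<partial>lborel)" for y
    proof -
      have lb: "locally_bounded_fun (\<lambda>_. v)" by (rule locally_bounded_fun_const)
      let ?D = "\<lambda>s. Dn n ((y - e *\<^sub>R v) + prim (\<lambda>_. v) s)"
      have D: "locally_bounded_fun ?D" "Xn n ((y - e *\<^sub>R v) + prim (\<lambda>_. v) e) = Xn n (y - e *\<^sub>R v) + prim ?D e"
        using chain_rule_prim(2)[OF xn(1)[of n] xn(2)[of n] lb, of "y - e *\<^sub>R v"]
          chain_rule_prim(1)[OF xn(1)[of n] xn(2)[of n] lb, of "y - e *\<^sub>R v" e]
        by (simp_all add: Dn_def)
      have "Xn n y - Xn n (y - e *\<^sub>R v) - e *\<^sub>R g y = prim ?D e - prim (\<lambda>_. g y) e"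
        using D(2) by (simp add: prim_const)
      also have "\<dots> = prim (\<lambda>s. ?D s - g y) e"
        using prim_diff[OF D(1) locally_bounded_fun_const] by simp
      finally have 1: "Xn n y - Xn n (y - e *\<^sub>R v) - e *\<^sub>R g y = prim (\<lambda>s. ?D s - g y) e" .
      have "(Xn n y - Xn n (y - e *\<^sub>R v)) /\<^sub>R e - g y = inverse e *\<^sub>R (Xn n y - Xn n (y - e *\<^sub>R v) - e *\<^sub>R g y)"
        using e by (simp add: scaleR_diff_right)
      also have "\<dots> = (\<integral>s. inverse e *\<^sub>R (kern e s *\<^sub>R (?D s - g y)) \<partial>lborel)"
        unfolding 1 prim_def[of "\<lambda>s. ?D s - g y"] by (rule integral_scaleR_right[symmetric])
      also have "\<dots> = (\<integral>s. (kern e s / e) *\<^sub>R (Dn n (y + (s - e) *\<^sub>R v) - g y) \<partial>lborel)"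
        by (simp add: prim_const scaleR_diff_left divide_inverse mult.commute algebra_simps)
      finally show ?thesis .
    qed
    have "nL R (\<lambda>y. (X y - X (y - e *\<^sub>R v)) /\<^sub>R e - g y)
      \<le> nL R (\<lambda>y. ((X y - X (y - e *\<^sub>R v)) - (Xn n y - Xn n (y - e *\<^sub>R v))) /\<^sub>R e)
        + nL R (\<lambda>y. (Xn n y - Xn n (y - e *\<^sub>R v)) /\<^sub>R e - g y)"
    proof (rule nL_add_le)
      fix y
      show "norm ((X y - X (y - e *\<^sub>R v)) /\<^sub>R e - g y)
        \<le> norm (((X y - X (y - e *\<^sub>R v)) - (Xn n y - Xn n (y - e *\<^sub>R v))) /\<^sub>R e) + norm ((Xn n y - Xn n (y - e *\<^sub>R v)) /\<^sub>R e - g y)"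
        using norm_triangle_ineq[of "((X y - X (y - e *\<^sub>R v)) - (Xn n y - Xn n (y - e *\<^sub>R v))) /\<^sub>R e" "(Xn n y - Xn n (y - e *\<^sub>R v)) /\<^sub>R e - g y"]
        by (simp add: scaleR_diff_right)
    qed measurable
    also have "nL R (\<lambda>y. ((X y - X (y - e *\<^sub>R v)) - (Xn n y - Xn n (y - e *\<^sub>R v))) /\<^sub>R e) \<le> \<theta> n"
    proof -
      let ?d = "\<lambda>y. Xn n y - X y"
      have "nL R (\<lambda>y. ((X y - X (y - e *\<^sub>R v)) - (Xn n y - Xn n (y - e *\<^sub>R v))) /\<^sub>R e)
        \<le> ennreal (inverse e) * nL R (\<lambda>y. ?d (y + (- e *\<^sub>R v)) - ?d y)"
      proof (rule nL_cmult_le)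
        fix y
        have eq: "(X y - X (y - e *\<^sub>R v)) - (Xn n y - Xn n (y - e *\<^sub>R v)) = ?d (y + (- e *\<^sub>R v)) - ?d y"
          by simp
        show "norm (((X y - X (y - e *\<^sub>R v)) - (Xn n y - Xn n (y - e *\<^sub>R v))) /\<^sub>R e)
          \<le> inverse e * norm (?d (y + (- e *\<^sub>R v)) - ?d y)"
          unfolding eq norm_scaleR using e by simp
      qed (use e in auto)
      also have "nL R (\<lambda>y. ?d (y + (- e *\<^sub>R v)) - ?d y) \<le> nL R (\<lambda>y. ?d (y + (- e *\<^sub>R v))) + nL R ?d"
        by (rule nL_add_le) (auto intro: norm_triangle_ineq4)
      also have "nL R (\<lambda>y. ?d (y + (- e *\<^sub>R v))) \<le> nL (R + norm (- e *\<^sub>R v)) ?d"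
        by (rule nL_shift) measurable
      also have "R + norm (- e *\<^sub>R v) = R'" using e by (simp add: R'_def)
      also have "nL R ?d \<le> nL R' ?d" by (rule nL_mono_radius) (use e in \<open>simp add: R'_def\<close>)
      finally show ?thesis by (simp add: \<theta>_def mult_left_mono add_mono)
    qed
    also have "nL R (\<lambda>y. (Xn n y - Xn n (y - e *\<^sub>R v)) /\<^sub>R e - g y) \<le> \<delta> n + \<eta>"
    proof -
      have "nL R (\<lambda>y. (Xn n y - Xn n (y - e *\<^sub>R v)) /\<^sub>R e - g y)
        \<le> (\<integral>\<^sup>+s. nL R (\<lambda>y. (kern e s / e) *\<^sub>R (Dn n (y + (s - e) *\<^sub>R v) - g y)) \<partial>lborel)"
        unfolding chain by (rule nL_integral_le) (auto intro: lborel.sigma_finite_measure_axioms)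
      also have "\<dots> \<le> (\<integral>\<^sup>+s. ennreal (inverse e) * indicator {0..e} s * (\<delta> n + \<eta>) \<partial>lborel)"
      proof (intro nn_integral_mono)
        fix s
        show "nL R (\<lambda>y. (kern e s / e) *\<^sub>R (Dn n (y + (s - e) *\<^sub>R v) - g y)) \<le> ennreal (inverse e) * indicator {0..e} s * (\<delta> n + \<eta>)"
        proof (cases "s \<in> {0..e}")
          case False
          then have "kern e s = 0" using e by (auto simp: kern_def)
          then show ?thesis by (simp add: nL_def)
        next
          case True
          define h where "h = (s - e) *\<^sub>R v"
          have hn: "norm h \<le> e * norm v" using True by (auto simp: h_def intro!: mult_right_mono)
          have "nL R (\<lambda>y. (kern e s / e) *\<^sub>R (Dn n (y + h) - g y)) \<le> ennreal (inverse e) * nL R (\<lambda>y. Dn n (y + h) - g y)"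
          proof (rule nL_cmult_le)
            fix y
            have "\<bar>kern e s / e\<bar> \<le> inverse e" using e by (auto simp: kern_def divide_inverse)
            then show "norm ((kern e s / e) *\<^sub>R (Dn n (y + h) - g y)) \<le> inverse e * norm (Dn n (y + h) - g y)"
              unfolding norm_scaleR by (rule mult_right_mono) simp
          qed (use e in auto)
          also have "nL R (\<lambda>y. Dn n (y + h) - g y) \<le> nL R (\<lambda>y. Dn n (y + h) - g (y + h)) + nL R (\<lambda>y. g (y + h) - g y)"
          proof (rule nL_add_le)
            show "norm (Dn n (y + h) - g y) \<le> norm (Dn n (y + h) - g (y + h)) + norm (g (y + h) - g y)" for y
              using norm_triangle_ineq[of "Dn n (y + h) - g (y + h)" "g (y + h) - g y"] by simp
          qed measurable
          also have "nL R (\<lambda>y. Dn n (y + h) - g (y + h)) \<le> nL (R + norm h) (\<lambda>y. Dn n y - g y)"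
            by (rule nL_shift[where f="\<lambda>y. Dn n y - g y"]) measurable
          also have "\<dots> \<le> \<delta> n" unfolding \<delta>_def R'_def by (rule nL_mono_radius) (use hn in simp)
          also have "nL R (\<lambda>y. g (y + h) - g y) \<le> \<eta>" unfolding g_def by (rule \<eta>[OF hn])
          finally show ?thesis using True by (simp add: h_def mult_left_mono add_mono)
        qed
      qed
      also have "\<dots> = ennreal (inverse e) * ennreal e * (\<delta> n + \<eta>)"
        using e by (simp add: nn_integral_multc nn_integral_cmult)
      also have "ennreal (inverse e) * ennreal e = 1" using e by (simp add: ennreal_mult[symmetric])
      finally show ?thesis by simp
    qed
    finally show ?thesis by (simp add: add_mono)
  qed
  then show ?thesis
    using LIMSEQ_le_const[OF lim] unfolding g_def by auto
qed

text \<open>Radon-Nikodym gives a density. It cannot exceed C on a set of positive measure, since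
  there the image measure would exceed C times Lebesgue measure; truncation with \<open>min\<close>
  makes the bound hold everywhere.\<close>

lemma bounded_density_exists:
  fixes g :: "'a::euclidean_space \<Rightarrow> 'a"
  assumes [measurable]: "g \<in> borel_measurable borel" and C0: "C \<ge> 0"
    and C: "\<And>A. A \<in> sets borel \<Longrightarrow> emeasure lborel (g -` A) \<le> ennreal C * emeasure lborel A"
  obtains \<xi> :: "'a \<Rightarrow> real" where "\<xi> \<in> borel_measurable borel" "\<And>x. 0 \<le> \<xi> x" "\<And>x. \<xi> x \<le> C"
    "distr lborel borel g = density lborel (\<lambda>x. ennreal (\<xi> x))"
proof -
  let ?N = "distr lborel borel g"
  have ac: "absolutely_continuous lborel ?N"
    unfolding absolutely_continuous_def
  proof
    fix A :: "'a set" assume A: "A \<in> null_sets lborel"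
    then have "emeasure ?N A \<le> ennreal C * emeasure lborel A"
      using C[of A] by (auto simp: emeasure_distr null_sets_def)
    then show "A \<in> null_sets ?N" using A by (auto simp: null_sets_def)
  qed
  obtain f where f: "f \<in> borel_measurable lborel" "density lborel f = ?N"
    using sigma_finite_measure.Radon_Nikodym[OF sigma_finite_lborel ac] by auto
  have [measurable]: "f \<in> borel_measurable borel" using f(1) by simp
  have "AE x in lborel. f x \<le> ennreal C"
  proof -
    have "AE x in lborel. \<not> (norm x \<le> real n \<and> f x \<ge> ennreal (C + 1 / real (Suc n)))" for n
    proof -
      \<comment> \<open>The restriction to a ball makes the measure of A finite, so that it can be
        cancelled; the margin 1/(n+1) is what forces it to be 0.\<close>
      define A where "A = {x. norm x \<le> real n \<and> f x \<ge> ennreal (C + 1 / real (Suc n))}"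
      have [measurable]: "A \<in> sets borel" unfolding A_def by measurable
      have fin: "emeasure lborel A < top"
        by (rule le_less_trans[OF emeasure_mono emeasure_cball_finite[of 0 "real n"]]) (auto simp: A_def)
      have "ennreal (C + 1 / real (Suc n)) * emeasure lborel A = (\<integral>\<^sup>+x. ennreal (C + 1 / real (Suc n)) * indicator A x \<partial>lborel)"
        by (simp add: nn_integral_cmult_indicator)
      also have "\<dots> \<le> (\<integral>\<^sup>+x. f x * indicator A x \<partial>lborel)"
        by (intro nn_integral_mono) (auto simp: A_def indicator_def)
      also have "\<dots> = emeasure ?N A" by (subst f(2)[symmetric]) (simp add: emeasure_density)
      also have "\<dots> \<le> ennreal C * emeasure lborel A" using C[of A] by (simp add: emeasure_distr)
      finally have le: "ennreal (C + 1 / real (Suc n)) * emeasure lborel A \<le> ennreal C * emeasure lborel A" .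
      obtain m where m: "emeasure lborel A = ennreal m" "m \<ge> 0" using fin by (cases "emeasure lborel A") auto
      have "ennreal ((C + 1 / real (Suc n)) * m) = ennreal (C + 1 / real (Suc n)) * ennreal m"
        by (rule ennreal_mult) (use C0 m in auto)
      moreover have "ennreal (C * m) = ennreal C * ennreal m" by (rule ennreal_mult) (use C0 m in auto)
      ultimately have "ennreal ((C + 1 / real (Suc n)) * m) \<le> ennreal (C * m)" using le m(1) by metis
      then have "(C + 1 / real (Suc n)) * m \<le> C * m"
        by (rule ennreal_le_iff[THEN iffD1, rotated]) (use C0 m in simp)
      then have "1 / real (Suc n) * m \<le> 0" by (simp add: algebra_simps)
      then have "m = 0" using m(2) by (simp add: mult_le_0_iff divide_le_0_iff)
      then have "A \<in> null_sets lborel" using m by (auto simp: null_sets_def)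
      from AE_not_in[OF this] show ?thesis by (simp add: A_def)
    qed
    then have "AE x in lborel. \<forall>n. \<not> (norm x \<le> real n \<and> f x \<ge> ennreal (C + 1 / real (Suc n)))"
      unfolding AE_all_countable by blast
    then show ?thesis
    proof eventually_elim
      fix x assume x: "\<forall>n. \<not> (norm x \<le> real n \<and> f x \<ge> ennreal (C + 1 / real (Suc n)))"
      show "f x \<le> ennreal C"
      proof (rule ennreal_le_epsilon)
        fix e :: real assume e: "e > 0"
        obtain N :: nat where N: "max (norm x) (1 / e) \<le> real N" using real_arch_simple by blast
        have "1 / e \<le> real (Suc N)" using N by simp
        then have "1 / real (Suc N) \<le> e" using e by (simp add: field_simps)
        moreover have "f x \<le> ennreal (C + 1 / real (Suc N))" using x N by (meson max.boundedE not_le less_imp_le)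
        ultimately have "f x \<le> ennreal (C + e)" by (meson add_left_mono ennreal_leI order_trans)
        then show "f x \<le> ennreal C + ennreal e" using C0 e by (simp add: ennreal_plus)
      qed
    qed
  qed
  then have "AE x in lborel. f x = ennreal (min C (enn2real (f x)))"
  proof eventually_elim
    fix x assume "f x \<le> ennreal C"
    then obtain r where "f x = ennreal r" "r \<ge> 0" "r \<le> C" using C0 by (cases "f x") (auto simp: top_unique)
    then show "f x = ennreal (min C (enn2real (f x)))" by simp
  qed
  then have "density lborel f = density lborel (\<lambda>x. ennreal (min C (enn2real (f x))))"
    by (intro density_cong) auto
  then show thesis using that[of "\<lambda>x. min C (enn2real (f x))"] f(2) C0 by simp
qed

lemma weak_D_Basis: "b \<in> Basis \<Longrightarrow> weak_D G y b = G b y"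
proof -
  assume b: "b \<in> Basis"
  have "weak_D G y b = (\<Sum>b'\<in>Basis. if b' = b then G b' y else 0)"
    unfolding weak_D_def using b by (intro sum.cong) (auto simp: inner_Basis)
  then show ?thesis using b by simp
qed

lemma linear_apply_sum:
  assumes "linear A" shows "A v = (\<Sum>b\<in>Basis. (v \<bullet> b) *\<^sub>R A b)"
proof -
  have "A v = A (\<Sum>b\<in>Basis. (v \<bullet> b) *\<^sub>R b)" by (simp add: euclidean_representation)
  then show ?thesis by (simp add: linear_sum[OF assms] linear_scale[OF assms])
qed

text \<open>The integrand is the divergence of the compactly supported field
  \<open>k v *\<^sub>R A v\<close>.\<close>

lemma integral_trace_identity:
  fixes A :: "'a::euclidean_space \<Rightarrow> 'a"
  assumes d: "\<And>x. (k has_derivative k' x) (at x)" and c: "\<And>v. continuous_on UNIV (\<lambda>x. k' x v)"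
    and k: "bump r k" and A: "linear A"
  shows "(\<integral>v. k' v (A v) + k v * tr A \<partial>lborel) = 0" "integrable lborel (\<lambda>v. k' v (A v) + k v * tr A)"
proof -
  have blA: "bounded_linear A" using A by (simp add: linear_conv_bounded_linear)
  have cA: "continuous_on UNIV A" using blA by (rule linear_continuous_on)
  have ck: "continuous_on UNIV k" using k by (simp add: bump_def)
  define F' where "F' b v u = k v * (A u \<bullet> b) + k' v u * (A v \<bullet> b)" for b v u
  have dF: "((\<lambda>v. k v * (A v \<bullet> b)) has_derivative F' b v) (at v)" for b v
    unfolding F'_def
    by (intro has_derivative_mult d bounded_linear.has_derivative[OF bounded_linear_inner_const]
        bounded_linear_imp_has_derivative blA)
  have cF: "continuous_on UNIV (\<lambda>v. F' b v u)" for b u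
    unfolding F'_def by (intro continuous_intros ck c cA)
  have bF: "bump r (\<lambda>v. k v * (A v \<bullet> b))" for b
    using k cA by (auto simp: bump_def intro!: continuous_intros)
  note 0 = integral_derivative_eq_0[OF dF cF bF]
  have eq: "k' v (A v) + k v * tr A = (\<Sum>b\<in>Basis. F' b v b)" for v
    using linear_apply_sum[OF has_derivative_linear[OF d], of v "A v"]
    by (simp add: F'_def tr_def sum.distrib sum_distrib_left mult.commute)
  show "(\<integral>v. k' v (A v) + k v * tr A \<partial>lborel) = 0" unfolding eq using 0 by simp
  show "integrable lborel (\<lambda>v. k' v (A v) + k v * tr A)" unfolding eq using 0 by simp
qed

text \<open>The trace identity allows one to subtract from the commutator integrand its limit, so that
  only the translation moduli of \<open>G\<close> and of \<open>\<xi>\<close> remain.\<close>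

lemma commutator_bound:
  fixes X :: "'a::euclidean_space \<Rightarrow> 'a" and \<xi> d :: "'a \<Rightarrow> real"
  assumes X: "weak_partials X G" and M: "\<And>x. norm (X x) \<le> M"
    and dm[measurable]: "d \<in> borel_measurable borel" and dG: "AE z in lborel. d z = tr (weak_D G z)"
    and \<xi>m[measurable]: "\<xi> \<in> borel_measurable borel" and C: "\<And>x. \<bar>\<xi> x\<bar> \<le> C" and e: "e > 0"
    and dk: "\<And>x. (k has_derivative k' x) (at x)" and ck: "\<And>v. continuous_on UNIV (\<lambda>x. k' x v)"
    and k: "bump 1 k"
    and \<alpha>: "\<And>h. norm h \<le> e \<Longrightarrow> nL R (\<lambda>y. \<Sum>b\<in>Basis. norm (G b (y + h) - G b y)) \<le> \<alpha>"
    and \<beta>: "\<And>h. norm h \<le> e \<Longrightarrow> nL R (\<lambda>y. (\<Sum>b\<in>Basis. norm (G b y)) * (\<xi> (y + h) - \<xi> y)) \<le> \<beta>"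
  defines "\<kappa> \<equiv> (\<lambda>v. (\<Sum>b\<in>Basis. norm (k' v b)) + \<bar>k v\<bar>)"
  shows "nL R (\<lambda>y. \<integral>w. (k' ((y - w) /\<^sub>R e) (X y - X w) / e ^ DIM('a) / e + k ((y - w) /\<^sub>R e) / e ^ DIM('a) * d y) * \<xi> w \<partial>lborel)
    \<le> (\<integral>\<^sup>+v. ennreal (\<kappa> v) \<partial>lborel) * (ennreal C * \<alpha> + \<beta>)"
proof -
  have [measurable]: "X \<in> borel_measurable borel" using weak_partials_loc1(1)[OF X] by auto
  have Gm[measurable]: "G b \<in> borel_measurable borel" if "b \<in> Basis" for b
    using weak_partials_loc1(2)[OF X that] by auto
  have km[measurable]: "k \<in> borel_measurable borel" using k by auto
  have lin: "linear (k' x)" for x by (rule has_derivative_linear[OF dk])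
  have kb: "bump 1 (\<lambda>x. k' x v)" for v by (rule bump_derivative[OF dk ck k])
  have [measurable]: "(\<lambda>x. k' x v) \<in> borel_measurable borel" for v using kb[of v] by auto
  note k'm = derivative_measurable[OF lin ck]
  have C0: "C \<ge> 0" using C abs_ge_zero order_trans by blast
  have M0: "M \<ge> 0" using M norm_ge_zero order_trans by blast
  have \<kappa>m[measurable]: "\<kappa> \<in> borel_measurable borel" unfolding \<kappa>_def by measurable
  have Dm: "(\<lambda>p. weak_D G (snd p) (fst p)) \<in> borel_measurable (borel \<Otimes>\<^sub>M borel)"
    unfolding weak_D_def by measurable
  have trm[measurable]: "(\<lambda>y. tr (weak_D G y)) \<in> borel_measurable borel"
    unfolding tr_def weak_D_def by measurable
  \<comment> \<open>The limit of the commutator integrand, with the difference quotient replaced by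
    the weak differential; by the trace identity its integral over v is 0.\<close>
  define p where "p v y = k' v (weak_D G y v) + k v * tr (weak_D G y)" for v y
  have pm: "(\<lambda>q. p (fst q) (snd q)) \<in> borel_measurable (borel \<Otimes>\<^sub>M borel)"
    unfolding p_def using k'm[OF measurable_fst Dm] by measurable
  have p0: "(\<integral>v. p v y \<partial>lborel) = 0" "integrable lborel (\<lambda>v. p v y)" for y
    unfolding p_def by (rule integral_trace_identity[OF dk ck k linear_weak_D])+
  \<comment> \<open>The integrand after the substitution \<open>w = y - e *\<^sub>R v\<close>, with
    X divided into a difference quotient in direction v.\<close>
  define q where "q v y = k' v ((X y - X (y - e *\<^sub>R v)) /\<^sub>R e) + k v * d y" for v y
  have qm: "(\<lambda>p. q (fst p) (snd p)) \<in> borel_measurable (borel \<Otimes>\<^sub>M borel)"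
    unfolding q_def
    using k'm[of fst "borel \<Otimes>\<^sub>M borel" "\<lambda>p. (X (snd p) - X (snd p - e *\<^sub>R fst p)) /\<^sub>R e"] by measurable
  have pair: "(\<lambda>v. (v, y)) \<in> borel \<rightarrow>\<^sub>M borel \<Otimes>\<^sub>M borel" "(\<lambda>y. (v, y)) \<in> borel \<rightarrow>\<^sub>M borel \<Otimes>\<^sub>M borel" for v y :: 'a
    by measurable
  have pv[measurable]: "p v \<in> borel_measurable borel" "q v \<in> borel_measurable borel"
    "(\<lambda>v. q v y) \<in> borel_measurable borel" for v y
    using measurable_compose[OF pair(2) pm] measurable_compose[OF pair(2) qm] measurable_compose[OF pair(1) qm] by simp_all
  have vanish: "k v = 0" "k' v u = 0" if "norm v > 1" for v u
    using k kb[of u] that by (auto simp: bump_def)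
  have k'le: "\<bar>k' v u\<bar> \<le> (\<Sum>b\<in>Basis. norm (k' v b)) * norm u" for v u
    using derivative_norm_le[OF lin, of v u] by simp
  \<comment> \<open>Needed to split the integral. The crude bound 2 M / e on the quotient suffices
    because e is fixed.\<close>
  have intq: "integrable lborel (\<lambda>v. q v y * \<xi> (y - e *\<^sub>R v))" for y
  proof -
    have b\<kappa>: "bump 1 \<kappa>" unfolding \<kappa>_def using k kb by (auto simp: bump_def intro!: continuous_intros)
    obtain B where B: "B \<ge> 0" "\<And>v. \<bar>\<kappa> v\<bar> \<le> B" using bump_bounded[OF b\<kappa>] by blast
    define S where "S = 2 * M / e + \<bar>d y\<bar>"
    have S0: "S \<ge> 0" using M0 e by (simp add: S_def)
    have "\<bar>q v y\<bar> \<le> \<kappa> v * S" for v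
    proof -
      have "norm ((X y - X (y - e *\<^sub>R v)) /\<^sub>R e) \<le> 2 * M / e"
        using norm_triangle_ineq4[of "X y" "X (y - e *\<^sub>R v)"] M[of y] M[of "y - e *\<^sub>R v"] e
        by (simp add: divide_inverse mult.commute del: scaleR_diff_right)
      then have u: "norm ((X y - X (y - e *\<^sub>R v)) /\<^sub>R e) \<le> S" "\<bar>d y\<bar> \<le> S" using M0 e by (auto simp: S_def add_increasing2 add_increasing)
      have "\<bar>k' v ((X y - X (y - e *\<^sub>R v)) /\<^sub>R e)\<bar> \<le> (\<Sum>b\<in>Basis. norm (k' v b)) * S"
        by (rule order_trans[OF k'le mult_left_mono[OF u(1)]]) (simp add: sum_nonneg)
      moreover have "\<bar>k v * d y\<bar> \<le> \<bar>k v\<bar> * S" unfolding abs_mult using u(2) by (rule mult_left_mono) simp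
      ultimately show ?thesis
        using abs_triangle_ineq[of "k' v ((X y - X (y - e *\<^sub>R v)) /\<^sub>R e)" "k v * d y"]
        by (simp add: q_def \<kappa>_def distrib_right)
    qed
    then have le: "\<bar>q v y * \<xi> (y - e *\<^sub>R v)\<bar> \<le> \<bar>\<kappa> v * (S * C)\<bar>" for v
    proof -
      have "\<bar>q v y * \<xi> (y - e *\<^sub>R v)\<bar> \<le> (\<kappa> v * S) * C"
        unfolding abs_mult using \<open>\<bar>q v y\<bar> \<le> \<kappa> v * S\<close> C[of "y - e *\<^sub>R v"]
        by (intro mult_mono) (auto intro: order_trans[OF abs_ge_zero])
      then show ?thesis by (simp add: mult.assoc)
    qed
    have "integrable lborel (\<lambda>v. \<kappa> v *\<^sub>R (S * C))"
      by (rule bump_integrable[OF b\<kappa> loc1_bounded[where c="\<bar>S * C\<bar>"]]) auto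
    then show ?thesis
      by (rule Bochner_Integration.integrable_bound) (use le in auto)
  qed
  define F where "F v y = q v y * \<xi> (y - e *\<^sub>R v) - p v y * \<xi> y" for v y
  have Q: "(\<integral>w. (k' ((y - w) /\<^sub>R e) (X y - X w) / e ^ DIM('a) / e + k ((y - w) /\<^sub>R e) / e ^ DIM('a) * d y) * \<xi> w \<partial>lborel)
      = (\<integral>v. F v y \<partial>lborel)" for y
  proof -
    let ?f = "\<lambda>w. (k' ((y - w) /\<^sub>R e) (X y - X w) / e ^ DIM('a) / e + k ((y - w) /\<^sub>R e) / e ^ DIM('a) * d y) * \<xi> w"
    have [measurable]: "(\<lambda>w. k' ((y - w) /\<^sub>R e) (X y - X w)) \<in> borel_measurable borel"
      by (rule k'm) measurable
    have "(\<integral>w. ?f w \<partial>lborel) = \<bar>e\<bar> ^ DIM('a) *\<^sub>R (\<integral>v. ?f (y - e *\<^sub>R v) \<partial>lborel)"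
      by (rule integral_affine_subst) (use e in auto)
    also have "\<dots> = (\<integral>v. e ^ DIM('a) * ?f (y - e *\<^sub>R v) \<partial>lborel)"
      using e by simp
    also have "\<dots> = (\<integral>v. q v y * \<xi> (y - e *\<^sub>R v) \<partial>lborel)"
    proof (rule Bochner_Integration.integral_cong[OF refl])
      fix v
      have "(y - (y - e *\<^sub>R v)) /\<^sub>R e = v" using e by simp
      moreover have "k' v ((X y - X (y - e *\<^sub>R v)) /\<^sub>R e) = k' v (X y - X (y - e *\<^sub>R v)) / e"
        using linear_scale[OF lin] by (simp add: divide_inverse mult.commute del: scaleR_diff_right)
      ultimately show "e ^ DIM('a) * ?f (y - e *\<^sub>R v) = q v y * \<xi> (y - e *\<^sub>R v)"
        using e by (simp add: q_def field_simps)
    qed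
    also have "\<dots> = (\<integral>v. F v y \<partial>lborel)"
      unfolding F_def using intq[of y] p0[of y] by simp
    finally show ?thesis .
  qed
  have Fm: "(\<lambda>(v, y). F v y) \<in> borel_measurable (lborel \<Otimes>\<^sub>M lborel)"
    unfolding F_def using pm qm by (simp add: case_prod_unfold) measurable
  have Fle: "nL R (F v) \<le> ennreal (\<kappa> v) * (ennreal C * \<alpha> + \<beta>)" for v
  proof (cases "norm v \<le> 1")
    case False
    then have "F v = (\<lambda>_. 0)" by (auto simp: F_def p_def q_def vanish fun_eq_iff)
    then show ?thesis by (simp add: nL_def)
  next
    case True
    define Nv where "Nv = (\<Sum>b\<in>Basis. norm (k' v b))"
    have Nv: "Nv \<ge> 0" "\<kappa> v = Nv + \<bar>k v\<bar>" by (auto simp: Nv_def \<kappa>_def sum_nonneg)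
    define g where "g y = (\<Sum>b\<in>Basis. norm (G b y))" for y
    have [measurable]: "g \<in> borel_measurable borel" unfolding g_def by measurable
    define h where "h = - (e *\<^sub>R v)"
    have h: "norm h \<le> e" using True e by (simp add: h_def mult_left_le)
    have vb: "\<bar>v \<bullet> b\<bar> \<le> 1" if "b \<in> Basis" for b using Basis_le_norm[OF that, of v] True by linarith
    have Dle: "norm (\<Sum>b\<in>Basis. (v \<bullet> b) *\<^sub>R z b) \<le> (\<Sum>b\<in>Basis. norm (z b))" for z :: "'a \<Rightarrow> 'a"
      by (rule sum_norm_le) (use vb in \<open>auto intro!: mult_left_le_one_le\<close>)
    define \<Delta> where "\<Delta> y = (X y - X (y - e *\<^sub>R v)) /\<^sub>R e - weak_D G y v" for y
    have [measurable]: "(\<lambda>y. weak_D G y v) \<in> borel_measurable borel"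
      using loc1_measurable[OF weak_D_loc1[OF X]] .
    have [measurable]: "\<Delta> \<in> borel_measurable borel" unfolding \<Delta>_def by measurable
    have \<Delta>\<alpha>: "nL R \<Delta> \<le> \<alpha>"
      unfolding \<Delta>_def
    proof (rule difference_quotient_bound[OF X M e])
      fix h' :: 'a assume "norm h' \<le> e * norm v"
      also have "\<dots> \<le> e" using True e by (simp add: mult_left_le)
      finally have h': "norm h' \<le> e" .
      have "nL R (\<lambda>y. weak_D G (y + h') v - weak_D G y v) \<le> nL R (\<lambda>y. \<Sum>b\<in>Basis. norm (G b (y + h') - G b y))"
      proof (rule nL_mono)
        fix y
        have "weak_D G (y + h') v - weak_D G y v = (\<Sum>b\<in>Basis. (v \<bullet> b) *\<^sub>R (G b (y + h') - G b y))"
          by (simp add: weak_D_def sum_subtractf scaleR_diff_right)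
        then show "norm (weak_D G (y + h') v - weak_D G y v) \<le> norm (\<Sum>b\<in>Basis. norm (G b (y + h') - G b y))"
          using Dle[of "\<lambda>b. G b (y + h') - G b y"] by simp
      qed
      also have "\<dots> \<le> \<alpha>" by (rule \<alpha>[OF h'])
      finally show "nL R (\<lambda>y. weak_D G (y + h') v - weak_D G y v) \<le> \<alpha>" .
    qed
    have ple: "\<bar>p v y\<bar> \<le> \<kappa> v * g y" for y
    proof -
      have g0: "g y \<ge> 0" by (simp add: g_def sum_nonneg)
      have "\<bar>k' v (weak_D G y v)\<bar> \<le> Nv * g y"
        using k'le[of v "weak_D G y v"] Dle[of "\<lambda>b. G b y"] Nv(1)
        by (auto simp: Nv_def weak_D_def g_def intro: order_trans mult_left_mono)
      moreover have "\<bar>tr (weak_D G y)\<bar> \<le> g y"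
        unfolding tr_def g_def
      proof (rule order_trans[OF sum_abs sum_mono])
        fix b :: 'a assume b: "b \<in> Basis"
        then show "\<bar>weak_D G y b \<bullet> b\<bar> \<le> norm (G b y)" by (simp add: weak_D_Basis Basis_le_norm)
      qed
      then have "\<bar>k v * tr (weak_D G y)\<bar> \<le> \<bar>k v\<bar> * g y" unfolding abs_mult by (rule mult_left_mono) simp
      ultimately show ?thesis
        using abs_triangle_ineq[of "k' v (weak_D G y v)" "k v * tr (weak_D G y)"] Nv by (simp add: p_def distrib_right)
    qed
    have "nL R (F v) \<le> nL R (\<lambda>y. Nv * C * norm (\<Delta> y)) + nL R (\<lambda>y. \<kappa> v * (g y * (\<xi> (y + h) - \<xi> y)))"
    proof -
      \<comment> \<open>The error splits into the defect \<open>\<Delta>\<close> of the difference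
        quotient, paired with the bounded \<xi>, and the translation of \<xi>, paired with a term
        bounded by the gradient g.\<close>
      define F2 where "F2 y = k' v (\<Delta> y) * \<xi> (y + h) + p v y * (\<xi> (y + h) - \<xi> y)" for y
      have "AE y in lborel. norm (F v y) = norm (F2 y)"
        using dG
      proof eventually_elim
        fix y assume "d y = tr (weak_D G y)"
        then have "q v y = k' v (\<Delta> y) + p v y"
          by (simp add: q_def p_def \<Delta>_def linear_diff[OF lin])
        then have "F v y = F2 y" by (simp add: F_def F2_def h_def algebra_simps)
        then show "norm (F v y) = norm (F2 y)" by simp
      qed
      then have "nL R (F v) = nL R F2" by (rule nL_cong_AE)
      also have "\<dots> \<le> nL R (\<lambda>y. Nv * C * norm (\<Delta> y)) + nL R (\<lambda>y. \<kappa> v * (g y * (\<xi> (y + h) - \<xi> y)))"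
      proof (rule nL_add_le)
        fix y
        have "\<bar>k' v (\<Delta> y) * \<xi> (y + h)\<bar> \<le> (Nv * norm (\<Delta> y)) * C"
          unfolding abs_mult using k'le[of v "\<Delta> y"] C[of "y + h"] Nv(1)
          by (intro mult_mono) (auto simp: Nv_def)
        moreover have "\<bar>p v y * (\<xi> (y + h) - \<xi> y)\<bar> \<le> (\<kappa> v * g y) * \<bar>\<xi> (y + h) - \<xi> y\<bar>"
          unfolding abs_mult by (intro mult_right_mono ple) simp
        moreover have "g y \<ge> 0" by (simp add: g_def sum_nonneg)
        ultimately show "norm (F2 y) \<le> norm (Nv * C * norm (\<Delta> y)) + norm (\<kappa> v * (g y * (\<xi> (y + h) - \<xi> y)))"
          using abs_triangle_ineq[of "k' v (\<Delta> y) * \<xi> (y + h)" "p v y * (\<xi> (y + h) - \<xi> y)"] Nv C0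
          by (simp add: F2_def abs_mult mult_ac)
      qed measurable
      finally show ?thesis .
    qed
    also have "nL R (\<lambda>y. Nv * C * norm (\<Delta> y)) \<le> ennreal (Nv * C) * nL R \<Delta>"
      by (rule nL_cmult_le) (use Nv C0 in \<open>auto simp: abs_mult\<close>)
    also have "\<dots> \<le> ennreal (\<kappa> v) * (ennreal C * \<alpha>)"
    proof -
      have "ennreal (Nv * C) * nL R \<Delta> \<le> ennreal (\<kappa> v * C) * \<alpha>"
        using Nv C0 \<Delta>\<alpha> by (intro mult_mono ennreal_leI mult_right_mono) auto
      then show ?thesis using Nv C0 by (simp add: ennreal_mult mult.assoc)
    qed
    also have "nL R (\<lambda>y. \<kappa> v * (g y * (\<xi> (y + h) - \<xi> y))) \<le> ennreal (\<kappa> v) * nL R (\<lambda>y. g y * (\<xi> (y + h) - \<xi> y))"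
      by (rule nL_cmult_le) (use Nv in \<open>auto simp: abs_mult\<close>)
    also have "nL R (\<lambda>y. g y * (\<xi> (y + h) - \<xi> y)) \<le> \<beta>" unfolding g_def by (rule \<beta>[OF h])
    finally show ?thesis by (simp add: distrib_left add_mono mult_left_mono)
  qed
  have "nL R (\<lambda>y. \<integral>v. F v y \<partial>lborel) \<le> (\<integral>\<^sup>+v. nL R (F v) \<partial>lborel)"
    by (rule nL_integral_le[OF sigma_finite_lborel Fm])
  also have "\<dots> \<le> (\<integral>\<^sup>+v. ennreal (\<kappa> v) * (ennreal C * \<alpha> + \<beta>) \<partial>lborel)"
    by (intro nn_integral_mono Fle)
  also have "\<dots> = (\<integral>\<^sup>+v. ennreal (\<kappa> v) \<partial>lborel) * (ennreal C * \<alpha> + \<beta>)"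
    by (rule nn_integral_multc) measurable
  finally show ?thesis unfolding Q .
qed


subsection \<open>The Jacobian density\<close>

lemma prim_shift:
  fixes u :: "real \<Rightarrow> 'a::euclidean_space"
  assumes u: "locally_bounded_fun u"
  shows "prim u (s + c) - prim u c = prim (\<lambda>r. u (r + c)) s"
proof -
  have [measurable]: "u \<in> borel_measurable borel" using u by auto
  have "prim u (s + c) - prim u c = (\<integral>r. (kern (s + c) r - kern c r) *\<^sub>R u r \<partial>lborel)"
    by (rule prim_diff_eq[OF u])
  also have "\<dots> = (\<integral>r. (kern (s + c) (r + c) - kern c (r + c)) *\<^sub>R u (r + c) \<partial>lborel)"
    by (rule integral_translation[symmetric]) measurable
  also have "\<dots> = prim (\<lambda>r. u (r + c)) s"
    unfolding prim_def
  proof (rule integral_cong_AE)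
    show "AE r in lborel. (kern (s + c) (r + c) - kern c (r + c)) *\<^sub>R u (r + c) = kern s r *\<^sub>R u (r + c)"
      \<comment> \<open>The intervals in \<open>kern\<close> are open, so the two sides may disagree
        at the end points, that is for r equal to 0, s or -c.\<close>
      using AE_lborel_singleton[of 0] AE_lborel_singleton[of s] AE_lborel_singleton[of "- c"]
    proof eventually_elim
      fix r :: real assume "r \<noteq> 0" "r \<noteq> s" "r \<noteq> - c"
      then have "kern (s + c) (r + c) - kern c (r + c) = kern s r" by (auto simp: kern_def)
      then show "(kern (s + c) (r + c) - kern c (r + c)) *\<^sub>R u (r + c) = kern s r *\<^sub>R u (r + c)" by simp
    qed
  qed measurable
  finally show ?thesis .
qed

lemma bounded_support_integrable:
  fixes f :: "'a::euclidean_space \<Rightarrow> 'b::euclidean_space"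
  assumes "f \<in> borel_measurable borel" "\<And>z. norm (f z) \<le> B" "\<And>z. norm z > R \<Longrightarrow> f z = 0"
  shows "integrable lborel f"
proof -
  have "f = (\<lambda>x. indicat_real (cball 0 R) x *\<^sub>R f x)" using assms(3) by (force simp: indicator_def fun_eq_iff)
  then show ?thesis using loc1_integrable[OF loc1_bounded[OF assms(1,2)], of R] by metis
qed

lemma integral_distr_density:
  fixes f :: "'a::euclidean_space \<Rightarrow> real"
  assumes [measurable]: "f \<in> borel_measurable borel" "g \<in> borel_measurable borel" "\<xi> \<in> borel_measurable borel"
    and nn: "\<And>x. 0 \<le> \<xi> x" and eq: "distr lborel borel g = density lborel (\<lambda>x. ennreal (\<xi> x))"
  shows "(\<integral>z. f (g z) \<partial>lborel) = (\<integral>w. f w * \<xi> w \<partial>lborel)"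
proof -
  have "(\<integral>z. f (g z) \<partial>lborel) = (\<integral>w. f w \<partial>distr lborel borel g)" by (rule integral_distr[symmetric]) auto
  also have "\<dots> = (\<integral>w. \<xi> w *\<^sub>R f w \<partial>lborel)" unfolding eq by (rule integral_density) (use nn in auto)
  finally show ?thesis by (simp add: mult.commute)
qed

lemma scaled_has_derivative:
  fixes k :: "'a::euclidean_space \<Rightarrow> real"
  assumes d: "\<And>x. (k has_derivative k' x) (at x)" and e: "e > 0"
  shows "(scaled k e has_derivative (\<lambda>u. k' (x /\<^sub>R e) u / e ^ DIM('a) / e)) (at x)"
proof -
  have "((\<lambda>x. k (x /\<^sub>R e)) has_derivative (\<lambda>u. k' (x /\<^sub>R e) (u /\<^sub>R e))) (at x)"
    by (rule has_derivative_compose[OF _ d]) (auto intro!: derivative_eq_intros)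
  then have "((\<lambda>x. k (x /\<^sub>R e) / e ^ DIM('a)) has_derivative (\<lambda>u. k' (x /\<^sub>R e) (u /\<^sub>R e) / e ^ DIM('a))) (at x)"
    using e by (auto intro!: derivative_eq_intros)
  moreover have "k' (x /\<^sub>R e) (u /\<^sub>R e) / e ^ DIM('a) = k' (x /\<^sub>R e) u / e ^ DIM('a) / e" for u
    using linear_scale[OF has_derivative_linear[OF d]] by (simp add: divide_inverse mult_ac)
  ultimately show ?thesis by (simp add: scaled_def[abs_def])
qed

lemma integral_scaled:
  assumes [measurable]: "k \<in> borel_measurable borel" and e: "e > 0"
  shows "(\<integral>z. scaled k e (y - z) \<partial>lborel) = integral\<^sup>L lborel k"
proof -
  have "conv (scaled k e) (\<lambda>_. 1::real) y = moll k e (\<lambda>_. 1::real) y"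
    by (subst conv_scaled_eq_moll[OF _ _ e]) auto
  then show ?thesis by (simp add: conv_def moll_def)
qed

text \<open>\<open>Qc k k' X d \<Phi> \<epsilon> \<tau>\<close> is the commutator of \<open>X\<close> with the mollification of the push-forward of Lebesgue
  measure under \<open>\<Phi> (- \<tau>)\<close>, written as an integral over initial points so that it is
  jointly measurable in \<open>\<tau>\<close> and \<open>y\<close>.\<close>

definition Qc :: "('a::euclidean_space \<Rightarrow> real) \<Rightarrow> ('a \<Rightarrow> 'a \<Rightarrow> real) \<Rightarrow> ('a \<Rightarrow> 'a) \<Rightarrow> ('a \<Rightarrow> real) \<Rightarrow> (real \<Rightarrow> 'a \<Rightarrow> 'a) \<Rightarrow> real \<Rightarrow> real \<Rightarrow> 'a \<Rightarrow> real" where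
  "Qc k k' X d \<Phi> e \<tau> y = (\<integral>z. k' ((y - \<Phi> (- \<tau>) z) /\<^sub>R e) (X y - X (\<Phi> (- \<tau>) z)) / e ^ DIM('a) / e
      + k ((y - \<Phi> (- \<tau>) z) /\<^sub>R e) / e ^ DIM('a) * d y \<partial>lborel)"

lemma Qc_measurable:
  fixes X :: "'a::euclidean_space \<Rightarrow> 'a"
  assumes \<Phi>: "good_flow X M \<Phi>" and [measurable]: "X \<in> borel_measurable borel" "d \<in> borel_measurable borel"
    and dk: "\<And>x. (k has_derivative k' x) (at x)" and ck: "\<And>v. continuous_on UNIV (\<lambda>x. k' x v)"
  shows "(\<lambda>(s, y). Qc k k' X d \<Phi> e (t - s) y) \<in> borel_measurable (borel \<Otimes>\<^sub>M borel)"
proof -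
  note [measurable] = good_flow_measurable(1)[OF \<Phi>]
  have [measurable]: "k \<in> borel_measurable borel"
    by (rule borel_measurable_continuous_onI[OF has_derivative_continuous_on_UNIV[OF dk]])
  have [measurable]: "(\<lambda>p. k' ((snd (fst p) - \<Phi> (- (t - fst (fst p))) (snd p)) /\<^sub>R e)
      (X (snd (fst p)) - X (\<Phi> (- (t - fst (fst p))) (snd p)))) \<in> borel_measurable ((borel \<Otimes>\<^sub>M borel) \<Otimes>\<^sub>M lborel)"
    by (rule derivative_measurable[OF has_derivative_linear[OF dk] ck]) measurable
  show ?thesis
    unfolding Qc_def case_prod_unfold
    by (rule lborel.borel_measurable_lebesgue_integral) (simp only: case_prod_unfold, measurable)
qed

text \<open>For fixed x and z the chain rule is applied in s along the difference of the two
  trajectories, with the integral of d as second coordinate; integration over z and Fubini then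
  produce \<open>Qc\<close>.\<close>

lemma jac_mollified_identity:
  fixes X :: "'a::euclidean_space \<Rightarrow> 'a" and \<xi> :: "'a \<Rightarrow> real"
  assumes \<Phi>: "good_flow X M \<Phi>" and X[measurable]: "X \<in> borel_measurable borel" and XM: "\<And>x. norm (X x) \<le> M"
    and d[measurable]: "d \<in> borel_measurable borel" and D: "\<And>z. \<bar>d z\<bar> \<le> D"
    and dk: "\<And>x. (k has_derivative k' x) (at x)" and ck: "\<And>v. continuous_on UNIV (\<lambda>x. k' x v)"
    and k: "bump 1 k" "integral\<^sup>L lborel k = 1" and e: "e > 0"
    and \<xi>[measurable]: "\<xi> \<in> borel_measurable borel" and \<xi>0: "\<And>x. 0 \<le> \<xi> x"
    and dist: "distr lborel borel (\<Phi> (- t)) = density lborel (\<lambda>x. ennreal (\<xi> x))"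
  shows "AE x in lborel. jac d \<Phi> t x - conv (scaled k e) \<xi> x
    = prim (\<lambda>s. jac d \<Phi> s x * Qc k k' X d \<Phi> e (t - s) (\<Phi> s x)) t"
  using good_flowD(2)[OF \<Phi>]
proof eventually_elim
  fix x assume fx: "\<forall>t. \<Phi> t x = x + prim (\<lambda>s. X (\<Phi> s x)) t"
  note [measurable] = good_flow_measurable[OF \<Phi>]
  have M0: "M \<ge> 0" using XM norm_ge_zero order_trans by blast
  have [measurable]: "k \<in> borel_measurable borel" using k by auto
  define K where "K = scaled k e"
  define K' where "K' p u = k' (p /\<^sub>R e) u / e ^ DIM('a) / e" for p u
  have dK: "(K has_derivative K' p) (at p)" for p
    unfolding K_def K'_def by (rule scaled_has_derivative[OF dk e])
  have cK': "continuous_on UNIV (\<lambda>p. K' p u)" for u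
    unfolding K'_def using e by (intro continuous_intros continuous_on_compose2[OF ck]) auto
  have cK: "continuous_on UNIV K" by (rule has_derivative_continuous_on_UNIV[OF dK])
  have Km[measurable]: "K \<in> borel_measurable borel" by (rule borel_measurable_continuous_onI[OF cK])
  have K0: "K p = 0" if "norm p > e" for p
  proof -
    have "norm (p /\<^sub>R e) > 1" using that e by (simp add: field_simps)
    then show ?thesis using k by (auto simp: K_def scaled_def bump_def)
  qed
  have bK: "bump e K" using cK K0 by (auto simp: bump_def)
  have bK': "bump e (\<lambda>p. K' p u)" for u by (rule bump_derivative[OF dK cK' bK])
  note lin = has_derivative_linear[OF dK]
  obtain B where B: "B \<ge> 0" "\<And>p. \<bar>K p\<bar> \<le> B" using bump_bounded[OF bK] by blast
  have "bump e (\<lambda>p. \<Sum>b\<in>Basis. norm (K' p b))"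
    using bK' by (auto simp: bump_def intro!: continuous_intros)
  then obtain B' where B': "B' \<ge> 0" "\<And>p. \<bar>\<Sum>b\<in>Basis. norm (K' p b)\<bar> \<le> B'" using bump_bounded by blast
  have K'le: "\<bar>K' p u\<bar> \<le> B' * norm u" for p u
    using derivative_norm_le[OF lin, of p u] mult_right_mono[OF B'(2)[of p], of "norm u"]
    by (simp add: sum_nonneg)
  define W where "W = exp (D * \<bar>t\<bar>)"
  have W: "\<bar>jac d \<Phi> s x\<bar> \<le> W" if "\<bar>s\<bar> \<le> \<bar>t\<bar>" for s
    using jac_bounds[OF d D \<Phi> that, of x] by (simp add: W_def)
  define H where "H z s = K' (\<Phi> s x - \<Phi> (s - t) z) (X (\<Phi> s x) - X (\<Phi> (s - t) z)) + K (\<Phi> s x - \<Phi> (s - t) z) * d (\<Phi> s x)" for z s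
  \<comment> \<open>x moves by at most \<open>M * \<bar>t\<bar>\<close> and z by at most twice that,
    since \<open>\<bar>s - t\<bar>\<close> is at most \<open>2 * \<bar>t\<bar>\<close>; hence the 3.
    Beyond this radius the kernel vanishes for all s involved, which gives Fubini a bounded
    support.\<close>
  have far: "norm (\<Phi> s x - \<Phi> (s - t) z) > e" if s: "\<bar>s\<bar> \<le> \<bar>t\<bar>" and z: "norm z > norm x + 3 * M * \<bar>t\<bar> + e" for s z
  proof -
    have 1: "norm (\<Phi> s x - x) \<le> M * \<bar>t\<bar>"
      using good_flowD(1)[OF \<Phi>, of s x] mult_left_mono[OF s M0] by linarith
    have "\<bar>s - t\<bar> \<le> 2 * \<bar>t\<bar>" using s by linarith
    then have 2: "norm (\<Phi> (s - t) z - z) \<le> M * (2 * \<bar>t\<bar>)"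
      using good_flowD(1)[OF \<Phi>, of "s - t" z] mult_left_mono[OF _ M0] by (meson order_trans)
    have "z = (z - \<Phi> (s - t) z) + ((\<Phi> (s - t) z - \<Phi> s x) + ((\<Phi> s x - x) + x))" by simp
    then have "norm z \<le> norm (z - \<Phi> (s - t) z) + (norm (\<Phi> (s - t) z - \<Phi> s x) + (norm (\<Phi> s x - x) + norm x))"
      by (metis add_left_mono norm_triangle_mono order_refl)
    then show ?thesis using 1 2 z by (simp add: norm_minus_commute)
  qed
  have H0: "H z s = 0" if "\<bar>s\<bar> \<le> \<bar>t\<bar>" "norm z > norm x + 3 * M * \<bar>t\<bar> + e" for z s
    using far[OF that] bK bK' by (auto simp: H_def bump_def)
  have HB: "\<bar>H z s\<bar> \<le> B' * (2 * M) + B * D" for z s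
  proof -
    have "norm (X (\<Phi> s x) - X (\<Phi> (s - t) z)) \<le> 2 * M"
      using norm_triangle_ineq4[of "X (\<Phi> s x)" "X (\<Phi> (s - t) z)"] XM[of "\<Phi> s x"] XM[of "\<Phi> (s - t) z"] by linarith
    then have "\<bar>K' (\<Phi> s x - \<Phi> (s - t) z) (X (\<Phi> s x) - X (\<Phi> (s - t) z))\<bar> \<le> B' * (2 * M)"
      by (rule order_trans[OF K'le mult_left_mono[OF _ B'(1)]])
    moreover have "\<bar>K (\<Phi> s x - \<Phi> (s - t) z) * d (\<Phi> s x)\<bar> \<le> B * D"
      unfolding abs_mult using B D by (intro mult_mono) auto
    ultimately show ?thesis unfolding H_def by linarith
  qed
  have Hm: "(\<lambda>q. H (snd q) (fst q)) \<in> borel_measurable (borel \<Otimes>\<^sub>M borel)"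
  proof -
    have [measurable]: "(\<lambda>q. K' (\<Phi> (fst q) x - \<Phi> (fst q - t) (snd q)) (X (\<Phi> (fst q) x) - X (\<Phi> (fst q - t) (snd q))))
        \<in> borel_measurable (borel \<Otimes>\<^sub>M borel)"
      by (rule derivative_measurable[OF lin cK']) measurable
    show ?thesis unfolding H_def by measurable
  qed
  note jm = jac_measurable(1)[OF d \<Phi>]
  have jx[measurable]: "(\<lambda>s. jac d \<Phi> s x) \<in> borel_measurable borel"
  proof -
    have "(\<lambda>s. (s, x)) \<in> borel \<rightarrow>\<^sub>M borel \<Otimes>\<^sub>M borel" by measurable
    from measurable_compose[OF this jm] show ?thesis by simp
  qed
  define f where "f q = kern t (fst q) * (jac d \<Phi> (fst q) x * H (snd q) (fst q))" for q
  have fm': "f \<in> borel_measurable (borel \<Otimes>\<^sub>M borel)" unfolding f_def using Hm by measurable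
  then have fm: "f \<in> borel_measurable borel" by (simp add: borel_prod)
  define R0 where "R0 = norm x + 3 * M * \<bar>t\<bar> + e"
  have intf: "integrable lborel f"
  proof (rule bounded_support_integrable[OF fm])
    fix q :: "real \<times> 'a"
    show "norm (f q) \<le> W * (B' * (2 * M) + B * D)"
    proof (cases "\<bar>fst q\<bar> \<le> \<bar>t\<bar>")
      case True
      have "\<bar>kern t (fst q)\<bar> * (\<bar>jac d \<Phi> (fst q) x\<bar> * \<bar>H (snd q) (fst q)\<bar>) \<le> 1 * (W * (B' * (2 * M) + B * D))"
        using W[OF True] HB[of "snd q" "fst q"]
        by (intro mult_mono) (auto simp: kern_def W_def)
      then show ?thesis by (simp add: f_def abs_mult)
    next
      case False
      have "0 \<le> W * (B' * (2 * M) + B * D)"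
        using HB[of x t] abs_ge_zero[of "H x t"] by (intro mult_nonneg_nonneg) (auto simp: W_def intro: order_trans)
      then show ?thesis using False kern_eq_0[of t "fst q"] by (simp add: f_def)
    qed
    assume q: "norm q > \<bar>t\<bar> + R0"
    show "f q = 0"
    proof (cases "\<bar>fst q\<bar> \<le> \<bar>t\<bar>")
      case True
      then have "norm (snd q) > R0" using norm_Pair_le[of "fst q" "snd q"] q by simp
      then show ?thesis using H0[OF True] by (simp add: f_def R0_def)
    next
      case False
      then show ?thesis using kern_eq_0[of t "fst q"] by (simp add: f_def)
    qed
  qed
  have lbx: "locally_bounded_fun (\<lambda>s. X (\<Phi> s x))" by (rule locally_bounded_funI[where M=M]) (use XM in auto)
  have lbd: "locally_bounded_fun (\<lambda>s. d (\<Phi> s x))" by (rule locally_bounded_funI[where M=D]) (use D in auto)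
  have id: "AE z in lborel. K (\<Phi> t x - z) * jac d \<Phi> t x - K (x - \<Phi> (- t) z) = (\<integral>s. f (s, z) \<partial>lborel)"
    using good_flowD(2)[OF \<Phi>]
  proof eventually_elim
    fix z assume fz: "\<forall>t. \<Phi> t z = z + prim (\<lambda>s. X (\<Phi> s z)) t"
    have lbz: "locally_bounded_fun (\<lambda>s. X (\<Phi> s z))" by (rule locally_bounded_funI[where M=M]) (use XM in auto)
    have lbzt: "locally_bounded_fun (\<lambda>s. X (\<Phi> (s - t) z))"
    proof (rule locally_bounded_funI[where M=M])
      show "(\<lambda>s. X (\<Phi> (s - t) z)) \<in> borel_measurable borel"
        by (rule measurable_compose[OF _ measurable_compose[OF good_flow_measurable(3)[OF \<Phi>, of z] X]]) measurable
    qed (rule XM)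
    have lbu: "locally_bounded_fun (\<lambda>s. X (\<Phi> s x) - X (\<Phi> (s - t) z))"
    proof (rule locally_bounded_funI[where M="2*M"])
      show "(\<lambda>s. X (\<Phi> s x) - X (\<Phi> (s - t) z)) \<in> borel_measurable borel"
        by (rule borel_measurable_diff[OF locally_bounded_fun_measurable[OF lbx] locally_bounded_fun_measurable[OF lbzt]])
      show "norm (X (\<Phi> s x) - X (\<Phi> (s - t) z)) \<le> 2 * M" for s
        using norm_triangle_ineq4[of "X (\<Phi> s x)" "X (\<Phi> (s - t) z)"] XM[of "\<Phi> s x"] XM[of "\<Phi> (s - t) z"] by linarith
    qed
    \<comment> \<open>The integral equation of the trajectory of z, restarted at time -t. It follows
      from subtracting two instances of the equation from time 0, without composing flow
      maps.\<close>
    have zshift: "prim (\<lambda>s. X (\<Phi> (s - t) z)) s = \<Phi> (s - t) z - \<Phi> (- t) z" for s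
    proof -
      have "prim (\<lambda>s. X (\<Phi> (s - t) z)) s = prim (\<lambda>s. X (\<Phi> s z)) (s - t) - prim (\<lambda>s. X (\<Phi> s z)) (- t)"
        using prim_shift[OF lbz, of s "- t"] by simp
      also have "\<dots> = (z + prim (\<lambda>s. X (\<Phi> s z)) (s - t)) - (z + prim (\<lambda>s. X (\<Phi> s z)) (- t))" by simp
      also have "\<dots> = \<Phi> (s - t) z - \<Phi> (- t) z" by (simp only: fz[rule_format, symmetric])
      finally show ?thesis .
    qed
    have z0: "\<Phi> 0 z = z" using fz[rule_format, of 0] by (simp only: prim_0 add_0_right)
    have curve: "(x - \<Phi> (- t) z, 0) + prim (\<lambda>s. (X (\<Phi> s x) - X (\<Phi> (s - t) z), d (\<Phi> s x))) s
      = (\<Phi> s x - \<Phi> (s - t) z, prim (\<lambda>s. d (\<Phi> s x)) s)" for s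
    proof -
      have "prim (\<lambda>s. X (\<Phi> s x) - X (\<Phi> (s - t) z)) s = prim (\<lambda>s. X (\<Phi> s x)) s - (\<Phi> (s - t) z - \<Phi> (- t) z)"
        unfolding prim_diff[OF lbx lbzt] zshift ..
      then have "x - \<Phi> (- t) z + prim (\<lambda>s. X (\<Phi> s x) - X (\<Phi> (s - t) z)) s = (x + prim (\<lambda>s. X (\<Phi> s x)) s) - \<Phi> (s - t) z"
        by simp
      also have "\<dots> = \<Phi> s x - \<Phi> (s - t) z" by (simp only: fx[rule_format, symmetric])
      finally show ?thesis by (simp only: prim_Pair(1)[OF lbu lbd] add_Pair add_0)
    qed
    define F' where "F' p v = K (fst p) * (snd v * exp (snd p)) + K' (fst p) (fst v) * exp (snd p)" for p v :: "'a \<times> real"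
    have dF: "((\<lambda>p. K (fst p) * exp (snd p)) has_derivative F' p) (at p)" for p
      unfolding F'_def
      by (intro has_derivative_mult has_derivative_compose[OF has_derivative_fst[OF has_derivative_ident] dK])
         (auto intro!: derivative_eq_intros simp: mult.commute)
    have cF: "continuous_on UNIV (\<lambda>p. F' p v)" for v
      unfolding F'_def
      by (intro continuous_intros continuous_on_compose2[OF cK] continuous_on_compose2[OF cK']) auto
    have "K (\<Phi> t x - \<Phi> (t - t) z) * jac d \<Phi> t x = K (x - \<Phi> (- t) z)
      + prim (\<lambda>s. F' (\<Phi> s x - \<Phi> (s - t) z, prim (\<lambda>s. d (\<Phi> s x)) s) (X (\<Phi> s x) - X (\<Phi> (s - t) z), d (\<Phi> s x))) t"
      using chain_rule_prim(1)[OF dF cF prim_Pair(2)[OF lbu lbd], of "(x - \<Phi> (- t) z, 0)" t]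
      unfolding curve by (simp add: jac_def)
    moreover have "(\<lambda>s. F' (\<Phi> s x - \<Phi> (s - t) z, prim (\<lambda>s. d (\<Phi> s x)) s) (X (\<Phi> s x) - X (\<Phi> (s - t) z), d (\<Phi> s x)))
      = (\<lambda>s. jac d \<Phi> s x * H z s)"
      by (simp add: F'_def H_def jac_def fun_eq_iff algebra_simps)
    moreover have "(\<integral>s. f (s, z) \<partial>lborel) = prim (\<lambda>s. jac d \<Phi> s x * H z s) t" by (simp add: f_def prim_def)
    ultimately show "K (\<Phi> t x - z) * jac d \<Phi> t x - K (x - \<Phi> (- t) z) = (\<integral>s. f (s, z) \<partial>lborel)"
      using z0 by simp
  qed
  have i1: "integrable lborel (\<lambda>z. K (\<Phi> t x - z) * jac d \<Phi> t x)"
  proof -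
    have "integrable lborel (\<lambda>z. K (\<Phi> t x - z) *\<^sub>R jac d \<Phi> t x)"
      by (rule conv_integrable[OF bK loc1_bounded[where c="\<bar>jac d \<Phi> t x\<bar>"]]) auto
    then show ?thesis by simp
  qed
  have i2: "integrable lborel (\<lambda>z. K (x - \<Phi> (- t) z))"
  proof (rule bounded_support_integrable[where B=B and R=R0])
    show "(\<lambda>z. K (x - \<Phi> (- t) z)) \<in> borel_measurable borel" by measurable
    show "norm (K (x - \<Phi> (- t) z)) \<le> B" for z using B(2) by simp
    have x0: "\<Phi> 0 x = x" using fx[rule_format, of 0] by (simp only: prim_0 add_0_right)
    show "K (x - \<Phi> (- t) z) = 0" if "norm z > R0" for z
      using far[of 0 z] that K0[of "x - \<Phi> (- t) z"] x0 by (simp add: R0_def)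
  qed
  have Fub: "(\<integral>z. \<integral>s. f (s, z) \<partial>lborel \<partial>lborel) = (\<integral>s. \<integral>z. f (s, z) \<partial>lborel \<partial>lborel)"
    using lborel_Fubini[OF intf] by simp
  have fzm: "(\<lambda>z. \<integral>s. f (s, z) \<partial>lborel) \<in> borel_measurable borel"
  proof -
    have "(\<lambda>(z, s). f (s, z)) \<in> borel_measurable (borel \<Otimes>\<^sub>M lborel)"
    proof -
      have "(\<lambda>p::'a \<times> real. (snd p, fst p)) \<in> borel \<Otimes>\<^sub>M lborel \<rightarrow>\<^sub>M borel \<Otimes>\<^sub>M borel" by measurable
      from measurable_compose[OF this fm'] show ?thesis by (simp add: case_prod_unfold)
    qed
    then show ?thesis by (rule lborel.borel_measurable_lebesgue_integral)
  qed
  \<comment> \<open>The two end points. At s = t the second curve is at z, and the integral of K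
    over z is 1; at s = 0 it is at \<open>\<Phi> (- t) z\<close>, and the image measure has density
    \<xi>.\<close>
  have "jac d \<Phi> t x - conv K \<xi> x = (\<integral>z. K (\<Phi> t x - z) * jac d \<Phi> t x - K (x - \<Phi> (- t) z) \<partial>lborel)"
  proof -
    have "(\<integral>z. K (\<Phi> t x - z) * jac d \<Phi> t x \<partial>lborel) = jac d \<Phi> t x"
      using integral_scaled[of k e "\<Phi> t x"] e k(2) by (simp add: K_def)
    moreover have "(\<integral>z. K (x - \<Phi> (- t) z) \<partial>lborel) = conv K \<xi> x"
      using integral_distr_density[of "\<lambda>w. K (x - w)" "\<Phi> (- t)" \<xi>] dist \<xi>0 by (simp add: conv_def)
    ultimately show ?thesis using i1 i2 by simp
  qed
  also have "\<dots> = (\<integral>z. \<integral>s. f (s, z) \<partial>lborel \<partial>lborel)"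
    by (rule integral_cong_AE) (use id i1 i2 fzm in auto)
  also have "\<dots> = (\<integral>s. kern t s *\<^sub>R (jac d \<Phi> s x * Qc k k' X d \<Phi> e (t - s) (\<Phi> s x)) \<partial>lborel)"
    unfolding Fub by (simp add: f_def Qc_def H_def K_def K'_def scaled_def)
  finally show "jac d \<Phi> t x - conv (scaled k e) \<xi> x = prim (\<lambda>s. jac d \<Phi> s x * Qc k k' X d \<Phi> e (t - s) (\<Phi> s x)) t"
    by (simp add: prim_def K_def)
qed

lemma nL_measurable:
  fixes q :: "real \<Rightarrow> 'a::euclidean_space \<Rightarrow> real"
  assumes [measurable]: "(\<lambda>(s, y). q s y) \<in> borel_measurable (borel \<Otimes>\<^sub>M borel)"
  shows "(\<lambda>s. nL R (q s)) \<in> borel_measurable borel"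
  unfolding nL_def by measurable

text \<open>The difference between \<open>jac\<close> and the mollified density is an integral over
  time of commutators along trajectories. For each time the commutator tends to 0 by
  \<open>commutator_bound\<close> and translation continuity; since the rate may depend on the time,
  a bound uniform in time and dominated convergence finish the argument.\<close>

lemma jac_is_density:
  fixes X :: "'a::euclidean_space \<Rightarrow> 'a"
  assumes X: "weak_partials X G" and XM: "\<And>x. norm (X x) \<le> M"
    and dm: "d \<in> borel_measurable borel" and D: "\<And>z. \<bar>d z\<bar> \<le> D"
    and dG: "AE z in lborel. d z = tr (weak_D G z)" and \<Phi>: "good_flow X M \<Phi>"
  shows "distr lborel borel (\<Phi> (- t)) = density lborel (\<lambda>x. ennreal (jac d \<Phi> t x))"
proof -
  have Xm[measurable]: "X \<in> borel_measurable borel" using weak_partials_loc1(1)[OF X] by auto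
  have M0: "M \<ge> 0" using XM norm_ge_zero order_trans by blast
  have Gm[measurable]: "G b \<in> borel_measurable borel" if "b \<in> Basis" for b
    using weak_partials_loc1(2)[OF X that] by auto
  note \<Phi>m = good_flow_measurable[OF \<Phi>]
  obtain k :: "'a \<Rightarrow> real" where "mollifier k" using mollifier_exists by blast
  then have k: "k \<in> Cc_inf" "integral\<^sup>L lborel k = 1" and kb: "bump 1 k"
    using mollifier_bump by (auto simp: mollifier_def)
  define k' where "k' x = frechet_derivative k (at x)" for x
  have dk: "(k has_derivative k' x) (at x)" for x
    unfolding k'_def by (rule Ck_SucD(1)[OF Cc_inf_D(1)[OF k(1)]])
  have ck: "continuous_on UNIV (\<lambda>x. k' x v)" for v
    unfolding k'_def using Ck_SucD(2)[OF Cc_inf_D(1)[OF k(1)], of 0] by simp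
  define e where "e n = inverse (real (Suc n))" for n
  have e: "e n > 0" "e n \<le> 1" for n by (auto simp: e_def divide_simps)
  have e0: "e \<longlonglongrightarrow> 0" unfolding e_def by (rule LIMSEQ_inverse_real_of_nat)
  \<comment> \<open>The commutator is evaluated at the times t - s with
    \<open>\<bar>s\<bar> \<le> \<bar>t\<bar>\<close>, which reach
    \<open>2 * \<bar>t\<bar>\<close>.\<close>
  define T where "T = 2 * \<bar>t\<bar> + 1"
  have T: "T > 0" by (simp add: T_def)
  obtain C where C: "C > 0" "\<And>s A. \<bar>s\<bar> \<le> T \<Longrightarrow> A \<in> sets borel \<Longrightarrow> emeasure lborel (\<Phi> s -` A) \<le> ennreal C * emeasure lborel A"
    using good_flowD(3)[OF \<Phi> T] by blast
  have "\<exists>\<xi>. \<xi> \<in> borel_measurable borel \<and> (\<forall>x. 0 \<le> \<xi> x) \<and> (\<forall>x. \<xi> x \<le> C) \<and>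
      distr lborel borel (\<Phi> (- r)) = density lborel (\<lambda>x. ennreal (\<xi> x))" if "\<bar>r\<bar> \<le> T" for r
  proof -
    have r: "\<bar>- r\<bar> \<le> T" using that by simp
    show ?thesis
      by (rule bounded_density_exists[OF \<Phi>m(2)[of "- r"] less_imp_le[OF C(1)] C(2)[OF r]]) auto
  qed
  \<comment> \<open>The densities are chosen separately for each r, so nothing is known about their
    dependence on r. Measurability in time is therefore read off from \<open>Qc\<close>, which is
    written with the flow itself.\<close>
  then obtain \<xi> where \<xi>: "\<And>r. \<bar>r\<bar> \<le> T \<Longrightarrow> \<xi> r \<in> borel_measurable borel" "\<And>r x. \<bar>r\<bar> \<le> T \<Longrightarrow> 0 \<le> \<xi> r x"
    "\<And>r x. \<bar>r\<bar> \<le> T \<Longrightarrow> \<xi> r x \<le> C" "\<And>r. \<bar>r\<bar> \<le> T \<Longrightarrow> distr lborel borel (\<Phi> (- r)) = density lborel (\<lambda>x. ennreal (\<xi> r x))"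
    by metis
  have \<xi>C: "\<bar>\<xi> r x\<bar> \<le> C" if "\<bar>r\<bar> \<le> T" for r x using \<xi>(2,3)[OF that, of x] by simp
  define g where "g y = (\<Sum>b\<in>Basis. norm (G b y))" for y
  have g1: "loc1 g"
    unfolding g_def
  proof (rule loc1_sum)
    fix b :: 'a assume "b \<in> Basis"
    then show "loc1 (\<lambda>y. norm (G b y))" using loc1_le[OF weak_partials_loc1(2)[OF X], of b "\<lambda>y. norm (G b y)" 1] by auto
  qed
  note [measurable] = loc1_measurable[OF g1]
  have g0: "g y \<ge> 0" for y by (simp add: g_def sum_nonneg)
  define \<kappa> where "\<kappa> v = (\<Sum>b\<in>Basis. norm (k' v b)) + \<bar>k v\<bar>" for v
  define K where "K = (\<integral>\<^sup>+v. ennreal (\<kappa> v) \<partial>lborel)"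
  have K: "K < top"
  proof -
    have "bump 1 \<kappa>" unfolding \<kappa>_def using kb bump_derivative[OF dk ck kb] by (auto simp: bump_def intro!: continuous_intros)
    then have "(\<integral>\<^sup>+v. ennreal \<bar>\<kappa> v\<bar> \<partial>lborel) < top" by (rule bump_nn_integral_finite)
    moreover have "\<bar>\<kappa> v\<bar> = \<kappa> v" for v by (simp add: \<kappa>_def sum_nonneg add_nonneg_nonneg)
    ultimately show ?thesis by (simp add: K_def)
  qed
  define a where "a R h = nL R (\<lambda>y. \<Sum>b\<in>Basis. norm (G b (y + h) - G b y))" for R and h :: 'a
  have a0: "((\<lambda>h. a R h) \<longlongrightarrow> 0) (nhds 0)" for R
  proof -
    have "((\<lambda>h. \<Sum>b\<in>Basis. nL R (\<lambda>y. G b (y + h) - G b y)) \<longlongrightarrow> (\<Sum>b\<in>(Basis::'a set). 0)) (nhds 0)"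
      by (intro tendsto_sum nL_translation_tendsto_0 weak_partials_loc1(2)[OF X])
    then have "((\<lambda>h. \<Sum>b\<in>Basis. nL R (\<lambda>y. G b (y + h) - G b y)) \<longlongrightarrow> 0) (nhds 0)" by simp
    moreover have "a R h \<le> (\<Sum>b\<in>Basis. nL R (\<lambda>y. G b (y + h) - G b y))" for h
    proof -
      have "a R h \<le> (\<Sum>b\<in>Basis. nL R (\<lambda>y. norm (G b (y + h) - G b y)))"
        unfolding a_def by (rule nL_sum_le) auto
      also have "\<dots> = (\<Sum>b\<in>Basis. nL R (\<lambda>y. G b (y + h) - G b y))" by (simp add: nL_def)
      finally show ?thesis .
    qed
    ultimately show ?thesis by (rule ennreal_tendsto_0_le)
  qed
  \<comment> \<open>Here the gradient g is unbounded and the increment of the density tends to 0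
    only in \<open>L\<^sup>1\<close>; boundedness of the densities makes the product small.\<close>
  define b where "b R r h = nL R (\<lambda>y. g y * (\<xi> r (y + h) - \<xi> r y))" for R r and h :: 'a
  have b0: "((\<lambda>h. b R r h) \<longlongrightarrow> 0) (nhds 0)" if r: "\<bar>r\<bar> \<le> T" for R r
  proof -
    note [measurable] = \<xi>(1)[OF r]
    have "((\<lambda>h. nL R (\<lambda>y. norm (g y) * norm (\<xi> r (y + h) - \<xi> r y))) \<longlongrightarrow> 0) (nhds 0)"
    proof (rule nL_mult_tendsto_0[OF g1, where M="2*C"])
      show "norm (\<xi> r (y + h) - \<xi> r y) \<le> 2 * C" for h y
        using \<xi>C[OF r, of "y + h"] \<xi>C[OF r, of y] by (simp add: abs_if split: if_splits)
      show "((\<lambda>h. nL R (\<lambda>y. \<xi> r (y + h) - \<xi> r y)) \<longlongrightarrow> 0) (nhds 0)"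
        by (rule nL_translation_tendsto_0[OF loc1_bounded[where c=C]]) (use \<xi>C[OF r] in auto)
    qed measurable
    then show ?thesis by (simp add: b_def nL_def abs_mult)
  qed
  define Q where "Q n r = Qc k k' X d \<Phi> (e n) r" for n r
  have Qle: "nL R (Q n r) \<le> K * (ennreal C * \<alpha> + \<beta>)"
    if r: "\<bar>r\<bar> \<le> T" and \<alpha>: "\<And>h. norm h \<le> e n \<Longrightarrow> a R h \<le> \<alpha>" and \<beta>: "\<And>h. norm h \<le> e n \<Longrightarrow> b R r h \<le> \<beta>" for R r n \<alpha> \<beta>
  proof -
    note [measurable] = \<xi>(1)[OF r] \<Phi>m(2)[of "- r"] dm
    have [measurable]: "k \<in> borel_measurable borel" using kb by auto
    have "Q n r y = (\<integral>w. (k' ((y - w) /\<^sub>R e n) (X y - X w) / e n ^ DIM('a) / e n + k ((y - w) /\<^sub>R e n) / e n ^ DIM('a) * d y) * \<xi> r w \<partial>lborel)" for y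
      unfolding Q_def Qc_def
    proof (rule integral_distr_density[where f="\<lambda>w. k' ((y - w) /\<^sub>R e n) (X y - X w) / e n ^ DIM('a) / e n + k ((y - w) /\<^sub>R e n) / e n ^ DIM('a) * d y", OF _ _ _ \<xi>(2)[OF r] \<xi>(4)[OF r]])
      have [measurable]: "(\<lambda>w. k' ((y - w) /\<^sub>R e n) (X y - X w)) \<in> borel_measurable borel"
        by (rule derivative_measurable[OF has_derivative_linear[OF dk] ck]) measurable
      show "(\<lambda>w. k' ((y - w) /\<^sub>R e n) (X y - X w) / e n ^ DIM('a) / e n + k ((y - w) /\<^sub>R e n) / e n ^ DIM('a) * d y) \<in> borel_measurable borel"
        by measurable
    qed measurable
    then have "nL R (Q n r) = nL R (\<lambda>y. \<integral>w. (k' ((y - w) /\<^sub>R e n) (X y - X w) / e n ^ DIM('a) / e n + k ((y - w) /\<^sub>R e n) / e n ^ DIM('a) * d y) * \<xi> r w \<partial>lborel)"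
      by presburger
    also have "\<dots> \<le> K * (ennreal C * \<alpha> + \<beta>)"
      unfolding K_def \<kappa>_def
      by (rule commutator_bound[OF X XM dm dG \<xi>(1)[OF r] \<xi>C[OF r] e(1) dk ck kb \<alpha>[unfolded a_def] \<beta>[unfolded b_def g_def]])
    finally show ?thesis .
  qed
  have Q0: "(\<lambda>n. nL R (Q n r)) \<longlonglongrightarrow> 0" if r: "\<bar>r\<bar> \<le> T" for R r
  proof (rule ennreal_tendsto_0I)
    fix \<eta> :: real assume \<eta>: "\<eta> > 0"
    obtain K0 where K0: "K = ennreal K0" "K0 \<ge> 0" using K by (cases K) auto
    \<comment> \<open>Chosen so that \<open>K0 * (C * \<eta>' + \<eta>')\<close> is at most \<eta>;
      the added 1's keep the denominator positive.\<close>
    define \<eta>' where "\<eta>' = \<eta> / ((K0 + 1) * (C + 1))"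
    have \<eta>': "\<eta>' > 0" using \<eta> K0 C by (simp add: \<eta>'_def)
    have "\<forall>\<^sub>F h in nhds 0. a R h \<le> ennreal \<eta>' \<and> b R r h \<le> ennreal \<eta>'"
      by (intro eventually_conj ennreal_tendsto_0D[OF a0 \<eta>'] ennreal_tendsto_0D[OF b0[OF r] \<eta>'])
    then obtain \<delta> where \<delta>: "\<delta> > 0" "\<And>h. norm h < \<delta> \<Longrightarrow> a R h \<le> ennreal \<eta>' \<and> b R r h \<le> ennreal \<eta>'"
      by (auto simp: eventually_nhds_metric)
    from order_tendstoD(2)[OF e0 \<delta>(1)] show "\<forall>\<^sub>F n in sequentially. nL R (Q n r) \<le> ennreal \<eta>"
    proof eventually_elim
      fix n assume n: "e n < \<delta>"
      have "nL R (Q n r) \<le> K * (ennreal C * ennreal \<eta>' + ennreal \<eta>')"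
        by (rule Qle[OF r]) (use \<delta>(2) n in auto)
      also have "\<dots> = ennreal (K0 * (C * \<eta>' + \<eta>'))"
        using K0 C \<eta>' by (simp add: ennreal_mult ennreal_plus)
      also have "\<dots> \<le> ennreal \<eta>"
      proof (rule ennreal_leI)
        have "K0 * (C * \<eta>' + \<eta>') \<le> (K0 + 1) * (C * \<eta>' + \<eta>')" using C \<eta>' by (intro mult_right_mono) auto
        also have "\<dots> = (K0 + 1) * (C + 1) * \<eta>'" by (simp add: algebra_simps)
        also have "\<dots> = \<eta>" using K0 C by (simp add: \<eta>'_def)
        finally show "K0 * (C * \<eta>' + \<eta>') \<le> \<eta>" .
      qed
      finally show "nL R (Q n r) \<le> ennreal \<eta>" .
    qed
  qed
  \<comment> \<open>The moduli are bounded crudely, by the triangle inequality for g and by 2 C for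
    the densities. As e is at most 1, the result depends neither on n nor on r and serves as the
    dominating constant.\<close>
  have Qbd: "nL R (Q n r) \<le> K * (ennreal C * (nL (R + 1) g + nL R g) + ennreal (2 * C) * nL R g)" if r: "\<bar>r\<bar> \<le> T" for R r n
  proof (rule Qle[OF r])
    fix h :: 'a assume h: "norm h \<le> e n"
    note [measurable] = \<xi>(1)[OF r]
    have "a R h \<le> nL R (\<lambda>y. g (y + h)) + nL R g"
      unfolding a_def
    proof (rule nL_add_le)
      fix y
      have "(\<Sum>b\<in>Basis. norm (G b (y + h) - G b y)) \<le> (\<Sum>b\<in>Basis. norm (G b (y + h)) + norm (G b y))"
        by (intro sum_mono norm_triangle_ineq4)
      then show "norm (\<Sum>b\<in>Basis. norm (G b (y + h) - G b y)) \<le> norm (g (y + h)) + norm (g y)"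
        using g0[of y] g0[of "y + h"] by (simp add: sum_nonneg g_def sum.distrib)
    qed measurable
    also have "nL R (\<lambda>y. g (y + h)) \<le> nL (R + norm h) g" by (rule nL_shift) measurable
    also have "\<dots> \<le> nL (R + 1) g" by (rule nL_mono_radius) (use h e(2)[of n] in linarith)
    finally show "a R h \<le> nL (R + 1) g + nL R g" by (simp add: add_right_mono)
    show "b R r h \<le> ennreal (2 * C) * nL R g"
      unfolding b_def
    proof (rule nL_cmult_le)
      fix y
      have "\<bar>\<xi> r (y + h) - \<xi> r y\<bar> \<le> 2 * C"
        using \<xi>C[OF r, of "y + h"] \<xi>C[OF r, of y] by (simp add: abs_if split: if_splits)
      then have "\<bar>g y\<bar> * \<bar>\<xi> r (y + h) - \<xi> r y\<bar> \<le> \<bar>g y\<bar> * (2 * C)" by (rule mult_left_mono) simp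
      then show "norm (g y * (\<xi> r (y + h) - \<xi> r y)) \<le> 2 * C * norm (g y)" by (simp add: abs_mult mult_ac)
    qed (use C in auto)
  qed
  have tT: "\<bar>t\<bar> \<le> T" by (simp add: T_def)
  note [measurable] = jac_measurable[OF dm \<Phi>] \<xi>(1)[OF tT]
  define W where "W = exp (D * \<bar>t\<bar>)"
  have "nL R (\<lambda>x. jac d \<Phi> t x - \<xi> t x) \<le> 0" for R
  proof (rule LIMSEQ_le_const)
    define R' where "R' = R + M * \<bar>t\<bar>"
    define B where "B = ennreal W * (ennreal C * (K * (ennreal C * (nL (R' + 1) g + nL R' g) + ennreal (2 * C) * nL R' g)))"
    have B: "B < top"
      unfolding B_def using K loc1_finite[OF g1, of R'] loc1_finite[OF g1, of "R' + 1"]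
      by (simp add: ennreal_mult_less_top)
    define I where "I n = (\<integral>\<^sup>+s. indicator {-\<bar>t\<bar>..\<bar>t\<bar>} s * (ennreal W * (ennreal C * nL R' (Q n (t - s)))) \<partial>lborel)" for n
    have Qm: "(\<lambda>(s, y). Q n (t - s) y) \<in> borel_measurable (borel \<Otimes>\<^sub>M borel)" for n
      unfolding Q_def by (rule Qc_measurable[OF \<Phi> Xm dm dk ck])
    have rt: "\<bar>t - s\<bar> \<le> T" if "\<bar>s\<bar> \<le> \<bar>t\<bar>" for s using that by (simp add: T_def)
    have "I \<longlonglongrightarrow> (\<integral>\<^sup>+s. 0 \<partial>(lborel::real measure))"
      unfolding I_def
    proof (rule nn_integral_dominated_convergence[where w="\<lambda>s. B * indicator {-\<bar>t\<bar>..\<bar>t\<bar>} s"])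
      note [measurable] = nL_measurable[OF Qm]
      show "(\<lambda>s. indicator {-\<bar>t\<bar>..\<bar>t\<bar>} s * (ennreal W * (ennreal C * nL R' (Q n (t - s))))) \<in> borel_measurable lborel" for n
        by measurable
      show "AE s in lborel. indicator {-\<bar>t\<bar>..\<bar>t\<bar>} s * (ennreal W * (ennreal C * nL R' (Q n (t - s)))) \<le> B * indicator {-\<bar>t\<bar>..\<bar>t\<bar>} s" for n
        unfolding B_def by (intro AE_I2) (auto simp: indicator_def abs_le_iff intro!: mult_left_mono Qbd rt)
      show "(\<integral>\<^sup>+s. B * indicator {-\<bar>t\<bar>..\<bar>t\<bar>} s \<partial>lborel) < \<infinity>"
        using B by (simp add: nn_integral_cmult_indicator ennreal_mult_less_top)
      show "AE s in lborel. (\<lambda>n. indicator {-\<bar>t\<bar>..\<bar>t\<bar>} s * (ennreal W * (ennreal C * nL R' (Q n (t - s))))) \<longlonglongrightarrow> 0"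
      proof (intro AE_I2)
        fix s
        show "(\<lambda>n. indicator {-\<bar>t\<bar>..\<bar>t\<bar>} s * (ennreal W * (ennreal C * nL R' (Q n (t - s))))) \<longlonglongrightarrow> 0"
        proof (cases "\<bar>s\<bar> \<le> \<bar>t\<bar>")
          case True
          have "(\<lambda>n. ennreal W * (ennreal C * nL R' (Q n (t - s)))) \<longlonglongrightarrow> 0"
            by (intro ennreal_tendsto_0_cmult Q0 rt True) auto
          then show ?thesis using True by (simp add: indicator_def abs_le_iff)
        next
          case False
          then have "s \<notin> {-\<bar>t\<bar>..\<bar>t\<bar>}" by auto
          then show ?thesis by simp
        qed
      qed
    qed measurable
    then have I0: "I \<longlonglongrightarrow> 0" by simp
    have \<xi>1: "loc1 (\<xi> t)" by (rule loc1_bounded[where c=C]) (use \<xi>C[OF tT] in auto)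
    have kbm[measurable]: "k \<in> borel_measurable borel" using kb by auto
    have ce: "conv (scaled k (e n)) (\<xi> t) = moll k (e n) (\<xi> t)" for n
      by (rule conv_scaled_eq_moll) (use e in auto)
    have m0: "(\<lambda>n. nL R (\<lambda>x. moll k (e n) (\<xi> t) x - \<xi> t x)) \<longlonglongrightarrow> 0"
      using filterlim_compose[OF moll_tendsto[OF kb k(2) \<xi>1, of R] sequence_at_right_0] by (simp add: e_def)
    show "(\<lambda>n. I n + nL R (\<lambda>x. moll k (e n) (\<xi> t) x - \<xi> t x)) \<longlonglongrightarrow> 0"
      using tendsto_add[OF I0 m0] by simp
    have "nL R (\<lambda>x. jac d \<Phi> t x - \<xi> t x) \<le> I n + nL R (\<lambda>x. moll k (e n) (\<xi> t) x - \<xi> t x)" for n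
    proof -
      have "nL R (\<lambda>x. jac d \<Phi> t x - \<xi> t x) \<le> nL R (\<lambda>x. jac d \<Phi> t x - moll k (e n) (\<xi> t) x) + nL R (\<lambda>x. moll k (e n) (\<xi> t) x - \<xi> t x)"
      proof (rule nL_add_le)
        show "norm (jac d \<Phi> t x - \<xi> t x) \<le> norm (jac d \<Phi> t x - moll k (e n) (\<xi> t) x) + norm (moll k (e n) (\<xi> t) x - \<xi> t x)" for x
          using norm_triangle_ineq[of "jac d \<Phi> t x - moll k (e n) (\<xi> t) x" "moll k (e n) (\<xi> t) x - \<xi> t x"] by simp
      qed measurable
      also have "nL R (\<lambda>x. jac d \<Phi> t x - moll k (e n) (\<xi> t) x) = nL R (\<lambda>x. prim (\<lambda>s. jac d \<Phi> s x * Q n (t - s) (\<Phi> s x)) t)"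
      proof (rule nL_cong_AE)
        show "AE x in lborel. norm (jac d \<Phi> t x - moll k (e n) (\<xi> t) x) = norm (prim (\<lambda>s. jac d \<Phi> s x * Q n (t - s) (\<Phi> s x)) t)"
          using jac_mollified_identity[OF \<Phi> Xm XM dm D dk ck kb k(2) e(1)[of n] \<xi>(1)[OF tT] \<xi>(2)[OF tT] \<xi>(4)[OF tT]]
          unfolding ce Q_def by eventually_elim (rule arg_cong)
      qed
      also have "\<dots> \<le> I n"
        unfolding I_def R'_def
      proof (rule nL_prim_flow_le[OF \<Phi> M0 Qm jac_measurable(1)[OF dm \<Phi>]])
        show "\<bar>jac d \<Phi> s x\<bar> \<le> W" if "\<bar>s\<bar> \<le> \<bar>t\<bar>" for s x
          using jac_bounds[OF dm D \<Phi> that, of x] by (simp add: W_def)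
        show "emeasure lborel (\<Phi> s -` A) \<le> ennreal C * emeasure lborel A" if "\<bar>s\<bar> \<le> \<bar>t\<bar>" "A \<in> sets borel" for s A
          by (rule C(2)) (use that in \<open>auto simp: T_def\<close>)
      qed simp
      finally show ?thesis by (simp add: add_right_mono)
    qed
    then show "\<exists>N. \<forall>n\<ge>N. nL R (\<lambda>x. jac d \<Phi> t x - \<xi> t x) \<le> I n + nL R (\<lambda>x. moll k (e n) (\<xi> t) x - \<xi> t x)"
      by blast
  qed
  then have "AE x in lborel. jac d \<Phi> t x - \<xi> t x = 0"
    by (intro nL_eq_0_imp_AE) auto
  then have "AE x in lborel. ennreal (\<xi> t x) = ennreal (jac d \<Phi> t x)" by eventually_elim simp
  then have "density lborel (\<lambda>x. ennreal (\<xi> t x)) = density lborel (\<lambda>x. ennreal (jac d \<Phi> t x))"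
    by (intro density_cong) auto
  then show ?thesis using \<xi>(4)[OF tT] by simp
qed


subsection \<open>Borel representatives of the data\<close>

text \<open>Ties every weak divergence, in particular the one selected by the choice in
  \<open>divergence\<close>, to the weak gradient, up to a null set.\<close>

lemma weak_divergence_eq_trace:
  fixes X X0 :: "'a::euclidean_space \<Rightarrow> 'a"
  assumes X: "weak_partials X G" and X0: "AE x in lborel. X0 x = X x" and d: "has_weak_divergence X0 d"
  shows "AE x in lborel. d x = tr (weak_D G x)"
proof -
  have Xm[measurable]: "X \<in> borel_measurable borel" using weak_partials_loc1(1)[OF X] by auto
  have "loc_integrable d" using d by (simp add: has_weak_divergence_def)
  then obtain f where f: "loc1 f" "AE x in lborel. d x = f x" by (rule loc_integrable_borel_version)
  have [measurable]: "f \<in> borel_measurable borel" using f(1) by auto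
  have tr1: "loc1 (\<lambda>x. tr (weak_D G x))"
    unfolding tr_def
  proof (rule loc1_sum)
    fix b :: 'a assume b: "b \<in> Basis"
    have l: "loc1 (\<lambda>x. weak_D G x b)" by (rule weak_D_loc1[OF X])
    then have [measurable]: "(\<lambda>x. weak_D G x b) \<in> borel_measurable borel" by auto
    show "loc1 (\<lambda>x. weak_D G x b \<bullet> b)"
      by (rule loc1_le[OF l, where c=1]) (use b in \<open>auto simp: Basis_le_norm\<close>)
  qed
  have "AE x in lborel. f x - tr (weak_D G x) = 0"
  proof (rule AE_zero_by_Cc_inf[OF loc1_diff[OF f(1) tr1]])
    fix \<psi> :: "'a \<Rightarrow> real" assume \<psi>: "\<psi> \<in> Cc_inf"
    obtain r where r: "bump r \<psi>" using Cc_inf_bump[OF \<psi>] by blast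
    have d\<psi>: "(\<psi> has_derivative frechet_derivative \<psi> (at z)) (at z)" for z
      by (rule Ck_SucD(1)[OF Cc_inf_D(1)[OF \<psi>]])
    have c\<psi>: "continuous_on UNIV (\<lambda>z. frechet_derivative \<psi> (at z) v)" for v
      using Ck_SucD(2)[OF Cc_inf_D(1)[OF \<psi>], of 0] by simp
    have rD: "bump r (\<lambda>z. frechet_derivative \<psi> (at z) v)" for v by (rule bump_derivative[OF d\<psi> c\<psi> r])
    note lin = has_derivative_linear[OF d\<psi>]
    have [measurable]: "\<psi> \<in> borel_measurable borel" using r by auto
    have m: "(\<lambda>x. frechet_derivative \<psi> (at x) (X x)) \<in> borel_measurable borel"
      using derivative_measurable[OF lin c\<psi>, of "\<lambda>x. x" borel X] by simp
    have i1: "integrable lborel (\<lambda>x. frechet_derivative \<psi> (at x) b *\<^sub>R X x)" for b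
      by (rule bump_integrable[OF rD weak_partials_loc1(1)[OF X]])
    have "(\<integral>x. frechet_derivative \<psi> (at x) (X x) \<partial>lborel) = (\<integral>x. (\<Sum>b\<in>Basis. (frechet_derivative \<psi> (at x) b *\<^sub>R X x) \<bullet> b) \<partial>lborel)"
      by (rule Bochner_Integration.integral_cong[OF refl], subst linear_apply_sum[OF lin]) (simp add: mult.commute)
    also have "\<dots> = (\<Sum>b\<in>Basis. (\<integral>x. frechet_derivative \<psi> (at x) b *\<^sub>R X x \<partial>lborel) \<bullet> b)"
      using i1 by (subst Bochner_Integration.integral_sum) (auto intro!: sum.cong integral_inner_left integrable_inner_left simp del: inner_scaleR_left)
    also have "\<dots> = (\<Sum>b\<in>Basis. - ((\<integral>x. \<psi> x *\<^sub>R G b x \<partial>lborel) \<bullet> b))"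
      using X \<psi> by (intro sum.cong) (auto simp: weak_partials_def)
    also have "\<dots> = - (\<Sum>b\<in>Basis. (\<integral>x. (\<psi> x *\<^sub>R G b x) \<bullet> b \<partial>lborel))"
      using bump_integrable[OF r weak_partials_loc1(2)[OF X]]
      by (simp add: sum_negf integral_inner_left del: inner_scaleR_left)
    also have "(\<Sum>b\<in>Basis. (\<integral>x. (\<psi> x *\<^sub>R G b x) \<bullet> b \<partial>lborel)) = (\<integral>x. (\<Sum>b\<in>Basis. (\<psi> x *\<^sub>R G b x) \<bullet> b) \<partial>lborel)"
      using bump_integrable[OF r weak_partials_loc1(2)[OF X]]
      by (intro Bochner_Integration.integral_sum[symmetric] integrable_inner_left) auto
    also have "\<dots> = (\<integral>x. \<psi> x *\<^sub>R tr (weak_D G x) \<partial>lborel)"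
      by (rule Bochner_Integration.integral_cong[OF refl]) (simp add: tr_def weak_D_Basis sum_distrib_left)
    finally have 1: "(\<integral>x. frechet_derivative \<psi> (at x) (X x) \<partial>lborel) = - (\<integral>x. \<psi> x *\<^sub>R tr (weak_D G x) \<partial>lborel)" .
    have "(LINT x|lebesgue. frechet_derivative \<psi> (at x) (X0 x)) = - (LINT x|lebesgue. \<psi> x * d x)"
      using d \<psi> by (simp add: has_weak_divergence_def)
    moreover have "(LINT x|lebesgue. frechet_derivative \<psi> (at x) (X0 x)) = (\<integral>x. frechet_derivative \<psi> (at x) (X x) \<partial>lborel)"
      by (rule lebesgue_integral_cong_lborel(2)[OF _ m]) (use X0 in \<open>eventually_elim, simp\<close>)
    moreover have "(LINT x|lebesgue. \<psi> x * d x) = (\<integral>x. \<psi> x *\<^sub>R f x \<partial>lborel)"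
    proof (rule lebesgue_integral_cong_lborel(2))
      show "AE x in lborel. \<psi> x * d x = \<psi> x *\<^sub>R f x" using f(2) by eventually_elim simp
    qed measurable
    ultimately have "(\<integral>x. \<psi> x *\<^sub>R f x \<partial>lborel) = (\<integral>x. \<psi> x *\<^sub>R tr (weak_D G x) \<partial>lborel)" using 1 by simp
    then show "(\<integral>x. \<psi> x *\<^sub>R (f x - tr (weak_D G x)) \<partial>lborel) = 0"
      using bump_integrable[OF r f(1)] bump_integrable[OF r tr1] by (simp add: right_diff_distrib)
  qed
  with f(2) show ?thesis by eventually_elim simp
qed

text \<open>Setting the function to 0 where the bound fails makes the bound hold everywhere.
  Primitives along curves then obey their Lipschitz bounds with no exceptional points.\<close>

lemma Linf_borel_version:
  fixes f :: "'a::euclidean_space \<Rightarrow> 'b::euclidean_space"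
  assumes "f \<in> Linf"
  obtains g M where "g \<in> borel_measurable borel" "\<And>x. norm (g x) \<le> M" "AE x in lborel. f x = g x"
proof -
  have fm: "f \<in> borel_measurable lebesgue" using assms by (simp add: Linf_def)
  obtain C where C: "AE x in lborel. norm (f x) \<le> C" using assms by (auto simp: Linf_def AE_lebesgue_iff)
  obtain g where [measurable]: "g \<in> borel_measurable borel" and g: "AE x in lborel. f x = g x"
    by (rule borel_version[OF fm])
  show thesis
  proof (rule that[of "\<lambda>x. if norm (g x) \<le> C then g x else 0" "max C 0"])
    show "AE x in lborel. f x = (if norm (g x) \<le> C then g x else 0)"
      using C g by eventually_elim simp
  qed auto
qed

text \<open>One Borel function d has to represent three objects at once: the bounded divergence of
  the hypothesis, the trace of the weak gradient, and the choice \<open>divergence\<close> that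
  occurs in the bracket.\<close>

lemma field_borel_data:
  fixes X0 :: "'a::euclidean_space \<Rightarrow> 'a"
  assumes W: "X0 \<in> W1p p \<inter> Linf" and bd: "bounded_divergence X0"
  obtains X G M d D where "weak_partials X G" "\<And>x. norm (X x) \<le> M" "AE x in lborel. X0 x = X x"
    "d \<in> borel_measurable borel" "\<And>z. \<bar>d z\<bar> \<le> D" "AE z in lborel. d z = tr (weak_D G z)"
    "AE z in lborel. divergence X0 z = d z"
proof -
  have L: "X0 \<in> Linf" using W by simp
  obtain X M where Xm[measurable]: "X \<in> borel_measurable borel" and XM: "\<And>x. norm (X x) \<le> M"
    and X0: "AE x in lborel. X0 x = X x"
    by (rule Linf_borel_version[OF L], rule that) assumption+
  have "\<forall>b\<in>Basis. \<exists>g. loc1 g \<and> (\<forall>\<psi>\<in>Cc_inf. (\<integral>x. frechet_derivative \<psi> (at x) b *\<^sub>R X x \<partial>lborel) = - (\<integral>x. \<psi> x *\<^sub>R g x \<partial>lborel))"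
  proof
    fix b :: 'a assume b: "b \<in> Basis"
    then obtain g0 where g0: "has_weak_partial X0 b g0" using W by (auto simp: W1p_def)
    then have "loc_integrable g0" by (simp add: has_weak_partial_def)
    then obtain g where g: "loc1 g" "AE x in lborel. g0 x = g x" by (rule loc_integrable_borel_version)
    have [measurable]: "g \<in> borel_measurable borel" using g(1) by auto
    have "(\<integral>x. frechet_derivative \<psi> (at x) b *\<^sub>R X x \<partial>lborel) = - (\<integral>x. \<psi> x *\<^sub>R g x \<partial>lborel)" if \<psi>: "\<psi> \<in> Cc_inf" for \<psi>
    proof -
      have "continuous_on UNIV (\<lambda>z. frechet_derivative \<psi> (at z) b)"
        using Ck_SucD(2)[OF Cc_inf_D(1)[OF \<psi>], of 0] by simp
      then have [measurable]: "(\<lambda>x. frechet_derivative \<psi> (at x) b) \<in> borel_measurable borel"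
        by (rule borel_measurable_continuous_onI)
      have [measurable]: "\<psi> \<in> borel_measurable borel" using Cc_inf_integrable[OF \<psi>] by auto
      have "(LINT x|lebesgue. frechet_derivative \<psi> (at x) b *\<^sub>R X0 x) = (\<integral>x. frechet_derivative \<psi> (at x) b *\<^sub>R X x \<partial>lborel)"
      proof (rule lebesgue_integral_cong_lborel(2))
        show "AE x in lborel. frechet_derivative \<psi> (at x) b *\<^sub>R X0 x = frechet_derivative \<psi> (at x) b *\<^sub>R X x"
          using X0 by eventually_elim simp
      qed measurable
      moreover have "(LINT x|lebesgue. \<psi> x *\<^sub>R g0 x) = (\<integral>x. \<psi> x *\<^sub>R g x \<partial>lborel)"
      proof (rule lebesgue_integral_cong_lborel(2))
        show "AE x in lborel. \<psi> x *\<^sub>R g0 x = \<psi> x *\<^sub>R g x" using g(2) by eventually_elim simp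
      qed measurable
      ultimately show ?thesis using g0 \<psi> by (simp add: has_weak_partial_def)
    qed
    with g(1) show "\<exists>g. loc1 g \<and> (\<forall>\<psi>\<in>Cc_inf. (\<integral>x. frechet_derivative \<psi> (at x) b *\<^sub>R X x \<partial>lborel) = - (\<integral>x. \<psi> x *\<^sub>R g x \<partial>lborel))"
      by blast
  qed
  then obtain G where G: "\<And>b. b \<in> Basis \<Longrightarrow> loc1 (G b)"
    "\<And>b \<psi>. b \<in> Basis \<Longrightarrow> \<psi> \<in> Cc_inf \<Longrightarrow> (\<integral>x. frechet_derivative \<psi> (at x) b *\<^sub>R X x \<partial>lborel) = - (\<integral>x. \<psi> x *\<^sub>R G b x \<partial>lborel)"
    by metis
  have wp: "weak_partials X G"
    unfolding weak_partials_def using loc1_bounded[OF Xm XM] G by blast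
  obtain d0 where d0: "d0 \<in> Linf" "has_weak_divergence X0 d0" using bd by (auto simp: bounded_divergence_def)
  obtain d D where dm: "d \<in> borel_measurable borel" and D: "\<And>x. norm (d x) \<le> D" and dd: "AE x in lborel. d0 x = d x"
    by (rule Linf_borel_version[OF d0(1)], rule that) assumption+
  have "has_weak_divergence X0 (divergence X0)"
    unfolding divergence_def by (rule someI[of "has_weak_divergence X0", OF d0(2)])
  note t = weak_divergence_eq_trace[OF wp X0 this] weak_divergence_eq_trace[OF wp X0 d0(2)]
  show thesis
  proof (rule that[OF wp XM X0 dm])
    show "\<bar>d z\<bar> \<le> D" for z using D[of z] by simp
    show "AE z in lborel. d z = tr (weak_D G z)" using t(2) dd by eventually_elim simp
    show "AE z in lborel. divergence X0 z = d z" using t dd by eventually_elim simp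
  qed
qed

lemma lie_bracket_borel:
  fixes X0 Y0 X Y :: "'a::euclidean_space \<Rightarrow> 'a"
  assumes br: "\<forall>\<phi>\<in>Cc 1. lie_bracket X0 Y0 \<phi> = 0"
    and [measurable]: "X \<in> borel_measurable borel" "Y \<in> borel_measurable borel" "dX \<in> borel_measurable borel" "dY \<in> borel_measurable borel"
    and X: "AE x in lborel. X0 x = X x" and Y: "AE x in lborel. Y0 x = Y x"
    and dX: "AE z in lborel. divergence X0 z = dX z" and dY: "AE z in lborel. divergence Y0 z = dY z"
    and \<psi>: "\<psi> \<in> Cc_inf"
  shows "(\<integral>z. (X z \<bullet> c) * frechet_derivative \<psi> (at z) (Y z) + dY z * (X z \<bullet> c * \<psi> z)
      - (Y z \<bullet> c) * frechet_derivative \<psi> (at z) (X z) - dX z * (Y z \<bullet> c * \<psi> z) \<partial>lborel) = 0"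
proof -
  \<comment> \<open>Test fields with a constant direction c; letting c vary recovers the
    vector-valued statement from scalar test functions.\<close>
  define \<phi> where "\<phi> z = \<psi> z *\<^sub>R c" for z
  have d\<psi>: "(\<psi> has_derivative frechet_derivative \<psi> (at z)) (at z)" for z
    by (rule Ck_SucD(1)[OF Cc_inf_D(1)[OF \<psi>]])
  have c\<psi>: "continuous_on UNIV (\<lambda>z. frechet_derivative \<psi> (at z) v)" for v
    using Ck_SucD(2)[OF Cc_inf_D(1)[OF \<psi>], of 0] by simp
  have "(\<phi> has_derivative (\<lambda>v. frechet_derivative \<psi> (at z) v *\<^sub>R c)) (at z)" for z
    unfolding \<phi>_def by (rule bounded_linear.has_derivative[OF bounded_linear_scaleR_left d\<psi>])
  from frechet_derivative_at[OF this, symmetric]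
  have d\<phi>: "frechet_derivative \<phi> (at z) = (\<lambda>v. frechet_derivative \<psi> (at z) v *\<^sub>R c)" for z .
  obtain r where "\<forall>x. norm x > r \<longrightarrow> \<psi> x = 0" using Cc_inf_D(2)[OF \<psi>] by blast
  then have "\<phi> \<in> Cc_inf"
    unfolding \<phi>_def
    by (intro Cc_infI[where r=r] Ck_linear_comp[OF bounded_linear_scaleR_left] Cc_inf_D(1)[OF \<psi>]) auto
  then have "\<phi> \<in> Cc 1" by (auto simp: Cc_inf_def)
  then have 0: "lie_bracket X0 Y0 \<phi> = 0" using br by blast
  note dm = derivative_measurable[OF has_derivative_linear[OF d\<psi>] c\<psi>]
  have [measurable]: "(\<lambda>z. frechet_derivative \<psi> (at z) (Y z)) \<in> borel_measurable borel"
    "(\<lambda>z. frechet_derivative \<psi> (at z) (X z)) \<in> borel_measurable borel" "\<psi> \<in> borel_measurable borel"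
    using dm[of "\<lambda>z. z" borel Y] dm[of "\<lambda>z. z" borel X] Cc_inf_integrable[OF \<psi>] by auto
  have "lie_bracket X0 Y0 \<phi> = (\<integral>z. (X z \<bullet> c) * frechet_derivative \<psi> (at z) (Y z) + dY z * (X z \<bullet> c * \<psi> z)
      - (Y z \<bullet> c) * frechet_derivative \<psi> (at z) (X z) - dX z * (Y z \<bullet> c * \<psi> z) \<partial>lborel)"
    unfolding lie_bracket_def
  proof (rule lebesgue_integral_cong_lborel(2))
    show "AE z in lborel. X0 z \<bullet> frechet_derivative \<phi> (at z) (Y0 z) + divergence Y0 z * (X0 z \<bullet> \<phi> z)
        - Y0 z \<bullet> frechet_derivative \<phi> (at z) (X0 z) - divergence X0 z * (Y0 z \<bullet> \<phi> z)
      = (X z \<bullet> c) * frechet_derivative \<psi> (at z) (Y z) + dY z * (X z \<bullet> c * \<psi> z)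
      - (Y z \<bullet> c) * frechet_derivative \<psi> (at z) (X z) - dX z * (Y z \<bullet> c * \<psi> z)"
      using X Y dX dY by eventually_elim (simp add: d\<phi> \<phi>_def mult.commute)
  qed measurable
  with 0 show ?thesis by simp
qed


subsection \<open>The determinant of two plane fields\<close>

lemma sum_Basis_vec: "(\<Sum>b\<in>(Basis :: (real^'n) set). f b) = (\<Sum>i\<in>UNIV. f (axis i 1))"
proof -
  have B: "(Basis :: (real^'n) set) = range (\<lambda>i. axis i 1)" by (auto simp: Basis_vec_def)
  have "inj (\<lambda>i::'n. axis i (1::real))" by (auto simp: inj_on_def axis_eq_axis)
  from sum.reindex[OF this, of f] show ?thesis unfolding B by (simp add: o_def)
qed

lemma perp_nth: "perp v $ 1 = - v $ 2" "perp v $ 2 = v $ 1"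
  by (simp_all add: perp_def)

lemma inner_perp: "v \<bullet> perp w = - v $ 1 * w $ 2 + v $ 2 * w $ 1"
  by (simp add: inner_vec_def sum_2 perp_nth)

lemma bounded_linear_perp: "bounded_linear perp"
proof -
  have "linear perp" by (rule linearI) (simp_all add: vec_eq_iff forall_2 perp_nth)
  then show ?thesis by (simp add: linear_conv_bounded_linear)
qed

text \<open>\<open>v \<bullet> perp w\<close> is minus the determinant of the pair v, w. Alternating
  forms on the plane are one-dimensional, so a linear map acts on this one, infinitesimally, by a
  scalar, its trace.\<close>

lemma trace_perp_identity:
  fixes A :: "real^2 \<Rightarrow> real^2"
  assumes "linear A"
  shows "A v \<bullet> perp w + v \<bullet> perp (A w) = tr A * (v \<bullet> perp w)"
proof -
  have A: "A u $ i = u $ 1 * A (axis 1 1) $ i + u $ 2 * A (axis 2 1) $ i" for u i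
    by (subst linear_apply_sum[OF assms]) (simp add: sum_Basis_vec sum_2 inner_axis)
  have "tr A = A (axis 1 1) $ 1 + A (axis 2 1) $ 2" by (simp add: tr_def sum_Basis_vec sum_2 inner_axis)
  then show ?thesis
    by (simp add: inner_perp A[of v 1] A[of v 2] A[of w 1] A[of w 2] algebra_simps)
qed

text \<open>The derivative of Jn along X converges in \<open>L\<^sup>1\<close> to an expression in
  \<open>DX X\<close> and \<open>DY X\<close>. Replacing \<open>DY X\<close> by \<open>DX Y\<close>
  makes it the left side of the trace identity for \<open>DX\<close>, hence d J, which is what
  \<open>transport_along_flow\<close> requires.\<close>

lemma determinant_transport:
  fixes X Y :: "real^2 \<Rightarrow> real^2"
  assumes X: "weak_partials X GX" and XM: "\<And>x. norm (X x) \<le> M"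
    and Y: "weak_partials Y GY" and YM: "\<And>x. norm (Y x) \<le> N"
    and dm: "d \<in> borel_measurable borel" and D: "\<And>z. \<bar>d z\<bar> \<le> D" and dG: "AE z in lborel. d z = tr (weak_D GX z)"
    and comm: "AE z in lborel. weak_D GX z (Y z) = weak_D GY z (X z)" and \<Phi>: "good_flow X M \<Phi>"
  shows "AE z in lborel. X (\<Phi> t z) \<bullet> perp (Y (\<Phi> t z)) = jac d \<Phi> t z * (X z \<bullet> perp (Y z))"
proof -
  have Xm[measurable]: "X \<in> borel_measurable borel" using weak_partials_loc1(1)[OF X] by auto
  obtain Xn DXn M' where xn:
    "\<And>n z. (Xn n has_derivative DXn n z) (at z)" "\<And>n v. continuous_on UNIV (\<lambda>z. DXn n z v)"
    "\<And>n z. norm (Xn n z) \<le> M'" "\<And>x. norm (X x) \<le> M'"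
    "L1cvg Xn X" "\<And>v. L1cvg (\<lambda>n z. DXn n z v) (\<lambda>z. weak_D GX z v)"
    by (rule weak_partials_L1cvg[OF X XM], rule that) assumption+
  obtain Yn DYn N' where yn:
    "\<And>n z. (Yn n has_derivative DYn n z) (at z)" "\<And>n v. continuous_on UNIV (\<lambda>z. DYn n z v)"
    "\<And>n z. norm (Yn n z) \<le> N'" "\<And>x. norm (Y x) \<le> N'"
    "L1cvg Yn Y" "\<And>v. L1cvg (\<lambda>n z. DYn n z v) (\<lambda>z. weak_D GY z v)"
    by (rule weak_partials_L1cvg[OF Y YM], rule that) assumption+
  have bb: "bounded_bilinear (\<lambda>v w. v \<bullet> perp w)"
    by (rule bounded_bilinear.comp[OF bounded_bilinear_inner bounded_linear_ident bounded_linear_perp])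
  \<comment> \<open>In the term where the gradient falls on X, the bounded factor is the second
    argument of the form; the flip puts it first for \<open>L1cvg_bilinear\<close>.\<close>
  note bb' = bounded_bilinear.flip[OF bb]
  \<comment> \<open>The differentials are approximated, but the direction stays the exact field X,
    since that is the velocity of the trajectories.\<close>
  have apply_X: "L1cvg (\<lambda>n z. Dn n z (X z)) (\<lambda>z. weak_D G z (X z))"
    if "\<And>n z. linear (Dn n z)" "\<And>v. L1cvg (\<lambda>n z. Dn n z v) (\<lambda>z. weak_D G z v)" for Dn and G :: "real^2 \<Rightarrow> real^2 \<Rightarrow> real^2"
  proof -
    have "L1cvg (\<lambda>n z. \<Sum>b\<in>Basis. (X z \<bullet> b) *\<^sub>R Dn n z b) (\<lambda>z. \<Sum>b\<in>Basis. (X z \<bullet> b) *\<^sub>R weak_D G z b)"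
    proof (intro L1cvg_sum finite_Basis)
      fix b :: "real^2" assume b: "b \<in> Basis"
      have le: "norm (X z \<bullet> b) \<le> M" for z using order_trans[OF Basis_le_norm[OF b, of "X z"] XM[of z]] by simp
      show "L1cvg (\<lambda>n z. (X z \<bullet> b) *\<^sub>R Dn n z b) (\<lambda>z. (X z \<bullet> b) *\<^sub>R weak_D G z b)"
        by (rule L1cvg_bilinear[OF bounded_bilinear_scaleR L1cvg_const[OF loc1_bounded[where c=M]] that(2), where M=M])
           (use le in auto)
    qed
    moreover have "(\<lambda>n z. Dn n z (X z)) = (\<lambda>n z. \<Sum>b\<in>Basis. (X z \<bullet> b) *\<^sub>R Dn n z b)"
      by (intro ext linear_apply_sum[OF that(1)])
    moreover have "(\<lambda>z. weak_D G z (X z)) = (\<lambda>z. \<Sum>b\<in>Basis. (X z \<bullet> b) *\<^sub>R weak_D G z b)"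
      by (intro ext linear_apply_sum[OF linear_weak_D])
    ultimately show ?thesis by (simp only:)
  qed
  define Jn where "Jn n z = Xn n z \<bullet> perp (Yn n z)" for n z
  define J where "J z = X z \<bullet> perp (Y z)" for z
  define DJn where "DJn n z v = Xn n z \<bullet> perp (DYn n z v) + DXn n z v \<bullet> perp (Yn n z)" for n z v
  have dJ: "(Jn n has_derivative DJn n z) (at z)" for n z
    unfolding Jn_def DJn_def
    by (rule bounded_bilinear.FDERIV[OF bb xn(1) yn(1)])
  have cJ: "continuous_on UNIV (\<lambda>z. DJn n z v)" for n v
    unfolding DJn_def
    by (intro continuous_on_add bounded_bilinear.continuous_on[OF bb] xn(2) yn(2)
        has_derivative_continuous_on_UNIV[OF xn(1)] has_derivative_continuous_on_UNIV[OF yn(1)])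
  have J: "L1cvg Jn J"
    unfolding Jn_def J_def by (rule L1cvg_bilinear[OF bb xn(5) yn(5) xn(3,4)])
  have Jm[measurable]: "J \<in> borel_measurable borel" by (rule L1cvgD(3)[OF J])
  have 1: "L1cvg (\<lambda>n z. Xn n z \<bullet> perp (DYn n z (X z))) (\<lambda>z. X z \<bullet> perp (weak_D GY z (X z)))"
    by (rule L1cvg_bilinear[OF bb xn(5) apply_X[OF has_derivative_linear[OF yn(1)] yn(6)] xn(3,4)])
  have 2: "L1cvg (\<lambda>n z. DXn n z (X z) \<bullet> perp (Yn n z)) (\<lambda>z. weak_D GX z (X z) \<bullet> perp (Y z))"
    by (rule L1cvg_bilinear[OF bb' yn(5) apply_X[OF has_derivative_linear[OF xn(1)] xn(6)] yn(3,4)])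
  have 3: "L1cvg (\<lambda>n z. (- d z) * Jn n z) (\<lambda>z. (- d z) * J z)"
    by (rule L1cvg_bilinear[OF bounded_bilinear_mult L1cvg_const[OF loc1_bounded[where c=D]] J, where M=D])
       (use dm D in auto)
  define w where "w z = X z \<bullet> perp (weak_D GY z (X z)) + weak_D GX z (X z) \<bullet> perp (Y z) + (- d z) * J z" for z
  have W: "L1cvg (\<lambda>n z. DJn n z (X z) - d z * Jn n z) w"
    using L1cvg_add[OF L1cvg_add[OF 1 2] 3] by (simp add: DJn_def w_def[abs_def])
  have w0: "AE z in lborel. w z = 0"
    using comm dG
  proof eventually_elim
    fix z assume "weak_D GX z (Y z) = weak_D GY z (X z)" "d z = tr (weak_D GX z)"
    then show "w z = 0" using trace_perp_identity[OF linear_weak_D, of GX z "X z" "Y z"]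
      by (simp add: w_def J_def algebra_simps)
  qed
  have "(\<lambda>n. nL R (\<lambda>z. DJn n z (X z) - d z * Jn n z)) \<longlonglongrightarrow> 0" for R
  proof -
    have "nL R (\<lambda>z. DJn n z (X z) - d z * Jn n z) = nL R (\<lambda>z. DJn n z (X z) - d z * Jn n z - w z)" for n
      by (rule nL_cong_AE) (use w0 in \<open>eventually_elim, simp\<close>)
    then show ?thesis using L1cvgD(4)[OF W, of R] by simp
  qed
  then show ?thesis
    using transport_along_flow[OF \<Phi> Xm XM dm D dJ cJ J, of t] by (simp add: J_def)
qed

text \<open>Compression makes the preimage of a null set null, at every single time.\<close>

lemma good_flow_AE_compose:
  assumes \<Phi>: "good_flow X M \<Phi>" and P: "AE z in lborel. P z"
  shows "AE z in lborel. P (\<Phi> t z)"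
proof -
  obtain N where N: "{z \<in> space lborel. \<not> P z} \<subseteq> N" "emeasure lborel N = 0" "N \<in> sets lborel"
    by (rule AE_E[OF P])
  have N': "N \<in> sets borel" using N(3) by simp
  have "\<bar>t\<bar> + 1 > 0" by simp
  from good_flowD(3)[OF \<Phi> this] obtain C where
    C: "\<And>s A. \<bar>s\<bar> \<le> \<bar>t\<bar> + 1 \<Longrightarrow> A \<in> sets borel \<Longrightarrow> emeasure lborel (\<Phi> s -` A) \<le> ennreal C * emeasure lborel A"
    by blast
  have "emeasure lborel (\<Phi> t -` N) \<le> ennreal C * emeasure lborel N" by (rule C[OF _ N']) simp
  then have "emeasure lborel (\<Phi> t -` N) = 0" using N(2) by simp
  moreover have "\<Phi> t -` N \<in> sets borel" using measurable_sets[OF good_flow_measurable(2)[OF \<Phi>] N', of t] by simp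
  ultimately have "\<Phi> t -` N \<in> null_sets lborel" by (simp add: null_sets_def)
  from AE_not_in[OF this] show ?thesis by eventually_elim (use N(1) in auto)
qed

section \<open>The density in space and time\<close>

lemma AE_lborel_uminus:
  fixes P :: "real \<Rightarrow> bool"
  assumes "AE t in lborel. P t" shows "AE t in lborel. P (- t)"
proof -
  obtain N where N: "{t \<in> space lborel. \<not> P t} \<subseteq> N" "emeasure lborel N = 0" "N \<in> sets lborel"
    by (rule AE_E[OF assms])
  have "emeasure (distr lborel borel uminus) N = emeasure lborel (uminus -` N \<inter> space lborel)"
    using N(3) by (intro emeasure_distr) auto
  then have "emeasure lborel (uminus -` N \<inter> space lborel) = 0"
    using N(2) by (simp add: lborel_distr_uminus)
  moreover have "uminus -` N \<inter> space lborel \<in> sets (lborel :: real measure)"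
    using N(3) by (intro measurable_sets[of uminus lborel lborel]) auto
  ultimately have "uminus -` N \<inter> space lborel \<in> null_sets lborel" by (simp add: null_sets_def)
  from AE_not_in[OF this] show ?thesis by eventually_elim (use N(1) in auto)
qed

text \<open>\<open>is_jacobian_density\<close> evaluates the flow at -t, while \<open>\<phi>\<close>
  and \<open>\<Phi>\<close> are known to agree only at almost every pair (t, z).\<close>

lemma AE_time_reversal:
  fixes P :: "real \<times> 'a::euclidean_space \<Rightarrow> bool"
  assumes P: "AE q in lborel. P q" shows "AE q in lborel. P (- fst q, snd q)"
proof -
  obtain N where N: "{q \<in> space lborel. \<not> P q} \<subseteq> N" "emeasure lborel N = 0" "N \<in> sets lborel"
    by (rule AE_E[OF P])
  have [measurable]: "N \<in> sets (borel \<Otimes>\<^sub>M borel)" using N(3) unfolding borel_prod by simp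
  have "AE q in lborel. q \<notin> N" using N by (intro AE_not_in) auto
  then have "AE t in lborel. AE z in lborel. (t, z) \<notin> N" by (rule AE_lborel_prodD)
  then have "AE t in lborel. AE z in lborel. (- t, z) \<notin> N" by (rule AE_lborel_uminus)
  then have "AE q in lborel. (- fst q, snd q) \<notin> N" by (intro AE_lborel_prodI) auto
  then show ?thesis by eventually_elim (use N(1) in auto)
qed

text \<open>Fubini reduces the space-time identity to a fixed t, where it says that
  \<open>jac\<close> is the density of the image measure. Replacing \<open>\<phi>\<close> by
  \<open>\<Phi>\<close> is legitimate because the integrals are over pairs.\<close>

lemma jac_is_jacobian_density:
  fixes X :: "'a::euclidean_space \<Rightarrow> 'a"
  assumes X: "weak_partials X G" and XM: "\<And>x. norm (X x) \<le> M"
    and dm: "d \<in> borel_measurable borel" and D: "\<And>z. \<bar>d z\<bar> \<le> D"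
    and dG: "AE z in lborel. d z = tr (weak_D G z)" and \<Phi>: "good_flow X M \<Phi>"
    and \<phi>: "AE q in lborel. \<phi> (fst q) (snd q) = \<Phi> (fst q) (snd q)"
  shows "is_jacobian_density \<phi> (\<lambda>q. jac d \<Phi> (fst q) (snd q))"
  unfolding is_jacobian_density_def
proof (intro conjI allI impI ballI)
  have M0: "M \<ge> 0" using XM norm_ge_zero order_trans by blast
  let ?E = "\<lambda>q. jac d \<Phi> (fst q) (snd q)"
  have Em: "?E \<in> borel_measurable (borel \<Otimes>\<^sub>M borel)"
    using jac_measurable(1)[OF dm \<Phi>] by (simp add: case_prod_unfold)
  then have Em': "?E \<in> borel_measurable borel" by (simp add: borel_prod)
  then show "?E \<in> borel_measurable lebesgue" by (intro measurable_completion) simp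
  have Ele: "\<bar>?E q\<bar> \<le> exp (D * T)" if "\<bar>fst q\<bar> \<le> T" for q T
    using jac_bounds[OF dm D \<Phi> that, of "snd q"] by simp
  show "\<exists>C. AE (t, z) in lebesgue. \<bar>t\<bar> \<le> T \<longrightarrow> \<bar>?E (t, z)\<bar> \<le> C" for T
    using Ele by (intro exI[of _ "exp (D * T)"] AE_I2) auto
  fix \<psi> :: "real \<times> 'a \<Rightarrow> real" assume \<psi>: "\<psi> \<in> Cc 0"
  have c\<psi>: "continuous_on UNIV \<psi>" using \<psi> by (simp add: Cc_def)
  have "bounded (closure {x. \<psi> x \<noteq> 0})" using \<psi> by (simp add: Cc_def compact_imp_bounded)
  then obtain r0 where r0: "\<forall>x\<in>closure {x. \<psi> x \<noteq> 0}. norm x \<le> r0" by (auto simp: bounded_iff)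
  define r where "r = \<bar>r0\<bar>"
  have \<psi>0: "\<psi> x = 0" if "norm x > r" for x
    using that r0 closure_subset[of "{x. \<psi> x \<noteq> 0}"] by (force simp: r_def)
  have bump: "bump r \<psi>" using c\<psi> \<psi>0 by (auto simp: bump_def)
  obtain B where B: "B \<ge> 0" "\<And>x. \<bar>\<psi> x\<bar> \<le> B" using bump_bounded[OF bump] by blast
  have \<psi>m: "\<psi> \<in> borel_measurable borel" using bump by auto
  have [measurable]: "\<psi> \<in> borel_measurable (borel \<Otimes>\<^sub>M borel)" using \<psi>m by (simp add: borel_prod)
  note \<Phi>m[measurable] = good_flow_measurable(1)[OF \<Phi>]
  define f where "f q = \<psi> (fst q, \<Phi> (- fst q) (snd q))" for q
  have fm: "f \<in> borel_measurable borel"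
  proof -
    have "f \<in> borel_measurable (borel \<Otimes>\<^sub>M borel)" unfolding f_def by measurable
    then show ?thesis by (simp add: borel_prod)
  qed
  have intf: "integrable lborel f"
  proof (rule bounded_support_integrable[OF fm])
    show "norm (f q) \<le> B" for q using B(2) by (simp add: f_def)
    \<comment> \<open>If \<open>\<bar>t\<bar> \<le> r\<close>, then z lies beyond r + M r, and a
      displacement of at most M r leaves its image outside the ball of radius r. If
      \<open>\<bar>t\<bar> > r\<close>, the time coordinate alone is outside the support.\<close>
    fix q :: "real \<times> 'a" assume q: "norm q > r + (r + M * r)"
    show "f q = 0"
    proof (cases "\<bar>fst q\<bar> \<le> r")
      case True
      then have "norm (snd q) > r + M * r" using norm_Pair_le[of "fst q" "snd q"] q by simp
      moreover have "norm (\<Phi> (- fst q) (snd q) - snd q) \<le> M * r"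
        using good_flowD(1)[OF \<Phi>, of "- fst q" "snd q"] mult_left_mono[OF True M0] by simp
      moreover have "norm (snd q) \<le> norm (\<Phi> (- fst q) (snd q)) + norm (\<Phi> (- fst q) (snd q) - snd q)"
        by (metis norm_minus_commute norm_triangle_sub)
      ultimately have "norm (\<Phi> (- fst q) (snd q)) > r" by linarith
      then have "norm (fst q, \<Phi> (- fst q) (snd q)) > r"
        using norm_snd_le[of "\<Phi> (- fst q) (snd q)" "fst q"] by linarith
      then show ?thesis by (simp add: f_def \<psi>0)
    next
      case False
      then have "norm (fst q, \<Phi> (- fst q) (snd q)) > r"
        using norm_fst_le[of "fst q" "\<Phi> (- fst q) (snd q)"] by simp
      then show ?thesis by (simp add: f_def \<psi>0)
    qed
  qed
  have E1: "loc1 ?E"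
  proof (rule loc1_locally_bounded[OF Em'])
    fix R
    have "norm (?E q) \<le> exp (D * R)" if "norm q \<le> R" for q
      using Ele[of q R] norm_fst_le[of "fst q" "snd q"] that by simp
    then show "\<exists>c. \<forall>q. norm q \<le> R \<longrightarrow> norm (?E q) \<le> c" by blast
  qed
  have intE: "integrable lborel (\<lambda>q. \<psi> q * ?E q)" using bump_integrable[OF bump E1] by simp
  have \<phi>': "AE q in lborel. \<phi> (- fst q) (snd q) = \<Phi> (- fst q) (snd q)"
    using AE_time_reversal[OF \<phi>] by simp
  have "(LINT (t, z)|lebesgue. \<psi> (t, \<phi> (- t) z)) = (\<integral>q. f q \<partial>lborel)"
  proof (rule lebesgue_integral_cong_lborel(2)[OF _ fm])
    show "AE q in lborel. (case q of (t, z) \<Rightarrow> \<psi> (t, \<phi> (- t) z)) = f q"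
      using \<phi>' by eventually_elim (simp add: f_def case_prod_unfold)
  qed
  also have "\<dots> = (\<integral>t. \<integral>z. \<psi> (t, \<Phi> (- t) z) \<partial>lborel \<partial>lborel)"
    using lborel_Fubini(2)[OF intf] by (simp add: f_def)
  also have "\<dots> = (\<integral>t. \<integral>w. \<psi> (t, w) * jac d \<Phi> t w \<partial>lborel \<partial>lborel)"
  proof (rule Bochner_Integration.integral_cong[OF refl])
    fix t
    show "(\<integral>z. \<psi> (t, \<Phi> (- t) z) \<partial>lborel) = (\<integral>w. \<psi> (t, w) * jac d \<Phi> t w \<partial>lborel)"
    proof (rule integral_distr_density[where f="\<lambda>w. \<psi> (t, w)" and \<xi>="jac d \<Phi> t"])
      have "continuous_on UNIV (\<lambda>w. \<psi> (t, w))" by (rule continuous_on_compose2[OF c\<psi>]) (auto intro!: continuous_intros)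
      then show "(\<lambda>w. \<psi> (t, w)) \<in> borel_measurable borel" by (rule borel_measurable_continuous_onI)
      show "\<Phi> (- t) \<in> borel_measurable borel" by (rule good_flow_measurable(2)[OF \<Phi>])
      show "jac d \<Phi> t \<in> borel_measurable borel" by (rule jac_measurable(2)[OF dm \<Phi>])
      show "0 \<le> jac d \<Phi> t x" for x by (simp add: jac_def)
      show "distr lborel borel (\<Phi> (- t)) = density lborel (\<lambda>x. ennreal (jac d \<Phi> t x))"
        by (rule jac_is_density[OF X XM dm D dG \<Phi>])
    qed
  qed
  also have "\<dots> = (\<integral>q. \<psi> q * ?E q \<partial>lborel)" using lborel_Fubini(2)[OF intE] by simp
  also have "\<dots> = (LINT q|lebesgue. \<psi> q * ?E q)"
    by (rule integral_completion[symmetric]) (use \<psi>m Em' in simp)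
  finally show "(LINT (t, z)|lebesgue. \<psi> (t, \<phi> (- t) z)) = (LINT (t, z)|lebesgue. \<psi> (t, z) * ?E (t, z))"
    by (simp add: case_prod_unfold)
qed

lemma jacobian_density_borel:
  fixes \<phi> :: "real \<Rightarrow> 'a::euclidean_space \<Rightarrow> 'a"
  assumes \<xi>: "is_jacobian_density \<phi> \<xi>"
  obtains f where "loc1 f" "AE q in lborel. \<xi> q = f q"
    "\<And>\<psi>. \<psi> \<in> Cc_inf \<Longrightarrow> (\<integral>q. \<psi> q *\<^sub>R f q \<partial>lborel) = (LINT (t, z)|lebesgue. \<psi> (t, \<phi> (- t) z))"
proof -
  have "\<xi> \<in> borel_measurable lebesgue" using \<xi> by (simp add: is_jacobian_density_def)
  then obtain f where fm[measurable]: "f \<in> borel_measurable borel" and f: "AE q in lborel. \<xi> q = f q"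
    by (rule borel_version)
  show thesis
  proof (rule that[OF _ f])
    have "nL R f < top" for R
    proof -
      have "\<forall>T>0. \<exists>C. AE (t, z) in lebesgue. \<bar>t\<bar> \<le> T \<longrightarrow> \<bar>\<xi> (t, z)\<bar> \<le> C"
        using \<xi> by (simp add: is_jacobian_density_def)
      then have "\<exists>C. AE (t, z) in lebesgue. \<bar>t\<bar> \<le> \<bar>R\<bar> + 1 \<longrightarrow> \<bar>\<xi> (t, z)\<bar> \<le> C" by simp
      then obtain C where "AE q in lborel. \<bar>fst q\<bar> \<le> \<bar>R\<bar> + 1 \<longrightarrow> \<bar>\<xi> q\<bar> \<le> C"
        unfolding AE_lebesgue_iff by (auto simp: case_prod_unfold)
      with f have "AE q in lborel. norm q \<le> R \<longrightarrow> norm (f q) \<le> norm (C::real)"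
      proof eventually_elim
        fix q :: "real \<times> 'a"
        assume "\<xi> q = f q" "\<bar>fst q\<bar> \<le> \<bar>R\<bar> + 1 \<longrightarrow> \<bar>\<xi> q\<bar> \<le> C"
        then show "norm q \<le> R \<longrightarrow> norm (f q) \<le> norm C" using norm_fst_le[of "fst q" "snd q"] by auto
      qed
      then have "nL R f \<le> nL R (\<lambda>_::real \<times> 'a. C)" by (rule nL_mono_AE)
      also have "\<dots> < top"
        by (rule loc1_finite[OF loc1_bounded[where c="\<bar>C\<bar>"]]) auto
      finally show ?thesis .
    qed
    then show "loc1 f" by (simp add: loc1_def)
    fix \<psi> :: "real \<times> 'a \<Rightarrow> real" assume \<psi>: "\<psi> \<in> Cc_inf"
    then have "\<psi> \<in> Cc 0" by (auto simp: Cc_inf_def)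
    then have "(LINT (t, z)|lebesgue. \<psi> (t, \<phi> (- t) z)) = (LINT (t, z)|lebesgue. \<psi> (t, z) * \<xi> (t, z))"
      using \<xi> by (simp add: is_jacobian_density_def)
    also have "\<dots> = (\<integral>q. \<psi> q *\<^sub>R f q \<partial>lborel)"
    proof (rule lebesgue_integral_cong_lborel(2))
      show "AE q in lborel. (case q of (t, z) \<Rightarrow> \<psi> (t, z) * \<xi> (t, z)) = \<psi> q *\<^sub>R f q"
        using f by eventually_elim (simp add: case_prod_unfold)
      have [measurable]: "\<psi> \<in> borel_measurable borel" using Cc_inf_integrable[OF \<psi>] by auto
      show "(\<lambda>q. \<psi> q *\<^sub>R f q) \<in> borel_measurable borel" by measurable
    qed
    finally show "(\<integral>q. \<psi> q *\<^sub>R f q \<partial>lborel) = (LINT (t, z)|lebesgue. \<psi> (t, \<phi> (- t) z))" by simp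
  qed
qed

text \<open>Makes the choice in \<open>det_flow\<close> harmless: whatever density is selected, it
  agrees with \<open>jac\<close> almost everywhere.\<close>

lemma jacobian_density_unique:
  assumes "is_jacobian_density \<phi> \<xi>" "is_jacobian_density \<phi> \<xi>'"
  shows "AE q in lborel. \<xi> q = \<xi>' q"
proof -
  obtain f where f: "loc1 f" "AE q in lborel. \<xi> q = f q"
    "\<And>\<psi>. \<psi> \<in> Cc_inf \<Longrightarrow> (\<integral>q. \<psi> q *\<^sub>R f q \<partial>lborel) = (LINT (t, z)|lebesgue. \<psi> (t, \<phi> (- t) z))"
    by (rule jacobian_density_borel[OF assms(1)], rule that) assumption+
  obtain g where g: "loc1 g" "AE q in lborel. \<xi>' q = g q"
    "\<And>\<psi>. \<psi> \<in> Cc_inf \<Longrightarrow> (\<integral>q. \<psi> q *\<^sub>R g q \<partial>lborel) = (LINT (t, z)|lebesgue. \<psi> (t, \<phi> (- t) z))"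
    by (rule jacobian_density_borel[OF assms(2)], rule that) assumption+
  have "AE q in lborel. f q - g q = 0"
  proof (rule AE_zero_by_Cc_inf[OF loc1_diff[OF f(1) g(1)]])
    fix \<psi> :: "real \<times> 'a \<Rightarrow> real" assume \<psi>: "\<psi> \<in> Cc_inf"
    obtain r where r: "bump r \<psi>" using Cc_inf_bump[OF \<psi>] by blast
    show "(\<integral>w. \<psi> w *\<^sub>R (f w - g w) \<partial>lborel) = 0"
      using bump_integrable[OF r f(1)] bump_integrable[OF r g(1)] f(3)[OF \<psi>] g(3)[OF \<psi>]
      by (simp add: right_diff_distrib)
  qed
  with f(2) g(2) show ?thesis by eventually_elim simp
qed

text \<open>Tested against \<psi>, both sides are continuous in time: the left by hypothesis, the
  right because trajectories are Lipschitz. They agree at almost every time, hence at every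
  time.\<close>

lemma weakly_continuous_flow_eq:
  fixes X :: "'a::euclidean_space \<Rightarrow> 'a"
  assumes wc: "weakly_continuous_in_time \<phi>" and \<Phi>: "good_flow X M \<Phi>"
    and X[measurable]: "X \<in> borel_measurable borel" and XM: "\<And>x. norm (X x) \<le> M"
    and \<phi>: "AE q in lborel. \<phi> (fst q) (snd q) = \<Phi> (fst q) (snd q)"
  shows "AE z in lborel. \<phi> t z = \<Phi> t z"
proof -
  have M0: "M \<ge> 0" using XM norm_ge_zero order_trans by blast
  note [measurable] = good_flow_measurable[OF \<Phi>]
  have \<Phi>1: "loc1 (\<Phi> s)" for s
  proof (rule loc1_locally_bounded)
    fix R
    have "norm (\<Phi> s z) \<le> R + M * \<bar>s\<bar>" if "norm z \<le> R" for z
      using norm_triangle_sub[of "\<Phi> s z" z] good_flowD(1)[OF \<Phi>, of s z] that by linarith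
    then show "\<exists>c. \<forall>z. norm z \<le> R \<longrightarrow> norm (\<Phi> s z) \<le> c" by blast
  qed measurable
  have ae: "AE s in lborel. AE z in lborel. \<phi> s z = \<Phi> s z" using AE_lborel_prodD[OF \<phi>] by simp
  have "loc_integrable (\<phi> t)" using wc by (simp add: weakly_continuous_in_time_def)
  then obtain f where f: "loc1 f" "AE z in lborel. \<phi> t z = f z" by (rule loc_integrable_borel_version)
  have "AE z in lborel. f z - \<Phi> t z = 0"
  proof (rule AE_zero_by_Cc_inf[OF loc1_diff[OF f(1) \<Phi>1]])
    fix \<psi> :: "'a \<Rightarrow> real" assume \<psi>: "\<psi> \<in> Cc_inf"
    obtain r where r: "bump r \<psi>" using Cc_inf_bump[OF \<psi>] by blast
    have [measurable]: "\<psi> \<in> borel_measurable borel" using r by auto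
    define a where "a s = (LINT x|lebesgue. \<psi> x *\<^sub>R \<phi> s x)" for s
    define b where "b s = (\<integral>x. \<psi> x *\<^sub>R \<Phi> s x \<partial>lborel)" for s
    have ca: "continuous_on UNIV a" using wc \<psi> by (simp add: weakly_continuous_in_time_def a_def[abs_def])
    have ab: "a s = (\<integral>x. \<psi> x *\<^sub>R g x \<partial>lborel)" if "AE z in lborel. \<phi> s z = g z" and [measurable]: "g \<in> borel_measurable borel" for s g
      unfolding a_def
    proof (rule lebesgue_integral_cong_lborel(2))
      show "AE x in lborel. \<psi> x *\<^sub>R \<phi> s x = \<psi> x *\<^sub>R g x" using that(1) by eventually_elim simp
    qed measurable
    have i: "integrable lborel (\<lambda>x. \<psi> x *\<^sub>R \<Phi> s x)" for s by (rule bump_integrable[OF r \<Phi>1])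
    have i\<psi>: "integrable lborel (\<lambda>x. M * \<bar>s - u\<bar> * \<bar>\<psi> x\<bar>)" for s u
      using Cc_inf_integrable[OF \<psi>] by simp
    define L where "L = (\<integral>x. \<bar>\<psi> x\<bar> \<partial>lborel)"
    have Lip: "norm (b s - b u) \<le> M * L * \<bar>s - u\<bar>" for s u
    proof -
      have "b s - b u = (\<integral>x. \<psi> x *\<^sub>R (\<Phi> s x - \<Phi> u x) \<partial>lborel)"
        using i by (simp add: b_def scaleR_diff_right)
      also have "norm \<dots> \<le> (\<integral>x. norm (\<psi> x *\<^sub>R (\<Phi> s x - \<Phi> u x)) \<partial>lborel)" by (rule integral_norm_bound)
      also have "\<dots> \<le> (\<integral>x. M * \<bar>s - u\<bar> * \<bar>\<psi> x\<bar> \<partial>lborel)"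
      proof (rule integral_mono_AE)
        show "integrable lborel (\<lambda>x. norm (\<psi> x *\<^sub>R (\<Phi> s x - \<Phi> u x)))"
          using Bochner_Integration.integrable_diff[OF i[of s] i[of u]] by (intro integrable_norm) (simp add: scaleR_diff_right)
        show "AE x in lborel. norm (\<psi> x *\<^sub>R (\<Phi> s x - \<Phi> u x)) \<le> M * \<bar>s - u\<bar> * \<bar>\<psi> x\<bar>"
          using good_flowD(2)[OF \<Phi>]
        proof eventually_elim
          fix x assume fx: "\<forall>t. \<Phi> t x = x + prim (\<lambda>s. X (\<Phi> s x)) t"
          have lb: "locally_bounded_fun (\<lambda>s. X (\<Phi> s x))" by (rule locally_bounded_funI[where M=M]) (use XM in auto)
          have "\<Phi> s x - \<Phi> u x = (x + prim (\<lambda>s. X (\<Phi> s x)) s) - (x + prim (\<lambda>s. X (\<Phi> s x)) u)"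
            by (simp only: fx[rule_format, symmetric])
          then have "norm (\<Phi> s x - \<Phi> u x) \<le> M * \<bar>s - u\<bar>"
            using norm_prim_diff_le[OF lb XM, of s u] norm_prim_diff_le[OF lb XM, of u s]
            by (simp add: abs_minus_commute norm_minus_commute)
          then have "\<bar>\<psi> x\<bar> * norm (\<Phi> s x - \<Phi> u x) \<le> \<bar>\<psi> x\<bar> * (M * \<bar>s - u\<bar>)" by (rule mult_left_mono) simp
          then show "norm (\<psi> x *\<^sub>R (\<Phi> s x - \<Phi> u x)) \<le> M * \<bar>s - u\<bar> * \<bar>\<psi> x\<bar>" by (simp add: mult.commute)
        qed
      qed (rule i\<psi>)
      also have "\<dots> = M * L * \<bar>s - u\<bar>" by (simp add: L_def)
      finally show ?thesis .
    qed
    have "a t = b t"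
    proof (rule ccontr)
      assume ne: "a t \<noteq> b t"
      have L0: "M * L \<ge> 0" using M0 by (auto simp: L_def intro!: mult_nonneg_nonneg)
      define \<epsilon> where "\<epsilon> = norm (a t - b t) / 2"
      have \<epsilon>: "\<epsilon> > 0" using ne by (simp add: \<epsilon>_def)
      obtain \<delta> where \<delta>: "\<delta> > 0" "\<And>s. \<bar>s - t\<bar> < \<delta> \<Longrightarrow> norm (a s - a t) < \<epsilon>"
        using ca \<epsilon> unfolding continuous_on_iff by (metis UNIV_I dist_norm dist_real_def)
      \<comment> \<open>Close enough that a moves by less than half the supposed gap and b, with
        Lipschitz constant M L, by at most half of it; the summand 1 covers M L = 0.\<close>
      define \<delta>' where "\<delta>' = min \<delta> (\<epsilon> / (M * L + 1))"
      have \<delta>': "\<delta>' > 0" using \<delta> \<epsilon> L0 by (simp add: \<delta>'_def)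
      obtain s where s: "\<bar>s - t\<bar> < \<delta>'" "AE z in lborel. \<phi> s z = \<Phi> s z"
        by (rule AE_lborel_dense[OF ae \<delta>', of t], rule that) assumption+
      have "a s = b s" unfolding b_def by (rule ab[OF s(2)]) measurable
      moreover have "norm (a s - a t) < \<epsilon>" using \<delta>(2) s(1) by (simp add: \<delta>'_def)
      moreover have "norm (b s - b t) \<le> \<epsilon>"
      proof -
        have "M * L * \<bar>s - t\<bar> \<le> (M * L + 1) * (\<epsilon> / (M * L + 1))"
          using s(1) L0 by (intro mult_mono) (auto simp: \<delta>'_def)
        also have "\<dots> = \<epsilon>" using L0 by simp
        finally show ?thesis using Lip[of s t] by linarith
      qed
      moreover have "norm (a t - b t) \<le> norm (a s - a t) + norm (b s - b t)"
        using norm_triangle_ineq4[of "b s - b t" "a s - a t"] \<open>a s = b s\<close> by (simp add: norm_minus_commute add.commute)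
      ultimately show False by (simp add: \<epsilon>_def)
    qed
    moreover have "a t = (\<integral>x. \<psi> x *\<^sub>R f x \<partial>lborel)" by (rule ab[OF f(2)]) (use f(1) in auto)
    ultimately show "(\<integral>x. \<psi> x *\<^sub>R (f x - \<Phi> t x) \<partial>lborel) = 0"
      using bump_integrable[OF r f(1)] i[of t] by (simp add: b_def scaleR_diff_right)
  qed
  with f(2) show ?thesis by eventually_elim simp
qed

text \<open>The constant c lets one lemma serve both flows: exchanging X and Y changes the sign of
  J, so c is 1 for one and -1 for the other. Besides \<open>det_flow\<close>, which is fixed only at
  almost every pair (t, z), a factor E with values at every t is supplied, so that bounds can be
  stated at single times.\<close>

lemma flow_determinant:
  fixes X0 Y0 :: "real^2 \<Rightarrow> real^2" and J :: "real^2 \<Rightarrow> real"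
  assumes X0: "X0 \<in> W1p p \<inter> Linf" and Y0: "Y0 \<in> W1p p \<inter> Linf"
    and bX: "bounded_divergence X0" and bY: "bounded_divergence Y0"
    and br: "\<forall>\<phi>\<in>Cc 1. lie_bracket X0 Y0 \<phi> = 0" and rlf: "regular_lagrangian_flow X0 \<phi>"
    and J_eq: "\<And>z. J z = c * (X0 z \<bullet> perp (Y0 z))"
  obtains E where "AE (t, z) in lebesgue. J (\<phi> t z) = det_flow \<phi> (t, z) * J z"
    "\<And>T. \<exists>C>0. \<forall>t z. \<bar>t\<bar> \<le> T \<longrightarrow> 1 / C \<le> E t z \<and> E t z \<le> C"
    "AE t in lebesgue. AE z in lebesgue. J (\<phi> t z) = E t z * J z"
    "\<And>t. weakly_continuous_in_time \<phi> \<Longrightarrow> AE z in lebesgue. J (\<phi> t z) = E t z * J z"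
proof -
  obtain X GX M dX DX where X: "weak_partials X GX" and XM: "\<And>x. norm (X x) \<le> M" and eqX: "AE x in lborel. X0 x = X x"
    and dXm: "dX \<in> borel_measurable borel" and DX: "\<And>z. \<bar>dX z\<bar> \<le> DX" and dXG: "AE z in lborel. dX z = tr (weak_D GX z)"
    and divX: "AE z in lborel. divergence X0 z = dX z"
    by (rule field_borel_data[OF X0 bX], rule that) assumption+
  obtain Y GY N dY DY where Y: "weak_partials Y GY" and YN: "\<And>x. norm (Y x) \<le> N" and eqY: "AE x in lborel. Y0 x = Y x"
    and dYm: "dY \<in> borel_measurable borel" and DY: "\<And>z. \<bar>dY z\<bar> \<le> DY" and dYG: "AE z in lborel. dY z = tr (weak_D GY z)"
    and divY: "AE z in lborel. divergence Y0 z = dY z"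
    by (rule field_borel_data[OF Y0 bY], rule that) assumption+
  have Xm: "X \<in> borel_measurable borel" and Ym: "Y \<in> borel_measurable borel"
    using weak_partials_loc1(1)[OF X] weak_partials_loc1(1)[OF Y] by auto
  have comm: "AE z in lborel. weak_D GX z (Y z) = weak_D GY z (X z)"
    by (rule vanishing_bracket_imp_commuting[OF X XM Y YN dXG dYG dXm dYm])
       (rule lie_bracket_borel[OF br Xm Ym dXm dYm eqX eqY divX divY])
  obtain \<Phi> where \<Phi>: "good_flow X M \<Phi>" and \<phi>: "AE q in lborel. \<phi> (fst q) (snd q) = \<Phi> (fst q) (snd q)"
    by (rule regular_lagrangian_flow_good[OF rlf Xm XM eqX])
  define E where "E = jac dX \<Phi>"
  have J: "AE z in lborel. J z = c * (X z \<bullet> perp (Y z))" using eqX eqY by eventually_elim (simp add: J_eq)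
  have flow: "AE z in lborel. J (\<Phi> t z) = E t z * J z" for t
    using J good_flow_AE_compose[OF \<Phi> J, of t] determinant_transport[OF X XM Y YN dXm DX dXG comm \<Phi>, of t]
    by eventually_elim (simp add: E_def mult.left_commute)
  have jd: "is_jacobian_density \<phi> (\<lambda>q. jac dX \<Phi> (fst q) (snd q))"
    by (rule jac_is_jacobian_density[OF X XM dXm DX dXG \<Phi> \<phi>])
  then have "is_jacobian_density \<phi> (det_flow \<phi>)"
    unfolding det_flow_def by (rule someI[of "is_jacobian_density \<phi>"])
  from jacobian_density_unique[OF this jd] have det: "AE q in lborel. det_flow \<phi> q = E (fst q) (snd q)"
    by (simp add: E_def)
  have \<phi>t: "AE t in lborel. AE z in lborel. \<phi> t z = \<Phi> t z" using AE_lborel_prodD[OF \<phi>] by simp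
  have joint: "AE q in lborel. J (\<Phi> (fst q) (snd q)) = E (fst q) (snd q) * J (snd q)"
  proof -
    \<comment> \<open>Passing from every fixed t to pairs needs a measurable predicate, so J is
      first replaced by a Borel version. The null set A where they differ is avoided at z and, by
      compression, at the image of z.\<close>
    define J1 where "J1 z = c * (X z \<bullet> perp (Y z))" for z
    have "continuous_on UNIV perp" by (rule linear_continuous_on[OF bounded_linear_perp])
    then have pm: "perp \<in> borel_measurable borel" by (rule borel_measurable_continuous_onI)
    have [measurable]: "J1 \<in> borel_measurable borel"
      unfolding J1_def using Xm measurable_compose[OF Ym pm] by measurable
    note [measurable] = good_flow_measurable(1)[OF \<Phi>] jac_measurable(1)[OF dXm \<Phi>]
    have 1: "AE q in lborel. J1 (\<Phi> (fst q) (snd q)) = E (fst q) (snd q) * J1 (snd q)"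
    proof (rule AE_lborel_prodI)
      show "Measurable.pred (borel \<Otimes>\<^sub>M borel) (\<lambda>q. J1 (\<Phi> (fst q) (snd q)) = E (fst q) (snd q) * J1 (snd q))"
        unfolding E_def by measurable
      show "AE t in lborel. AE z in lborel. J1 (\<Phi> (fst (t, z)) (snd (t, z))) = E (fst (t, z)) (snd (t, z)) * J1 (snd (t, z))"
        using determinant_transport[OF X XM Y YN dXm DX dXG comm \<Phi>] by (simp add: J1_def E_def mult.left_commute)
    qed
    obtain A where A: "{z \<in> space lborel. \<not> J z = J1 z} \<subseteq> A" "emeasure lborel A = 0" "A \<in> sets lborel"
      using J by (auto simp: J1_def elim: AE_E)
    have [measurable]: "A \<in> sets borel" using A(3) by simp
    have nA: "AE z in lborel. z \<notin> A" using A by (intro AE_not_in) auto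
    have 2: "AE q in lborel. snd q \<notin> A \<and> \<Phi> (fst q) (snd q) \<notin> A"
    proof (rule AE_lborel_prodI)
      show "Measurable.pred (borel \<Otimes>\<^sub>M borel) (\<lambda>q::real \<times> (real^2). snd q \<notin> A \<and> \<Phi> (fst q) (snd q) \<notin> A)" by measurable
      show "AE t in lborel. AE z in lborel. snd (t, z) \<notin> A \<and> \<Phi> (fst (t, z)) (snd (t, z)) \<notin> A"
      proof (rule AE_I2)
        fix t :: real
        show "AE z in lborel. snd (t, z) \<notin> A \<and> \<Phi> (fst (t, z)) (snd (t, z)) \<notin> A"
          using nA good_flow_AE_compose[OF \<Phi> nA, of t] by eventually_elim simp
      qed
    qed
    have JA: "J z = J1 z" if "z \<notin> A" for z using A(1) that by auto
    from 1 2 show ?thesis by eventually_elim (simp add: JA)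
  qed
  show thesis
  proof (rule that[of E])
    have "AE q in lborel. J (\<phi> (fst q) (snd q)) = det_flow \<phi> q * J (snd q)"
      using joint det \<phi> by eventually_elim simp
    then show "AE (t, z) in lebesgue. J (\<phi> t z) = det_flow \<phi> (t, z) * J z"
      unfolding AE_lebesgue_iff by (simp add: case_prod_unfold)
    show "\<exists>C>0. \<forall>t z. \<bar>t\<bar> \<le> T \<longrightarrow> 1 / C \<le> E t z \<and> E t z \<le> C" for T
      using jac_bounds[OF dXm DX \<Phi>]
      \<comment> \<open>The exponent in \<open>jac\<close> is an integral of d over an interval of
        length at most T, hence between -DX T and DX T.\<close>
      by (intro exI[of _ "exp (DX * T)"]) (auto simp: E_def exp_minus inverse_eq_divide)
    show "AE t in lebesgue. AE z in lebesgue. J (\<phi> t z) = E t z * J z"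
      unfolding AE_lebesgue_iff using \<phi>t
    proof eventually_elim
      fix t assume "AE z in lborel. \<phi> t z = \<Phi> t z"
      with flow[of t] show "AE z in lborel. J (\<phi> t z) = E t z * J z" by eventually_elim simp
    qed
    fix t assume "weakly_continuous_in_time \<phi>"
    from weakly_continuous_flow_eq[OF this \<Phi> Xm XM \<phi>, of t] flow[of t]
    show "AE z in lebesgue. J (\<phi> t z) = E t z * J z"
      unfolding AE_lebesgue_iff by eventually_elim simp
  qed
qed

lemma two_sided_bound:
  fixes j :: real
  assumes "1 / C \<le> e" "e \<le> C" and eq: "j' = e * j" and "j > 0"
  shows "1 / C * j \<le> j' \<and> j' \<le> C * j"
  unfolding eq using assms by (intro conjI mult_right_mono) auto
theorem proposition1p5:
  fixes p :: real
    and X Y :: "real ^ 2 \<Rightarrow> real ^ 2"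
    and \<phi>X \<phi>Y :: "real \<Rightarrow> real ^ 2 \<Rightarrow> real ^ 2"
    and J :: "real ^ 2 \<Rightarrow> real"
  defines "J \<equiv> (\<lambda>z. X z \<bullet> perp (Y z))"
  assumes "p \<ge> 1"
    and "X \<in> W1p p \<inter> Linf" and "Y \<in> W1p p \<inter> Linf"
    and "bounded_divergence X" and "bounded_divergence Y"
    and "\<forall>\<phi>\<in>Cc 1. lie_bracket X Y \<phi> = 0"
    and "regular_lagrangian_flow X \<phi>X" and "regular_lagrangian_flow Y \<phi>Y"
  shows "(AE (t, z) in lebesgue. J (\<phi>X t z) = det_flow \<phi>X (t, z) * J z) \<and>
    (AE (s, z) in lebesgue. J (\<phi>Y s z) = det_flow \<phi>Y (s, z) * J z) \<and>
    (\<forall>T>0. \<exists>C>0.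
       (AE t in lebesgue. t \<in> {-T<..<T} \<longrightarrow>
          (AE z in lebesgue. J z > 0 \<longrightarrow>
             1 / C * J z \<le> J (\<phi>X t z) \<and> J (\<phi>X t z) \<le> C * J z)) \<and>
       (weakly_continuous_in_time \<phi>X \<longrightarrow> (\<forall>t\<in>{-T<..<T}.
          AE z in lebesgue. J z > 0 \<longrightarrow>
             1 / C * J z \<le> J (\<phi>X t z) \<and> J (\<phi>X t z) \<le> C * J z))) \<and>
    (\<forall>T>0. \<exists>C>0.
       (AE s in lebesgue. s \<in> {-T<..<T} \<longrightarrow>
          (AE z in lebesgue. J z > 0 \<longrightarrow>
             1 / C * J z \<le> J (\<phi>Y s z) \<and> J (\<phi>Y s z) \<le> C * J z)) \<and>
       (weakly_continuous_in_time \<phi>Y \<longrightarrow> (\<forall>s\<in>{-T<..<T}.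
          AE z in lebesgue. J z > 0 \<longrightarrow>
             1 / C * J z \<le> J (\<phi>Y s z) \<and> J (\<phi>Y s z) \<le> C * J z)))"
proof -
  note hX = assms(3) and hY = assms(4) and bX = assms(5) and bY = assms(6) and br = assms(7)
    and fX = assms(8) and fY = assms(9)
  \<comment> \<open>The integrand changes sign under the exchange, and the Bochner integral commutes
    with negation even where it is a default value.\<close>
  have "lie_bracket Y X \<phi> = - lie_bracket X Y \<phi>" for \<phi>
    unfolding lie_bracket_def by (subst integral_minus[symmetric]) (simp add: algebra_simps)
  with br have br': "\<forall>\<phi>\<in>Cc 1. lie_bracket Y X \<phi> = 0" by simp
  have JX: "J z = 1 * (X z \<bullet> perp (Y z))" for z by (simp add: J_def)
  have JY: "J z = - 1 * (Y z \<bullet> perp (X z))" for z by (simp add: J_def inner_perp)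
  obtain eX where eX: "AE (t, z) in lebesgue. J (\<phi>X t z) = det_flow \<phi>X (t, z) * J z"
    and eXC: "\<And>T. \<exists>C>0. \<forall>t z. \<bar>t\<bar> \<le> T \<longrightarrow> 1 / C \<le> eX t z \<and> eX t z \<le> C"
    and eXae: "AE t in lebesgue. AE z in lebesgue. J (\<phi>X t z) = eX t z * J z"
    and eXwc: "\<And>t. weakly_continuous_in_time \<phi>X \<Longrightarrow> AE z in lebesgue. J (\<phi>X t z) = eX t z * J z"
    by (rule flow_determinant[OF hX hY bX bY br fX JX], rule that) assumption+
  obtain eY where eY: "AE (t, z) in lebesgue. J (\<phi>Y t z) = det_flow \<phi>Y (t, z) * J z"
    and eYC: "\<And>T. \<exists>C>0. \<forall>t z. \<bar>t\<bar> \<le> T \<longrightarrow> 1 / C \<le> eY t z \<and> eY t z \<le> C"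
    and eYae: "AE t in lebesgue. AE z in lebesgue. J (\<phi>Y t z) = eY t z * J z"
    and eYwc: "\<And>t. weakly_continuous_in_time \<phi>Y \<Longrightarrow> AE z in lebesgue. J (\<phi>Y t z) = eY t z * J z"
    by (rule flow_determinant[OF hY hX bY bX br' fY JY], rule that) assumption+
  \<comment> \<open>C is extracted from E before any time is fixed, so the same constant serves the
    almost-every-time clause and the every-time clause.\<close>
  have bounds: "\<exists>C>0. (AE t in lebesgue. t \<in> {-T<..<T} \<longrightarrow>
          (AE z in lebesgue. J z > 0 \<longrightarrow> 1 / C * J z \<le> J (\<phi> t z) \<and> J (\<phi> t z) \<le> C * J z)) \<and>
       (weakly_continuous_in_time \<phi> \<longrightarrow> (\<forall>t\<in>{-T<..<T}.
          AE z in lebesgue. J z > 0 \<longrightarrow> 1 / C * J z \<le> J (\<phi> t z) \<and> J (\<phi> t z) \<le> C * J z))"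
    if EC: "\<And>T. \<exists>C>0. \<forall>t z. \<bar>t\<bar> \<le> T \<longrightarrow> 1 / C \<le> E t z \<and> E t z \<le> C"
      and ae: "AE t in lebesgue. AE z in lebesgue. J (\<phi> t z) = E t z * J z"
      and wc: "\<And>t. weakly_continuous_in_time \<phi> \<Longrightarrow> AE z in lebesgue. J (\<phi> t z) = E t z * J z"
    for E :: "real \<Rightarrow> real ^ 2 \<Rightarrow> real" and \<phi> T
  proof -
    obtain C where C: "C > 0" "\<And>t z. \<bar>t\<bar> \<le> T \<Longrightarrow> 1 / C \<le> E t z \<and> E t z \<le> C" using EC by blast
    have *: "AE z in lebesgue. J z > 0 \<longrightarrow> 1 / C * J z \<le> J (\<phi> t z) \<and> J (\<phi> t z) \<le> C * J z"
      if t: "t \<in> {-T<..<T}" and J: "AE z in lebesgue. J (\<phi> t z) = E t z * J z" for t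
      using J
    proof eventually_elim
      fix z assume "J (\<phi> t z) = E t z * J z"
      moreover have "1 / C \<le> E t z" "E t z \<le> C" using C(2)[of t z] t by auto
      ultimately show "J z > 0 \<longrightarrow> 1 / C * J z \<le> J (\<phi> t z) \<and> J (\<phi> t z) \<le> C * J z"
        using two_sided_bound by blast
    qed
    show ?thesis
    proof (intro exI[of _ C] conjI impI ballI C(1))
      show "AE t in lebesgue. t \<in> {-T<..<T} \<longrightarrow>
          (AE z in lebesgue. J z > 0 \<longrightarrow> 1 / C * J z \<le> J (\<phi> t z) \<and> J (\<phi> t z) \<le> C * J z)"
        using ae by eventually_elim (use * in blast)
    qed (use * wc in blast)
  qed
  show ?thesis
    by (intro conjI allI impI eX eY bounds[OF eXC eXae eXwc] bounds[OF eYC eYae eYwc])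
qed

end
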